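(* Let $v>0$ and $m\in\mathbb{Z}\setminus\{0\}$. Near the boundary divisor $D$ (i.e. for $y_1$ or $y_2$ large), up to a smooth function of $(q_1,q_2)$ vanishing along $D=\{q_1q_2=0\}$, one has $$\Xi(v,z,m)\sim \mathrm{L}(q_1,q_2,m)+\frac12\sum_{(b,c)\in\mathbb{Z}^2,\ -bc=m}\frac{t}{\sqrt v}\Big(B(v,s;b,c)-I(v,s;b,c)\Big),$$ where $\mathrm{L}(q_1,q_2,m)=\frac12\sum_{(b,c)\in\mathbb{Z}^2,\,-bc=m}-\log\big|q_1^{|c|}-q_2^{|b|}\big|^2$ if $m>0$ and $\mathrm{L}(q_1,q_2,m)=0$ if $m<0$.
   Context: For $z=(z_1,z_2)\in\mathbb{H}^2$ write $z_j=x_j+iy_j$, $q_j=e^{2\pi iz_j}$, $t=\sqrt{y_1y_2}$, $s=\sqrt{y_1/y_2}$. $L_m=\{M\in M_2(\mathbb{Z}):\det M=m\}$; for $M=\begin{pmatrix}a&b\\c&d\end{pmatrix}$, $R(z,M)=|a-bz_2-cz_1+dz_1z_2|^2/(2y_1y_2)$; $-\mathrm{Ei}(-x)=\int_1^\infty e^{-xr}dr/r$; $\Xi(v,z,m)=\frac12\sum_{M\in L_m}-\mathrm{Ei}(-2\pi vR(z,M))$. $B(v,s;b,c)=\int_1^\infty e^{-\pi v(b/s+cs)^2u}u^{-3/2}du$; $I(v,s;b,c)=4\pi\sqrt v\min(|b|/s,|c|s)$ if $bc<0$, and $0$ otherwise. $D=X(1)\times\{\infty\}+\{\infty\}\times X(1)$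 in $X=X(1)\times X(1)$, locally $\{q_1q_2=0\}$; the functions involved are invariant under $z_j\mapsto z_j+1$ and so are functions of $(q_1,q_2)$ near the boundary.
   Formalization: "Smooth function of (q1,q2) vanishing along D" fails if it means C^∞ across D; proved instead: smooth off D, continuous and zero on D, all z-derivatives tend to 0 at D, C^k at the corner (0,0) for each k. The identity is stated where no R(z,M)=0, since both sides are infinite there. *)

theory Defs
  imports "HOL-Analysis.Analysis"
begin

definition H2 :: "(complex \<times> complex) set" where
  "H2 = {z. Im (fst z) > 0 \<and> Im (snd z) > 0}"

definition qmap :: "complex \<times> complex \<Rightarrow> complex \<times> complex" where
  "qmap z = (exp (2 * complex_of_real pi * \<i> * fst z), exp (2 * complex_of_real pi * \<i> * snd z))"

definition tpar :: "complex \<times> complex \<Rightarrow> real" where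
  "tpar z = sqrt (Im (fst z) * Im (snd z))"

definition spar :: "complex \<times> complex \<Rightarrow> real" where
  "spar z = sqrt (Im (fst z) / Im (snd z))"

definition Lset :: "int \<Rightarrow> (int^2^2) set" where
  "Lset m = {M. det M = m}"

definition R :: "complex \<times> complex \<Rightarrow> int^2^2 \<Rightarrow> real" where
  "R z M =
     (cmod (of_int (M$1$1) - of_int (M$1$2) * snd z - of_int (M$2$1) * fst z
            + of_int (M$2$2) * fst z * snd z))\<^sup>2 / (2 * Im (fst z) * Im (snd z))"

text \<open>\<open>nEi x\<close> stands for \<open>- Ei (- x)\<close>. It is meaningful for \<open>x > 0\<close>; at \<open>x = 0\<close> the
  integral diverges (the true value is \<open>+\<infinity>\<close>) and the library returns a default value.\<close>

definition nEi :: "real \<Rightarrow> real" where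
  "nEi x = (LINT r:{1..}|lborel. exp (- x * r) / r)"

definition Xi :: "real \<Rightarrow> complex \<times> complex \<Rightarrow> int \<Rightarrow> real" where
  "Xi v z m = 1/2 * (\<Sum>\<^sub>\<infinity>M\<in>Lset m. nEi (2 * pi * v * R z M))"

definition B :: "real \<Rightarrow> real \<Rightarrow> int \<Rightarrow> int \<Rightarrow> real" where
  "B v s b c =
     (LINT u:{1..}|lborel.
        exp (- pi * v * (of_int b / s + of_int c * s)\<^sup>2 * u) * u powr (- 3/2))"

definition I :: "real \<Rightarrow> real \<Rightarrow> int \<Rightarrow> int \<Rightarrow> real" where
  "I v s b c =
     (if b * c < 0 then 4 * pi * sqrt v * min (\<bar>of_int b\<bar> / s) (\<bar>of_int c\<bar> * s) else 0)"

definition Lfun :: "complex \<times> complex \<Rightarrow> int \<Rightarrow> real" where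
  "Lfun q m =
     (if m > 0
      then 1/2 * (\<Sum>(b,c) | - b * c = m.
             - ln ((cmod (fst q ^ nat \<bar>c\<bar> - snd q ^ nat \<bar>b\<bar>))\<^sup>2))
      else 0)"

definition bidisc :: "real \<Rightarrow> (complex \<times> complex) set" where
  "bidisc r = {q. cmod (fst q) < r \<and> cmod (snd q) < r}"

text \<open>The boundary divisor in the coordinates \<open>(q\<^sub>1, q\<^sub>2)\<close>. A point \<open>(q\<^sub>1, 0)\<close> with
  \<open>q\<^sub>1 \<noteq> 0\<close> lies over an interior point of \<open>X(1) \<times> {\<infinity>}\<close>; all of these occur,
  since \<open>z\<^sub>1\<close> runs through the whole upper half-plane.\<close>

definition D :: "(complex \<times> complex) set" where
  "D = {q \<in> bidisc 1. fst q * snd q = 0}"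

text \<open>\<open>Ck_on k f S\<close>: on the open set \<open>S\<close>, \<open>f\<close> is \<open>k\<close> times continuously
  differentiable over the reals.\<close>

primrec Ck_on ::
  "nat \<Rightarrow> ('a::real_normed_vector \<Rightarrow> 'b::real_normed_vector) \<Rightarrow> 'a set \<Rightarrow> bool" where
  "Ck_on 0 f S \<longleftrightarrow> continuous_on S f"
| "Ck_on (Suc k) f S \<longleftrightarrow>
     (\<forall>x\<in>S. f differentiable (at x)) \<and>
     (\<forall>w. Ck_on k (\<lambda>x. frechet_derivative f (at x) w) S)"

definition smooth_on ::
  "('a::real_normed_vector \<Rightarrow> 'b::real_normed_vector) \<Rightarrow> 'a set \<Rightarrow> bool" where
  "smooth_on f S \<longleftrightarrow> (\<forall>k. Ck_on k f S)"

primrec iter_deriv ::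
  "'a::real_normed_vector list \<Rightarrow> ('a \<Rightarrow> 'b::real_normed_vector) \<Rightarrow> 'a \<Rightarrow> 'b" where
  "iter_deriv [] f = f"
| "iter_deriv (w # ws) f = iter_deriv ws (\<lambda>x. frechet_derivative f (at x) w)"

text \<open>Smoothness up to \<open>D\<close> of a function \<open>F\<close> of \<open>(q\<^sub>1, q\<^sub>2)\<close> vanishing along \<open>D\<close>.
  Being \<open>C\<^sup>\<infinity>\<close> on all of \<open>U\<close> would be too much to ask of the remainder in the asymptotics of
  \<open>Xi\<close>: near \<open>(q\<^sub>1, 0)\<close> with \<open>q\<^sub>1 \<noteq> 0\<close> the average over \<open>arg q\<^sub>2\<close> of the matrices with
  \<open>M$2$2 \<noteq> 0\<close> contributes a positive quantity of exact order
  \<open>\<bar>q\<^sub>2\<bar> powr \<kappa> / sqrt (- ln \<bar>q\<^sub>2\<bar>)\<close>, where \<open>\<kappa> > 0\<close> depends continuously on \<open>z\<^sub>1\<close>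
  and tends to infinity as \<open>q\<^sub>1\<close> tends to \<open>0\<close>. So differentiability in \<open>(q\<^sub>1, q\<^sub>2)\<close> at a point
  of \<open>D\<close> holds up to a finite order, and this order grows without bound towards the corner
  \<open>(0, 0)\<close>. What holds, and what is required here, is: \<open>F\<close> is smooth off \<open>D\<close>; it extends
  continuously by zero to \<open>D\<close>; so do all its derivatives with respect to
  \<open>z\<^sub>j = ln q\<^sub>j / (2 \<pi> \<i>)\<close>; and at the corner \<open>F\<close> is differentiable in \<open>(q\<^sub>1, q\<^sub>2)\<close> to
  every order, across \<open>D\<close>. A function that is \<open>C\<^sup>\<infinity>\<close> on \<open>U\<close> and zero on \<open>D\<close> satisfies all
  these conditions.\<close>

definition smooth_vanishing_along_D ::
  "(complex \<times> complex \<Rightarrow> real) \<Rightarrow> (complex \<times> complex) set \<Rightarrow> bool" where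
  "smooth_vanishing_along_D F U \<longleftrightarrow>
     smooth_on F (U - D) \<and>
     continuous_on U F \<and>
     (\<forall>p\<in>D. F p = 0) \<and>
     (\<forall>ws. \<forall>p\<in>D.
        (iter_deriv ws (\<lambda>z. F (qmap z)) \<longlongrightarrow> 0)
          (inf (filtercomap qmap (nhds p)) (principal H2))) \<and>
     (\<forall>k. \<exists>\<epsilon>>0. bidisc \<epsilon> \<subseteq> U \<and> Ck_on k F (bidisc \<epsilon>))"

end

theory Submission
  imports Defs "HOL-Probability.Probability" "HOL-Real_Asymp.Real_Asymp"
begin

text \<open>The matrices with lower right entry \<open>0\<close> form finitely many lines, indexed by the
  factorisations \<open>- b * c = m\<close> and parametrised by the free entry \<open>a\<close>. On each line Poisson
  summation in \<open>a\<close> (theta inversion) turns the sum of \<open>- Ei\<close> into a zero mode, which is the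
  \<open>B\<close>-term, and nonzero modes \<open>n\<close> given by integrals over \<open>{1..}\<close>. Completing these to integrals
  over \<open>{0..}\<close> makes them sum to \<open>- ln \<bar>1 - exp (2 \<pi> \<i> (x + \<i> \<bar>\<omega>\<bar>))\<bar>\<^sup>2\<close>, where
  \<open>x + \<i> \<omega> = b z\<^sub>2 + c z\<^sub>1\<close>. This gives \<open>L\<close> and the \<open>I\<close>-term for \<open>m > 0\<close>, and a logarithm that
  is smooth in \<open>(q\<^sub>1, q\<^sub>2)\<close> for \<open>m < 0\<close>. The identity is
  obtained by comparing derivatives in \<open>v\<close> and the limits as \<open>v\<close> tends to infinity.

  What is left over, namely the missing integrals over \<open>{0..1}\<close> and the matrices with nonzero
  lower right entry, decays together with all derivatives in \<open>z\<close> like \<open>exp (- \<delta> y\<^sub>1 y\<^sub>2)\<close> up to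
  polynomial factors. A derivative in \<open>q\<close> costs one factor \<open>1 / q\<^sub>1\<close> or \<open>1 / q\<^sub>2\<close>, and
  \<open>exp (- \<delta> y\<^sub>1 y\<^sub>2)\<close> beats any fixed power of these once \<open>y\<^sub>1\<close> and \<open>y\<^sub>2\<close> are both large.\<close>

section \<open>Sums and integrals\<close>

text \<open>Differentiation in \<open>v\<close> makes Poisson summation elementary here: the
  derivative of \<open>nEi (v * X)\<close> is - exp (- v X) / v, a pure Gaussian in the free entry,
  so no integral over \<open>{1..}\<close> is exchanged with the sum. The main obstacle is the
  demand for derivatives of every order. No higher derivative is ever computed: each remainder is
  placed in a class that is stable under differentiation and whose members all obey a bound of the
  same type, so a bound for members is a bound for all derivatives. The neighbourhood of
  \<open>D\<close> is cut out by y1 y2 > 2 |m|: for a nonzero lower right entry d, d (a - b z2 - c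
  z1 + d z1 z2) = m + (d z1 - b) (d z2 - c). The product has modulus at least d^2 y1 y2, so m
  cancels at most half of it. In the coordinates q the decay turns into a power of |q1 q2| whose
  exponent is proportional to eta once y1, y2 >= eta; this is why smoothness of a given order is
  obtained only on a small enough bidisc.\<close>

text \<open>The tail of \<open>M\<close> outside \<open>K\<close> bounds the tail of every
  \<open>h\<close> dominated by \<open>M\<close>, so one finite set serves all parameter values at
  once. This uniformity replaces uniform convergence in the interchanges of sums with limits,
  derivatives and integrals below.\<close>

lemma infsum_finite_tail:
  fixes M :: "'i \<Rightarrow> real"
  assumes M: "M summable_on J" and pos: "\<And>i. i \<in> J \<Longrightarrow> M i \<ge> 0" and e: "e > 0"
  obtains K where "finite K" "K \<subseteq> J"
    "\<And>h :: 'i \<Rightarrow> real. (\<And>i. i \<in> J \<Longrightarrow> \<bar>h i\<bar> \<le> M i) \<Longrightarrow> \<bar>infsum h J - sum h K\<bar> \<le> e"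
proof -
  obtain K where K: "finite K" "K \<subseteq> J" "dist (sum M K) (infsum M J) \<le> e"
    using infsum_finite_approximation[OF M e] by blast
  have "\<bar>infsum h J - sum h K\<bar> \<le> e" if h: "\<And>i. i \<in> J \<Longrightarrow> \<bar>h i\<bar> \<le> M i" for h :: "'i \<Rightarrow> real"
  proof -
    have MJK: "M summable_on (J - K)"
      using M by (rule summable_on_subset_banach) auto
    have habs: "(\<lambda>i. \<bar>h i\<bar>) summable_on J"
      using M by (rule summable_on_comparison_test) (use h in auto)
    have hJ: "h summable_on J"
      using habs summable_on_iff_abs_summable_on_real[of h J] by simp
    have hJK: "h summable_on (J - K)" "(\<lambda>i. \<bar>h i\<bar>) summable_on (J - K)"
      using hJ habs by (auto intro: summable_on_subset_banach)
    have split: "infsum g J = sum g K + infsum g (J - K)" if "g summable_on J" for g :: "'i \<Rightarrow> real"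
    proof -
      have "infsum g (K \<union> (J - K)) = infsum g K + infsum g (J - K)"
        by (rule infsum_Un_disjoint) (use that K in \<open>auto intro: summable_on_subset_banach\<close>)
      moreover have "K \<union> (J - K) = J" using K by auto
      ultimately show ?thesis using K by simp
    qed
    have "\<bar>infsum h J - sum h K\<bar> = \<bar>infsum h (J - K)\<bar>"
      using split[OF hJ] by simp
    also have "\<dots> \<le> (\<Sum>\<^sub>\<infinity>i\<in>J - K. \<bar>h i\<bar>)"
      using norm_infsum_bound[of h "J - K"] hJK by simp
    also have "\<dots> \<le> infsum M (J - K)"
      by (rule infsum_mono) (use h hJK MJK in auto)
    also have "\<dots> = infsum M J - sum M K" using split[OF M] by simp
    also have "\<dots> \<le> e" using K(3) by (auto simp: dist_real_def)
    finally show ?thesis .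
  qed
  then show ?thesis using K that by blast
qed

lemma abs_summable_comparison:
  fixes f M :: "'i \<Rightarrow> real"
  assumes "M summable_on J" "\<And>i. i \<in> J \<Longrightarrow> \<bar>f i\<bar> \<le> M i"
  shows "f summable_on J"
proof -
  have "(\<lambda>i. \<bar>f i\<bar>) summable_on J"
    using assms(1) by (rule summable_on_comparison_test) (use assms in auto)
  then show ?thesis using summable_on_iff_abs_summable_on_real[of f J] by simp
qed

lemma abs_infsum_le:
  fixes f M :: "'i \<Rightarrow> real"
  assumes "M summable_on J" "\<And>i. i \<in> J \<Longrightarrow> \<bar>f i\<bar> \<le> M i"
  shows "\<bar>infsum f J\<bar> \<le> infsum M J"
proof -
  have 1: "(\<lambda>i. \<bar>f i\<bar>) summable_on J"
    using assms(1) by (rule summable_on_comparison_test) (use assms in auto)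
  then have "\<bar>infsum f J\<bar> \<le> (\<Sum>\<^sub>\<infinity>i\<in>J. \<bar>f i\<bar>)"
    using norm_infsum_bound[of f J] by simp
  also have "\<dots> \<le> infsum M J"
    by (rule infsum_mono) (use assms 1 in auto)
  finally show ?thesis .
qed

text \<open>The bound \<open>M i\<close> passes to the limit \<open>g i\<close>, so the same finite
  set approximates the sums on both sides.\<close>

lemma infsum_tendsto_dominated:
  fixes f :: "'i \<Rightarrow> 'a \<Rightarrow> real"
  assumes lim: "\<And>i. i \<in> J \<Longrightarrow> (f i \<longlongrightarrow> g i) F"
    and bd: "eventually (\<lambda>x. \<forall>i\<in>J. \<bar>f i x\<bar> \<le> M i) F"
    and M: "M summable_on J" and F: "F \<noteq> bot"
  shows "((\<lambda>x. \<Sum>\<^sub>\<infinity>i\<in>J. f i x) \<longlongrightarrow> infsum g J) F"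
proof (rule tendstoI)
  fix e :: real assume e: "e > 0"
  have gM: "\<bar>g i\<bar> \<le> M i" if "i \<in> J" for i
  proof -
    have "((\<lambda>x. \<bar>f i x\<bar>) \<longlongrightarrow> \<bar>g i\<bar>) F" using lim[OF that] by (intro tendsto_intros)
    then show ?thesis
      by (rule tendsto_upperbound[OF _ _ F]) (use bd that in \<open>auto elim: eventually_mono\<close>)
  qed
  then have pos: "M i \<ge> 0" if "i \<in> J" for i using that by fastforce
  obtain K where K: "finite K" "K \<subseteq> J"
    "\<And>h :: 'i \<Rightarrow> real. (\<And>i. i \<in> J \<Longrightarrow> \<bar>h i\<bar> \<le> M i) \<Longrightarrow> \<bar>infsum h J - sum h K\<bar> \<le> e/4"
    using infsum_finite_tail[OF M pos, of "e/4"] e by auto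
  have "((\<lambda>x. \<Sum>i\<in>K. f i x) \<longlongrightarrow> sum g K) F"
    using lim K by (intro tendsto_sum) auto
  then have "eventually (\<lambda>x. dist (\<Sum>i\<in>K. f i x) (sum g K) < e/4) F"
    by (rule tendstoD) (use e in auto)
  with bd show "eventually (\<lambda>x. dist (\<Sum>\<^sub>\<infinity>i\<in>J. f i x) (infsum g J) < e) F"
  proof eventually_elim
    case (elim x)
    have "\<bar>(\<Sum>\<^sub>\<infinity>i\<in>J. f i x) - (\<Sum>i\<in>K. f i x)\<bar> \<le> e/4" using K(3)[of "\<lambda>i. f i x"] elim by auto
    moreover have "\<bar>infsum g J - sum g K\<bar> \<le> e/4" using K(3)[of g] gM by auto
    ultimately show ?case using elim(2) e unfolding dist_real_def by linarith
  qed
qed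

text \<open>The mean value inequality on the convex set \<open>S\<close> bounds the linearisation
  error of the i-th term by a multiple of \<open>M i * norm (y - z)\<close>. After division by the
  increment the errors are dominated by a summable family, so all but finitely many are negligible
  uniformly in \<open>y\<close>.\<close>

lemma has_derivative_infsum:
  fixes f :: "'i \<Rightarrow> 'a::real_normed_vector \<Rightarrow> real"
  assumes S: "open S" "convex S" "z \<in> S"
    and der: "\<And>i y. i \<in> J \<Longrightarrow> y \<in> S \<Longrightarrow> (f i has_derivative f' i y) (at y)"
    and bd: "\<And>i y h. i \<in> J \<Longrightarrow> y \<in> S \<Longrightarrow> \<bar>f' i y h\<bar> \<le> M i * norm h"
    and M: "M summable_on J"
    and sm: "\<And>y. y \<in> S \<Longrightarrow> (\<lambda>i. f i y) summable_on J"
  shows "((\<lambda>y. \<Sum>\<^sub>\<infinity>i\<in>J. f i y) has_derivative (\<lambda>h. \<Sum>\<^sub>\<infinity>i\<in>J. f' i z h)) (at z)"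
proof -
  define M1 where "M1 i = \<bar>M i\<bar>" for i
  have M1: "M1 summable_on J" unfolding M1_def using M
      summable_on_iff_abs_summable_on_real[of M J] by simp
  have bd1: "\<bar>f' i y h\<bar> \<le> M1 i * norm h" if "i \<in> J" "y \<in> S" for i y h
    using bd[OF that, of h] unfolding M1_def
    by (meson abs_ge_self mult_right_mono norm_ge_zero order_trans)
  have smf': "(\<lambda>i. f' i z h) summable_on J" for h
    by (rule abs_summable_comparison[OF summable_on_cmult_left[OF M1, of "norm h"]]) (use bd1 S in auto)
  have lin: "linear (f' i z)" if "i \<in> J" for i
    using der[OF that S(3)] has_derivative_linear by blast
  have bl: "bounded_linear (\<lambda>h. \<Sum>\<^sub>\<infinity>i\<in>J. f' i z h)"
  proof (rule bounded_linear_intro)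
    fix x y :: 'a and r :: real
    have "(\<Sum>\<^sub>\<infinity>i\<in>J. f' i z (x + y)) = (\<Sum>\<^sub>\<infinity>i\<in>J. f' i z x + f' i z y)"
      by (rule infsum_cong) (simp add: lin linear_add)
    also have "\<dots> = (\<Sum>\<^sub>\<infinity>i\<in>J. f' i z x) + (\<Sum>\<^sub>\<infinity>i\<in>J. f' i z y)"
      by (rule infsum_add) (rule smf')+
    finally show "(\<Sum>\<^sub>\<infinity>i\<in>J. f' i z (x + y)) = (\<Sum>\<^sub>\<infinity>i\<in>J. f' i z x) + (\<Sum>\<^sub>\<infinity>i\<in>J. f' i z y)" .
    have "(\<Sum>\<^sub>\<infinity>i\<in>J. f' i z (r *\<^sub>R x)) = (\<Sum>\<^sub>\<infinity>i\<in>J. r * f' i z x)"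
      by (rule infsum_cong) (simp add: lin linear_scale)
    then show "(\<Sum>\<^sub>\<infinity>i\<in>J. f' i z (r *\<^sub>R x)) = r *\<^sub>R (\<Sum>\<^sub>\<infinity>i\<in>J. f' i z x)"
      by (simp add: infsum_cmult_right')
    have "norm (\<Sum>\<^sub>\<infinity>i\<in>J. f' i z x) \<le> (\<Sum>\<^sub>\<infinity>i\<in>J. M1 i * norm x)"
      unfolding real_norm_def
      by (rule abs_infsum_le[OF summable_on_cmult_left[OF M1, of "norm x"]]) (use bd1 S in auto)
    then show "norm (\<Sum>\<^sub>\<infinity>i\<in>J. f' i z x) \<le> norm x * infsum M1 J"
      by (simp add: infsum_cmult_left' mult.commute)
  qed
  have "\<exists>d>0. \<forall>y. norm (y - z) < d \<longrightarrow>
      norm ((\<Sum>\<^sub>\<infinity>i\<in>J. f i y) - (\<Sum>\<^sub>\<infinity>i\<in>J. f i z) - (\<Sum>\<^sub>\<infinity>i\<in>J. f' i z (y - z))) \<le> e * norm (y - z)"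
    if e: "e > 0" for e
  proof -
    obtain K where K: "finite K" "K \<subseteq> J"
      "\<And>h :: 'i \<Rightarrow> real. (\<And>i. i \<in> J \<Longrightarrow> \<bar>h i\<bar> \<le> M1 i) \<Longrightarrow> \<bar>infsum h J - sum h K\<bar> \<le> e/4"
      using infsum_finite_tail[OF M1, of "e/4"] e by (auto simp: M1_def)
    have "((\<lambda>y. \<Sum>i\<in>K. f i y) has_derivative (\<lambda>h. \<Sum>i\<in>K. f' i z h)) (at z)"
      using K S by (intro has_derivative_sum der) auto
    then obtain d1 where d1: "d1 > 0" "\<And>y. norm (y - z) < d1 \<Longrightarrow>
      norm ((\<Sum>i\<in>K. f i y) - (\<Sum>i\<in>K. f i z) - (\<Sum>i\<in>K. f' i z (y - z))) \<le> e/2 * norm (y - z)"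
      using e unfolding has_derivative_at_alt by (meson half_gt_zero)
    obtain d2 where d2: "d2 > 0" "ball z d2 \<subseteq> S" using S open_contains_ball by blast
    have "norm ((\<Sum>\<^sub>\<infinity>i\<in>J. f i y) - (\<Sum>\<^sub>\<infinity>i\<in>J. f i z) - (\<Sum>\<^sub>\<infinity>i\<in>J. f' i z (y - z))) \<le> e * norm (y - z)"
      if y: "norm (y - z) < min d1 d2" for y
    proof (cases "y = z")
      case True
      then have "(\<Sum>\<^sub>\<infinity>i\<in>J. f' i z (y - z)) = 0"
        by (auto intro!: infsum_0 simp: lin linear_0)
      then show ?thesis using True by simp
    next
      case False
      have yS: "y \<in> S" using y d2 by (auto simp: dist_norm norm_minus_commute)
      define n where "n = norm (y - z)"
      have n: "n > 0" using False n_def by simp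
      define h where "h i = f i y - f i z - f' i z (y - z)" for i
      have hb: "\<bar>h i\<bar> \<le> 2 * n * M1 i" if i: "i \<in> J" for i
      proof -
        have "norm (f i y - f i z) \<le> M1 i * norm (y - z)"
          by (rule differentiable_bound[OF S(2)])
             (use der i S yS bd1[OF i] in \<open>auto intro!: onorm_bound has_derivative_at_withinI[OF der[OF i]] simp: M1_def\<close>)
        moreover have "\<bar>f' i z (y - z)\<bar> \<le> M1 i * norm (y - z)" using bd1 i S by auto
        ultimately show ?thesis unfolding h_def n_def by (simp add: abs_le_iff algebra_simps)
      qed
      have "\<bar>infsum (\<lambda>i. h i / (2 * n)) J - (\<Sum>i\<in>K. h i / (2 * n))\<bar> \<le> e/4"
        by (rule K(3)) (use hb n in \<open>simp add: field_simps\<close>)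
      moreover have "infsum (\<lambda>i. h i / (2 * n)) J = infsum h J / (2 * n)"
        using infsum_cmult_left'[of h "1/(2*n)" J] by simp
      moreover have "(\<Sum>i\<in>K. h i / (2 * n)) = sum h K / (2 * n)" by (simp add: sum_divide_distrib)
      ultimately have "\<bar>infsum h J - sum h K\<bar> / (2 * n) \<le> e/4"
        using n by (simp add: diff_divide_distrib[symmetric] abs_divide)
      then have 1: "\<bar>infsum h J - sum h K\<bar> \<le> e/2 * n" using n by (simp add: field_simps)
      have 2: "\<bar>sum h K\<bar> \<le> e/2 * n"
        using d1(2)[of y] y unfolding h_def n_def by (simp add: sum_subtractf)
      have 3: "infsum h J = (\<Sum>\<^sub>\<infinity>i\<in>J. f i y) - (\<Sum>\<^sub>\<infinity>i\<in>J. f i z) - (\<Sum>\<^sub>\<infinity>i\<in>J. f' i z (y - z))"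
      proof -
        have "((\<lambda>i. (f i y + - f i z) + - f' i z (y - z)) has_sum
           ((\<Sum>\<^sub>\<infinity>i\<in>J. f i y) + - (\<Sum>\<^sub>\<infinity>i\<in>J. f i z)) + - (\<Sum>\<^sub>\<infinity>i\<in>J. f' i z (y - z))) J"
          by (intro has_sum_add, simp_all add: has_sum_uminus has_sum_infsum sm smf' yS S)
        then show ?thesis unfolding h_def by (simp add: infsumI)
      qed
      have "\<bar>infsum h J\<bar> \<le> e * n" using 1 2 by linarith
      then show ?thesis using 3 n_def by simp
    qed
    then show ?thesis using d1 d2 by (intro exI[of _ "min d1 d2"]) auto
  qed
  then show ?thesis unfolding has_derivative_at_alt using bl by blast
qed

section \<open>Integrals over half-lines, the exponential integral and Gaussian tails\<close>

text \<open>Near \<open>x\<close> the tail is a constant minus \<open>integral {c..y} g\<close> with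
  \<open>c\<close> fixed below \<open>x\<close>, so the fundamental theorem applies.
  \<open>nEi\<close>, \<open>erfcI\<close> and \<open>heat_tail\<close> all have their parameter
  brought into the limit of integration, which avoids differentiating under an integral.\<close>

lemma tail_integral_has_derivative:
  fixes g :: "real \<Rightarrow> real"
  assumes int: "\<And>y. y > a \<Longrightarrow> set_integrable lborel {y..} g"
    and cont: "continuous_on {a<..} g" and x: "x > a"
  shows "((\<lambda>y. LINT r:{y..}|lborel. g r) has_real_derivative - g x) (at x)"
proof -
  define c where "c = (a + x) / 2"
  define d where "d = x + 1"
  have c: "a < c" "c < x" "x < d" using x by (auto simp: c_def d_def)
  have eq: "(LINT r:{y..}|lborel. g r) = (LINT r:{c..}|lborel. g r) - integral {c..y} g" if y: "c \<le> y" for y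
  proof -
    have i1: "set_integrable lborel {c..<y} g" "set_integrable lborel {c..y} g"
      using int[OF c(1)] by (auto intro: set_integrable_subset)
    have i2: "set_integrable lborel {y..} g" using int c y by auto
    have "{c..} = {c..<y} \<union> {y..}" using y by auto
    then have "(LINT r:{c..}|lborel. g r) = (LINT r:{c..<y}|lborel. g r) + (LINT r:{y..}|lborel. g r)"
      using set_integral_Un[of "{c..<y}" "{y..}" lborel g] i1 i2 by (simp add: ivl_disj_int)
    moreover have "(LINT r:{c..<y}|lborel. g r) = (LINT r:{c..y}|lborel. g r)"
      unfolding set_lebesgue_integral_def
    proof (rule integral_cong_AE)
      show "(\<lambda>x. indicator {c..<y} x *\<^sub>R g x) \<in> borel_measurable lborel"
        "(\<lambda>x. indicator {c..y} x *\<^sub>R g x) \<in> borel_measurable lborel"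
        using i1 unfolding set_integrable_def by auto
      show "AE x in lborel. indicator {c..<y} x *\<^sub>R g x = indicator {c..y} x *\<^sub>R g x"
        using AE_lborel_singleton[of y] by eventually_elim (auto simp: indicator_def)
    qed
    moreover have "(LINT r:{c..y}|lborel. g r) = integral {c..y} g"
      using i1(2) by (rule set_borel_integral_eq_integral)
    ultimately show ?thesis by simp
  qed
  have "((\<lambda>y. integral {c..y} g) has_vector_derivative g x) (at x within {c..d})"
    by (rule integral_has_vector_derivative) (use c in \<open>auto intro: continuous_on_subset[OF cont]\<close>)
  then have "((\<lambda>y. integral {c..y} g) has_real_derivative g x) (at x)"
    using c at_within_Icc_at[of c x d] by (simp add: has_real_derivative_iff_has_vector_derivative)
  then have "((\<lambda>y. (LINT r:{c..}|lborel. g r) - integral {c..y} g) has_real_derivative - g x) (at x)"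
    by (auto intro!: derivative_eq_intros)
  then show ?thesis
  proof (rule has_field_derivative_transform_within_open[where S="{c<..}"])
    fix y assume "y \<in> {c<..}"
    then show "(LINT r:{c..}|lborel. g r) - integral {c..y} g = (LINT r:{y..}|lborel. g r)"
      by (subst eq[of y]) auto
  qed (use c in auto)
qed

lemma set_integrable_exp_tail:
  fixes k :: real
  assumes "k > 0"
  shows "set_integrable lborel {y..} (\<lambda>r. exp (- k * r))"
    "(LINT r:{y..}|lborel. exp (- k * r)) = exp (- k * y) / k"
proof -
  have "(\<integral>\<^sup>+r. ennreal (exp (- k * r)) * indicator {y..} r \<partial>lborel) = ennreal (0 - (- exp (- k * y) / k))"
  proof (rule nn_integral_FTC_atLeast[where F="\<lambda>r. - exp (- k * r) / k"])
    show "((\<lambda>r. - exp (- k * r) / k) \<longlongrightarrow> 0) at_top"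
      using assms by real_asymp
  qed (use assms in \<open>auto intro!: derivative_eq_intros\<close>)
  also have "(\<integral>\<^sup>+r. ennreal (exp (- k * r)) * indicator {y..} r \<partial>lborel)
      = (\<integral>\<^sup>+r. ennreal (indicator {y..} r *\<^sub>R exp (- k * r)) \<partial>lborel)"
    by (intro nn_integral_cong) (auto simp: indicator_def)
  finally have "has_bochner_integral lborel (\<lambda>r. indicator {y..} r *\<^sub>R exp (- k * r)) (exp (- k * y) / k)"
    by (intro has_bochner_integral_nn_integral) (use assms in auto)
  then show "set_integrable lborel {y..} (\<lambda>r. exp (- k * r))"
    "(LINT r:{y..}|lborel. exp (- k * r)) = exp (- k * y) / k"
    unfolding set_integrable_def set_lebesgue_integral_def by (auto simp: has_bochner_integral_iff)
qed

lemma set_integrable_exp_over_tail: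
  fixes y :: real
  assumes "y > 0"
  shows "set_integrable lborel {y..} (\<lambda>r. exp (- r) / r)"
proof (rule set_integrable_bound[OF set_integrable_mult_right[of "1/y", OF set_integrable_exp_tail(1)[of 1 y]]])
  show "set_borel_measurable lborel {y..} (\<lambda>r. exp (- r) / r)"
    unfolding set_borel_measurable_def by measurable
  show "AE r in lborel. r \<in> {y..} \<longrightarrow> norm (exp (- r) / r) \<le> norm (1 / y * exp (- 1 * r))"
    using assms by (auto intro!: divide_left_mono)
qed auto

lemma set_integral_Ici_scale:
  fixes f :: "real \<Rightarrow> real"
  assumes "c > 0"
  shows "(LINT r:{1..}|lborel. f r) = (LINT r:{c..}|lborel. f (r / c)) / c"
proof -
  have "(LINT r:{c..}|lborel. f (r / c)) = c * (LINT r|lborel. indicator {c..} (0 + c * r) *\<^sub>R f ((0 + c * r) / c))"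
    unfolding set_lebesgue_integral_def
    using assms lborel_integral_real_affine[of c "\<lambda>r. indicator {c..} r *\<^sub>R f (r / c)" 0] by simp
  also have "(\<lambda>r. indicator {c..} (0 + c * r) *\<^sub>R f ((0 + c * r) / c)) = (\<lambda>r. indicator {1..} r *\<^sub>R f r)"
    using assms by (auto simp: fun_eq_iff indicator_def)
  finally show ?thesis using assms by (simp add: set_lebesgue_integral_def)
qed

lemma nEi_tail:
  assumes "x > 0"
  shows "nEi x = (LINT r:{x..}|lborel. exp (- r) / r)"
proof -
  have "nEi x = (LINT r:{x..}|lborel. exp (- x * (r / x)) / (r / x)) / x"
    unfolding nEi_def by (rule set_integral_Ici_scale[OF assms])
  also have "\<dots> = (LINT r:{x..}|lborel. x * (exp (- r) / r)) / x"
    using assms by (simp add: mult.commute)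
  also have "\<dots> = (LINT r:{x..}|lborel. exp (- r) / r)"
    using assms by (simp only: set_integral_mult_right) simp
  finally show ?thesis .
qed

lemma nEi_has_derivative:
  assumes "x > 0"
  shows "(nEi has_real_derivative - (exp (- x) / x)) (at x)"
proof -
  have "((\<lambda>y. LINT r:{y..}|lborel. exp (- r) / r) has_real_derivative - (exp (- x) / x)) (at x)"
    by (rule tail_integral_has_derivative[of 0])
       (use assms set_integrable_exp_over_tail in \<open>auto intro!: continuous_intros\<close>)
  then show ?thesis
    by (rule has_field_derivative_transform_within_open[where S="{0<..}"]) (use assms nEi_tail in auto)
qed

lemma nEi_nonneg: "nEi x \<ge> 0"
  unfolding nEi_def set_lebesgue_integral_def
  by (rule Bochner_Integration.integral_nonneg) (auto simp: indicator_def)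

lemma nEi_le:
  assumes "x > 0"
  shows "nEi x \<le> exp (- x) / x"
proof -
  have "nEi x = (LINT r:{x..}|lborel. exp (- r) / r)" by (rule nEi_tail[OF assms])
  also have "\<dots> \<le> (LINT r:{x..}|lborel. 1 / x * exp (- 1 * r))"
    by (rule set_integral_mono)
       (use assms set_integrable_exp_over_tail set_integrable_exp_tail(1)[of 1 x] in
         \<open>auto intro!: divide_left_mono\<close>)
  also have "\<dots> = exp (- x) / x"
    using set_integrable_exp_tail(2)[of 1 x] by (simp add: set_integral_mult_right)
  finally show ?thesis .
qed

text \<open>This is \<open>sqrt pi / 2\<close> times the usual complementary error function.\<close>

definition erfcI :: "real \<Rightarrow> real" where
  "erfcI x = (LINT r:{x..}|lborel. exp (- r\<^sup>2))"

lemma gaussian_has_bochner_integral: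
  "has_bochner_integral lborel (\<lambda>r::real. exp (- r\<^sup>2)) (sqrt pi)"
  using has_bochner_integral_even_function[OF gaussian_moment_even_pos[where k=0]] by simp

lemma set_integrable_gaussian:
  assumes "A \<in> sets borel"
  shows "set_integrable lborel A (\<lambda>r::real. exp (- r\<^sup>2))"
  unfolding set_integrable_def
  by (rule integrable_mult_indicator)
     (use assms gaussian_has_bochner_integral in \<open>auto simp: has_bochner_integral_iff\<close>)

lemma erfcI_has_derivative: "(erfcI has_real_derivative - exp (- x\<^sup>2)) (at x)"
  unfolding erfcI_def[abs_def]
  by (rule tail_integral_has_derivative[of "x - 1"])
     (auto intro!: continuous_intros set_integrable_gaussian)

lemma erfcI_nonneg: "erfcI x \<ge> 0"
  unfolding erfcI_def set_lebesgue_integral_def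
  by (rule Bochner_Integration.integral_nonneg) (auto simp: indicator_def)

lemma erfcI_le: "erfcI x \<le> sqrt pi"
proof -
  have "erfcI x \<le> (LINT r:UNIV|lborel. exp (- r\<^sup>2))"
    unfolding erfcI_def set_lebesgue_integral_def
    using set_integrable_gaussian[of "{x..}"] set_integrable_gaussian[of UNIV]
    unfolding set_integrable_def
    by (intro Bochner_Integration.integral_mono) (auto simp: indicator_def)
  then show ?thesis using has_bochner_integral_integral_eq[OF gaussian_has_bochner_integral]
    by (simp add: set_lebesgue_integral_def)
qed

lemma erfcI_at_top: "(erfcI \<longlongrightarrow> 0) at_top"
proof (rule tendsto_sandwich[of "\<lambda>_. 0" _ _ "\<lambda>x. exp (- x)"])
  show "\<forall>\<^sub>F x in at_top. erfcI x \<le> exp (- x)"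
  proof (rule eventually_at_top_linorderI[of 1])
    fix x :: real assume "x \<ge> 1"
    have "r \<le> r\<^sup>2" if "r \<ge> x" for r using that \<open>x \<ge> 1\<close> by (simp add: power2_eq_square)
    then have "erfcI x \<le> (LINT r:{x..}|lborel. exp (- 1 * r))"
      unfolding erfcI_def
      by (intro set_integral_mono set_integrable_gaussian set_integrable_exp_tail) auto
    then show "erfcI x \<le> exp (- x)" using set_integrable_exp_tail(2)[of 1 x] by simp
  qed
  show "((\<lambda>x::real. exp (- x)) \<longlongrightarrow> 0) at_top" by real_asymp
qed (auto simp: erfcI_nonneg)

lemma erfcI_reflect: "erfcI (- x) = sqrt pi - erfcI x"
proof -
  have disj: "{..x} \<inter> {x<..} = {}" and UN: "{..x} \<union> {x<..} = UNIV" by auto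
  have "(LINT r:UNIV|lborel. exp (- r\<^sup>2)) = (LINT r:{..x}|lborel. exp (- r\<^sup>2)) + (LINT r:{x<..}|lborel. exp (- r\<^sup>2))"
    using set_integral_Un[of "{..x}" "{x<..}" lborel "\<lambda>r. exp (- r\<^sup>2)"]
      disj UN
    by (simp add: set_integrable_gaussian)
  moreover have "(LINT r:{x<..}|lborel. exp (- r\<^sup>2)) = erfcI x"
    unfolding set_lebesgue_integral_def erfcI_def
  proof (rule integral_cong_AE)
    show "AE r in lborel. indicator {x<..} r *\<^sub>R exp (- r\<^sup>2) = indicator {x..} r *\<^sub>R exp (- r\<^sup>2)"
      using AE_lborel_singleton[of x] by eventually_elim (auto simp: indicator_def)
  qed auto
  moreover have "(LINT r:{..x}|lborel. exp (- r\<^sup>2)) = erfcI (- x)"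
    unfolding set_lebesgue_integral_def erfcI_def
    by (subst lborel_integral_real_affine[where c="-1" and t=0])
       (auto intro!: Bochner_Integration.integral_cong simp: indicator_def)
  ultimately show ?thesis
    using has_bochner_integral_integral_eq[OF gaussian_has_bochner_integral]
    by (simp add: set_lebesgue_integral_def)
qed

lemma erfcI_at_bot: "(erfcI \<longlongrightarrow> sqrt pi) at_bot"
proof -
  have "((\<lambda>x. sqrt pi - erfcI (- x)) \<longlongrightarrow> sqrt pi - 0) at_bot"
    by (intro tendsto_intros filterlim_compose[OF erfcI_at_top filterlim_uminus_at_top_at_bot])
  moreover have "(\<lambda>x. sqrt pi - erfcI (- x)) = erfcI" by (auto simp: erfcI_reflect)
  ultimately show ?thesis by simp
qed

text \<open>Substituting \<open>r = \<rho> + a + b\<close>, the exponent \<open>2ab - r\<^sup>2\<close> becomes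
  \<open>- (\<rho> + b)\<^sup>2 - a\<^sup>2 - 2a\<rho>\<close>.\<close>

lemma exp_erfcI_le:
  assumes "a \<ge> 0"
  shows "exp (2 * a * b) * erfcI (a + b) \<le> sqrt pi * exp (- a\<^sup>2)"
proof -
  have "exp (2 * a * b) * erfcI (a + b) = (LINT r:{a + b..}|lborel. exp (2 * a * b) * exp (- r\<^sup>2))"
    unfolding erfcI_def by (simp add: set_integral_mult_right)
  also have "\<dots> \<le> (LINT r:{a + b..}|lborel. exp (- a\<^sup>2) * exp (- (r - a)\<^sup>2))"
  proof (rule set_integral_mono)
    have "integrable lborel (\<lambda>r. exp (- (r - a)\<^sup>2))"
      using lborel_integrable_real_affine[of "\<lambda>r. exp (- r\<^sup>2)" 1 "- a"] gaussian_has_bochner_integral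
      by (simp add: has_bochner_integral_iff)
    then show "set_integrable lborel {a + b..} (\<lambda>r. exp (- a\<^sup>2) * exp (- (r - a)\<^sup>2))"
      unfolding set_integrable_def by (intro integrable_mult_indicator) auto
    fix r assume "r \<in> {a + b..}"
    then have "0 \<le> 2 * a * (r - (a + b))" using assms by simp
    then show "exp (2 * a * b) * exp (- r\<^sup>2) \<le> exp (- a\<^sup>2) * exp (- (r - a)\<^sup>2)"
      by (simp add: exp_add[symmetric] power2_eq_square algebra_simps)
  qed (auto intro!: set_integrable_gaussian)
  also have "\<dots> = exp (- a\<^sup>2) * (LINT r:{a + b..}|lborel. exp (- (r - a)\<^sup>2))"
    by (simp add: set_integral_mult_right)
  also have "(LINT r:{a + b..}|lborel. exp (- (r - a)\<^sup>2)) = erfcI b"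
    unfolding set_lebesgue_integral_def erfcI_def
    by (subst lborel_integral_real_affine[where c=1 and t=a])
       (auto intro!: Bochner_Integration.integral_cong simp: indicator_def)
  also have "exp (- a\<^sup>2) * erfcI b \<le> sqrt pi * exp (- a\<^sup>2)"
    using erfcI_le[of b] by (simp add: mult.commute)
  finally show ?thesis .
qed

section \<open>Summable majorants on the integers\<close>

lemma summable_on_int_inverse_square: "(\<lambda>b::int. 1 / (1 + (real_of_int b)\<^sup>2)) summable_on UNIV"
proof -
  have "summable (\<lambda>n. 1 / (1 + (real n)\<^sup>2))"
  proof (rule summable_comparison_test_ev)
    show "summable (\<lambda>n. inverse ((real n) ^ 2))" by (rule inverse_power_summable) simp
    show "\<forall>\<^sub>F n in sequentially. norm (1 / (1 + (real n)\<^sup>2)) \<le> inverse ((real n) ^ 2)"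
      by (rule eventually_sequentiallyI[of 1]) (auto simp: divide_simps add_pos_nonneg not_less intro: add_nonneg_nonneg)
  qed
  then have n: "(\<lambda>n::nat. 1 / (1 + (real n)\<^sup>2)) summable_on UNIV"
    by (subst summable_on_UNIV_nonneg_real_iff) auto
  have "(\<lambda>b::int. 1 / (1 + (real_of_int b)\<^sup>2)) summable_on range int"
    "(\<lambda>b::int. 1 / (1 + (real_of_int b)\<^sup>2)) summable_on range (\<lambda>n. - int n)"
    using n by (subst summable_on_reindex; simp add: inj_on_def o_def)+
  then have "(\<lambda>b::int. 1 / (1 + (real_of_int b)\<^sup>2)) summable_on (range int \<union> range (\<lambda>n. - int n))"
    by (rule summable_on_union)
  moreover have "range int \<union> range (\<lambda>n. - int n) = UNIV"
  proof -
    have "b \<in> range int \<union> range (\<lambda>n. - int n)" for b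
      by (cases b rule: int_cases2) auto
    then show ?thesis by auto
  qed
  ultimately show ?thesis by simp
qed

lemma summable_on_nat_inverse_square: "(\<lambda>n::nat. 1 / (1 + (real n)\<^sup>2)) summable_on J"
proof -
  have "(\<lambda>b::int. 1 / (1 + (real_of_int b)\<^sup>2)) summable_on range int"
    using summable_on_int_inverse_square by (rule summable_on_subset_banach) auto
  then have "(\<lambda>n::nat. 1 / (1 + (real n)\<^sup>2)) summable_on UNIV"
    by (subst (asm) summable_on_reindex) (auto simp: inj_on_def o_def)
  then show ?thesis by (rule summable_on_subset_banach) auto
qed

lemma exp_neg_square_le:
  fixes s k :: real
  assumes "k > 0"
  shows "exp (- k * s\<^sup>2) \<le> (1 + 1 / k) / (1 + s\<^sup>2)"
proof -
  have "1 + s\<^sup>2 \<le> (1 + 1 / k) * (1 + k * s\<^sup>2)" using assms by (simp add: field_simps)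
  also have "\<dots> \<le> (1 + 1 / k) * exp (k * s\<^sup>2)"
    using assms by (intro mult_left_mono) auto
  finally have "(1 + s\<^sup>2) * exp (- k * s\<^sup>2) \<le> (1 + 1 / k) * (exp (k * s\<^sup>2) * exp (- k * s\<^sup>2))"
    by (simp add: mult_right_mono mult.assoc[symmetric])
  then show ?thesis by (simp add: exp_add[symmetric] field_simps pos_le_divide_eq add_pos_nonneg)
qed

text \<open>Peetre's inequality: translating the weight costs only a factor that is polynomial in
  the shift. It makes one majorant in \<open>b\<close> serve all real parts of \<open>z\<close>, up
  to polynomial factors.\<close>

lemma inverse_square_shift_le:
  fixes b x :: real
  shows "1 / (1 + (b - x)\<^sup>2) \<le> 2 * (1 + x\<^sup>2) * (1 / (1 + b\<^sup>2))"
proof -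
  \<comment> \<open>This quantity is the difference of the two sides after clearing
    denominators.\<close>
  have "0 \<le> (b - 2 * x)\<^sup>2 + 2 * (x * (b - x))\<^sup>2 + 1" by simp
  then have "1 + b\<^sup>2 \<le> 2 * (1 + x\<^sup>2) * (1 + (b - x)\<^sup>2)"
    by (simp add: power2_eq_square algebra_simps)
  then show ?thesis by (simp add: field_simps add_pos_nonneg)
qed

lemma exp_neg_square_shift_le:
  fixes b x k :: real
  assumes "k > 0"
  shows "exp (- k * (b - x)\<^sup>2) \<le> 2 * (1 + 1 / k) * (1 + x\<^sup>2) * (1 / (1 + b\<^sup>2))"
proof -
  have "exp (- k * (b - x)\<^sup>2) \<le> (1 + 1 / k) * (1 / (1 + (b - x)\<^sup>2))"
    using exp_neg_square_le[OF assms] by simp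
  also have "\<dots> \<le> (1 + 1 / k) * (2 * (1 + x\<^sup>2) * (1 / (1 + b\<^sup>2)))"
    using assms by (intro mult_left_mono inverse_square_shift_le) auto
  also have "\<dots> = 2 * (1 + 1 / k) * (1 + x\<^sup>2) * (1 / (1 + b\<^sup>2))" by (simp only: mult_ac)
  finally show ?thesis .
qed

section \<open>Termwise integration and uniqueness of Fourier coefficients\<close>

lemma integral_infsum_dominated:
  fixes f :: "'i \<Rightarrow> real \<Rightarrow> real"
  assumes cont: "\<And>i. i \<in> J \<Longrightarrow> continuous_on {a..b} (f i)"
    and bd: "\<And>i y. i \<in> J \<Longrightarrow> y \<in> {a..b} \<Longrightarrow> \<bar>f i y\<bar> \<le> M i"
    and M: "M summable_on J" and ab: "a \<le> b"
  shows "continuous_on {a..b} (\<lambda>y. \<Sum>\<^sub>\<infinity>i\<in>J. f i y)"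
    and "integral {a..b} (\<lambda>y. \<Sum>\<^sub>\<infinity>i\<in>J. f i y) = (\<Sum>\<^sub>\<infinity>i\<in>J. integral {a..b} (f i))"
proof -
  have pos: "M i \<ge> 0" if "i \<in> J" for i using bd[OF that, of a] ab by auto
  show c: "continuous_on {a..b} (\<lambda>y. \<Sum>\<^sub>\<infinity>i\<in>J. f i y)"
    unfolding continuous_on_def
  proof
    fix y assume y: "y \<in> {a..b}"
    show "((\<lambda>y. \<Sum>\<^sub>\<infinity>i\<in>J. f i y) \<longlongrightarrow> (\<Sum>\<^sub>\<infinity>i\<in>J. f i y)) (at y within {a..b})"
    proof (cases "at y within {a..b} = bot")
      case False
      then show ?thesis
        by (intro infsum_tendsto_dominated[where M=M])
           (use cont y bd M in \<open>auto simp: continuous_on_def eventually_at_topological\<close>)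
    qed simp
  qed
  have "\<bar>integral {a..b} (\<lambda>y. \<Sum>\<^sub>\<infinity>i\<in>J. f i y) - (\<Sum>\<^sub>\<infinity>i\<in>J. integral {a..b} (f i))\<bar> \<le> e"
    if e: "e > 0" for e
  proof -
    define e' where "e' = e / (2 * (b - a) + 1)"
    have e': "e' > 0" "2 * (b - a) * e' \<le> e"
      using e ab unfolding e'_def by (auto simp: field_simps)
    obtain K where K: "finite K" "K \<subseteq> J"
      "\<And>h :: 'i \<Rightarrow> real. (\<And>i. i \<in> J \<Longrightarrow> \<bar>h i\<bar> \<le> M i) \<Longrightarrow> \<bar>infsum h J - sum h K\<bar> \<le> e'"
      using infsum_finite_tail[OF M pos e'(1)] by auto
    have int: "f i integrable_on {a..b}" if "i \<in> J" for i
      using cont[OF that] by (rule integrable_continuous_real)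
    have 1: "\<bar>integral {a..b} (\<lambda>y. \<Sum>\<^sub>\<infinity>i\<in>J. f i y) - (\<Sum>i\<in>K. integral {a..b} (f i))\<bar> \<le> e' * (b - a)"
    proof -
      have "integral {a..b} (\<lambda>y. \<Sum>\<^sub>\<infinity>i\<in>J. f i y) - (\<Sum>i\<in>K. integral {a..b} (f i))
        = integral {a..b} (\<lambda>y. (\<Sum>\<^sub>\<infinity>i\<in>J. f i y) - (\<Sum>i\<in>K. f i y))"
      proof (subst Henstock_Kurzweil_Integration.integral_diff)
        show "(\<lambda>y. \<Sum>i\<in>K. f i y) integrable_on {a..b}"
          by (rule integrable_sum) (use K int in auto)
        have "integral {a..b} (\<lambda>y. \<Sum>i\<in>K. f i y) = (\<Sum>i\<in>K. integral {a..b} (f i))"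
          by (rule integral_sum) (use K int in auto)
        then show "integral {a..b} (\<lambda>y. \<Sum>\<^sub>\<infinity>i\<in>J. f i y) - (\<Sum>i\<in>K. integral {a..b} (f i))
          = integral {a..b} (\<lambda>y. \<Sum>\<^sub>\<infinity>i\<in>J. f i y) - integral {a..b} (\<lambda>y. \<Sum>i\<in>K. f i y)" by simp
      qed (rule integrable_continuous_real[OF c])
      also have "norm \<dots> \<le> e' * (b - a)"
      proof (rule integral_bound[OF ab])
        have "continuous_on {a..b} (\<lambda>y. \<Sum>i\<in>K. f i y)"
          by (intro continuous_intros cont) (use K in auto)
        then show "continuous_on {a..b} (\<lambda>y. (\<Sum>\<^sub>\<infinity>i\<in>J. f i y) - (\<Sum>i\<in>K. f i y))"
          by (intro continuous_on_diff c)
      qed (use K bd in auto)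
      finally show ?thesis by simp
    qed
    have 2: "\<bar>(\<Sum>\<^sub>\<infinity>i\<in>J. integral {a..b} (f i)) - (\<Sum>i\<in>K. integral {a..b} (f i))\<bar> \<le> e' * (b - a)"
    proof (cases "b = a")
      case False
      have "\<bar>integral {a..b} (f i)\<bar> \<le> M i * (b - a)" if "i \<in> J" for i
        using integral_bound[OF ab cont[OF that], of "M i"] bd[OF that] by simp
      then have "\<bar>(\<Sum>\<^sub>\<infinity>i\<in>J. integral {a..b} (f i) / (b - a)) - (\<Sum>i\<in>K. integral {a..b} (f i) / (b - a))\<bar> \<le> e'"
        using ab False by (intro K(3)) (simp add: field_simps)
      moreover have "(\<Sum>\<^sub>\<infinity>i\<in>J. integral {a..b} (f i) / (b - a)) = (\<Sum>\<^sub>\<infinity>i\<in>J. integral {a..b} (f i)) / (b - a)"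
        using infsum_cmult_left'[of "\<lambda>i. integral {a..b} (f i)" "1 / (b - a)" J] by simp
      ultimately have "\<bar>(\<Sum>\<^sub>\<infinity>i\<in>J. integral {a..b} (f i)) - (\<Sum>i\<in>K. integral {a..b} (f i))\<bar> / (b - a) \<le> e'"
        using ab False by (simp add: sum_divide_distrib[symmetric] diff_divide_distrib[symmetric] abs_divide)
      then show ?thesis using ab False by (simp add: pos_divide_le_eq)
    qed simp
    have "\<bar>integral {a..b} (\<lambda>y. \<Sum>\<^sub>\<infinity>i\<in>J. f i y) - (\<Sum>\<^sub>\<infinity>i\<in>J. integral {a..b} (f i))\<bar> \<le> 2 * (e' * (b - a))"
      using abs_triangle_ineq4[of "integral {a..b} (\<lambda>y. \<Sum>\<^sub>\<infinity>i\<in>J. f i y) - (\<Sum>i\<in>K. integral {a..b} (f i))"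
        "(\<Sum>\<^sub>\<infinity>i\<in>J. integral {a..b} (f i)) - (\<Sum>i\<in>K. integral {a..b} (f i))"] 1 2
      by simp
    also have "\<dots> \<le> e" using e'(2) by (simp add: mult_ac)
    finally show ?thesis .
  qed
  then have "\<bar>integral {a..b} (\<lambda>y. \<Sum>\<^sub>\<infinity>i\<in>J. f i y) - (\<Sum>\<^sub>\<infinity>i\<in>J. integral {a..b} (f i))\<bar> \<le> 0"
    by (metis field_le_epsilon add_0)
  then show "integral {a..b} (\<lambda>y. \<Sum>\<^sub>\<infinity>i\<in>J. f i y) = (\<Sum>\<^sub>\<infinity>i\<in>J. integral {a..b} (f i))"
    unfolding abs_le_zero_iff right_minus_eq .
qed

text \<open>The trigonometric polynomials \<open>cos (\<pi> (y - p)) ^ (2 N)\<close> concentrate at \<open>p\<close> as \<open>N\<close> grows.\<close>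

lemma fourier_coefficients_zero_imp_nonpos:
  fixes g :: "real \<Rightarrow> real"
  assumes g: "continuous_on {0..1} g"
    and coef: "\<And>(k::int) \<alpha>. integral {0..1} (\<lambda>y. g y * cos (2 * pi * k * y + \<alpha>)) = 0"
    and p: "0 < p" "p < 1"
  shows "g p \<le> 0"
proof (rule ccontr)
  assume "\<not> g p \<le> 0"
  then have gp: "g p > 0" by simp
  define ker where "ker y = (cos (pi * (y - p)))\<^sup>2" for y
  have contk: "continuous_on S ker" for S unfolding ker_def by (intro continuous_intros)
  \<comment> \<open>The kernel contains the frequencies -1, 0 and 1 only, so multiplication by it
    moves a frequency \<open>k\<close> to \<open>k - 1\<close>, \<open>k\<close> and
    \<open>k + 1\<close> and changes the phase. Hence the induction below runs over arbitrary
    \<open>k\<close> and \<open>\<alpha>\<close>; the free phase also covers sine and cosine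
    coefficients together.\<close>
  have ker_mult: "ker y * cos (2 * pi * of_int k * y + \<alpha>)
      = 1/2 * cos (2 * pi * of_int k * y + \<alpha>)
        + (1/4 * cos (2 * pi * of_int (k + 1) * y + (\<alpha> - 2 * pi * p))
        + 1/4 * cos (2 * pi * of_int (k - 1) * y + (\<alpha> + 2 * pi * p)))" for y \<alpha> and k :: int
  proof -
    have "ker y = 1/2 + 1/2 * cos (2 * (pi * (y - p)))"
      unfolding ker_def by (simp only: cos_double_cos) (simp add: field_simps)
    moreover have "cos (2 * (pi * (y - p))) * cos (2 * pi * of_int k * y + \<alpha>)
      = 1/2 * (cos (2 * pi * of_int (k - 1) * y + (\<alpha> + 2 * pi * p))
          + cos (2 * pi * of_int (k + 1) * y + (\<alpha> - 2 * pi * p)))"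
    proof -
      have "cos (2 * (pi * (y - p))) * cos (2 * pi * of_int k * y + \<alpha>)
        = (cos (2 * (pi * (y - p)) - (2 * pi * of_int k * y + \<alpha>))
          + cos (2 * (pi * (y - p)) + (2 * pi * of_int k * y + \<alpha>))) / 2"
        by (rule cos_times_cos)
      moreover have "2 * (pi * (y - p)) - (2 * pi * of_int k * y + \<alpha>)
        = - (2 * pi * of_int (k - 1) * y + (\<alpha> + 2 * pi * p))" by (simp add: algebra_simps)
      moreover have "2 * (pi * (y - p)) + (2 * pi * of_int k * y + \<alpha>)
        = 2 * pi * of_int (k + 1) * y + (\<alpha> - 2 * pi * p)" by (simp add: algebra_simps)
      ultimately show ?thesis by (simp only: cos_minus)
    qed
    ultimately show ?thesis by (simp add: algebra_simps)
  qed
  have zero: "integral {0..1} (\<lambda>y. g y * ker y ^ N * cos (2 * pi * of_int k * y + \<alpha>)) = 0" for N and k :: int and \<alpha>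
  proof (induction N arbitrary: k \<alpha>)
    case 0
    then show ?case using coef by simp
  next
    case (Suc N)
    define T where "T k \<alpha> y = g y * ker y ^ N * cos (2 * pi * of_int k * y + \<alpha>)" for k :: int and \<alpha> y
    have iT: "(\<lambda>y. c * T k \<alpha> y) integrable_on {0..1}" for c \<alpha> and k :: int
      unfolding T_def by (intro integrable_continuous_real continuous_intros g contk)
    have T0: "integral {0..1} (\<lambda>y. c * T k \<alpha> y) = 0" for c k \<alpha>
      using Suc[of k \<alpha>] by (simp add: T_def)
    have "(\<lambda>y. g y * ker y ^ Suc N * cos (2 * pi * of_int k * y + \<alpha>)) =
      (\<lambda>y. 1/2 * T k \<alpha> y + (1/4 * T (k+1) (\<alpha> - 2 * pi * p) y + 1/4 * T (k-1) (\<alpha> + 2 * pi * p) y))"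
    proof
      fix y
      have "g y * ker y ^ Suc N * cos (2 * pi * of_int k * y + \<alpha>)
        = g y * ker y ^ N * (ker y * cos (2 * pi * of_int k * y + \<alpha>))" by simp
      then show "g y * ker y ^ Suc N * cos (2 * pi * of_int k * y + \<alpha>) =
         1/2 * T k \<alpha> y + (1/4 * T (k+1) (\<alpha> - 2 * pi * p) y + 1/4 * T (k-1) (\<alpha> + 2 * pi * p) y)"
        unfolding ker_mult T_def by (simp only: distrib_left mult_ac)
    qed
    then show ?case
      by (simp only: Henstock_Kurzweil_Integration.integral_add iT integrable_add T0)
  qed
  have int0: "integral {0..1} (\<lambda>y. g y * ker y ^ N) = 0" for N
    using zero[of N 0 0] by simp
  have "isCont g p" using g p by (simp add: continuous_on_interior)
  then obtain \<delta>0 where d0: "\<delta>0 > 0" "\<And>y. \<bar>y - p\<bar> < \<delta>0 \<Longrightarrow> \<bar>g y - g p\<bar> < g p / 2"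
    using gp unfolding continuous_at_eps_delta dist_real_def by (metis half_gt_zero)
  define \<delta> where "\<delta> = min (\<delta>0 / 2) (min (p / 2) ((1 - p) / 2))"
  have d: "\<delta> > 0" "\<delta> < \<delta>0" "\<delta> < p" "\<delta> < 1 - p" "\<delta> \<le> 1/4"
    using d0 p unfolding \<delta>_def by (auto simp: min_def)
  have gpos: "g y \<ge> g p / 2" if "\<bar>y - p\<bar> \<le> \<delta>" for y
    using d0(2)[of y] that d(2) by linarith
  obtain Bd where Bd: "\<And>y. y \<in> {0..1} \<Longrightarrow> \<bar>g y\<bar> \<le> Bd"
    using compact_continuous_image[OF g] compact_imp_bounded bounded_iff
    by (metis compact_Icc imageI real_norm_def)
  have Bd0: "Bd \<ge> 0" using Bd[of 0] by auto
  \<comment> \<open>\<open>r1\<close> bounds the kernel from above at distance at least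
    \<open>\<delta>\<close> from \<open>p\<close>, and \<open>r2\<close> bounds it from below within
    distance \<open>\<delta> / 2\<close>. The gap \<open>r1 < r2\<close> makes the concentration
    exponential in \<open>N\<close>.\<close>
  define r1 where "r1 = (cos (pi * \<delta>))\<^sup>2"
  define r2 where "r2 = (cos (pi * (\<delta> / 2)))\<^sup>2"
  have cpos: "cos (pi * \<delta>) > 0" using d by (intro cos_gt_zero_pi) (auto simp: field_simps intro: order.strict_trans[of _ 0])
  have clt: "cos (pi * \<delta>) < cos (pi * (\<delta> / 2))"
    using d by (intro cos_monotone_0_pi) (auto simp: field_simps)
  have r: "0 < r1" "r1 < r2"
    unfolding r1_def r2_def using cpos clt by (auto intro!: power_strict_mono)
  have kabs: "ker y = (cos (pi * \<bar>y - p\<bar>))\<^sup>2" for y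
    unfolding ker_def by (cases "y \<ge> p") (auto simp: abs_if right_diff_distrib cos_diff mult.commute)
  have k1: "ker y \<le> r1" if y: "y \<in> {0..1}" "\<bar>y - p\<bar> \<ge> \<delta>" for y
  proof -
    \<comment> \<open>The kernel peaks again at \<open>p - 1\<close> and \<open>p + 1\<close>; a
      distance of at most \<open>1 - \<delta>\<close> from \<open>p\<close> keeps \<open>y\<close>
      away from these two peaks.\<close>
    have le: "\<bar>y - p\<bar> \<le> 1 - \<delta>" using y d by auto
    have a: "cos (pi * \<bar>y - p\<bar>) \<le> cos (pi * \<delta>)"
      using y d le by (intro cos_monotone_0_pi_le) (auto simp: mult_le_cancel_left_pos)
    have "cos (pi * (1 - \<delta>)) \<le> cos (pi * \<bar>y - p\<bar>)"
      using y d le by (intro cos_monotone_0_pi_le) (auto simp: mult_le_cancel_left_pos)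
    moreover have "cos (pi * (1 - \<delta>)) = - cos (pi * \<delta>)" by (simp add: right_diff_distrib)
    ultimately have "\<bar>cos (pi * \<bar>y - p\<bar>)\<bar> \<le> \<bar>cos (pi * \<delta>)\<bar>" using a by auto
    then show ?thesis unfolding kabs r1_def by (simp only: abs_le_square_iff)
  qed
  have k2: "ker y \<ge> r2" if y: "\<bar>y - p\<bar> \<le> \<delta> / 2" for y
  proof -
    have "cos (pi * (\<delta> / 2)) \<le> cos (pi * \<bar>y - p\<bar>)"
      using y d by (intro cos_monotone_0_pi_le) (auto simp: mult_le_cancel_left_pos field_simps)
    then show ?thesis unfolding kabs r2_def using clt cpos by (intro power_mono) auto
  qed
  have main: "g p / 2 * r2 ^ N * \<delta> \<le> Bd * r1 ^ N" for N
  proof -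
    \<comment> \<open>A minorant of \<open>g y * ker y ^ N\<close>. Near \<open>p\<close> it records
      the main contribution, in the ring between \<open>\<delta> / 2\<close> and
      \<open>\<delta>\<close> the product is merely nonnegative, and further away the loss is at
      most \<open>Bd * r1 ^ N\<close>.\<close>
    define lo where "lo y = (if \<bar>y - p\<bar> \<le> \<delta> / 2 then g p / 2 * r2 ^ N else 0) - Bd * r1 ^ N" for y
    have "(lo has_integral (g p / 2 * r2 ^ N * \<delta> - Bd * r1 ^ N)) {0..1}"
    proof -
      have "((\<lambda>y. g p / 2 * r2 ^ N) has_integral (p + \<delta> / 2 - (p - \<delta> / 2)) *\<^sub>R (g p / 2 * r2 ^ N)) {p - \<delta> / 2..p + \<delta> / 2}"
        using has_integral_const_real[of "g p / 2 * r2 ^ N" "p - \<delta> / 2" "p + \<delta> / 2"] d by simp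
      then have "((\<lambda>y. if y \<in> {p - \<delta> / 2..p + \<delta> / 2} then g p / 2 * r2 ^ N else 0)
         has_integral (p + \<delta> / 2 - (p - \<delta> / 2)) *\<^sub>R (g p / 2 * r2 ^ N)) {0..1}"
        by (subst has_integral_restrict) (use d in auto)
      moreover have "((\<lambda>y. Bd * r1 ^ N) has_integral (1 - 0) *\<^sub>R (Bd * r1 ^ N)) {0..1::real}"
        using has_integral_const_real[of "Bd * r1 ^ N" 0 1] by simp
      ultimately have "((\<lambda>y. (if y \<in> {p - \<delta> / 2..p + \<delta> / 2} then g p / 2 * r2 ^ N else 0) - Bd * r1 ^ N)
         has_integral ((p + \<delta> / 2 - (p - \<delta> / 2)) *\<^sub>R (g p / 2 * r2 ^ N) - (1 - 0) *\<^sub>R (Bd * r1 ^ N))) {0..1}"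
        by (rule has_integral_diff)
      moreover have "(\<lambda>y. (if y \<in> {p - \<delta> / 2..p + \<delta> / 2} then g p / 2 * r2 ^ N else 0) - Bd * r1 ^ N) = lo"
        proof -
        have "y \<in> {p - \<delta> / 2..p + \<delta> / 2} \<longleftrightarrow> \<bar>y - p\<bar> \<le> \<delta> / 2" for y
          unfolding atLeastAtMost_iff by linarith
        then show ?thesis unfolding lo_def by presburger
      qed
      ultimately show ?thesis by (simp add: mult_ac)
    qed
    moreover have "((\<lambda>y. g y * ker y ^ N) has_integral 0) {0..1}"
      using int0[of N] by (metis integrable_integral integrable_continuous_real continuous_on_mult[OF g continuous_on_power[OF contk]])
    moreover have "lo y \<le> g y * ker y ^ N" if y: "y \<in> {0..1}" for y
    proof (cases "\<bar>y - p\<bar> \<le> \<delta>")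
      case True
      have r0: "Bd * r1 ^ N \<ge> 0" using Bd0 r by auto
      have k0: "ker y \<ge> 0" unfolding ker_def by simp
      show ?thesis
      proof (cases "\<bar>y - p\<bar> \<le> \<delta> / 2")
        case True2: True
        have "g p / 2 * r2 ^ N \<le> g y * ker y ^ N"
          using gpos[OF True] gp k2[OF True2] r by (intro mult_mono power_mono) auto
        then show ?thesis using r0 True2 unfolding lo_def by simp
      next
        case False
        have "0 \<le> g y * ker y ^ N" using gpos[OF True] gp k0 by auto
        then show ?thesis using r0 False unfolding lo_def by simp
      qed
    next
      case False
      have k0: "ker y \<ge> 0" unfolding ker_def by simp
      have "\<bar>g y * ker y ^ N\<bar> \<le> Bd * r1 ^ N"
        unfolding abs_mult using Bd[OF y] k1[OF y] False k0 Bd0 by (intro mult_mono) (auto intro!: power_mono)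
      then show ?thesis using False d unfolding lo_def by auto
    qed
    ultimately have "g p / 2 * r2 ^ N * \<delta> - Bd * r1 ^ N \<le> 0"
      using has_integral_le by blast
    then show ?thesis by simp
  qed
  have "(\<lambda>N. Bd * (r1 / r2) ^ N) \<longlonglongrightarrow> Bd * 0"
    using r by (intro tendsto_mult tendsto_const LIMSEQ_realpow_zero) auto
  moreover have "g p / 2 * \<delta> \<le> Bd * (r1 / r2) ^ N" for N
    using main[of N] r by (simp add: power_divide field_simps)
  ultimately have "g p / 2 * \<delta> \<le> Bd * 0"
    by (intro LIMSEQ_le_const) auto
  then show False using gp d by (simp add: mult_le_0_iff)
qed

section \<open>Theta inversion\<close>

text \<open>Real and imaginary part of the characteristic function exp (- t^2 / 2) of the standard
  normal law, combined by the addition formula for the cosine.\<close>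

lemma std_normal_cos_integral:
  fixes t \<alpha> :: real
  shows "integrable lborel (\<lambda>x. std_normal_density x * cos (t * x + \<alpha>))"
    and "(LBINT x. std_normal_density x * cos (t * x + \<alpha>)) = exp (- t\<^sup>2 / 2) * cos \<alpha>"
proof -
  interpret real_distribution std_normal_distribution by (rule real_dist_normal_dist)
  have ie: "complex_integrable std_normal_distribution (\<lambda>x. iexp (t * x))"
    by (rule integrable_iexp) auto
  have ch: "(CLINT x|std_normal_distribution. iexp (t * x)) = complex_of_real (exp (- t\<^sup>2 / 2))"
    using char_std_normal_distribution by (simp add: char_def fun_eq_iff)
  have c: "(LINT x|std_normal_distribution. cos (t * x)) = exp (- t\<^sup>2 / 2)"
    using arg_cong[OF ch, of Re] integral_Re[OF ie] by (simp add: Re_exp)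
  have s: "(LINT x|std_normal_distribution. sin (t * x)) = 0"
    using arg_cong[OF ch, of Im] integral_Im[OF ie] by (simp add: Im_exp)
  have ic: "integrable std_normal_distribution (\<lambda>x. cos (t * x))" "integrable std_normal_distribution (\<lambda>x. sin (t * x))"
    by (intro integrable_const_bound[where B=1]; simp)+
  have id: "integrable std_normal_distribution (\<lambda>x. cos (t * x + \<alpha>))"
    by (intro integrable_const_bound[where B=1]; simp)
  have e: "(LINT x|std_normal_distribution. cos (t * x + \<alpha>)) = exp (- t\<^sup>2 / 2) * cos \<alpha>"
    using ic c s by (simp add: cos_add)
  show "integrable lborel (\<lambda>x. std_normal_density x * cos (t * x + \<alpha>))"
    using id by (subst (asm) integrable_density) (auto simp: normal_density_nonneg)
  show "(LBINT x. std_normal_density x * cos (t * x + \<alpha>)) = exp (- t\<^sup>2 / 2) * cos \<alpha>"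
    using e by (subst (asm) integral_density) (auto simp: normal_density_nonneg)
qed

lemma gaussian_cos_integral:
  fixes \<tau> k \<alpha> :: real
  assumes "\<tau> > 0"
  shows "integrable lborel (\<lambda>r. exp (- pi * r\<^sup>2 / \<tau>) * cos (2 * pi * k * r + \<alpha>))"
    and "(LBINT r. exp (- pi * r\<^sup>2 / \<tau>) * cos (2 * pi * k * r + \<alpha>))
          = sqrt \<tau> * exp (- pi * k\<^sup>2 * \<tau>) * cos \<alpha>"
proof -
  \<comment> \<open>The scaling \<open>r = c * x\<close> turns exp (- pi r^2 / \<tau>) into exp (-
    x^2 / 2).\<close>
  define c where "c = sqrt (\<tau> / (2 * pi))"
  define t where "t = 2 * pi * k * c"
  have c: "c > 0" "c\<^sup>2 = \<tau> / (2 * pi)" using assms by (auto simp: c_def)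
  define f where "f r = exp (- pi * r\<^sup>2 / \<tau>) * cos (2 * pi * k * r + \<alpha>)" for r
  have fc: "f (0 + c * x) = sqrt (2 * pi) * (std_normal_density x * cos (t * x + \<alpha>))" for x
  proof -
    have "- pi * (c * x)\<^sup>2 / \<tau> = - x\<^sup>2 / 2"
      using assms c(2) by (simp add: power_mult_distrib field_simps)
    then show ?thesis unfolding f_def std_normal_density_def t_def by (simp add: mult_ac)
  qed
  have "integrable lborel (\<lambda>x. f (0 + c * x))"
    unfolding fc using std_normal_cos_integral(1) by simp
  then show "integrable lborel (\<lambda>r. exp (- pi * r\<^sup>2 / \<tau>) * cos (2 * pi * k * r + \<alpha>))"
    using lborel_integrable_real_affine_iff[of c f 0] c unfolding f_def by simp
  have "(LBINT r. f r) = c * (LBINT x. f (0 + c * x))"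
    using lborel_integral_real_affine[of c f 0] c by simp
  also have "\<dots> = c * (sqrt (2 * pi) * (exp (- t\<^sup>2 / 2) * cos \<alpha>))"
    unfolding fc using std_normal_cos_integral(2) by simp
  also have "c * sqrt (2 * pi) = sqrt \<tau>" using assms by (simp add: c_def real_sqrt_mult[symmetric])
  then have "c * (sqrt (2 * pi) * (exp (- t\<^sup>2 / 2) * cos \<alpha>)) = sqrt \<tau> * (exp (- t\<^sup>2 / 2) * cos \<alpha>)"
    by (metis mult.assoc)
  also have "- t\<^sup>2 / 2 = - pi * k\<^sup>2 * \<tau>"
    using c(2) by (simp add: t_def power_mult_distrib) (simp add: power2_eq_square)
  finally show "(LBINT r. exp (- pi * r\<^sup>2 / \<tau>) * cos (2 * pi * k * r + \<alpha>))
          = sqrt \<tau> * exp (- pi * k\<^sup>2 * \<tau>) * cos \<alpha>" unfolding f_def by simp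
qed

text \<open>The half-open range is chosen so that the unit intervals from \<open>a - 1\<close> to
  \<open>a\<close> tile \<open>{- real N..real N}\<close> exactly in
  \<open>integral_unit_intervals\<close>.\<close>

lemma has_sum_int_symmetric_tendsto:
  fixes f :: "int \<Rightarrow> real"
  assumes "f summable_on UNIV"
  shows "(\<lambda>N::nat. \<Sum>a\<in>{- int N<..int N}. f a) \<longlonglongrightarrow> infsum f UNIV"
proof -
  have "(sum f \<longlongrightarrow> infsum f UNIV) (finite_subsets_at_top UNIV)"
    using has_sum_infsum[OF assms] unfolding has_sum_def .
  moreover have "filterlim (\<lambda>N::nat. {- int N<..int N}) (finite_subsets_at_top UNIV) sequentially"
    unfolding filterlim_def le_filter_def
  proof (intro allI impI)
    fix P assume "eventually P (finite_subsets_at_top (UNIV :: int set))"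
    then obtain X where X: "finite X" "\<And>Y. finite Y \<Longrightarrow> X \<subseteq> Y \<Longrightarrow> P Y"
      unfolding eventually_finite_subsets_at_top by auto
    define m where "m = (if X = {} then 0 else Max (abs ` X))"
    have m: "\<bar>x\<bar> \<le> m" if "x \<in> X" for x using that X(1) by (auto simp: m_def)
    have "\<forall>\<^sub>F N in sequentially. P {- int N<..int N}"
    proof (rule eventually_sequentiallyI[of "nat m + 1"])
      fix N assume "nat m + 1 \<le> N"
      then have "X \<subseteq> {- int N<..int N}" using m by fastforce
      then show "P {- int N<..int N}" using X(2) by auto
    qed
    then show "eventually P (filtermap (\<lambda>N::nat. {- int N<..int N}) sequentially)"
      by (simp add: eventually_filtermap)
  qed
  ultimately show ?thesis by (rule filterlim_compose)
qed

lemma integral_unit_intervals: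
  fixes f :: "real \<Rightarrow> real"
  assumes f: "integrable lborel f" "continuous_on UNIV f"
  shows "(\<lambda>N::nat. \<Sum>a\<in>{- int N<..int N}. integral {of_int a - 1..of_int a} f) \<longlonglongrightarrow> (LBINT r. f r)"
proof -
  have int: "f integrable_on {a..b}" for a b
    using continuous_on_subset[OF f(2)] by (intro integrable_continuous_real) auto
  have sum: "(\<Sum>a\<in>{- int N<..int N}. integral {of_int a - 1..of_int a} f) = integral {- real N..real N} f" for N
  proof (induction N)
    case (Suc N)
    have "{- int (Suc N)<..int (Suc N)} = insert (int (Suc N)) (insert (- int N) {- int N<..int N})"
      by auto
    then have "(\<Sum>a\<in>{- int (Suc N)<..int (Suc N)}. integral {of_int a - 1..of_int a} f)
      = integral {real N..real N + 1} f + (integral {- real N - 1..- real N} f + integral {- real N..real N} f)"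
      using Suc by (simp add: add.commute)
    also have "integral {- real N - 1..- real N} f + integral {- real N..real N} f = integral {- real N - 1..real N} f"
      by (rule Henstock_Kurzweil_Integration.integral_combine) (use int in auto)
    also have "integral {real N..real N + 1} f + \<dots> = integral {- real N - 1..real N + 1} f"
      by (subst add.commute, rule Henstock_Kurzweil_Integration.integral_combine) (use int in auto)
    finally show ?case by (simp add: add.commute[of 1])
  qed simp
  have "(\<lambda>N. LBINT r. indicator {- real N..real N} r *\<^sub>R f r) \<longlonglongrightarrow> (LBINT r. f r)"
  proof (rule integral_dominated_convergence[where w="\<lambda>r. \<bar>f r\<bar>"])
    show "AE r in lborel. (\<lambda>N. indicator {- real N..real N} r *\<^sub>R f r) \<longlonglongrightarrow> f r"
    proof (rule AE_I2, rule tendsto_eventually)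
      fix r :: real
      show "\<forall>\<^sub>F N in sequentially. indicator {- real N..real N} r *\<^sub>R f r = f r"
      proof (rule eventually_sequentiallyI[of "nat \<lceil>\<bar>r\<bar>\<rceil>"])
        fix N assume "nat \<lceil>\<bar>r\<bar>\<rceil> \<le> N"
        then have "\<bar>r\<bar> \<le> real N" by linarith
        then show "indicator {- real N..real N} r *\<^sub>R f r = f r" by (auto simp: indicator_def abs_le_iff)
      qed
    qed
  qed (use f(1) in \<open>auto simp: indicator_def\<close>)
  moreover have "(LBINT r. indicator {- real N..real N} r *\<^sub>R f r) = integral {- real N..real N} f" for N
  proof -
    have "set_integrable lborel {- real N..real N} f"
      unfolding set_integrable_def using f(1) by (intro integrable_mult_indicator) auto
    from set_borel_integral_eq_integral(2)[OF this] show ?thesis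
      unfolding set_lebesgue_integral_def .
  qed
  ultimately show ?thesis unfolding sum by simp
qed

lemma integral_cos_period:
  fixes n :: int
  shows "integral {0..1} (\<lambda>y. cos (2 * pi * of_int n * y + \<alpha>)) = (if n = 0 then cos \<alpha> else 0)"
proof (cases "n = 0")
  case False
  have "((\<lambda>y. cos (2 * pi * of_int n * y + \<alpha>)) has_integral
      (sin (2 * pi * of_int n * 1 + \<alpha>) / (2 * pi * of_int n) - sin (2 * pi * of_int n * 0 + \<alpha>) / (2 * pi * of_int n))) {0..1}"
    by (rule fundamental_theorem_of_calculus)
       (use False in \<open>auto intro!: derivative_eq_intros simp: has_real_derivative_iff_has_vector_derivative[symmetric]\<close>)
  moreover have "sin (2 * pi * of_int n * 1 + \<alpha>) = sin \<alpha>"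
    by (simp add: sin_add sin_int_2pin cos_int_2pin)
  ultimately show ?thesis using False by (simp add: integral_unique)
qed simp

text \<open>Both sides are continuous and 1-periodic in \<open>x\<close>, and both have the
  coefficient sqrt \<tau> exp (- pi k^2 \<tau>) cos \<alpha> against each test function cos (2 pi k
  y + \<alpha>). On the left the integrals of the translates over \<open>{0..1}\<close> join to one
  Gaussian integral over the line. Uniqueness of Fourier coefficients then gives equality on a
  period.\<close>

theorem theta_inversion_int:
  fixes \<tau> x :: real
  assumes "\<tau> > 0"
  shows "(\<Sum>\<^sub>\<infinity>a::int. exp (- pi * (of_int a - x)\<^sup>2 / \<tau>))
          = sqrt \<tau> * (\<Sum>\<^sub>\<infinity>n::int. exp (- pi * (of_int n)\<^sup>2 * \<tau>) * cos (2 * pi * of_int n * x))"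
proof -
  define A where "A x = (\<Sum>\<^sub>\<infinity>a::int. exp (- pi * (of_int a - x)\<^sup>2 / \<tau>))" for x
  define \<Theta> where "\<Theta> x = sqrt \<tau> * (\<Sum>\<^sub>\<infinity>n::int. exp (- pi * (of_int n)\<^sup>2 * \<tau>) * cos (2 * pi * of_int n * x))" for x
  define MA where "MA a = 4 * (1 + 1 / (pi / \<tau>)) * (1 / (1 + (real_of_int a)\<^sup>2))" for a
  define MT where "MT n = (1 + 1 / (pi * \<tau>)) * (1 / (1 + (real_of_int n)\<^sup>2))" for n
  have MA: "MA summable_on UNIV" and MT: "MT summable_on UNIV"
    unfolding MA_def MT_def by (intro summable_on_cmult_right summable_on_int_inverse_square)+
  have bA: "\<bar>exp (- pi * (of_int a - x)\<^sup>2 / \<tau>)\<bar> \<le> MA a" if x: "x \<in> {0..1}" for a x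
  proof -
    have "exp (- (pi / \<tau>) * (of_int a - x)\<^sup>2) \<le> 2 * (1 + 1 / (pi / \<tau>)) * (1 + x\<^sup>2) * (1 / (1 + (real_of_int a)\<^sup>2))"
      by (rule exp_neg_square_shift_le) (use assms in simp)
    also have "\<dots> \<le> 2 * (1 + 1 / (pi / \<tau>)) * 2 * (1 / (1 + (real_of_int a)\<^sup>2))"
      using x assms by (intro mult_left_mono mult_right_mono) (auto simp: power_le_one add_nonneg_nonneg)
    finally show ?thesis unfolding MA_def by simp
  qed
  have bT0: "\<bar>exp (- pi * (of_int n)\<^sup>2 * \<tau>)\<bar> \<le> MT n" for n
    using exp_neg_square_le[of "pi * \<tau>" "of_int n"] assms unfolding MT_def by (simp add: mult_ac)
  have bcos: "\<bar>c * cos u\<bar> \<le> M" if "\<bar>c\<bar> \<le> M" for c u M :: real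
    using that abs_cos_le_one[of u] by (metis abs_mult abs_ge_zero mult_left_le order_trans)
  define IA where "IA k \<alpha> a = integral {0..1} (\<lambda>y. exp (- pi * (of_int a - y)\<^sup>2 / \<tau>) * cos (2 * pi * of_int k * y + \<alpha>))"
    for k :: int and \<alpha> and a :: int
  have A_coef: "integral {0..1} (\<lambda>y. A y * cos (2 * pi * of_int k * y + \<alpha>)) = sqrt \<tau> * exp (- pi * (of_int k)\<^sup>2 * \<tau>) * cos \<alpha>"
    for k :: int and \<alpha>
  proof -
    define f where "f r = exp (- pi * r\<^sup>2 / \<tau>) * cos (2 * pi * of_int k * r + - \<alpha>)" for r
    have fint: "integrable lborel f" "(LBINT r. f r) = sqrt \<tau> * exp (- pi * (of_int k)\<^sup>2 * \<tau>) * cos \<alpha>"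
      using gaussian_cos_integral[OF assms, of "of_int k" "- \<alpha>"] unfolding f_def by auto
    have fc: "continuous_on S f" for S unfolding f_def using assms by (intro continuous_intros) auto
    \<comment> \<open>The substitution is \<open>r = of_int a - y\<close>. The integer
      \<open>k * a\<close> drops out of the cosine, and the reflection turns the phase
      \<open>\<alpha>\<close> into \<open>- \<alpha>\<close>, as anticipated in
      \<open>f\<close>.\<close>
    have IA: "IA k \<alpha> a = integral {of_int a - 1..of_int a} f" for a
    proof -
      have img: "{y. \<exists>x\<in>{real_of_int a - 1..real_of_int a}. y = real_of_int a - x} = {0..1}"
      proof (intro set_eqI iffI)
        fix y :: real assume "y \<in> {0..1}"
        then have "real_of_int a - y \<in> {real_of_int a - 1..real_of_int a}" "y = real_of_int a - (real_of_int a - y)" by auto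
        then show "y \<in> {y. \<exists>x\<in>{real_of_int a - 1..real_of_int a}. y = real_of_int a - x}" by blast
      qed auto
      have "(f has_integral integral {of_int a - 1..of_int a} f) (cbox (of_int a - 1) (of_int a))"
        using fc by (simp add: integrable_continuous_real integrable_integral)
      from has_integral_affinity[OF this, of "- 1" "of_int a"]
      have "((\<lambda>y. f (of_int a - y)) has_integral integral {of_int a - 1..of_int a} f) {0..1}"
        using img by (simp add: image_def)
      moreover have "f (of_int a - y) = exp (- pi * (of_int a - y)\<^sup>2 / \<tau>) * cos (2 * pi * of_int k * y + \<alpha>)" for y
      proof -
        have "cos (2 * pi * of_int k * (of_int a - y) + - \<alpha>) = cos (2 * pi * of_int (k * a) - (2 * pi * of_int k * y + \<alpha>))"
          by (simp add: algebra_simps)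
        also have "\<dots> = cos (2 * pi * of_int k * y + \<alpha>)"
          unfolding cos_diff cos_int_2pin sin_int_2pin by simp
        finally show ?thesis unfolding f_def by simp
      qed
      ultimately show ?thesis unfolding IA_def by (simp add: integral_unique)
    qed
    have "integral {0..1} (\<lambda>y. A y * cos (2 * pi * of_int k * y + \<alpha>)) =
       integral {0..1} (\<lambda>y. \<Sum>\<^sub>\<infinity>a::int. exp (- pi * (of_int a - y)\<^sup>2 / \<tau>) * cos (2 * pi * of_int k * y + \<alpha>))"
      unfolding A_def by (simp add: infsum_cmult_left')
    also have "\<dots> = (\<Sum>\<^sub>\<infinity>a. IA k \<alpha> a)" unfolding IA_def
      by (rule integral_infsum_dominated(2)[where M=MA])
         (use assms MA bA bcos in \<open>auto intro!: continuous_intros\<close>)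
    also have "\<dots> = (LBINT r. f r)"
    proof (rule LIMSEQ_unique)
      have "IA k \<alpha> summable_on UNIV"
      proof (rule abs_summable_comparison[OF MA])
        fix a :: int
        have "norm (IA k \<alpha> a) \<le> MA a * (1 - 0)" unfolding IA_def
          by (rule integral_bound) (use assms bA bcos in \<open>auto intro!: continuous_intros\<close>)
        then show "\<bar>IA k \<alpha> a\<bar> \<le> MA a" by simp
      qed
      then show "(\<lambda>N::nat. \<Sum>a\<in>{- int N<..int N}. IA k \<alpha> a) \<longlonglongrightarrow> (\<Sum>\<^sub>\<infinity>a. IA k \<alpha> a)"
        by (rule has_sum_int_symmetric_tendsto)
      show "(\<lambda>N::nat. \<Sum>a\<in>{- int N<..int N}. IA k \<alpha> a) \<longlonglongrightarrow> (LBINT r. f r)"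
        unfolding IA by (rule integral_unit_intervals[OF fint(1) fc])
    qed
    finally show ?thesis using fint(2) by simp
  qed
  have T_coef: "integral {0..1} (\<lambda>y. \<Theta> y * cos (2 * pi * of_int k * y + \<alpha>)) = sqrt \<tau> * exp (- pi * (of_int k)\<^sup>2 * \<tau>) * cos \<alpha>"
    for k :: int and \<alpha>
  proof -
    define E where "E n = exp (- pi * (real_of_int n)\<^sup>2 * \<tau>)" for n
    have I1: "integral {0..1} (\<lambda>y. E n * cos (2 * pi * of_int n * y) * cos (2 * pi * of_int k * y + \<alpha>))
      = E k * cos \<alpha> * (1/2 * ((if n = k then 1 else 0) + (if n = - k then 1 else 0)))" for n
    proof -
      have prod: "(\<lambda>y. E n * cos (2 * pi * of_int n * y) * cos (2 * pi * of_int k * y + \<alpha>))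
        = (\<lambda>y. E n / 2 * cos (2 * pi * of_int (k - n) * y + \<alpha>) + E n / 2 * cos (2 * pi * of_int (k + n) * y + \<alpha>))"
      proof
        fix y
        have "cos (2 * pi * of_int k * y + \<alpha>) * cos (2 * pi * of_int n * y)
          = (cos (2 * pi * of_int k * y + \<alpha> - 2 * pi * of_int n * y) + cos (2 * pi * of_int k * y + \<alpha> + 2 * pi * of_int n * y)) / 2"
          by (rule cos_times_cos)
        moreover have "2 * pi * of_int k * y + \<alpha> - 2 * pi * of_int n * y = 2 * pi * of_int (k - n) * y + \<alpha>"
          "2 * pi * of_int k * y + \<alpha> + 2 * pi * of_int n * y = 2 * pi * of_int (k + n) * y + \<alpha>"
          by (simp_all add: algebra_simps)
        ultimately show "E n * cos (2 * pi * of_int n * y) * cos (2 * pi * of_int k * y + \<alpha>)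
          = E n / 2 * cos (2 * pi * of_int (k - n) * y + \<alpha>) + E n / 2 * cos (2 * pi * of_int (k + n) * y + \<alpha>)"
          by (simp add: field_simps)
      qed
      have "integral {0..1} (\<lambda>y. E n * cos (2 * pi * of_int n * y) * cos (2 * pi * of_int k * y + \<alpha>))
        = E n / 2 * (if k - n = 0 then cos \<alpha> else 0) + E n / 2 * (if k + n = 0 then cos \<alpha> else 0)"
        unfolding prod
        by (subst Henstock_Kurzweil_Integration.integral_add)
           (auto intro!: integrable_continuous_real continuous_intros simp del: of_int_diff of_int_add simp: integral_cos_period)
      also have "\<dots> = E k * cos \<alpha> * (1/2 * ((if n = k then 1 else 0) + (if n = - k then 1 else 0)))"
        by (auto simp: E_def)
      finally show ?thesis .
    qed
    have "integral {0..1} (\<lambda>y. \<Theta> y * cos (2 * pi * of_int k * y + \<alpha>)) =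
       integral {0..1} (\<lambda>y. sqrt \<tau> * (\<Sum>\<^sub>\<infinity>n::int. E n * cos (2 * pi * of_int n * y) * cos (2 * pi * of_int k * y + \<alpha>)))"
      unfolding \<Theta>_def E_def by (subst infsum_cmult_left') (simp only: mult.assoc)
    also have "\<dots> = sqrt \<tau> * integral {0..1} (\<lambda>y. \<Sum>\<^sub>\<infinity>n::int. E n * cos (2 * pi * of_int n * y) * cos (2 * pi * of_int k * y + \<alpha>))"
      by simp
    also have "integral {0..1} (\<lambda>y. \<Sum>\<^sub>\<infinity>n::int. E n * cos (2 * pi * of_int n * y) * cos (2 * pi * of_int k * y + \<alpha>))
      = (\<Sum>\<^sub>\<infinity>n::int. integral {0..1} (\<lambda>y. E n * cos (2 * pi * of_int n * y) * cos (2 * pi * of_int k * y + \<alpha>)))"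
      by (rule integral_infsum_dominated(2)[where M=MT])
         (use assms MT bT0 bcos in \<open>auto intro!: continuous_intros simp: E_def\<close>)
    also have "\<dots> = E k * cos \<alpha> * (1/2 * ((\<Sum>\<^sub>\<infinity>n::int. (if n = k then 1 else 0) + (if n = - k then 1 else 0))))"
      by (simp only: I1 infsum_cmult_right')
    also have "(\<Sum>\<^sub>\<infinity>n::int. (if n = k then 1 else 0) + (if n = - k then 1 else 0 :: real)) = 1 + 1"
    proof -
      have one: "((\<lambda>n::int. if n = j then 1 else 0 :: real) has_sum 1) UNIV" for j
        using has_sum_finite_neutralI[of "{j}" UNIV "\<lambda>n. if n = j then 1 else 0 :: real"] by simp
      show ?thesis by (rule infsumI[OF has_sum_add[OF one one]])
    qed
    finally show ?thesis unfolding E_def by simp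
  qed
  have cA: "continuous_on {0..1} A" unfolding A_def
    by (rule integral_infsum_dominated(1)[where M=MA]) (use assms MA bA in \<open>auto intro!: continuous_intros\<close>)
  have cT: "continuous_on {0..1} \<Theta>" unfolding \<Theta>_def
    by (intro continuous_intros integral_infsum_dominated(1)[where M=MT])
       (use assms MT bT0 bcos in \<open>auto intro!: continuous_intros\<close>)
  have coef_int: "(\<lambda>y. h y * cos (2 * pi * of_int k * y + \<alpha>)) integrable_on {0..1}" if "continuous_on {0..1} h" for h :: "real \<Rightarrow> real" and k :: int and \<alpha>
    using that by (intro integrable_continuous_real continuous_intros)
  \<comment> \<open>The uniqueness lemma is one-sided, so it is applied to both differences. It
    covers interior points only; the endpoints follow by continuity.\<close>
  have le: "A p - \<Theta> p \<le> 0" if "0 < p" "p < 1" for p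
    by (rule fourier_coefficients_zero_imp_nonpos[of "\<lambda>p. A p - \<Theta> p"])
       (use that cA cT in \<open>auto intro!: continuous_intros simp: left_diff_distrib coef_int Henstock_Kurzweil_Integration.integral_diff A_coef T_coef\<close>)
  have ge: "\<Theta> p - A p \<le> 0" if "0 < p" "p < 1" for p
    by (rule fourier_coefficients_zero_imp_nonpos[of "\<lambda>p. \<Theta> p - A p"])
       (use that cA cT in \<open>auto intro!: continuous_intros simp: left_diff_distrib coef_int Henstock_Kurzweil_Integration.integral_diff A_coef T_coef\<close>)
  have eq: "A p - \<Theta> p = 0" if "p \<in> {0..1}" for p
  proof (rule continuous_constant_on_closure[of "{0<..<1}" "\<lambda>p. A p - \<Theta> p" 0])
    show "A y - \<Theta> y = 0" if "y \<in> {0<..<1}" for y using le[of y] ge[of y] that by auto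
  qed (use that cA cT in \<open>auto intro!: continuous_intros\<close>)
  have perA: "A (x + of_int j) = A x" for x and j :: int
  proof -
    have "A (x + of_int j) = (\<Sum>\<^sub>\<infinity>a::int. exp (- pi * (of_int (a - j) - x)\<^sup>2 / \<tau>))"
      unfolding A_def by (simp add: algebra_simps)
    also have "\<dots> = A x" unfolding A_def
      by (rule infsum_reindex_bij_witness[of _ "\<lambda>a. a + j" "\<lambda>a. a - j"]) auto
    finally show ?thesis .
  qed
  have perT: "\<Theta> (x + of_int j) = \<Theta> x" for x and j :: int
  proof -
    have "cos (2 * pi * of_int n * (x + of_int j)) = cos (2 * pi * of_int n * x)" for n :: int
    proof -
      have "cos (2 * pi * of_int n * (x + of_int j)) = cos (2 * pi * of_int n * x + 2 * pi * of_int (n * j))"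
        by (simp add: algebra_simps)
      also have "\<dots> = cos (2 * pi * of_int n * x)"
        unfolding cos_add cos_int_2pin sin_int_2pin by simp
      finally show ?thesis .
    qed
    then show ?thesis unfolding \<Theta>_def by simp
  qed
  have "A x = A (frac x + of_int \<lfloor>x\<rfloor>)" by (simp add: frac_def)
  also have "\<dots> = \<Theta> (frac x + of_int \<lfloor>x\<rfloor>)"
    unfolding perA perT using eq[of "frac x"] frac_lt_1[of x] by auto
  also have "\<dots> = \<Theta> x" by (simp add: frac_def)
  finally show ?thesis unfolding A_def \<Theta>_def .
qed

lemma infsum_int_even:
  fixes h :: "int \<Rightarrow> real"
  assumes "h summable_on UNIV" "\<And>n. h (- n) = h n"
  shows "infsum h UNIV = h 0 + 2 * (\<Sum>\<^sub>\<infinity>n\<in>{1..}. h (int n))"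
proof -
  have U: "(UNIV :: int set) = {0} \<union> (int ` {1..} \<union> (\<lambda>n. - int n) ` {1..})"
  proof -
    have "b \<in> {0} \<union> (int ` {1..} \<union> (\<lambda>n. - int n) ` {1..})" for b
    proof (cases b rule: int_cases3)
      case (pos n)
      then show ?thesis by auto
    next
      case (neg n)
      then show ?thesis by auto
    qed auto
    then show ?thesis by auto
  qed
  have s: "h summable_on S" for S using assms(1) by (rule summable_on_subset_banach) auto
  have "infsum h UNIV = infsum h {0} + (infsum h (int ` {1..}) + infsum h ((\<lambda>n. - int n) ` {1..}))"
    by (subst U, subst infsum_Un_disjoint, (use s in auto)[3], subst infsum_Un_disjoint) (use s in auto)
  also have "infsum h (int ` {1..}) = (\<Sum>\<^sub>\<infinity>n\<in>{1..}. h (int n))"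
    by (subst infsum_reindex) (auto simp: inj_on_def o_def)
  also have "infsum h ((\<lambda>n. - int n) ` {1..}) = (\<Sum>\<^sub>\<infinity>n\<in>{1..}. h (int n))"
    by (subst infsum_reindex) (auto simp: inj_on_def o_def assms(2))
  finally show ?thesis by simp
qed

corollary theta_inversion:
  fixes \<tau> x :: real
  assumes "\<tau> > 0"
  shows "(\<Sum>\<^sub>\<infinity>a::int. exp (- pi * (of_int a - x)\<^sup>2 / \<tau>))
          = sqrt \<tau> * (1 + 2 * (\<Sum>\<^sub>\<infinity>n\<in>{1::nat..}. exp (- pi * (real n)\<^sup>2 * \<tau>) * cos (2 * pi * real n * x)))"
proof -
  have "(\<lambda>n::int. exp (- pi * (of_int n)\<^sup>2 * \<tau>) * cos (2 * pi * of_int n * x)) summable_on UNIV"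
  proof (rule abs_summable_comparison)
    show "(\<lambda>n::int. (1 + 1 / (pi * \<tau>)) * (1 / (1 + (real_of_int n)\<^sup>2))) summable_on UNIV"
      by (intro summable_on_cmult_right summable_on_int_inverse_square)
    fix n :: int
    have "\<bar>exp (- pi * (of_int n)\<^sup>2 * \<tau>) * cos (2 * pi * of_int n * x)\<bar> \<le> exp (- pi * (of_int n)\<^sup>2 * \<tau>)"
      unfolding abs_mult by (simp add: mult_left_le)
    also have "\<dots> \<le> (1 + 1 / (pi * \<tau>)) * (1 / (1 + (real_of_int n)\<^sup>2))"
      using exp_neg_square_le[of "pi * \<tau>" "of_int n"] assms by (simp add: mult_ac)
    finally show "\<bar>exp (- pi * (of_int n)\<^sup>2 * \<tau>) * cos (2 * pi * of_int n * x)\<bar>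
      \<le> (1 + 1 / (pi * \<tau>)) * (1 / (1 + (real_of_int n)\<^sup>2))" .
  qed
  then show ?thesis unfolding theta_inversion_int[OF assms] by (subst infsum_int_even) auto
qed

section \<open>Sums over a line of matrices\<close>

text \<open>For \<open>t > 0\<close> and \<open>n \<ge> 1\<close> this is a closed form of the
  integral over u from 0 to v of t u^(-3/2) exp (- pi u w^2 - pi n^2 t^2 / u):
  \<open>tail_term_has_derivative\<close> gives the derivative in \<open>v\<close>, and
  \<open>tail_term_le\<close> gives the limit 0 as \<open>v\<close> tends to 0. It is the part of
  the n-th mode that is missing when the integral starts at 1.\<close>

definition tail_term :: "real \<Rightarrow> real \<Rightarrow> real \<Rightarrow> nat \<Rightarrow> real" where
  "tail_term v t w n =
     (exp (2 * pi * real n * (w * t)) * erfcI (sqrt pi * (real n * t / sqrt v + sqrt v * w))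
      + exp (- 2 * pi * real n * (w * t)) * erfcI (sqrt pi * (real n * t / sqrt v - sqrt v * w)))
     / (sqrt pi * real n)"

lemma tail_term_minus: "tail_term v t (- w) n = tail_term v t w n"
  unfolding tail_term_def by simp

lemma tail_term_nonneg: "tail_term v t w n \<ge> 0"
  unfolding tail_term_def by (simp add: erfcI_nonneg)

lemma exp_erfcI_gaussian_le:
  assumes "v > 0" "t \<ge> 0"
  shows "exp (2 * pi * real n * (w * t)) * erfcI (sqrt pi * (real n * t / sqrt v + sqrt v * w))
           \<le> sqrt pi * exp (- pi * (real n)\<^sup>2 * t\<^sup>2 / v)"
proof -
  have "2 * (sqrt pi * (real n * t / sqrt v)) * (sqrt pi * (sqrt v * w)) = 2 * pi * real n * (w * t)"
    using assms by (simp add: field_simps)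
  moreover have "- (sqrt pi * (real n * t / sqrt v))\<^sup>2 = - pi * (real n)\<^sup>2 * t\<^sup>2 / v"
    using assms by (simp add: power_mult_distrib power_divide)
  moreover have "sqrt pi * (real n * t / sqrt v + sqrt v * w) = sqrt pi * (real n * t / sqrt v) + sqrt pi * (sqrt v * w)"
    by (rule distrib_left)
  moreover have "sqrt pi * (real n * t / sqrt v) \<ge> 0" using assms by simp
  ultimately show ?thesis
    using exp_erfcI_le[of "sqrt pi * (real n * t / sqrt v)" "sqrt pi * (sqrt v * w)"] by metis
qed

text \<open>The bound is uniform in \<open>w\<close>, so it serves the summability over
  \<open>n\<close> as well as the limit \<open>w\<close> to 0. It degenerates as \<open>v\<close>
  grows.\<close>

lemma tail_term_le:
  assumes "v > 0" "t \<ge> 0" "n \<ge> 1"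
  shows "tail_term v t w n \<le> 2 * exp (- pi * (real n)\<^sup>2 * t\<^sup>2 / v)"
proof -
  let ?e = "exp (- pi * (real n)\<^sup>2 * t\<^sup>2 / v)"
  have "exp (2 * pi * real n * (w * t)) * erfcI (sqrt pi * (real n * t / sqrt v + sqrt v * w)) \<le> sqrt pi * ?e"
    using exp_erfcI_gaussian_le[OF assms(1,2)] by simp
  moreover have "exp (- 2 * pi * real n * (w * t)) * erfcI (sqrt pi * (real n * t / sqrt v - sqrt v * w)) \<le> sqrt pi * ?e"
    using exp_erfcI_gaussian_le[OF assms(1,2), of n "- w"] by simp
  ultimately have "tail_term v t w n \<le> (sqrt pi * ?e + sqrt pi * ?e) / (sqrt pi * real n)"
    unfolding tail_term_def by (intro divide_right_mono add_mono) auto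
  also have "\<dots> = 2 * ?e / real n" by (simp add: field_simps)
  also have "\<dots> \<le> 2 * ?e" using assms(3) by (simp add: field_simps)
  finally show ?thesis .
qed

text \<open>The bound is uniform in \<open>v\<close>, as needed for the limit \<open>v\<close> to
  infinity, where the Gaussian bound is lost. For the growing exponential, 2ab - (a + b)^2 <= - 2ab
  pays back the factor exp (2ab); for the decaying one, \<open>erfcI_le\<close> suffices.\<close>

lemma tail_term_le_exp:
  assumes "v > 0" "t > 0" "w > 0" "n \<ge> 1"
  shows "tail_term v t w n \<le> 2 * exp (- 2 * pi * real n * (w * t))"
proof -
  let ?e = "exp (- 2 * pi * real n * (w * t))"
  define a where "a = sqrt pi * (real n * t / sqrt v)"
  define b where "b = sqrt pi * (sqrt v * w)"
  have ab: "a \<ge> 0" "b \<ge> 0" using assms by (auto simp: a_def b_def)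
  have ab2: "2 * a * b = 2 * pi * real n * (w * t)"
    using assms unfolding a_def b_def by (simp add: field_simps)
  have "exp (2 * a * b) * erfcI (a + b) \<le> exp (2 * a * b) * (sqrt pi * exp (- (a + b)\<^sup>2))"
    using exp_erfcI_le[of "a + b" 0] ab by (intro mult_left_mono) auto
  also have "\<dots> = sqrt pi * exp (2 * a * b - (a + b)\<^sup>2)" by (simp add: exp_diff exp_minus field_simps)
  also have "\<dots> \<le> sqrt pi * exp (- (2 * a * b))"
  proof -
    have "2 * a * b - (a + b)\<^sup>2 = - (2 * a * b) - (a - b)\<^sup>2" by (simp add: power2_eq_square algebra_simps)
    then show ?thesis by simp
  qed
  finally have 1: "exp (2 * pi * real n * (w * t)) * erfcI (sqrt pi * (real n * t / sqrt v + sqrt v * w)) \<le> sqrt pi * ?e"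
    unfolding ab2 by (simp add: a_def b_def distrib_left)
  have 2: "?e * erfcI (sqrt pi * (real n * t / sqrt v - sqrt v * w)) \<le> sqrt pi * ?e"
    using erfcI_le by (simp add: mult.commute)
  have "tail_term v t w n \<le> (sqrt pi * ?e + sqrt pi * ?e) / (sqrt pi * real n)"
    unfolding tail_term_def using 1 2 by (intro divide_right_mono add_mono) auto
  also have "\<dots> = 2 * ?e / real n" by (simp add: field_simps)
  also have "\<dots> \<le> 2 * ?e" using assms(4) by (simp add: field_simps)
  finally show ?thesis .
qed

text \<open>With a proportional to 1 / sqrt v and b to sqrt v, the products exp (2ab) exp (- (a +
  b)^2) and exp (- 2ab) exp (- (a - b)^2) both equal exp (- a^2 - b^2). The contributions of the
  derivative of b cancel and those of the derivative of a add up.\<close>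

lemma tail_term_has_derivative:
  assumes v: "v > 0" and n: "n \<ge> 1"
  shows "((\<lambda>v. tail_term v t w n) has_real_derivative
      t * exp (- pi * v * w\<^sup>2 - pi * (real n)\<^sup>2 * t\<^sup>2 / v) / (v * sqrt v)) (at v)"
proof -
  define a where "a u = sqrt pi * (real n * t / sqrt u)" for u
  define b where "b u = sqrt pi * (sqrt u * w)" for u
  define E where "E = exp (- pi * v * w\<^sup>2 - pi * (real n)\<^sup>2 * t\<^sup>2 / v)"
  have da: "(a has_real_derivative - a v / (2 * v)) (at v)"
    unfolding a_def using v
    by (auto intro!: derivative_eq_intros simp: field_simps)
  have db: "(b has_real_derivative b v / (2 * v)) (at v)"
    unfolding b_def using v
    by (auto intro!: derivative_eq_intros simp: field_simps)
  have ab2: "2 * a v * b v = 2 * pi * real n * (w * t)"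
    using v unfolding a_def b_def by (simp add: field_simps)
  have sq: "a v ^ 2 + b v ^ 2 = pi * v * w\<^sup>2 + pi * (real n)\<^sup>2 * t\<^sup>2 / v"
    using v unfolding a_def b_def by (simp add: power_mult_distrib power_divide)
  have e1: "exp (2 * pi * real n * (w * t)) * exp (- (a v + b v)\<^sup>2) = E"
    unfolding ab2[symmetric] E_def using sq
    by (simp add: exp_add[symmetric] power2_eq_square algebra_simps)
  have e2: "exp (- 2 * pi * real n * (w * t)) * exp (- (a v - b v)\<^sup>2) = E"
  proof -
    have "- 2 * pi * real n * (w * t) = - (2 * a v * b v)" using ab2 by simp
    then show ?thesis unfolding E_def using sq
      by (simp add: exp_add[symmetric] power2_eq_square algebra_simps)
  qed
  have d1: "((\<lambda>u. erfcI (a u + b u)) has_real_derivative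
      - exp (- (a v + b v)\<^sup>2) * (- a v / (2 * v) + b v / (2 * v))) (at v)"
    by (rule DERIV_chain2[OF erfcI_has_derivative DERIV_add[OF da db]])
  have d2: "((\<lambda>u. erfcI (a u - b u)) has_real_derivative
      - exp (- (a v - b v)\<^sup>2) * (- a v / (2 * v) - b v / (2 * v))) (at v)"
    by (rule DERIV_chain2[OF erfcI_has_derivative DERIV_diff[OF da db]])
  have "((\<lambda>u. (exp (2 * pi * real n * (w * t)) * erfcI (a u + b u)
      + exp (- 2 * pi * real n * (w * t)) * erfcI (a u - b u)) / (sqrt pi * real n)) has_real_derivative
      (exp (2 * pi * real n * (w * t)) * (- exp (- (a v + b v)\<^sup>2) * (- a v / (2 * v) + b v / (2 * v)))
      + exp (- 2 * pi * real n * (w * t)) * (- exp (- (a v - b v)\<^sup>2) * (- a v / (2 * v) - b v / (2 * v)))) / (sqrt pi * real n)) (at v)"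
    by (intro DERIV_cdivide DERIV_add DERIV_cmult d1 d2)
  also have "(\<lambda>u. (exp (2 * pi * real n * (w * t)) * erfcI (a u + b u)
      + exp (- 2 * pi * real n * (w * t)) * erfcI (a u - b u)) / (sqrt pi * real n)) = (\<lambda>u. tail_term u t w n)"
    unfolding tail_term_def a_def b_def by (simp add: algebra_simps)
  also have "(exp (2 * pi * real n * (w * t)) * (- exp (- (a v + b v)\<^sup>2) * (- a v / (2 * v) + b v / (2 * v)))
      + exp (- 2 * pi * real n * (w * t)) * (- exp (- (a v - b v)\<^sup>2) * (- a v / (2 * v) - b v / (2 * v)))) / (sqrt pi * real n)
      = (E * (a v / (2 * v) - b v / (2 * v)) + E * (a v / (2 * v) + b v / (2 * v))) / (sqrt pi * real n)"
    unfolding e1[symmetric] e2[symmetric] e2[unfolded e1[symmetric], symmetric]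
    using e1 e2 by (simp add: algebra_simps)
  also have "\<dots> = E * a v / (v * (sqrt pi * real n))" using v by (simp add: field_simps)
  also have "\<dots> = t * E / (v * sqrt v)" unfolding a_def using v n by (simp add: field_simps)
  finally show ?thesis unfolding E_def .
qed

lemma tail_term_tendsto:
  assumes "t > 0" "w > 0" "n \<ge> 1"
  shows "((\<lambda>v. tail_term v t w n) \<longlongrightarrow> exp (- 2 * pi * real n * (w * t)) / real n) at_top"
proof -
  have n: "real n > 0" using assms by simp
  have f1: "filterlim (\<lambda>v. sqrt pi * (real n * t / sqrt v + sqrt v * w)) at_top at_top"
    using assms n pi_gt_zero by real_asymp
  have f2: "filterlim (\<lambda>v. sqrt pi * (real n * t / sqrt v - sqrt v * w)) at_bot at_top"
    using assms n pi_gt_zero by real_asymp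
  have "((\<lambda>v. tail_term v t w n) \<longlongrightarrow>
     (exp (2 * pi * real n * (w * t)) * 0 + exp (- 2 * pi * real n * (w * t)) * sqrt pi) / (sqrt pi * real n)) at_top"
    unfolding tail_term_def
    by (intro tendsto_intros filterlim_compose[OF erfcI_at_top f1] filterlim_compose[OF erfcI_at_bot f2])
       (use n in auto)
  then show ?thesis using n by (simp add: field_simps)
qed

section \<open>The zero mode and the limit of the nonzero modes\<close>

lemma set_integrable_powr_tail:
  assumes "y > 0"
  shows "set_integrable lborel {y..} (\<lambda>u::real. u powr (- 3/2))"
proof -
  have "(\<integral>\<^sup>+u. ennreal (u powr (- 3/2)) * indicator {y..} u \<partial>lborel) = ennreal (0 - (- 2 * y powr (- 1/2)))"
  proof (rule nn_integral_FTC_atLeast[where F="\<lambda>u. - 2 * u powr (- 1/2)"])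
    show "((\<lambda>u::real. - 2 * u powr (- 1/2)) \<longlongrightarrow> 0) at_top" by real_asymp
    fix u :: real assume "y \<le> u"
    then show "((\<lambda>u. - 2 * u powr (- 1/2)) has_real_derivative u powr (- 3/2)) (at u)"
      using assms by (auto intro!: derivative_eq_intros simp: powr_diff[symmetric])
  qed auto
  also have "(\<integral>\<^sup>+u. ennreal (u powr (- 3/2)) * indicator {y..} u \<partial>lborel)
      = (\<integral>\<^sup>+u. ennreal (indicator {y..} u *\<^sub>R u powr (- 3/2)) \<partial>lborel)"
    by (intro nn_integral_cong) (auto simp: indicator_def)
  finally have "has_bochner_integral lborel (\<lambda>u. indicator {y..} u *\<^sub>R u powr (- 3/2)) (2 * y powr (- 1/2))"
    by (intro has_bochner_integral_nn_integral) auto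
  then show ?thesis unfolding set_integrable_def by (simp add: has_bochner_integral_iff)
qed

text \<open>Up to the factor t this is the zero mode of a line of matrices. It differs from
  \<open>B\<close> by a factor \<open>sqrt v\<close>, with \<open>v\<close> moved from the integrand
  to the limit of integration (\<open>B_eq_heat_tail\<close>).\<close>

definition heat_tail :: "real \<Rightarrow> real \<Rightarrow> real" where
  "heat_tail v w = (LINT u:{v..}|lborel. exp (- pi * w\<^sup>2 * u) * u powr (- 3/2))"

lemma set_integrable_heat_tail:
  assumes "y > 0"
  shows "set_integrable lborel {y..} (\<lambda>u::real. exp (- pi * w\<^sup>2 * u) * u powr (- 3/2))"
proof (rule set_integrable_bound[OF set_integrable_powr_tail[OF assms]])
  show "set_borel_measurable lborel {y..} (\<lambda>u::real. exp (- pi * w\<^sup>2 * u) * u powr (- 3/2))"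
    unfolding set_borel_measurable_def by measurable
  show "AE u in lborel. u \<in> {y..} \<longrightarrow> norm (exp (- pi * w\<^sup>2 * u) * u powr (- 3/2)) \<le> norm (u powr (- 3/2))"
    using assms by (auto simp: mult_le_cancel_right1)
qed

lemma heat_tail_nonneg: "heat_tail v w \<ge> 0"
  unfolding heat_tail_def set_lebesgue_integral_def
  by (rule Bochner_Integration.integral_nonneg) (auto simp: indicator_def)

lemma heat_tail_has_derivative:
  assumes "v > 0"
  shows "((\<lambda>v. heat_tail v w) has_real_derivative - (exp (- pi * w\<^sup>2 * v) / (v * sqrt v))) (at v)"
proof -
  have "((\<lambda>v. heat_tail v w) has_real_derivative - (exp (- pi * w\<^sup>2 * v) * v powr (- 3/2))) (at v)"
    unfolding heat_tail_def
    by (rule tail_integral_has_derivative[of 0])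
       (use assms set_integrable_heat_tail in \<open>auto intro!: continuous_intros\<close>)
  moreover have "v powr (- 3/2) = 1 / (v * sqrt v)"
  proof -
    have "v powr (3/2) = v powr (1 + 1/2)" by simp
    also have "\<dots> = v * sqrt v" using assms unfolding powr_add by (simp add: powr_half_sqrt)
    finally show ?thesis using powr_minus[of v "3/2"] by (simp add: field_simps)
  qed
  ultimately show ?thesis by simp
qed

lemma heat_tail_at_top:
  assumes "w \<noteq> 0"
  shows "((\<lambda>v. heat_tail v w) \<longlongrightarrow> 0) at_top"
proof (rule tendsto_sandwich[of "\<lambda>_. 0" _ _ "\<lambda>v. exp (- (pi * w\<^sup>2) * v) / (pi * w\<^sup>2)"])
  have k: "pi * w\<^sup>2 > 0" using assms by simp
  show "\<forall>\<^sub>F v in at_top. heat_tail v w \<le> exp (- (pi * w\<^sup>2) * v) / (pi * w\<^sup>2)"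
  proof (rule eventually_at_top_linorderI[of 1])
    fix v :: real assume v: "v \<ge> 1"
    have "heat_tail v w \<le> (LINT u:{v..}|lborel. exp (- (pi * w\<^sup>2) * u))"
      unfolding heat_tail_def
    proof (rule set_integral_mono)
      fix u assume "u \<in> {v..}"
      then have "u powr (- 3/2) \<le> 1" using v powr_mono[of "- 3/2" 0 u] by simp
      then show "exp (- pi * w\<^sup>2 * u) * u powr (- 3/2) \<le> exp (- (pi * w\<^sup>2) * u)"
        by (simp add: mult_le_cancel_left1)
    qed (use v k set_integrable_heat_tail set_integrable_exp_tail(1)[OF k] in auto)
    then show "heat_tail v w \<le> exp (- (pi * w\<^sup>2) * v) / (pi * w\<^sup>2)"
      using set_integrable_exp_tail(2)[OF k] by simp
  qed
  show "((\<lambda>v. exp (- (pi * w\<^sup>2) * v) / (pi * w\<^sup>2)) \<longlongrightarrow> 0) at_top"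
  proof -
    have "((\<lambda>v::real. exp (- k * v) / k) \<longlongrightarrow> 0) at_top" if "k > 0" for k :: real
      using that by real_asymp
    from this[OF k] show ?thesis .
  qed
qed (auto simp: heat_tail_nonneg)

text \<open>Real part of the power series of - Ln (1 - z) at z = exp (2 pi i (x + i y)). The
  hypothesis \<open>y > 0\<close> gives the absolute convergence that an unordered sum
  requires.\<close>

lemma infsum_cos_exp_eq_ln:
  fixes x y :: real
  assumes "y > 0"
  shows "(\<Sum>\<^sub>\<infinity>n\<in>{1::nat..}. 2 * cos (2 * pi * real n * x) * (exp (- 2 * pi * real n * y) / real n))
    = - ln ((cmod (1 - exp (Complex (- 2 * pi * y) (2 * pi * x))))\<^sup>2)"
proof -
  define z where "z = exp (Complex (- 2 * pi * y) (2 * pi * x))"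
  have zn: "z ^ n = exp (Complex (- 2 * pi * real n * y) (2 * pi * real n * x))" for n
  proof -
    have "of_nat n * Complex (- 2 * pi * y) (2 * pi * x) = Complex (- 2 * pi * real n * y) (2 * pi * real n * x)"
      by (simp add: complex_eq_iff)
    then show ?thesis unfolding z_def exp_of_nat_mult[symmetric] by simp
  qed
  have z1: "cmod z < 1" using assms by (simp add: z_def norm_exp_eq_Re)
  have nz: "1 - z \<noteq> 0" using z1 by auto
  have "(\<lambda>n. - (z ^ n / of_nat n)) sums Ln (1 - z)"
    using Ln_series'[of "- z"] z1 by simp
  then have "(\<lambda>n. Re (- (z ^ n / of_nat n))) sums Re (Ln (1 - z))" by (rule sums_Re)
  then have s: "(\<lambda>n. - 2 * Re (- (z ^ n / of_nat n))) sums (- 2 * Re (Ln (1 - z)))" by (rule sums_mult)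
  have Re_zn: "- 2 * Re (- (z ^ n / of_nat n)) = 2 * cos (2 * pi * real n * x) * (exp (- 2 * pi * real n * y) / real n)" for n
    unfolding zn by (cases "n = 0") (auto simp: Re_exp Re_divide_of_nat)
  have "summable (\<lambda>n. norm (2 * cos (2 * pi * real n * x) * (exp (- 2 * pi * real n * y) / real n)))"
  proof (rule summable_comparison_test_ev)
    show "summable (\<lambda>n. 2 * cmod z ^ n)" using z1 by (intro summable_mult summable_geometric) auto
    show "\<forall>\<^sub>F n in sequentially. norm (norm (2 * cos (2 * pi * real n * x) * (exp (- 2 * pi * real n * y) / real n))) \<le> 2 * cmod z ^ n"
    proof (rule eventually_sequentiallyI[of 1])
      fix n :: nat assume n: "n \<ge> 1"
      have "cmod z ^ n = exp (- 2 * pi * real n * y)"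
        unfolding norm_power[symmetric] zn by (simp add: norm_exp_eq_Re)
      moreover have "\<bar>cos (2 * pi * real n * x)\<bar> * (exp (- 2 * pi * real n * y) / real n) \<le> 1 * (exp (- 2 * pi * real n * y) / 1)"
        using n by (intro mult_mono divide_left_mono) auto
      ultimately show "norm (norm (2 * cos (2 * pi * real n * x) * (exp (- 2 * pi * real n * y) / real n))) \<le> 2 * cmod z ^ n"
        by (simp add: abs_mult)
    qed
  qed
  from norm_summable_imp_has_sum[OF this s[unfolded Re_zn]]
  have "((\<lambda>n. 2 * cos (2 * pi * real n * x) * (exp (- 2 * pi * real n * y) / real n)) has_sum (- 2 * Re (Ln (1 - z)))) UNIV" .
  \<comment> \<open>The term at n = 0 vanishes because division by zero yields 0.\<close>
  then have "((\<lambda>n. 2 * cos (2 * pi * real n * x) * (exp (- 2 * pi * real n * y) / real n)) has_sum (- 2 * Re (Ln (1 - z)))) {1..}"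
    by (subst has_sum_cong_neutral[where T=UNIV]) (auto simp: not_le)
  then have "(\<Sum>\<^sub>\<infinity>n\<in>{1::nat..}. 2 * cos (2 * pi * real n * x) * (exp (- 2 * pi * real n * y) / real n)) = - 2 * Re (Ln (1 - z))"
    by (rule infsumI)
  also have "\<dots> = - ln ((cmod (1 - z))\<^sup>2)" using nz by (simp add: ln_realpow)
  finally show ?thesis unfolding z_def .
qed

section \<open>The Poisson identity for a single line\<close>

text \<open>This is \<open>2 * pi * R\<close> for the matrix with upper left entry \<open>a\<close>
  and lower right entry 0, where x + i w t = b z2 + c z1; see \<open>R_eq_line_arg\<close>.\<close>

definition line_arg :: "real \<Rightarrow> real \<Rightarrow> real \<Rightarrow> int \<Rightarrow> real" where
  "line_arg t w x a = pi * ((of_int a - x)\<^sup>2 / t\<^sup>2 + w\<^sup>2)"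

definition line_sum :: "real \<Rightarrow> real \<Rightarrow> real \<Rightarrow> real \<Rightarrow> real" where
  "line_sum v t w x = (\<Sum>\<^sub>\<infinity>a. nEi (v * line_arg t w x a))"

definition tail_sum :: "real \<Rightarrow> real \<Rightarrow> real \<Rightarrow> real \<Rightarrow> real" where
  "tail_sum v t w x = (\<Sum>\<^sub>\<infinity>n\<in>{1..}. 2 * cos (2 * pi * real n * x) * tail_term v t w n)"

lemma exp_line_arg_le:
  assumes "t > 0" "k > 0" "u \<ge> k"
  shows "exp (- u * line_arg t w x a)
    \<le> 2 * (1 + 1 / (pi * k / t\<^sup>2)) * (1 + x\<^sup>2) * (1 / (1 + (real_of_int a)\<^sup>2))"
proof -
  have "k * (pi * ((of_int a - x)\<^sup>2 / t\<^sup>2)) \<le> u * line_arg t w x a"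
    unfolding line_arg_def using assms by (intro mult_mono mult_left_mono) auto
  then have "exp (- u * line_arg t w x a) \<le> exp (- (pi * k / t\<^sup>2) * (of_int a - x)\<^sup>2)"
    by (simp add: field_simps)
  also have "\<dots> \<le> 2 * (1 + 1 / (pi * k / t\<^sup>2)) * (1 + x\<^sup>2) * (1 / (1 + (real_of_int a)\<^sup>2))"
    by (rule exp_neg_square_shift_le) (use assms in simp)
  finally show ?thesis .
qed

text \<open>If \<open>w\<close> vanishes, the distance from \<open>x\<close> to the nearest integer
  takes over. That bound does not involve \<open>w\<close>, which the last conclusion records for
  use in the limit \<open>w\<close> to 0.\<close>

lemma line_arg_lower_bound:
  assumes "t > 0" "w \<noteq> 0 \<or> x \<notin> \<int>"
  obtains c where "c > 0" "\<And>a. line_arg t w x a \<ge> c" "w = 0 \<Longrightarrow> \<forall>w' a. line_arg t w' x a \<ge> c"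
proof (cases "x \<in> \<int>")
  case True
  then show ?thesis
    using assms by (intro that[of "pi * w\<^sup>2"]) (auto simp: line_arg_def)
next
  case False
  define d where "d = min (frac x) (1 - frac x)"
  have fr: "frac x > 0" using False by (simp add: frac_gt_0_iff)
  have d: "d > 0" unfolding d_def using fr frac_lt_1[of x] by auto
  have ax: "\<bar>of_int a - x\<bar> \<ge> d" for a :: int
  proof (cases "a \<le> \<lfloor>x\<rfloor>")
    case True
    then have "real_of_int a \<le> of_int \<lfloor>x\<rfloor>" by simp
    then show ?thesis unfolding d_def frac_def by (auto simp: min_def)
  next
    case False
    then have "\<lfloor>x\<rfloor> + 1 \<le> a" by simp
    then have "of_int \<lfloor>x\<rfloor> + 1 \<le> real_of_int a" by linarith
    then show ?thesis unfolding d_def frac_def by (auto simp: min_def)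
  qed
  have "line_arg t w' x a \<ge> pi * (d\<^sup>2 / t\<^sup>2)" for w' a
  proof -
    have "d\<^sup>2 \<le> (of_int a - x)\<^sup>2" using ax[of a] d by (metis abs_le_square_iff abs_of_pos)
    then show ?thesis unfolding line_arg_def using assms
      by (intro mult_left_mono add_increasing2 divide_right_mono) auto
  qed
  then show ?thesis using d assms by (intro that[of "pi * (d\<^sup>2 / t\<^sup>2)"]) auto
qed

lemma nEi_line_arg_le:
  assumes "t > 0" "k > 0" "u \<ge> k" "c > 0" "line_arg t w x a \<ge> c"
  shows "\<bar>nEi (u * line_arg t w x a)\<bar>
    \<le> (1 / (k * c)) * (2 * (1 + 1 / (pi * k / t\<^sup>2)) * (1 + x\<^sup>2)) * (1 / (1 + (real_of_int a)\<^sup>2))"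
proof -
  have kc: "k * c \<le> u * line_arg t w x a" using assms by (intro mult_mono) auto
  have p: "u * line_arg t w x a > 0" using assms kc by (meson mult_pos_pos order_less_le_trans)
  have "\<bar>nEi (u * line_arg t w x a)\<bar> \<le> exp (- u * line_arg t w x a) * (1 / (u * line_arg t w x a))"
    using nEi_le[OF p] nEi_nonneg by simp
  also have "\<dots> \<le> (2 * (1 + 1 / (pi * k / t\<^sup>2)) * (1 + x\<^sup>2) * (1 / (1 + (real_of_int a)\<^sup>2))) * (1 / (k * c))"
    using assms kc p by (intro mult_mono exp_line_arg_le divide_left_mono mult_nonneg_nonneg add_nonneg_nonneg) auto
  finally show ?thesis by (simp add: mult_ac)
qed

lemma summable_line_sum:
  assumes "v > 0" "t > 0" "w \<noteq> 0 \<or> x \<notin> \<int>"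
  shows "(\<lambda>a. nEi (v * line_arg t w x a)) summable_on UNIV"
proof -
  obtain c where c: "c > 0" "\<And>a. line_arg t w x a \<ge> c"
    using line_arg_lower_bound[OF assms(2,3)] by metis
  show ?thesis
    by (rule abs_summable_comparison[OF summable_on_cmult_right[OF summable_on_int_inverse_square]
          nEi_line_arg_le[OF assms(2,1) order_refl c]])
qed

text \<open>The derivative of \<open>nEi (v * X)\<close> in \<open>v\<close> is - exp (- v X) / v,
  so theta inversion with \<open>\<tau> = t\<^sup>2 / v\<close> applies to the differentiated sum.
  Its zero mode is the derivative of \<open>t * heat_tail v w\<close>, and its n-th mode is that of
  the n-th summand of \<open>- tail_sum v t w x\<close>. Positivity of \<open>w\<close> lets a
  geometric series dominate the limit at infinite \<open>v\<close>.\<close>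

lemma line_sum_identity_pos:
  assumes v: "v > 0" and t: "t > 0" and w: "w > 0"
  shows "line_sum v t w x = t * heat_tail v w
    - ln ((cmod (1 - exp (Complex (- 2 * pi * (w * t)) (2 * pi * x))))\<^sup>2) - tail_sum v t w x"
proof -
  define c where "c = pi * w\<^sup>2"
  have c: "c > 0" "line_arg t w x a \<ge> c" for a using w by (auto simp: c_def line_arg_def)
  define X where "X = line_arg t w x"
  have X: "X a > 0" for a using c(1) c(2)[of a] unfolding X_def by simp
  define Th where "Th u = (\<Sum>\<^sub>\<infinity>n\<in>{1::nat..}. exp (- pi * (real n)\<^sup>2 * (t\<^sup>2 / u)) * cos (2 * pi * real n * x))" for u
  have d1: "((\<lambda>u. line_sum u t w x) has_real_derivative
      - (exp (- pi * w\<^sup>2 * u) * t * (1 + 2 * Th u) / (u * sqrt u))) (at u)" if u: "u > 0" for u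
  proof -
    define K where "K = (2 / u) * (2 * (1 + 1 / (pi * (u / 2) / t\<^sup>2)) * (1 + x\<^sup>2))"
    have "((\<lambda>y. \<Sum>\<^sub>\<infinity>a. nEi (y * X a)) has_derivative (\<lambda>h. \<Sum>\<^sub>\<infinity>a. - (exp (- (u * X a)) / u) * h)) (at u)"
    proof (rule has_derivative_infsum[where S="{u/2<..}" and M="\<lambda>a. K * (1 / (1 + (real_of_int a)\<^sup>2))"
          and f'="\<lambda>a y h. - (exp (- (y * X a)) / y) * h"])
      fix a :: int and y assume y: "y \<in> {u/2<..}"
      then have "y > 0" using u by simp
      then have "(nEi has_real_derivative - (exp (- (y * X a)) / (y * X a))) (at (y * X a))"
        using X by (intro nEi_has_derivative) auto
      then have "((\<lambda>y. nEi (y * X a)) has_real_derivative - (exp (- (y * X a)) / (y * X a)) * X a) (at y)"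
        by (rule DERIV_chain2) (auto intro!: derivative_eq_intros)
      moreover have "- (exp (- (y * X a)) / (y * X a)) * X a = - (exp (- (y * X a)) / y)"
        using X[of a] \<open>y > 0\<close> by simp
      ultimately show "((\<lambda>y. nEi (y * X a)) has_derivative (\<lambda>h. - (exp (- (y * X a)) / y) * h)) (at y)"
        by (simp only: has_field_derivative_def)
      fix h :: real
      have "exp (- y * X a) * (1 / y) \<le> (2 * (1 + 1 / (pi * (u / 2) / t\<^sup>2)) * (1 + x\<^sup>2) * (1 / (1 + (real_of_int a)\<^sup>2))) * (2 / u)"
        unfolding X_def using y u t
        by (intro mult_mono exp_line_arg_le mult_nonneg_nonneg add_nonneg_nonneg) (auto simp: field_simps)
      then have "exp (- (y * X a)) / y \<le> K * (1 / (1 + (real_of_int a)\<^sup>2))"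
        unfolding K_def by (simp add: mult_ac)
      then have "exp (- (y * X a)) / y * \<bar>h\<bar> \<le> K * (1 / (1 + (real_of_int a)\<^sup>2)) * \<bar>h\<bar>"
        by (rule mult_right_mono) simp
      then show "\<bar>- (exp (- (y * X a)) / y) * h\<bar> \<le> K * (1 / (1 + (real_of_int a)\<^sup>2)) * norm h"
        using \<open>y > 0\<close> by (simp add: abs_mult)
    next
      show "(\<lambda>a. K * (1 / (1 + (real_of_int a)\<^sup>2))) summable_on UNIV"
        by (intro summable_on_cmult_right summable_on_int_inverse_square)
      fix y assume "y \<in> {u/2<..}"
      then show "(\<lambda>a. nEi (y * X a)) summable_on UNIV"
        unfolding X_def using u t w by (intro summable_line_sum) auto
    qed (use u in auto)
    moreover have "(\<Sum>\<^sub>\<infinity>a. - (exp (- (u * X a)) / u) * h) =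
        - (exp (- pi * w\<^sup>2 * u) * t * (1 + 2 * Th u) / (u * sqrt u)) * h" for h
    proof -
      have e: "- (exp (- (u * X a)) / u) * h = - (exp (- pi * w\<^sup>2 * u) / u * h) * exp (- pi * (of_int a - x)\<^sup>2 / (t\<^sup>2 / u))" for a
      proof -
        have "- (u * X a) = - pi * w\<^sup>2 * u + - pi * (of_int a - x)\<^sup>2 / (t\<^sup>2 / u)"
          unfolding X_def line_arg_def using u t by (simp add: field_simps)
        then show ?thesis by (simp only: exp_add) simp
      qed
      have "(\<Sum>\<^sub>\<infinity>a. - (exp (- (u * X a)) / u) * h)
        = - (exp (- pi * w\<^sup>2 * u) / u * h) * (\<Sum>\<^sub>\<infinity>a::int. exp (- pi * (of_int a - x)\<^sup>2 / (t\<^sup>2 / u)))"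
        unfolding e by (rule infsum_cmult_right')
      also have "(\<Sum>\<^sub>\<infinity>a::int. exp (- pi * (of_int a - x)\<^sup>2 / (t\<^sup>2 / u))) = sqrt (t\<^sup>2 / u) * (1 + 2 * Th u)"
        unfolding Th_def by (rule theta_inversion) (use u t in auto)
      also have "sqrt (t\<^sup>2 / u) = t / sqrt u" using t by (simp add: real_sqrt_divide)
      finally show ?thesis using u by (simp add: field_simps)
    qed
    ultimately show ?thesis unfolding has_field_derivative_def line_sum_def X_def by (simp only:)
  qed
  have d2: "((\<lambda>u. tail_sum u t w x) has_real_derivative
      exp (- pi * w\<^sup>2 * u) * t * (2 * Th u) / (u * sqrt u)) (at u)" if u: "u > 0" for u
  proof -
    define K where "K = 4 * t / (u / 2 * sqrt (u / 2)) * (1 + 1 / (pi * t\<^sup>2 / (2 * u)))"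
    define g where "g n y = t * exp (- pi * y * w\<^sup>2 - pi * (real n)\<^sup>2 * t\<^sup>2 / y) / (y * sqrt y)" for n y
    have "((\<lambda>y. \<Sum>\<^sub>\<infinity>n\<in>{1..}. 2 * cos (2 * pi * real n * x) * tail_term y t w n) has_derivative
        (\<lambda>h. \<Sum>\<^sub>\<infinity>n\<in>{1..}. 2 * cos (2 * pi * real n * x) * g n u * h)) (at u)"
    \<comment> \<open>Both ends of the interval matter: the factor y^(-3/2) needs \<open>y\<close>
      bounded below, and the Gaussian in \<open>n\<close>, whose width grows with \<open>y\<close>,
      needs it bounded above.\<close>
    proof (rule has_derivative_infsum[where S="{u/2<..<2*u}" and M="\<lambda>n. K * (1 / (1 + (real n)\<^sup>2))"
          and f'="\<lambda>n y h. 2 * cos (2 * pi * real n * x) * g n y * h"])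
      fix n y assume n: "n \<in> {1::nat..}" and y: "y \<in> {u/2<..<2*u}"
      then have "y > 0" using u by simp
      then show "((\<lambda>y. 2 * cos (2 * pi * real n * x) * tail_term y t w n) has_derivative
         (\<lambda>h. 2 * cos (2 * pi * real n * x) * g n y * h)) (at y)"
        using DERIV_cmult[OF tail_term_has_derivative[of y n t w], of "2 * cos (2 * pi * real n * x)"] n
        unfolding g_def has_field_derivative_def by (simp only: atLeast_iff simp_thms)
      fix h :: real
      have "pi * (real n)\<^sup>2 * t\<^sup>2 / (2 * u) \<le> pi * (real n)\<^sup>2 * t\<^sup>2 / y"
        using y u by (intro divide_left_mono mult_nonneg_nonneg) auto
      moreover have "0 \<le> pi * y * w\<^sup>2" using \<open>y > 0\<close> by simp
      ultimately have "exp (- pi * y * w\<^sup>2 - pi * (real n)\<^sup>2 * t\<^sup>2 / y) \<le> exp (- (pi * t\<^sup>2 / (2 * u)) * (real n)\<^sup>2)"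
        by (simp add: mult_ac)
      also have "\<dots> \<le> (1 + 1 / (pi * t\<^sup>2 / (2 * u))) / (1 + (real n)\<^sup>2)"
        by (rule exp_neg_square_le) (use u t in simp)
      finally have e: "exp (- pi * y * w\<^sup>2 - pi * (real n)\<^sup>2 * t\<^sup>2 / y) \<le> (1 + 1 / (pi * t\<^sup>2 / (2 * u))) / (1 + (real n)\<^sup>2)" .
      have "u / 2 * sqrt (u / 2) \<le> y * sqrt y"
        using y u by (intro mult_mono) auto
      then have "t / (y * sqrt y) \<le> t / (u / 2 * sqrt (u / 2))"
        using u t \<open>y > 0\<close> by (intro divide_left_mono) auto
      then have "t / (y * sqrt y) * exp (- pi * y * w\<^sup>2 - pi * (real n)\<^sup>2 * t\<^sup>2 / y)
         \<le> t / (u / 2 * sqrt (u / 2)) * ((1 + 1 / (pi * t\<^sup>2 / (2 * u))) / (1 + (real n)\<^sup>2))"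
        using u t \<open>y > 0\<close> by (intro mult_mono e) auto
      then have g: "g n y \<le> t / (u / 2 * sqrt (u / 2)) * ((1 + 1 / (pi * t\<^sup>2 / (2 * u))) / (1 + (real n)\<^sup>2))"
        unfolding g_def by simp
      have g0: "g n y \<ge> 0" unfolding g_def using t \<open>y > 0\<close> by simp
      have "\<bar>2 * cos (2 * pi * real n * x) * g n y * h\<bar> = 2 * \<bar>cos (2 * pi * real n * x)\<bar> * g n y * \<bar>h\<bar>"
        using g0 by (simp add: abs_mult)
      also have "\<dots> \<le> 4 * 1 * (t / (u / 2 * sqrt (u / 2)) * ((1 + 1 / (pi * t\<^sup>2 / (2 * u))) / (1 + (real n)\<^sup>2))) * \<bar>h\<bar>"
        using g g0 by (intro mult_mono) auto
      also have "\<dots> = K * (1 / (1 + (real n)\<^sup>2)) * norm h" unfolding K_def by simp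
      finally show "\<bar>2 * cos (2 * pi * real n * x) * g n y * h\<bar> \<le> K * (1 / (1 + (real n)\<^sup>2)) * norm h" .
    next
      show "(\<lambda>n::nat. K * (1 / (1 + (real n)\<^sup>2))) summable_on {1..}"
        by (intro summable_on_cmult_right summable_on_nat_inverse_square)
      fix y assume y: "y \<in> {u/2<..<2*u}"
      show "(\<lambda>n. 2 * cos (2 * pi * real n * x) * tail_term y t w n) summable_on {1..}"
      proof (rule abs_summable_comparison)
        show "(\<lambda>n::nat. (4 * (1 + 1 / (pi * t\<^sup>2 / y))) * (1 / (1 + (real n)\<^sup>2))) summable_on {1..}"
          by (intro summable_on_cmult_right summable_on_nat_inverse_square)
        fix n assume n: "n \<in> {1::nat..}"
        have "tail_term y t w n \<le> 2 * exp (- pi * (real n)\<^sup>2 * t\<^sup>2 / y)"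
          using y u t n by (intro tail_term_le) auto
        also have "exp (- pi * (real n)\<^sup>2 * t\<^sup>2 / y) = exp (- (pi * t\<^sup>2 / y) * (real n)\<^sup>2)" by (simp add: mult_ac)
        also have "\<dots> \<le> (1 + 1 / (pi * t\<^sup>2 / y)) / (1 + (real n)\<^sup>2)"
          by (rule exp_neg_square_le) (use y u t in simp)
        finally have "tail_term y t w n \<le> 2 * ((1 + 1 / (pi * t\<^sup>2 / y)) / (1 + (real n)\<^sup>2))" by simp
        then have "2 * \<bar>cos (2 * pi * real n * x)\<bar> * tail_term y t w n \<le> 2 * 1 * (2 * ((1 + 1 / (pi * t\<^sup>2 / y)) / (1 + (real n)\<^sup>2)))"
          using tail_term_nonneg by (intro mult_mono) auto
        then show "\<bar>2 * cos (2 * pi * real n * x) * tail_term y t w n\<bar> \<le> (4 * (1 + 1 / (pi * t\<^sup>2 / y))) * (1 / (1 + (real n)\<^sup>2))"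
          using tail_term_nonneg[of y t w n] by (simp add: abs_mult)
      qed
    qed (use u in auto)
    moreover have "(\<Sum>\<^sub>\<infinity>n\<in>{1..}. 2 * cos (2 * pi * real n * x) * g n u * h) =
        exp (- pi * w\<^sup>2 * u) * t * (2 * Th u) / (u * sqrt u) * h" for h
    proof -
      have "2 * cos (2 * pi * real n * x) * g n u * h = (exp (- pi * w\<^sup>2 * u) * t * 2 / (u * sqrt u) * h)
          * (exp (- pi * (real n)\<^sup>2 * (t\<^sup>2 / u)) * cos (2 * pi * real n * x))" for n
      proof -
        have "- pi * u * w\<^sup>2 - pi * (real n)\<^sup>2 * t\<^sup>2 / u = - pi * w\<^sup>2 * u + - pi * (real n)\<^sup>2 * (t\<^sup>2 / u)"
          by simp
        then show ?thesis unfolding g_def by (simp only: exp_add) simp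
      qed
      then show ?thesis unfolding Th_def
        by (simp only: infsum_cmult_right') simp
    qed
    ultimately show ?thesis unfolding has_field_derivative_def tail_sum_def by (simp only:)
  qed
  \<comment> \<open>\<open>H\<close> has derivative zero, so its value at \<open>v\<close> is its
    limit at infinity, where \<open>line_sum\<close> and \<open>heat_tail\<close> vanish and only
    the logarithm remains.\<close>
  define H where "H u = line_sum u t w x + tail_sum u t w x - t * heat_tail u w" for u
  have "(H has_real_derivative 0) (at u)" if u: "u > 0" for u
  proof -
    have "(H has_real_derivative - (exp (- pi * w\<^sup>2 * u) * t * (1 + 2 * Th u) / (u * sqrt u))
       + exp (- pi * w\<^sup>2 * u) * t * (2 * Th u) / (u * sqrt u) - t * - (exp (- pi * w\<^sup>2 * u) / (u * sqrt u))) (at u)"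
      unfolding H_def by (intro DERIV_add DERIV_diff DERIV_cmult d1 d2 heat_tail_has_derivative u)
    moreover have "- (exp (- pi * w\<^sup>2 * u) * t * (1 + 2 * Th u) / (u * sqrt u))
       + exp (- pi * w\<^sup>2 * u) * t * (2 * Th u) / (u * sqrt u) - t * - (exp (- pi * w\<^sup>2 * u) / (u * sqrt u)) = 0"
      using u by (simp add: field_simps)
    ultimately show ?thesis by simp
  qed
  then have const: "H u = H v" if "u > 0" for u
  proof -
    assume H: "\<And>u. u > 0 \<Longrightarrow> (H has_real_derivative 0) (at u)"
    have "H constant_on {0<..}"
      by (rule has_field_derivative_0_imp_constant_on) (use H in auto)
    then show "H u = H v" using that v unfolding constant_on_def by auto
  qed
  have lim1: "((\<lambda>u. line_sum u t w x) \<longlongrightarrow> infsum (\<lambda>_::int. 0) UNIV) at_top"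
    unfolding line_sum_def
  proof (rule infsum_tendsto_dominated)
    fix a
    have "((\<lambda>u. nEi (u * X a)) \<longlongrightarrow> 0) at_top"
    proof (rule tendsto_sandwich[of "\<lambda>_. 0" _ _ "\<lambda>u. exp (- (u * X a)) / (u * X a)"])
      show "\<forall>\<^sub>F u in at_top. nEi (u * X a) \<le> exp (- (u * X a)) / (u * X a)"
        by (rule eventually_at_top_linorderI[of 1]) (use X in \<open>auto intro!: nEi_le\<close>)
      have "((\<lambda>u::real. exp (- (u * y)) / (u * y)) \<longlongrightarrow> 0) at_top" if "y > 0" for y :: real
        using that by real_asymp
      from this[OF X] show "((\<lambda>u. exp (- (u * X a)) / (u * X a)) \<longlongrightarrow> 0) at_top" .
    qed (auto simp: nEi_nonneg)
    then show "((\<lambda>u. nEi (u * line_arg t w x a)) \<longlongrightarrow> 0) at_top" unfolding X_def .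
  next
    show "\<forall>\<^sub>F u in at_top. \<forall>a\<in>UNIV. \<bar>nEi (u * line_arg t w x a)\<bar>
       \<le> (1 / (1 * c)) * (2 * (1 + 1 / (pi * 1 / t\<^sup>2)) * (1 + x\<^sup>2)) * (1 / (1 + (real_of_int a)\<^sup>2))"
      by (rule eventually_at_top_linorderI[of 1]) (use nEi_line_arg_le[OF t zero_less_one _ c] in blast)
  qed ((rule summable_on_cmult_right summable_on_int_inverse_square)+, simp)
  have lim2: "((\<lambda>u. tail_sum u t w x) \<longlongrightarrow>
      (\<Sum>\<^sub>\<infinity>n\<in>{1::nat..}. 2 * cos (2 * pi * real n * x) * (exp (- 2 * pi * real n * (w * t)) / real n))) at_top"
    unfolding tail_sum_def
  proof (rule infsum_tendsto_dominated)
    fix n assume "n \<in> {1::nat..}"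
    then show "((\<lambda>u. 2 * cos (2 * pi * real n * x) * tail_term u t w n) \<longlongrightarrow>
       2 * cos (2 * pi * real n * x) * (exp (- 2 * pi * real n * (w * t)) / real n)) at_top"
      using t w by (intro tendsto_mult tendsto_const tail_term_tendsto) auto
  next
    show "\<forall>\<^sub>F u in at_top. \<forall>n\<in>{1..}. \<bar>2 * cos (2 * pi * real n * x) * tail_term u t w n\<bar> \<le> 4 * exp (- 2 * pi * (w * t)) ^ n"
    proof (rule eventually_at_top_linorderI[of 1], rule ballI)
      fix u :: real and n assume u: "u \<ge> 1" and n: "n \<in> {1::nat..}"
      have "tail_term u t w n \<le> 2 * exp (- 2 * pi * real n * (w * t))"
        using u t w n by (intro tail_term_le_exp) auto
      then have "2 * \<bar>cos (2 * pi * real n * x)\<bar> * tail_term u t w n \<le> 2 * 1 * (2 * exp (- 2 * pi * real n * (w * t)))"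
        using tail_term_nonneg by (intro mult_mono) auto
      moreover have "exp (- 2 * pi * (w * t)) ^ n = exp (- 2 * pi * real n * (w * t))"
        unfolding exp_of_nat_mult[symmetric] by (simp add: mult_ac)
      ultimately show "\<bar>2 * cos (2 * pi * real n * x) * tail_term u t w n\<bar> \<le> 4 * exp (- 2 * pi * (w * t)) ^ n"
        using tail_term_nonneg[of u t w n] by (simp add: abs_mult)
    qed
    have "summable (\<lambda>n. exp (- 2 * pi * (w * t)) ^ n)"
      using t w by (intro summable_geometric) auto
    then have "(\<lambda>n. exp (- 2 * pi * (w * t)) ^ n) summable_on UNIV"
      by (subst summable_on_UNIV_nonneg_real_iff) auto
    then show "(\<lambda>n. 4 * exp (- 2 * pi * (w * t)) ^ n) summable_on {1..}"
      by (intro summable_on_cmult_right) (auto intro: summable_on_subset_banach)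
  qed auto
  have lim: "(H \<longlongrightarrow> 0 + - ln ((cmod (1 - exp (Complex (- 2 * pi * (w * t)) (2 * pi * x))))\<^sup>2) - t * 0) at_top"
    unfolding H_def using lim1 lim2 infsum_cos_exp_eq_ln[of "w * t" x] t w
    by (intro tendsto_intros heat_tail_at_top) (auto simp: mult_pos_pos)
  moreover have "(H \<longlongrightarrow> H v) at_top"
  proof (rule tendsto_eventually)
    show "\<forall>\<^sub>F u in at_top. H u = H v"
      by (rule eventually_at_top_linorderI[of 1]) (use const in auto)
  qed
  ultimately have "H v = 0 + - ln ((cmod (1 - exp (Complex (- 2 * pi * (w * t)) (2 * pi * x))))\<^sup>2) - t * 0"
    by (rule tendsto_unique[OF trivial_limit_at_top_linorder, rotated])
  then show ?thesis unfolding H_def by simp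
qed

text \<open>Negative \<open>w\<close> follows by evenness. At \<open>w = 0\<close> the series
  obtained for infinite \<open>v\<close> is not absolutely convergent, so this case is instead the
  limit of the identity along w = 1 / (k + 1). There \<open>x\<close> is not an integer, which keeps
  all arguments of \<open>nEi\<close> away from 0.\<close>

theorem line_sum_identity:
  assumes v: "v > 0" and t: "t > 0" and w: "w \<noteq> 0 \<or> x \<notin> \<int>"
  shows "line_sum v t w x = t * heat_tail v w
    - ln ((cmod (1 - exp (Complex (- 2 * pi * (\<bar>w\<bar> * t)) (2 * pi * x))))\<^sup>2) - tail_sum v t w x"
proof (cases "w = 0")
  case False
  have "line_sum v t w x = line_sum v t \<bar>w\<bar> x" "heat_tail v w = heat_tail v \<bar>w\<bar>"
    unfolding line_sum_def line_arg_def heat_tail_def by simp_all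
  moreover have "tail_sum v t w x = tail_sum v t \<bar>w\<bar> x"
    unfolding tail_sum_def by (cases "w \<ge> 0") (auto simp: tail_term_minus[symmetric, of v t w])
  ultimately show ?thesis using line_sum_identity_pos[OF v t, of "\<bar>w\<bar>" x] False by simp
next
  case True
  define s where "s k = 1 / real (Suc k)" for k
  have s: "s \<longlonglongrightarrow> 0" "s k > 0" for k
    unfolding s_def using LIMSEQ_inverse_real_of_nat by (auto simp: inverse_eq_divide)
  obtain c where c: "c > 0" "\<And>w' a. line_arg t w' x a \<ge> c"
    using line_arg_lower_bound[OF t w] True by metis
  have l1: "(\<lambda>k. line_sum v t (s k) x) \<longlonglongrightarrow> line_sum v t 0 x"
    unfolding line_sum_def
  proof (rule infsum_tendsto_dominated)
    fix a
    have "v * line_arg t 0 x a > 0" using v c(1) c(2)[of 0 a] by simp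
    then have "isCont nEi (v * line_arg t 0 x a)" by (rule DERIV_isCont[OF nEi_has_derivative])
    moreover have "(\<lambda>k. v * line_arg t (s k) x a) \<longlonglongrightarrow> v * line_arg t 0 x a"
      unfolding line_arg_def by (intro tendsto_intros s)
    ultimately show "(\<lambda>k. nEi (v * line_arg t (s k) x a)) \<longlonglongrightarrow> nEi (v * line_arg t 0 x a)"
      by (rule isCont_tendsto_compose)
  next
    show "\<forall>\<^sub>F k in sequentially. \<forall>a\<in>UNIV. \<bar>nEi (v * line_arg t (s k) x a)\<bar>
       \<le> (1 / (v * c)) * (2 * (1 + 1 / (pi * v / t\<^sup>2)) * (1 + x\<^sup>2)) * (1 / (1 + (real_of_int a)\<^sup>2))"
      using nEi_line_arg_le[OF t v order_refl c] by (intro always_eventually) blast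
  qed ((rule summable_on_cmult_right summable_on_int_inverse_square)+, simp)
  have l2: "(\<lambda>k. tail_sum v t (s k) x) \<longlonglongrightarrow> tail_sum v t 0 x"
    unfolding tail_sum_def
  proof (rule infsum_tendsto_dominated)
    fix n :: nat assume n: "n \<in> {1..}"
    have ce: "isCont erfcI y" for y by (rule DERIV_isCont[OF erfcI_has_derivative])
    show "(\<lambda>k. 2 * cos (2 * pi * real n * x) * tail_term v t (s k) n) \<longlonglongrightarrow> 2 * cos (2 * pi * real n * x) * tail_term v t 0 n"
      unfolding tail_term_def using n
      by (intro tendsto_intros isCont_tendsto_compose[OF ce] s) auto
  next
    show "\<forall>\<^sub>F k in sequentially. \<forall>n\<in>{1..}. \<bar>2 * cos (2 * pi * real n * x) * tail_term v t (s k) n\<bar>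
      \<le> (4 * (1 + 1 / (pi * t\<^sup>2 / v))) * (1 / (1 + (real n)\<^sup>2))"
    proof (intro always_eventually allI ballI)
      fix k and n :: nat assume n: "n \<in> {1..}"
      have "tail_term v t (s k) n \<le> 2 * exp (- pi * (real n)\<^sup>2 * t\<^sup>2 / v)"
        using v t n by (intro tail_term_le) auto
      also have "exp (- pi * (real n)\<^sup>2 * t\<^sup>2 / v) = exp (- (pi * t\<^sup>2 / v) * (real n)\<^sup>2)" by (simp add: mult_ac)
      also have "\<dots> \<le> (1 + 1 / (pi * t\<^sup>2 / v)) / (1 + (real n)\<^sup>2)"
        by (rule exp_neg_square_le) (use v t in simp)
      finally have "tail_term v t (s k) n \<le> 2 * ((1 + 1 / (pi * t\<^sup>2 / v)) / (1 + (real n)\<^sup>2))" by simp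
      then have "2 * \<bar>cos (2 * pi * real n * x)\<bar> * tail_term v t (s k) n \<le> 2 * 1 * (2 * ((1 + 1 / (pi * t\<^sup>2 / v)) / (1 + (real n)\<^sup>2)))"
        using tail_term_nonneg by (intro mult_mono) auto
      then show "\<bar>2 * cos (2 * pi * real n * x) * tail_term v t (s k) n\<bar> \<le> (4 * (1 + 1 / (pi * t\<^sup>2 / v))) * (1 / (1 + (real n)\<^sup>2))"
        using tail_term_nonneg[of v t "s k" n] by (simp add: abs_mult)
    qed
  qed ((rule summable_on_cmult_right summable_on_nat_inverse_square)+, simp)
  have l3: "(\<lambda>k. heat_tail v (s k)) \<longlonglongrightarrow> heat_tail v 0"
    unfolding heat_tail_def set_lebesgue_integral_def
  proof (rule integral_dominated_convergence[where w="\<lambda>u. indicator {v..} u *\<^sub>R u powr (- 3/2)"])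
    show "integrable lborel (\<lambda>u. indicator {v..} u *\<^sub>R u powr (- 3/2))"
      using set_integrable_powr_tail[OF v] unfolding set_integrable_def .
    show "AE u in lborel. (\<lambda>k. indicator {v..} u *\<^sub>R (exp (- pi * (s k)\<^sup>2 * u) * u powr (- 3/2)))
      \<longlonglongrightarrow> indicator {v..} u *\<^sub>R (exp (- pi * 0\<^sup>2 * u) * u powr (- 3/2))"
      by (intro AE_I2 tendsto_intros s)
    show "AE u in lborel. norm (indicator {v..} u *\<^sub>R (exp (- pi * (s k)\<^sup>2 * u) * u powr (- 3/2)))
       \<le> indicator {v..} u *\<^sub>R u powr (- 3/2)" for k
      using v by (auto simp: indicator_def mult_le_cancel_right1)
  qed auto
  have nz: "(cmod (1 - exp (Complex 0 (2 * pi * x))))\<^sup>2 \<noteq> 0"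
  proof
    assume "(cmod (1 - exp (Complex 0 (2 * pi * x))))\<^sup>2 = 0"
    then have "exp (Complex 0 (2 * pi * x)) = 1" by simp
    then obtain n :: int where "2 * pi * x = of_int (2 * n) * pi" unfolding exp_eq_1 by auto
    then have "x = of_int n" by simp
    then show False using w True by auto
  qed
  have l4: "(\<lambda>k. ln ((cmod (1 - exp (Complex (- 2 * pi * (s k * t)) (2 * pi * x))))\<^sup>2)) \<longlonglongrightarrow>
     ln ((cmod (1 - exp (Complex (- 2 * pi * (0 * t)) (2 * pi * x))))\<^sup>2)"
    by (intro tendsto_intros tendsto_Complex s) (use nz in auto)
  have "(\<lambda>k. line_sum v t (s k) x) = (\<lambda>k. t * heat_tail v (s k)
    - ln ((cmod (1 - exp (Complex (- 2 * pi * (s k * t)) (2 * pi * x))))\<^sup>2) - tail_sum v t (s k) x)"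
    using line_sum_identity_pos[OF v t s(2)] by (intro ext)
  moreover have "(\<lambda>k. t * heat_tail v (s k)
    - ln ((cmod (1 - exp (Complex (- 2 * pi * (s k * t)) (2 * pi * x))))\<^sup>2) - tail_sum v t (s k) x)
    \<longlonglongrightarrow> t * heat_tail v 0 - ln ((cmod (1 - exp (Complex (- 2 * pi * (0 * t)) (2 * pi * x))))\<^sup>2) - tail_sum v t 0 x"
    by (intro tendsto_intros l2 l3 l4)
  ultimately have "(\<lambda>k. line_sum v t (s k) x) \<longlonglongrightarrow> t * heat_tail v 0 - ln ((cmod (1 - exp (Complex (- 2 * pi * (0 * t)) (2 * pi * x))))\<^sup>2) - tail_sum v t 0 x"
    by (simp only:)
  from LIMSEQ_unique[OF l1 this]
  have "line_sum v t 0 x = t * heat_tail v 0 - ln ((cmod (1 - exp (Complex (- 2 * pi * (0 * t)) (2 * pi * x))))\<^sup>2) - tail_sum v t 0 x" .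
  then show ?thesis using True by simp
qed

section \<open>Closed classes of smooth functions\<close>

text \<open>Stability under directional derivatives, required only on \<open>S\<close>. Every
  iterated derivative of a member agrees on \<open>S\<close> with a member again, so whatever is
  proved for all members holds for derivatives of all orders.\<close>

definition closed_class :: "('a::real_normed_vector \<Rightarrow> real) set \<Rightarrow> 'a set \<Rightarrow> bool" where
  "closed_class C S \<longleftrightarrow> open S \<and> (\<forall>f\<in>C. \<exists>f'. (\<forall>x\<in>S. (f has_derivative f' x) (at x)) \<and>
     (\<forall>w. \<exists>g\<in>C. \<forall>x\<in>S. f' x w = g x))"

text \<open>\<open>h\<close> need only agree with \<open>f\<close> on the open set \<open>S\<close>:
  outside \<open>S\<close> an iterated \<open>frechet_derivative\<close> may be an arbitrary choice,
  so the inductions below cannot identify functions globally.\<close>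

lemma closed_class_frechet:
  assumes "closed_class C S" "f \<in> C" "\<And>x. x \<in> S \<Longrightarrow> h x = f x"
  shows "\<And>x. x \<in> S \<Longrightarrow> h differentiable (at x)"
    and "\<And>w. \<exists>g\<in>C. \<forall>x\<in>S. frechet_derivative h (at x) w = g x"
proof -
  have S: "open S" using assms(1) by (simp add: closed_class_def)
  obtain f' where f': "\<And>x. x \<in> S \<Longrightarrow> (f has_derivative f' x) (at x)" "\<And>w. \<exists>g\<in>C. \<forall>x\<in>S. f' x w = g x"
    using assms(1,2) unfolding closed_class_def by metis
  have h': "(h has_derivative f' x) (at x)" if "x \<in> S" for x
    by (rule has_derivative_transform_within_open[OF f'(1)[OF that] S that]) (use assms(3) in auto)
  show "h differentiable (at x)" if "x \<in> S" for x
    using h'[OF that] by (auto simp: differentiable_def)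
  show "\<exists>g\<in>C. \<forall>x\<in>S. frechet_derivative h (at x) w = g x" for w
    using f'(2)[of w] frechet_derivative_at[OF h'] by metis
qed

lemma closed_class_iter_deriv:
  assumes "closed_class C S" "f \<in> C" "\<And>x. x \<in> S \<Longrightarrow> h x = f x"
  shows "\<exists>g\<in>C. \<forall>x\<in>S. iter_deriv ws h x = g x"
  using assms(2,3)
proof (induction ws arbitrary: f h)
  case (Cons w ws)
  obtain g where "g \<in> C" "\<And>x. x \<in> S \<Longrightarrow> frechet_derivative h (at x) w = g x"
    using closed_class_frechet(2)[OF assms(1) Cons.prems] by metis
  then show ?case using Cons.IH by simp
qed auto

lemma closed_class_Ck_on:
  assumes "closed_class C S" "f \<in> C" "\<And>x. x \<in> S \<Longrightarrow> h x = f x"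
  shows "Ck_on k h S"
  using assms(2,3)
proof (induction k arbitrary: f h)
  case 0
  have "h differentiable (at x)" if "x \<in> S" for x
    using closed_class_frechet(1)[OF assms(1) 0 that] .
  then show ?case
    by (auto intro!: continuous_at_imp_continuous_on differentiable_imp_continuous_within)
next
  case (Suc k)
  have "Ck_on k (\<lambda>x. frechet_derivative h (at x) w) S" for w
  proof -
    obtain g where g: "g \<in> C" "\<And>x. x \<in> S \<Longrightarrow> frechet_derivative h (at x) w = g x"
      using closed_class_frechet(2)[OF assms(1) Suc.prems] by metis
    show ?thesis by (rule Suc.IH[OF g])
  qed
  then show ?case using closed_class_frechet(1)[OF assms(1) Suc.prems] by simp
qed

lemma closed_class_plus:
  assumes "closed_class C S" "closed_class D' S"
  shows "closed_class {\<lambda>x. f x + g x | f g. f \<in> C \<and> g \<in> D'} S"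
  unfolding closed_class_def
proof (intro conjI ballI)
  fix h assume "h \<in> {\<lambda>x. f x + g x | f g. f \<in> C \<and> g \<in> D'}"
  then obtain f g where h: "h = (\<lambda>x. f x + g x)" "f \<in> C" "g \<in> D'" by blast
  obtain f' where f': "\<forall>x\<in>S. (f has_derivative f' x) (at x)" "\<forall>w. \<exists>g\<in>C. \<forall>x\<in>S. f' x w = g x"
    using assms(1) h(2) unfolding closed_class_def by blast
  obtain g' where g': "\<forall>x\<in>S. (g has_derivative g' x) (at x)" "\<forall>w. \<exists>g\<in>D'. \<forall>x\<in>S. g' x w = g x"
    using assms(2) h(3) unfolding closed_class_def by blast
  show "\<exists>h'. (\<forall>x\<in>S. (h has_derivative h' x) (at x)) \<and>
     (\<forall>w. \<exists>k\<in>{\<lambda>x. f x + g x | f g. f \<in> C \<and> g \<in> D'}. \<forall>x\<in>S. h' x w = k x)"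
  proof (intro exI[of _ "\<lambda>x w. f' x w + g' x w"] conjI ballI allI)
    fix w
    obtain k l where k: "k \<in> C" "\<forall>x\<in>S. f' x w = k x" and l: "l \<in> D'" "\<forall>x\<in>S. g' x w = l x"
      using f'(2)[rule_format, of w] g'(2)[rule_format, of w] by blast
    then show "\<exists>k\<in>{\<lambda>x. f x + g x | f g. f \<in> C \<and> g \<in> D'}. \<forall>x\<in>S. f' x w + g' x w = k x"
      by (intro bexI[of _ "\<lambda>x. k x + l x"]) auto
  qed (use h f' g' in \<open>auto intro!: has_derivative_add\<close>)
qed (use assms in \<open>auto simp: closed_class_def\<close>)

lemma Ck_on_cong:
  assumes "open S" "\<And>x. x \<in> S \<Longrightarrow> f x = g x" "Ck_on k f S"
  shows "Ck_on k g S"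
  using assms(2,3)
proof (induction k arbitrary: f g)
  case 0
  then show ?case using continuous_on_cong[of S S f g] by simp
next
  case (Suc k)
  have gd: "(g has_derivative frechet_derivative f (at x)) (at x)" if "x \<in> S" for x
  proof (rule has_derivative_transform_within_open[OF _ assms(1) that])
    show "(f has_derivative frechet_derivative f (at x)) (at x)"
      using Suc.prems that by (simp add: frechet_derivative_works[symmetric])
  qed (use Suc.prems in auto)
  then have fr: "frechet_derivative g (at x) = frechet_derivative f (at x)" if "x \<in> S" for x
    using frechet_derivative_at[OF gd] that by simp
  have "Ck_on k (\<lambda>x. frechet_derivative g (at x) w) S" for w
    by (rule Suc.IH[of "\<lambda>x. frechet_derivative f (at x) w"]) (use Suc.prems fr in auto)
  then show ?case using gd by (auto simp: differentiable_def)
qed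

lemma Ck_on_add:
  assumes "open S" "Ck_on k f S" "Ck_on k g S"
  shows "Ck_on k (\<lambda>x. f x + g x) S"
  using assms(2,3)
proof (induction k arbitrary: f g)
  case (Suc k)
  have "frechet_derivative f (at x) w + frechet_derivative g (at x) w = frechet_derivative (\<lambda>x. f x + g x) (at x) w"
    if "x \<in> S" for x w
  proof -
    have "((\<lambda>x. f x + g x) has_derivative (\<lambda>w. frechet_derivative f (at x) w + frechet_derivative g (at x) w)) (at x)"
      using Suc.prems that by (intro has_derivative_add) (auto simp: frechet_derivative_works[symmetric])
    from frechet_derivative_at[OF this] show ?thesis by (rule fun_cong)
  qed
  note fr = this
  have "Ck_on k (\<lambda>x. frechet_derivative (\<lambda>x. f x + g x) (at x) w) S" for w
  proof (rule Ck_on_cong[OF assms(1)])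
    show "Ck_on k (\<lambda>x. frechet_derivative f (at x) w + frechet_derivative g (at x) w) S"
      by (rule Suc.IH) (use Suc.prems in \<open>simp_all only: Ck_on.simps\<close>)
  qed (rule fr)
  moreover have "(\<lambda>x. f x + g x) differentiable (at x)" if "x \<in> S" for x
    using Suc.prems that by (intro differentiable_add) auto
  ultimately show ?case by simp
qed (auto intro: continuous_on_add)

lemma Ck_on_mono:
  assumes "Ck_on k f S" "T \<subseteq> S"
  shows "Ck_on k f T"
  using assms(1)
proof (induction k arbitrary: f)
  case 0
  then show ?case using assms(2) continuous_on_subset by auto
qed (use assms(2) in auto)

section \<open>Modules of families stable under differentiation\<close>

text \<open>\<open>fam_poly A\<close> is an algebra meant for families of polynomial growth, and
  \<open>fam_mod A G\<close> is the module over it generated by rapidly decaying families. If atoms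
  differentiate into the algebra and generators into the module, then the module is stable under
  differentiation, and its members inherit the decay of the generators up to polynomial factors. The
  index \<open>i\<close> is carried along because growth has to be controlled jointly in
  \<open>i\<close> and \<open>z\<close>.\<close>

inductive_set fam_poly :: "('i \<Rightarrow> 'a \<Rightarrow> real) set \<Rightarrow> ('i \<Rightarrow> 'a \<Rightarrow> real) set"
  for A :: "('i \<Rightarrow> 'a \<Rightarrow> real) set" where
  const: "(\<lambda>i z. c) \<in> fam_poly A"
| atom: "a \<in> A \<Longrightarrow> a \<in> fam_poly A"
| add: "p \<in> fam_poly A \<Longrightarrow> q \<in> fam_poly A \<Longrightarrow> (\<lambda>i z. p i z + q i z) \<in> fam_poly A"
| mult: "p \<in> fam_poly A \<Longrightarrow> q \<in> fam_poly A \<Longrightarrow> (\<lambda>i z. p i z * q i z) \<in> fam_poly A"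

inductive_set fam_mod :: "('i \<Rightarrow> 'a \<Rightarrow> real) set \<Rightarrow> ('i \<Rightarrow> 'a \<Rightarrow> real) set \<Rightarrow> ('i \<Rightarrow> 'a \<Rightarrow> real) set"
  for A :: "('i \<Rightarrow> 'a \<Rightarrow> real) set" and G :: "('i \<Rightarrow> 'a \<Rightarrow> real) set" where
  gen: "e \<in> G \<Longrightarrow> e \<in> fam_mod A G"
| add: "f \<in> fam_mod A G \<Longrightarrow> g \<in> fam_mod A G \<Longrightarrow> (\<lambda>i z. f i z + g i z) \<in> fam_mod A G"
| mult: "p \<in> fam_poly A \<Longrightarrow> f \<in> fam_mod A G \<Longrightarrow> (\<lambda>i z. p i z * f i z) \<in> fam_mod A G"

lemma fam_poly_minus: "p \<in> fam_poly A \<Longrightarrow> (\<lambda>i z. - p i z) \<in> fam_poly A"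
  using fam_poly.mult[OF fam_poly.const[where c="-1"], of p A] by simp

definition fam_deriv where
  "fam_deriv J S f C \<longleftrightarrow> (\<exists>f'. (\<forall>i\<in>J. \<forall>z\<in>S. (f i has_derivative f' i z) (at z)) \<and> (\<forall>w. (\<lambda>i z. f' i z w) \<in> C))"

lemma fam_derivI:
  assumes "\<And>i z. i \<in> J \<Longrightarrow> z \<in> S \<Longrightarrow> (f i has_derivative f' i z) (at z)"
    "\<And>w. (\<lambda>i z. f' i z w) \<in> C"
  shows "fam_deriv J S f C"
  using assms unfolding fam_deriv_def by blast

lemma fam_poly_deriv:
  assumes A: "\<And>a. a \<in> A \<Longrightarrow> fam_deriv J S a (fam_poly A)" and "p \<in> fam_poly A"
  shows "fam_deriv J S p (fam_poly A)"
  using assms(2)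
proof induction
  case (const c)
  then show ?case by (intro fam_derivI[where f'="\<lambda>i z h. 0"]) (auto intro: fam_poly.const)
next
  case (atom a)
  then show ?case by (rule A)
next
  case (add p q)
  then obtain p' q' where "\<forall>i\<in>J. \<forall>z\<in>S. (p i has_derivative p' i z) (at z)" "\<forall>w. (\<lambda>i z. p' i z w) \<in> fam_poly A"
    "\<forall>i\<in>J. \<forall>z\<in>S. (q i has_derivative q' i z) (at z)" "\<forall>w. (\<lambda>i z. q' i z w) \<in> fam_poly A"
    unfolding fam_deriv_def by blast
  then show ?case
    by (intro fam_derivI[where f'="\<lambda>i z h. p' i z h + q' i z h"]
          fam_poly.add has_derivative_add) auto
next
  case (mult p q)
  then obtain p' q' where "\<forall>i\<in>J. \<forall>z\<in>S. (p i has_derivative p' i z) (at z)" "\<forall>w. (\<lambda>i z. p' i z w) \<in> fam_poly A"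
    "\<forall>i\<in>J. \<forall>z\<in>S. (q i has_derivative q' i z) (at z)" "\<forall>w. (\<lambda>i z. q' i z w) \<in> fam_poly A"
    unfolding fam_deriv_def by blast
  with mult.hyps show ?case
    by (intro fam_derivI[where f'="\<lambda>i z h. p i z * q' i z h + p' i z h * q i z"]
          fam_poly.add fam_poly.mult has_derivative_mult) auto
qed

lemma fam_mod_deriv:
  assumes A: "\<And>a. a \<in> A \<Longrightarrow> fam_deriv J S a (fam_poly A)"
    and G: "\<And>e. e \<in> G \<Longrightarrow> fam_deriv J S e (fam_mod A G)" and "f \<in> fam_mod A G"
  shows "fam_deriv J S f (fam_mod A G)"
  using assms(3)
proof induction
  case (gen e)
  then show ?case by (rule G)
next
  case (add p q)
  then obtain p' q' where "\<forall>i\<in>J. \<forall>z\<in>S. (p i has_derivative p' i z) (at z)" "\<forall>w. (\<lambda>i z. p' i z w) \<in> fam_mod A G"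
    "\<forall>i\<in>J. \<forall>z\<in>S. (q i has_derivative q' i z) (at z)" "\<forall>w. (\<lambda>i z. q' i z w) \<in> fam_mod A G"
    unfolding fam_deriv_def by blast
  then show ?case
    by (intro fam_derivI[where f'="\<lambda>i z h. p' i z h + q' i z h"]
          fam_mod.add has_derivative_add) auto
next
  case (mult p q)
  obtain p' where "\<forall>i\<in>J. \<forall>z\<in>S. (p i has_derivative p' i z) (at z)" "\<forall>w. (\<lambda>i z. p' i z w) \<in> fam_poly A"
    using fam_poly_deriv[OF A mult.hyps(1)] unfolding fam_deriv_def by blast
  moreover obtain q' where "\<forall>i\<in>J. \<forall>z\<in>S. (q i has_derivative q' i z) (at z)" "\<forall>w. (\<lambda>i z. q' i z w) \<in> fam_mod A G"
    using mult.IH unfolding fam_deriv_def by blast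
  ultimately show ?case using mult.hyps
    by (intro fam_derivI[where f'="\<lambda>i z h. p i z * q' i z h + p' i z h * q i z"]
          fam_mod.add fam_mod.mult has_derivative_mult) auto
qed

text \<open>\<open>L \<ge> 1\<close> makes its powers monotone in the exponent, so the bounds of two
  summands fit under one common power.\<close>

lemma fam_poly_bound:
  fixes L :: "'i \<Rightarrow> 'a \<Rightarrow> real"
  assumes A: "\<And>a. a \<in> A \<Longrightarrow> \<exists>c\<ge>0. \<exists>N. \<forall>i\<in>J. \<forall>z\<in>S. \<bar>a i z\<bar> \<le> c * L i z ^ N"
    and L: "\<And>i z. i \<in> J \<Longrightarrow> z \<in> S \<Longrightarrow> L i z \<ge> 1" and "p \<in> fam_poly A"
  shows "\<exists>c\<ge>0. \<exists>N. \<forall>i\<in>J. \<forall>z\<in>S. \<bar>p i z\<bar> \<le> c * L i z ^ N"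
  using assms(3)
proof induction
  case (const c)
  then show ?case by (intro exI[of _ "\<bar>c\<bar>"] conjI exI[of _ 0]) auto
next
  case (atom a)
  then show ?case by (rule A)
next
  case (add p q)
  then obtain c N c' N' where b: "c \<ge> 0" "c' \<ge> 0" "\<forall>i\<in>J. \<forall>z\<in>S. \<bar>p i z\<bar> \<le> c * L i z ^ N"
    "\<forall>i\<in>J. \<forall>z\<in>S. \<bar>q i z\<bar> \<le> c' * L i z ^ N'" by blast
  have "\<bar>p i z + q i z\<bar> \<le> (c + c') * L i z ^ (N + N')" if "i \<in> J" "z \<in> S" for i z
  proof -
    have "c * L i z ^ N \<le> c * L i z ^ (N + N')" "c' * L i z ^ N' \<le> c' * L i z ^ (N + N')"
      using L[OF that] b(1,2) by (auto intro!: mult_left_mono power_increasing)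
    then have "\<bar>p i z\<bar> \<le> c * L i z ^ (N + N')" "\<bar>q i z\<bar> \<le> c' * L i z ^ (N + N')"
      using b(3,4) that by (meson order_trans)+
    then show ?thesis by (simp add: distrib_right)
  qed
  then show ?case using b by (intro exI[of _ "c + c'"] conjI exI[of _ "N + N'"]) auto
next
  case (mult p q)
  then obtain c N c' N' where b: "c \<ge> 0" "c' \<ge> 0" "\<forall>i\<in>J. \<forall>z\<in>S. \<bar>p i z\<bar> \<le> c * L i z ^ N"
    "\<forall>i\<in>J. \<forall>z\<in>S. \<bar>q i z\<bar> \<le> c' * L i z ^ N'" by blast
  have "\<bar>p i z * q i z\<bar> \<le> (c * c') * L i z ^ (N + N')" if "i \<in> J" "z \<in> S" for i z
  proof -
    have "\<bar>p i z\<bar> * \<bar>q i z\<bar> \<le> (c * L i z ^ N) * (c' * L i z ^ N')"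
      using b L[OF that] that by (intro mult_mono) auto
    then show ?thesis by (simp add: abs_mult power_add mult_ac)
  qed
  then show ?case using b by (intro exI[of _ "c * c'"] conjI exI[of _ "N + N'"]) auto
qed

lemma fam_mod_bound:
  fixes L Ex :: "'i \<Rightarrow> 'a \<Rightarrow> real"
  assumes A: "\<And>a. a \<in> A \<Longrightarrow> \<exists>c\<ge>0. \<exists>N. \<forall>i\<in>J. \<forall>z\<in>S. \<bar>a i z\<bar> \<le> c * L i z ^ N"
    and L: "\<And>i z. i \<in> J \<Longrightarrow> z \<in> S \<Longrightarrow> L i z \<ge> 1"
    and G: "\<And>e. e \<in> G \<Longrightarrow> \<exists>c\<ge>0. \<forall>i\<in>J. \<forall>z\<in>S. \<bar>e i z\<bar> \<le> c * Ex i z"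
    and Ex: "\<And>i z. i \<in> J \<Longrightarrow> z \<in> S \<Longrightarrow> Ex i z \<ge> 0"
    and "f \<in> fam_mod A G"
  shows "\<exists>c\<ge>0. \<exists>N. \<forall>i\<in>J. \<forall>z\<in>S. \<bar>f i z\<bar> \<le> c * (L i z ^ N * Ex i z)"
  using assms(5)
proof induction
  case (gen e)
  then obtain c where "c \<ge> 0" "\<forall>i\<in>J. \<forall>z\<in>S. \<bar>e i z\<bar> \<le> c * Ex i z" using G by blast
  then show ?case by (intro exI[of _ c] conjI exI[of _ 0]) auto
next
  case (add p q)
  then obtain c N c' N' where b: "c \<ge> 0" "c' \<ge> 0" "\<forall>i\<in>J. \<forall>z\<in>S. \<bar>p i z\<bar> \<le> c * (L i z ^ N * Ex i z)"
    "\<forall>i\<in>J. \<forall>z\<in>S. \<bar>q i z\<bar> \<le> c' * (L i z ^ N' * Ex i z)" by blast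
  have "\<bar>p i z + q i z\<bar> \<le> (c + c') * (L i z ^ (N + N') * Ex i z)" if "i \<in> J" "z \<in> S" for i z
  proof -
    have "c * (L i z ^ N * Ex i z) \<le> c * (L i z ^ (N + N') * Ex i z)" "c' * (L i z ^ N' * Ex i z) \<le> c' * (L i z ^ (N + N') * Ex i z)"
      using L[OF that] Ex[OF that] b(1,2) by (auto intro!: mult_left_mono mult_right_mono power_increasing)
    then have "\<bar>p i z\<bar> \<le> c * (L i z ^ (N + N') * Ex i z)" "\<bar>q i z\<bar> \<le> c' * (L i z ^ (N + N') * Ex i z)"
      using b(3,4) that by (meson order_trans)+
    then show ?thesis by (simp add: distrib_right)
  qed
  then show ?case using b by (intro exI[of _ "c + c'"] conjI exI[of _ "N + N'"]) auto
next
  case (mult p q)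
  then obtain c' N' where b': "c' \<ge> 0" "\<forall>i\<in>J. \<forall>z\<in>S. \<bar>q i z\<bar> \<le> c' * (L i z ^ N' * Ex i z)" by blast
  obtain c N where b: "c \<ge> 0" "\<forall>i\<in>J. \<forall>z\<in>S. \<bar>p i z\<bar> \<le> c * L i z ^ N"
    using fam_poly_bound[OF A L mult.hyps(1)] by blast
  have "\<bar>p i z * q i z\<bar> \<le> (c * c') * (L i z ^ (N + N') * Ex i z)" if "i \<in> J" "z \<in> S" for i z
  proof -
    have "\<bar>p i z\<bar> * \<bar>q i z\<bar> \<le> (c * L i z ^ N) * (c' * (L i z ^ N' * Ex i z))"
      using b b' L[OF that] that by (intro mult_mono) auto
    then show ?thesis by (simp add: abs_mult power_add mult_ac)
  qed
  then show ?case using b b' by (intro exI[of _ "c * c'"] conjI exI[of _ "N + N'"]) auto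
qed

text \<open>The bounding function \<open>H\<close> may depend on the direction of the derivative.
  Linearity reduces to the finitely many basis directions, and continuity of \<open>H\<close> on a
  closed ball supplies the constants for termwise differentiation.\<close>

lemma fam_sum_closed_class:
  fixes S :: "'a::euclidean_space set" and \<mu> :: "'i \<Rightarrow> real"
  assumes S: "open S"
    and der: "\<And>f. f \<in> F \<Longrightarrow> fam_deriv J S f F"
    and bd: "\<And>f. f \<in> F \<Longrightarrow> \<exists>H. continuous_on S H \<and> (\<forall>i\<in>J. \<forall>z\<in>S. \<bar>f i z\<bar> \<le> H z * \<mu> i)"
    and \<mu>: "\<mu> summable_on J" "\<And>i. i \<in> J \<Longrightarrow> \<mu> i \<ge> 0"
  shows "closed_class {\<lambda>z. \<Sum>\<^sub>\<infinity>i\<in>J. f i z | f. f \<in> F} S"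
  unfolding closed_class_def
proof (intro conjI ballI S)
  fix h assume "h \<in> {\<lambda>z. \<Sum>\<^sub>\<infinity>i\<in>J. f i z | f. f \<in> F}"
  then obtain f where h: "h = (\<lambda>z. \<Sum>\<^sub>\<infinity>i\<in>J. f i z)" and f: "f \<in> F" by blast
  obtain f' where f': "\<And>i z. i \<in> J \<Longrightarrow> z \<in> S \<Longrightarrow> (f i has_derivative f' i z) (at z)" "\<And>w. (\<lambda>i z. f' i z w) \<in> F"
    using der[OF f] unfolding fam_deriv_def by metis
  have "(h has_derivative (\<lambda>w. \<Sum>\<^sub>\<infinity>i\<in>J. f' i z w)) (at z)" if z: "z \<in> S" for z
  proof -
    obtain r where r: "r > 0" "cball z r \<subseteq> S" using S z open_contains_cball by blast
    have "\<exists>K. \<forall>i\<in>J. \<forall>y\<in>ball z r. \<bar>f' i y b\<bar> \<le> K * \<mu> i" for b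
    proof -
      obtain H where H: "continuous_on S H" "\<forall>i\<in>J. \<forall>z\<in>S. \<bar>f' i z b\<bar> \<le> H z * \<mu> i"
        using bd[OF f'(2)[of b]] by blast
      have "compact (H ` cball z r)"
        using H(1) r(2) by (intro compact_continuous_image) (auto intro: continuous_on_subset)
      then obtain K where K: "\<forall>y\<in>cball z r. norm (H y) \<le> K"
        using compact_imp_bounded bounded_iff by (metis imageI)
      have "\<bar>f' i y b\<bar> \<le> K * \<mu> i" if "i \<in> J" "y \<in> ball z r" for i y
      proof -
        have "y \<in> cball z r" using that by auto
        then have "\<bar>f' i y b\<bar> \<le> H y * \<mu> i" "H y \<le> K" using H(2) r(2) that K by fastforce+
        then show ?thesis using \<mu>(2)[OF that(1)] by (meson mult_right_mono order_trans)
      qed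
      then show ?thesis by blast
    qed
    then obtain K where K: "\<And>b i y. i \<in> J \<Longrightarrow> y \<in> ball z r \<Longrightarrow> \<bar>f' i y b\<bar> \<le> K b * \<mu> i"
      by metis
    show ?thesis unfolding h
    proof (rule has_derivative_infsum[where S="ball z r" and M="\<lambda>i. (\<Sum>b\<in>Basis. K b) * \<mu> i"])
      fix i y w assume i: "i \<in> J" and y: "y \<in> ball z r"
      have yS: "y \<in> S" using y r(2) by auto
      interpret bounded_linear "f' i y" using f'(1)[OF i yS] has_derivative_bounded_linear by blast
      have "f' i y w = f' i y (\<Sum>b\<in>Basis. (w \<bullet> b) *\<^sub>R b)" by (simp add: euclidean_representation)
      also have "\<dots> = (\<Sum>b\<in>Basis. (w \<bullet> b) * f' i y b)" by (simp add: sum scaleR)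
      also have "\<bar>\<dots>\<bar> \<le> (\<Sum>b\<in>Basis. \<bar>(w \<bullet> b) * f' i y b\<bar>)" by (rule sum_abs)
      also have "\<dots> \<le> (\<Sum>b\<in>Basis. norm w * (K b * \<mu> i))"
        unfolding abs_mult using K[OF i y] by (intro sum_mono mult_mono Basis_le_norm) auto
      also have "\<dots> = (\<Sum>b\<in>Basis. K b) * \<mu> i * norm w"
        by (simp add: sum_distrib_right sum_distrib_left mult_ac)
      finally show "\<bar>f' i y w\<bar> \<le> (\<Sum>b\<in>Basis. K b) * \<mu> i * norm w" .
    next
      fix y assume y: "y \<in> ball z r"
      then have yS: "y \<in> S" using r(2) by auto
      obtain H where H: "\<forall>i\<in>J. \<forall>z\<in>S. \<bar>f i z\<bar> \<le> H z * \<mu> i"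
        using bd[OF f] by blast
      show "(\<lambda>i. f i y) summable_on J"
        by (rule abs_summable_comparison[OF summable_on_cmult_right[OF \<mu>(1), of "H y"]]) (use H yS in auto)
    qed (use f' subsetD[OF r(2)] r(1) \<mu> in \<open>auto intro!: summable_on_cmult_right\<close>)
  qed
  then show "\<exists>h'. (\<forall>z\<in>S. (h has_derivative h' z) (at z)) \<and>
     (\<forall>w. \<exists>g\<in>{\<lambda>z. \<Sum>\<^sub>\<infinity>i\<in>J. f i z | f. f \<in> F}. \<forall>z\<in>S. h' z w = g z)"
  proof (intro exI[of _ "\<lambda>z w. \<Sum>\<^sub>\<infinity>i\<in>J. f' i z w"] conjI allI)
    fix w
    have "(\<lambda>z. \<Sum>\<^sub>\<infinity>i\<in>J. f' i z w) \<in> {\<lambda>z. \<Sum>\<^sub>\<infinity>i\<in>J. f i z | f. f \<in> F}"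
      unfolding mem_Collect_eq by (intro exI[of _ "\<lambda>i z. f' i z w"] conjI refl f'(2))
    then show "\<exists>g\<in>{\<lambda>z. \<Sum>\<^sub>\<infinity>i\<in>J. f i z | f. f \<in> F}. \<forall>z\<in>S. (\<Sum>\<^sub>\<infinity>i\<in>J. f' i z w) = g z"
      by (rule bexI[rotated]) simp
  qed simp
qed

section \<open>Absorbing polynomial factors into exponentials\<close>

text \<open>The exponential is shared out evenly: each of the \<open>n\<close> factors 1 + p is at
  most a constant times exp (k p / n).\<close>

lemma one_plus_power_exp_le:
  fixes p k :: real
  assumes "k > 0" "p \<ge> 0"
  shows "(1 + p) ^ n * exp (- k * p) \<le> (1 + real n / k) ^ n"
proof (cases "n = 0")
  case False
  define c where "c = k / real n"
  have c: "c > 0" "real n / k = 1 / c" using assms False by (auto simp: c_def)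
  have "1 + p \<le> (1 + 1 / c) * (1 + c * p)" using c assms by (simp add: field_simps)
  also have "\<dots> \<le> (1 + 1 / c) * exp (c * p)" using c by (intro mult_left_mono) auto
  finally have "(1 + p) ^ n \<le> ((1 + 1 / c) * exp (c * p)) ^ n" using assms by (intro power_mono) auto
  also have "\<dots> = (1 + real n / k) ^ n * exp (k * p)"
    unfolding power_mult_distrib exp_of_nat_mult[symmetric] c(2) using False by (simp add: c_def)
  finally have "(1 + p) ^ n * exp (- k * p) \<le> (1 + real n / k) ^ n * exp (k * p) * exp (- k * p)"
    by (intro mult_right_mono) auto
  then show ?thesis by (simp add: mult.assoc exp_add[symmetric])
qed (use assms in auto)

text \<open>The constant does not depend on the width of the Gaussian; a small \<open>h\<close> is
  paid for by powers of \<open>y\<close>. Two extra powers of 1 + |s| produce the weight 1 / (1 +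
  s^2), whence the exponent \<open>N + 2\<close>.\<close>

lemma power_gaussian_le:
  fixes k :: real
  assumes k: "k > 0"
  obtains c where "c \<ge> 0" "\<And>s h y :: real. h > 0 \<Longrightarrow> 1 \<le> y \<Longrightarrow> 1 / h \<le> y \<Longrightarrow>
    (1 + \<bar>s\<bar>) ^ N * exp (- k * (h * s\<^sup>2)) \<le> c * y ^ (N + 2) * (1 / (1 + s\<^sup>2))"
proof
  define c where "c = 2 ^ (N + 2) * (1 + real (N + 2) / k) ^ (N + 2)"
  show "c \<ge> 0" using k by (simp add: c_def)
  fix s h y :: real assume h: "h > 0" and y: "1 \<le> y" and hy: "1 / h \<le> y"
  have s0: "s\<^sup>2 \<ge> 0" "1 + s\<^sup>2 > 0" by (auto simp: add_pos_nonneg)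
  have "1 \<le> y * h" using h hy by (simp add: field_simps)
  then have "s\<^sup>2 \<le> y * h * s\<^sup>2" using s0(1) by (metis mult_right_mono mult_1)
  then have a: "1 + s\<^sup>2 \<le> y * (1 + h * s\<^sup>2)" using y by (simp add: distrib_left mult.assoc)
  have "0 \<le> (\<bar>s\<bar> - 1)\<^sup>2" by simp
  then have "\<bar>s\<bar> \<le> 1 + s\<^sup>2" by (simp add: power2_eq_square algebra_simps abs_mult_self_eq)
  then have b: "1 + \<bar>s\<bar> \<le> 2 * (y * (1 + h * s\<^sup>2))" using a by (smt (verit) s0)
  have "(1 + \<bar>s\<bar>) ^ (N + 2) * exp (- k * (h * s\<^sup>2)) \<le> (2 * (y * (1 + h * s\<^sup>2))) ^ (N + 2) * exp (- k * (h * s\<^sup>2))"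
    using b by (intro mult_right_mono power_mono) auto
  also have "\<dots> = 2 ^ (N + 2) * y ^ (N + 2) * ((1 + h * s\<^sup>2) ^ (N + 2) * exp (- k * (h * s\<^sup>2)))"
    by (simp only: power_mult_distrib mult.assoc)
  also have "\<dots> \<le> 2 ^ (N + 2) * y ^ (N + 2) * (1 + real (N + 2) / k) ^ (N + 2)"
    using h y k by (intro mult_left_mono one_plus_power_exp_le) auto
  finally have e: "(1 + \<bar>s\<bar>) ^ (N + 2) * exp (- k * (h * s\<^sup>2)) \<le> c * y ^ (N + 2)"
    by (simp add: c_def mult_ac)
  have "1 + s\<^sup>2 \<le> (1 + \<bar>s\<bar>)\<^sup>2" by (simp add: power2_eq_square algebra_simps abs_mult_self_eq)
  then have "(1 + \<bar>s\<bar>) ^ N * exp (- k * (h * s\<^sup>2)) * (1 + s\<^sup>2) \<le> (1 + \<bar>s\<bar>) ^ N * exp (- k * (h * s\<^sup>2)) * (1 + \<bar>s\<bar>)\<^sup>2"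
    by (intro mult_left_mono) auto
  also have "\<dots> = (1 + \<bar>s\<bar>) ^ (N + 2) * exp (- k * (h * s\<^sup>2))" by (simp only: power_add mult_ac)
  also note e
  finally show "(1 + \<bar>s\<bar>) ^ N * exp (- k * (h * s\<^sup>2)) \<le> c * y ^ (N + 2) * (1 / (1 + s\<^sup>2))"
    using s0(2) by (simp add: field_simps)
qed

definition lattice_weight :: "int \<times> int \<times> int \<Rightarrow> real" where
  "lattice_weight = (\<lambda>(b, c, d). 1 / (1 + (of_int b)\<^sup>2) * (1 / (1 + (of_int c)\<^sup>2) * (1 / (1 + (of_int d)\<^sup>2))))"

lemma summable_on_mult_product:
  fixes f :: "'i \<Rightarrow> real" and g :: "'j \<Rightarrow> real"
  assumes "f summable_on UNIV" "g summable_on UNIV" "\<And>x. f x \<ge> 0" "\<And>x. g x \<ge> 0"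
  shows "(\<lambda>(x, y). f x * g y) summable_on UNIV"
proof -
  have "(\<lambda>(x, y). f x * g y) summable_on (SIGMA x:UNIV. UNIV)"
    by (rule summable_on_SigmaI[where g="\<lambda>x. f x * infsum g UNIV"])
       (use assms in \<open>auto intro!: has_sum_cmult_right has_sum_infsum summable_on_cmult_left\<close>)
  then show ?thesis by simp
qed

lemma summable_lattice_weight: "lattice_weight summable_on J"
proof -
  have "(\<lambda>(b, x :: int \<times> int). 1 / (1 + (real_of_int b)\<^sup>2) * (case x of (c, d) \<Rightarrow> 1 / (1 + (real_of_int c)\<^sup>2) * (1 / (1 + (real_of_int d)\<^sup>2)))) summable_on UNIV"
    by (intro summable_on_mult_product summable_on_int_inverse_square) (auto split: prod.splits)
  moreover have "(\<lambda>(b, x :: int \<times> int). 1 / (1 + (real_of_int b)\<^sup>2) * (case x of (c, d) \<Rightarrow> 1 / (1 + (real_of_int c)\<^sup>2) * (1 / (1 + (real_of_int d)\<^sup>2)))) = lattice_weight"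
    unfolding lattice_weight_def by (auto simp: fun_eq_iff)
  ultimately have "lattice_weight summable_on UNIV" by simp
  then show ?thesis by (rule summable_on_subset_banach) auto
qed

lemma lattice_weight_nonneg: "lattice_weight i \<ge> 0"
  unfolding lattice_weight_def by (auto split: prod.splits)

section \<open>Decaying families\<close>

text \<open>Polynomial families already known to differentiate into \<open>fam_poly A\<close>. This
  lets atoms such as \<open>1 / XM i z\<close> be checked one after another, before stability of the
  whole algebra is available.\<close>

definition fam_diff where
  "fam_diff J S A = {p \<in> fam_poly A. fam_deriv J S p (fam_poly A)}"

lemma fam_deriv_chain:
  fixes \<phi> :: "real \<Rightarrow> real"
  assumes p: "fam_deriv J S p (fam_poly A)"
    and \<phi>: "\<And>i z. i \<in> J \<Longrightarrow> z \<in> S \<Longrightarrow> (\<phi> has_real_derivative h i z) (at (p i z))"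
    and C: "\<And>q. q \<in> fam_poly A \<Longrightarrow> (\<lambda>i z. q i z * h i z) \<in> C"
  shows "fam_deriv J S (\<lambda>i z. \<phi> (p i z)) C"
proof -
  obtain p' where p': "\<And>i z. i \<in> J \<Longrightarrow> z \<in> S \<Longrightarrow> (p i has_derivative p' i z) (at z)"
      "\<And>w. (\<lambda>i z. p' i z w) \<in> fam_poly A"
    using p unfolding fam_deriv_def by blast
  show ?thesis
  proof (rule fam_derivI[where f'="\<lambda>i z w. p' i z w * h i z"])
    fix i z assume "i \<in> J" "z \<in> S"
    then show "((\<lambda>z. \<phi> (p i z)) has_derivative (\<lambda>w. p' i z w * h i z)) (at z)"
      using DERIV_compose_FDERIV[OF \<phi> p'(1)] by blast
  next
    fix w
    show "(\<lambda>i z. p' i z w * h i z) \<in> C" by (rule C[OF p'(2)])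
  qed
qed

lemma fam_diff_const: "(\<lambda>i z. c) \<in> fam_diff J S A"
  unfolding fam_diff_def
  by (auto intro!: fam_poly.const fam_derivI[where f'="\<lambda>i z h. 0"])

lemma fam_diff_add:
  assumes "p \<in> fam_diff J S A" "q \<in> fam_diff J S A"
  shows "(\<lambda>i z. p i z + q i z) \<in> fam_diff J S A"
proof -
  obtain p' where "\<forall>i\<in>J. \<forall>z\<in>S. (p i has_derivative p' i z) (at z)" "\<forall>w. (\<lambda>i z. p' i z w) \<in> fam_poly A"
    using assms(1) unfolding fam_diff_def fam_deriv_def by blast
  moreover obtain q' where "\<forall>i\<in>J. \<forall>z\<in>S. (q i has_derivative q' i z) (at z)" "\<forall>w. (\<lambda>i z. q' i z w) \<in> fam_poly A"
    using assms(2) unfolding fam_diff_def fam_deriv_def by blast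
  ultimately have "fam_deriv J S (\<lambda>i z. p i z + q i z) (fam_poly A)"
    by (intro fam_derivI[where f'="\<lambda>i z h. p' i z h + q' i z h"] fam_poly.add has_derivative_add) auto
  then show ?thesis using assms by (simp add: fam_diff_def fam_poly.add)
qed

lemma fam_diff_mult:
  assumes "p \<in> fam_diff J S A" "q \<in> fam_diff J S A"
  shows "(\<lambda>i z. p i z * q i z) \<in> fam_diff J S A"
proof -
  have pq: "p \<in> fam_poly A" "q \<in> fam_poly A" using assms by (auto simp: fam_diff_def)
  obtain p' where "\<forall>i\<in>J. \<forall>z\<in>S. (p i has_derivative p' i z) (at z)" "\<forall>w. (\<lambda>i z. p' i z w) \<in> fam_poly A"
    using assms(1) unfolding fam_diff_def fam_deriv_def by blast
  moreover obtain q' where "\<forall>i\<in>J. \<forall>z\<in>S. (q i has_derivative q' i z) (at z)" "\<forall>w. (\<lambda>i z. q' i z w) \<in> fam_poly A"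
    using assms(2) unfolding fam_diff_def fam_deriv_def by blast
  ultimately have "fam_deriv J S (\<lambda>i z. p i z * q i z) (fam_poly A)"
    by (intro fam_derivI[where f'="\<lambda>i z h. p i z * q' i z h + p' i z h * q i z"]
        fam_poly.add fam_poly.mult pq has_derivative_mult) auto
  then show ?thesis using pq by (simp add: fam_diff_def fam_poly.mult)
qed

lemma fam_diff_minus:
  assumes "p \<in> fam_diff J S A"
  shows "(\<lambda>i z. - p i z) \<in> fam_diff J S A"
  using fam_diff_mult[OF fam_diff_const[where c="-1"] assms] by simp

lemma fam_diff_subtract:
  assumes "p \<in> fam_diff J S A" "q \<in> fam_diff J S A"
  shows "(\<lambda>i z. p i z - q i z) \<in> fam_diff J S A"
  using fam_diff_add[OF assms(1) fam_diff_minus[OF assms(2)]] by simp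

lemma fam_diff_atom:
  assumes "a \<in> A" "\<And>i z. i \<in> J \<Longrightarrow> z \<in> S \<Longrightarrow> (a i has_derivative f i) (at z)"
    "\<And>w. (\<lambda>i z. f i w) \<in> fam_poly A"
  shows "a \<in> fam_diff J S A"
  unfolding fam_diff_def
  by (auto intro!: fam_poly.atom assms fam_derivI[where f'="\<lambda>i z. f i"])

lemma fam_diff_chain:
  assumes p: "fam_deriv J S p (fam_poly A)" and "(\<lambda>i z. \<phi> (p i z)) \<in> A"
    and \<phi>: "\<And>i z. i \<in> J \<Longrightarrow> z \<in> S \<Longrightarrow> (\<phi> has_real_derivative h i z) (at (p i z))"
    and h: "h \<in> fam_poly A"
  shows "(\<lambda>i z. \<phi> (p i z)) \<in> fam_diff J S A"
proof -
  have "fam_deriv J S (\<lambda>i z. \<phi> (p i z)) (fam_poly A)"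
    by (rule fam_deriv_chain[OF p \<phi>]) (use h in \<open>auto intro: fam_poly.mult\<close>)
  then show ?thesis using assms(2) by (simp add: fam_diff_def fam_poly.atom)
qed

lemma fam_diffD: "p \<in> fam_diff J S A \<Longrightarrow> fam_deriv J S p (fam_poly A)"
  by (simp add: fam_diff_def)

lemma fam_diff_inverse:
  assumes p: "p \<in> fam_diff J S A" and A: "(\<lambda>i z. 1 / p i z) \<in> A"
    and nz: "\<And>i z. i \<in> J \<Longrightarrow> z \<in> S \<Longrightarrow> p i z > 0"
  shows "(\<lambda>i z. 1 / p i z) \<in> fam_diff J S A"
proof (rule fam_diff_chain[OF fam_diffD[OF p] A, where h="\<lambda>i z. - ((1 / p i z) * (1 / p i z))"])
  fix i z assume "i \<in> J" "z \<in> S"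
  then have "p i z \<noteq> 0" using nz by force
  then show "((\<lambda>y. 1 / y) has_real_derivative - ((1 / p i z) * (1 / p i z))) (at (p i z))"
    by (auto intro!: derivative_eq_intros simp: field_simps power2_eq_square)
next
  show "(\<lambda>i z. - ((1 / p i z) * (1 / p i z))) \<in> fam_poly A"
    by (intro fam_poly_minus fam_poly.mult fam_poly.atom A)
qed

lemmas fam_diff_intros = fam_diff_const fam_diff_add fam_diff_mult fam_diff_minus fam_diff_subtract
abbreviation (input) idx1 :: "int \<times> int \<times> int \<Rightarrow> real" where "idx1 i \<equiv> of_int (fst i)"
abbreviation (input) idx2 :: "int \<times> int \<times> int \<Rightarrow> real" where "idx2 i \<equiv> of_int (fst (snd i))"
abbreviation (input) idx3 :: "int \<times> int \<times> int \<Rightarrow> real" where "idx3 i \<equiv> of_int (snd (snd i))"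

text \<open>Expands to y1 y2 + y1 / y2 + y2 / y1 + 1 / (y1 y2). On the product of half-planes this
  single quantity is at least 1 and dominates the heights, their inverses, ratios and product, so
  powers of it measure all atoms.\<close>

definition cusp_height :: "complex \<times> complex \<Rightarrow> real" where
  "cusp_height z = (Im (fst z) + 1 / Im (fst z)) * (Im (snd z) + 1 / Im (snd z))"

text \<open>The factors in the real parts pay for translating the lattice weights by multiples of
  these real parts.\<close>

definition size_weight :: "complex \<times> complex \<Rightarrow> real" where
  "size_weight z = (1 + (Re (fst z))\<^sup>2) * (1 + (Re (snd z))\<^sup>2) * cusp_height z"

lemma add_inverse_ge_1:
  fixes y :: real
  assumes "y > 0"
  shows "y + 1 / y \<ge> 1"
proof (cases "y \<ge> 1")
  case False
  then have "1 / y \<ge> 1" using assms by simp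
  then show ?thesis using assms by linarith
qed (use assms in \<open>simp add: add_increasing2\<close>)

lemma cusp_height_bounds:
  assumes "Im (fst z) > 0" "Im (snd z) > 0"
  shows "cusp_height z \<ge> 1" "Im (fst z) \<le> cusp_height z" "Im (snd z) \<le> cusp_height z"
    "1 / Im (fst z) \<le> cusp_height z" "1 / Im (snd z) \<le> cusp_height z"
    "Im (snd z) / Im (fst z) \<le> cusp_height z" "Im (fst z) / Im (snd z) \<le> cusp_height z"
    "Im (fst z) * Im (snd z) \<le> cusp_height z" "1 / (Im (fst z) * Im (snd z)) \<le> cusp_height z"
proof -
  define a where "a = Im (fst z)"
  define b where "b = Im (snd z)"
  have ab: "a > 0" "b > 0" using assms by (auto simp: a_def b_def)
  have h: "cusp_height z = (a + 1 / a) * (b + 1 / b)" by (simp add: cusp_height_def a_def b_def)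
  have ge: "a + 1 / a \<ge> 1" "b + 1 / b \<ge> 1" using add_inverse_ge_1 ab by auto
  have l: "a + 1 / a \<le> cusp_height z" "b + 1 / b \<le> cusp_height z"
    unfolding h using ge by (auto simp: mult_le_cancel_left1 mult_le_cancel_right1)
  show "cusp_height z \<ge> 1" using l ge by linarith
  show "Im (fst z) \<le> cusp_height z" "1 / Im (fst z) \<le> cusp_height z"
    "Im (snd z) \<le> cusp_height z" "1 / Im (snd z) \<le> cusp_height z"
    using l ab unfolding a_def[symmetric] b_def[symmetric] by (smt (verit) divide_pos_pos)+
  have "cusp_height z = a * b + a / b + (b / a + 1 / (a * b))" unfolding h using ab by (simp add: distrib_left distrib_right add_divide_distrib divide_inverse mult_ac)
  moreover have "a * b \<ge> 0" "a / b \<ge> 0" "b / a \<ge> 0" "1 / (a * b) \<ge> 0" using ab by auto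
  ultimately show "Im (snd z) / Im (fst z) \<le> cusp_height z" "Im (fst z) / Im (snd z) \<le> cusp_height z"
    "Im (fst z) * Im (snd z) \<le> cusp_height z" "1 / (Im (fst z) * Im (snd z)) \<le> cusp_height z"
    unfolding a_def[symmetric] b_def[symmetric] by linarith+
qed

lemma size_weight_ge:
  assumes "Im (fst z) > 0" "Im (snd z) > 0"
  shows "k \<ge> 1 \<Longrightarrow> cusp_height z ^ k * ((1 + (Re (fst z))\<^sup>2) * (1 + (Re (snd z))\<^sup>2)) \<le> size_weight z ^ k"
    and "size_weight z \<ge> 1" "cusp_height z \<le> size_weight z"
proof -
  define q where "q = (1 + (Re (fst z))\<^sup>2) * (1 + (Re (snd z))\<^sup>2)"
  have q: "q \<ge> 1" unfolding q_def using mult_mono[of 1 "1 + (Re (fst z))\<^sup>2" 1 "1 + (Re (snd z))\<^sup>2"] by simp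
  have h: "cusp_height z \<ge> 1" using cusp_height_bounds assms by auto
  show "cusp_height z ^ k * ((1 + (Re (fst z))\<^sup>2) * (1 + (Re (snd z))\<^sup>2)) \<le> size_weight z ^ k" if "k \<ge> 1"
  proof -
    have "q \<le> q ^ k" using q that by (metis power_increasing power_one_right)
    then have "cusp_height z ^ k * q \<le> cusp_height z ^ k * q ^ k" using h by (intro mult_left_mono) auto
    then show ?thesis
      unfolding size_weight_def q_def[symmetric] by (simp add: power_mult_distrib mult.commute)
  qed
  show "cusp_height z \<le> size_weight z" unfolding size_weight_def q_def[symmetric]
    using q h by (simp add: mult_le_cancel_right1)
  then show "size_weight z \<ge> 1" using h by simp
qed

locale boundary_expansion =
  fixes v :: real and m :: int
  assumes v: "v > 0" and m: "m \<noteq> 0"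
begin

text \<open>The factor 2 is what \<open>XM_lower\<close> needs: m then cancels at most half of the
  product (d z1 - b) (d z2 - c).\<close>

definition Om :: "(complex \<times> complex) set" where
  "Om = {z. Im (fst z) > 0 \<and> Im (snd z) > 0 \<and> Im (fst z) * Im (snd z) > 2 * of_int \<bar>m\<bar>}"

lemma open_Om: "open Om"
  unfolding Om_def by (intro open_Collect_conj open_Collect_less continuous_intros)

lemma OmD:
  assumes "z \<in> Om"
  shows "Im (fst z) > 0" "Im (snd z) > 0" "Im (fst z) * Im (snd z) > 2 * of_int \<bar>m\<bar>" "Im (fst z) * Im (snd z) \<ge> 2"
proof -
  show "Im (fst z) > 0" "Im (snd z) > 0" and *: "Im (fst z) * Im (snd z) > 2 * of_int \<bar>m\<bar>" using assms by (auto simp: Om_def)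
  have "real_of_int \<bar>m\<bar> \<ge> 1" using m by linarith
  then show "Im (fst z) * Im (snd z) \<ge> 2" using * by linarith
qed

text \<open>Half of the rate pi v / 4 found for the matrices with nonzero lower right entry, and
  half of the rate pi / v of the Fourier tail. The other halves absorb polynomial factors in the
  index.\<close>

definition decay_rate :: real where
  "decay_rate = min (pi * v / 8) (pi / (2 * v))"

lemma decay_rate_pos: "decay_rate > 0" using v by (simp add: decay_rate_def)

subsection \<open>Matrices with nonzero lower right entry\<close>

text \<open>The index \<open>(b, c, d)\<close> stands for the matrix with second column \<open>(b, d)\<close> and lower left
  entry \<open>c\<close>; its upper left entry is \<open>(m + b * c) div d\<close>.\<close>

definition JM :: "(int \<times> int \<times> int) set" where
  "JM = {(b, c, d). d \<noteq> 0 \<and> d dvd m + b * c}"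

text \<open>With a d - b c = m, d (a - b z2 - c z1 + d z1 z2) = m + (d z1 - b) (d z2 - c). This
  eliminates a. \<open>u1\<close> and \<open>u2\<close> are the real parts of the two factors, whose
  imaginary parts are d y1 and d y2; \<open>Q_re\<close> and \<open>Q_im\<close> below are the real
  and imaginary part of the right side divided by d.\<close>

definition u1 :: "int \<times> int \<times> int \<Rightarrow> complex \<times> complex \<Rightarrow> real" where
  "u1 i z = idx3 i * Re (fst z) - idx1 i"

definition u2 :: "int \<times> int \<times> int \<Rightarrow> complex \<times> complex \<Rightarrow> real" where
  "u2 i z = idx3 i * Re (snd z) - idx2 i"

definition Q_re :: "int \<times> int \<times> int \<Rightarrow> complex \<times> complex \<Rightarrow> real" where
  "Q_re i z = (of_int m + u1 i z * u2 i z - (idx3 i * idx3 i) * (Im (fst z) * Im (snd z))) * (1 / idx3 i)"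

definition Q_im :: "int \<times> int \<times> int \<Rightarrow> complex \<times> complex \<Rightarrow> real" where
  "Q_im i z = u1 i z * Im (snd z) + u2 i z * Im (fst z)"

definition XM :: "int \<times> int \<times> int \<Rightarrow> complex \<times> complex \<Rightarrow> real" where
  "XM i z = (pi * v) * ((Q_re i z * Q_re i z + Q_im i z * Q_im i z) * ((1 / Im (fst z)) * (1 / Im (snd z))))"

text \<open>The entries b and c enter only through \<open>u1\<close> and \<open>u2\<close>, which
  the Gaussian \<open>exM\<close> controls; as atoms of their own they would not be bounded by
  \<open>lenM\<close> independently of the real parts of \<open>z\<close>.\<close>

definition AM :: "(int \<times> int \<times> int \<Rightarrow> complex \<times> complex \<Rightarrow> real) set" where
  "AM = {\<lambda>i z. idx3 i, \<lambda>i z. 1 / idx3 i, u1, u2, \<lambda>i z. Im (fst z), \<lambda>i z. Im (snd z),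
     \<lambda>i z. 1 / Im (fst z), \<lambda>i z. 1 / Im (snd z), \<lambda>i z. 1 / XM i z}"

text \<open>Two generators suffice: the derivative of \<open>nEi\<close> at X is - exp (- X) / X,
  which is also the origin of the atom \<open>1 / XM i z\<close>.\<close>

definition GM :: "(int \<times> int \<times> int \<Rightarrow> complex \<times> complex \<Rightarrow> real) set" where
  "GM = {\<lambda>i z. exp (- XM i z), \<lambda>i z. nEi (XM i z)}"

definition exM :: "int \<times> int \<times> int \<Rightarrow> complex \<times> complex \<Rightarrow> real" where
  "exM i z = exp (- (pi * v / 4) * ((idx3 i)\<^sup>2 * (Im (fst z) * Im (snd z))
     + (Im (snd z) / Im (fst z)) * (u1 i z)\<^sup>2 + (Im (fst z) / Im (snd z)) * (u2 i z)\<^sup>2))"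

lemma JM_idx3: "i \<in> JM \<Longrightarrow> \<bar>idx3 i\<bar> \<ge> 1"
  unfolding JM_def by (auto simp del: of_int_abs simp: of_int_abs[symmetric])

text \<open>For the factors A = d z1 - b and B = d z2 - c, |A B| >= d^2 y1 y2 >= 2 |m|, so |m + A B|
  >= |A B| / 2. The constant lower bound then comes from d^2 >= 1 and y1 y2 >= 2.\<close>

lemma XM_lower:
  assumes i: "i \<in> JM" and z: "z \<in> Om"
  shows "XM i z \<ge> (pi * v / 4) * ((idx3 i)\<^sup>2 * (Im (fst z) * Im (snd z))
     + (Im (snd z) / Im (fst z)) * (u1 i z)\<^sup>2 + (Im (fst z) / Im (snd z)) * (u2 i z)\<^sup>2)"
    and "XM i z \<ge> pi * v / 2"
proof -
  define y1 where "y1 = Im (fst z)"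
  define y2 where "y2 = Im (snd z)"
  define d where "d = idx3 i"
  define p where "p = u1 i z"
  define q where "q = u2 i z"
  have y: "y1 > 0" "y2 > 0" "y1 * y2 > 2 * \<bar>of_int m\<bar>" "y1 * y2 \<ge> 2"
    using OmD[OF z] by (auto simp: y1_def y2_def)
  have d: "\<bar>d\<bar> \<ge> 1" using JM_idx3[OF i] by (simp add: d_def)
  then have d2: "d\<^sup>2 \<ge> 1" "d \<noteq> 0" by (auto simp: abs_le_square_iff[of 1 d, simplified])
  define a where "a = Complex p (d * y1)"
  define b where "b = Complex q (d * y2)"
  have ca: "cmod a \<ge> \<bar>d\<bar> * y1" and cb: "cmod b \<ge> \<bar>d\<bar> * y2"
    using abs_Im_le_cmod[of a] abs_Im_le_cmod[of b] y by (auto simp: a_def b_def abs_mult)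
  have "cmod a * cmod b \<ge> (\<bar>d\<bar> * y1) * (\<bar>d\<bar> * y2)"
    using ca cb y by (intro mult_mono) auto
  moreover have "(\<bar>d\<bar> * y1) * (\<bar>d\<bar> * y2) = d\<^sup>2 * (y1 * y2)"
    by (simp add: power2_eq_square)
  moreover have "d\<^sup>2 * (y1 * y2) \<ge> 1 * (y1 * y2)" using d2 y by (intro mult_right_mono) auto
  ultimately have ab: "cmod a * cmod b \<ge> 2 * \<bar>of_int m\<bar>" using y by linarith
  have "cmod (of_int m + a * b) \<ge> cmod (a * b) - cmod (of_int m)"
    by (metis add.commute norm_diff_ineq)
  then have "cmod (of_int m + a * b) \<ge> cmod a * cmod b / 2" using ab by (simp add: norm_mult)
  then have "(cmod (of_int m + a * b))\<^sup>2 \<ge> (cmod a * cmod b / 2)\<^sup>2" by (intro power_mono) auto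
  then have 1: "(cmod (of_int m + a * b))\<^sup>2 \<ge> (cmod a)\<^sup>2 * (cmod b)\<^sup>2 / 4" by (simp add: power_divide power_mult_distrib)
  have ca2: "(cmod a)\<^sup>2 = p\<^sup>2 + d\<^sup>2 * y1\<^sup>2" and cb2: "(cmod b)\<^sup>2 = q\<^sup>2 + d\<^sup>2 * y2\<^sup>2"
    by (simp_all add: a_def b_def cmod_power2 power_mult_distrib)
  have Qre: "Q_re i z = Re (of_int m + a * b) / d" and Qim: "Q_im i z = Im (of_int m + a * b) / d"
    unfolding Q_re_def Q_im_def a_def b_def using d2
    by (simp_all add: d_def[symmetric] p_def[symmetric] q_def[symmetric] y1_def[symmetric] y2_def[symmetric] field_simps)
  have Q2: "Q_re i z * Q_re i z + Q_im i z * Q_im i z = (cmod (of_int m + a * b))\<^sup>2 / d\<^sup>2"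
    unfolding Qre Qim cmod_power2 by (simp only: power2_eq_square times_divide_times_eq add_divide_distrib)
  \<comment> \<open>In the expanded product the nonnegative term p^2 q^2 is dropped; after division
    by y1 y2 what remains is a diagonal quadratic form in d, p and q.\<close>
  have "(cmod a)\<^sup>2 * (cmod b)\<^sup>2 \<ge> d\<^sup>2 * (d\<^sup>2 * (y1\<^sup>2 * y2\<^sup>2) + p\<^sup>2 * y2\<^sup>2 + q\<^sup>2 * y1\<^sup>2)"
    unfolding ca2 cb2 by (simp add: algebra_simps)
  with 1 have 2: "(cmod (of_int m + a * b))\<^sup>2 \<ge> d\<^sup>2 * (d\<^sup>2 * (y1\<^sup>2 * y2\<^sup>2) + p\<^sup>2 * y2\<^sup>2 + q\<^sup>2 * y1\<^sup>2) / 4" by linarith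
  have 3: "Q_re i z * Q_re i z + Q_im i z * Q_im i z \<ge> (d\<^sup>2 * (y1\<^sup>2 * y2\<^sup>2) + p\<^sup>2 * y2\<^sup>2 + q\<^sup>2 * y1\<^sup>2) / 4"
    unfolding Q2 using 2 d2 by (simp add: field_simps)
  have "XM i z \<ge> (pi * v) * ((d\<^sup>2 * (y1\<^sup>2 * y2\<^sup>2) + p\<^sup>2 * y2\<^sup>2 + q\<^sup>2 * y1\<^sup>2) / 4 * ((1 / y1) * (1 / y2)))"
    unfolding XM_def y1_def[symmetric] y2_def[symmetric]
    using 3 v y by (intro mult_left_mono mult_right_mono) auto
  also have "(pi * v) * ((d\<^sup>2 * (y1\<^sup>2 * y2\<^sup>2) + p\<^sup>2 * y2\<^sup>2 + q\<^sup>2 * y1\<^sup>2) / 4 * ((1 / y1) * (1 / y2)))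
     = (pi * v / 4) * (d\<^sup>2 * (y1 * y2) + (y2 / y1) * p\<^sup>2 + (y1 / y2) * q\<^sup>2)"
    using y by (simp add: field_simps power2_eq_square)
  finally show main: "XM i z \<ge> (pi * v / 4) * ((idx3 i)\<^sup>2 * (Im (fst z) * Im (snd z))
     + (Im (snd z) / Im (fst z)) * (u1 i z)\<^sup>2 + (Im (fst z) / Im (snd z)) * (u2 i z)\<^sup>2)"
    unfolding y1_def y2_def d_def p_def q_def .
  have "1 * 2 \<le> d\<^sup>2 * (y1 * y2)" using d2 y by (intro mult_mono) auto
  then have "2 \<le> d\<^sup>2 * (y1 * y2) + (y2 / y1) * p\<^sup>2 + (y1 / y2) * q\<^sup>2" using y by (intro add_increasing2) auto
  then have "(pi * v / 4) * 2 \<le> (pi * v / 4) * (d\<^sup>2 * (y1 * y2) + (y2 / y1) * p\<^sup>2 + (y1 / y2) * q\<^sup>2)"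
    using v by (intro mult_left_mono) auto
  also note main[folded y1_def y2_def d_def p_def q_def]
  finally show "XM i z \<ge> pi * v / 2" by simp
qed

lemma XM_pos: "i \<in> JM \<Longrightarrow> z \<in> Om \<Longrightarrow> XM i z > 0"
  using XM_lower(2) v by (metis half_gt_zero mult_pos_pos order_less_le_trans pi_gt_zero)

lemma AM_diff:
  shows "(\<lambda>i z. idx3 i) \<in> fam_diff JM Om AM" "(\<lambda>i z. 1 / idx3 i) \<in> fam_diff JM Om AM"
    "u1 \<in> fam_diff JM Om AM" "u2 \<in> fam_diff JM Om AM"
    "(\<lambda>i z. Im (fst z)) \<in> fam_diff JM Om AM" "(\<lambda>i z. Im (snd z)) \<in> fam_diff JM Om AM"
    "(\<lambda>i z. 1 / Im (fst z)) \<in> fam_diff JM Om AM" "(\<lambda>i z. 1 / Im (snd z)) \<in> fam_diff JM Om AM"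
    "XM \<in> fam_diff JM Om AM" "(\<lambda>i z. 1 / XM i z) \<in> fam_diff JM Om AM"
proof -
  have mem: "a \<in> AM \<Longrightarrow> a \<in> fam_poly AM" for a by (rule fam_poly.atom)
  show c1: "(\<lambda>i z. idx3 i) \<in> fam_diff JM Om AM"
    by (rule fam_diff_atom[where f="\<lambda>i h. 0"]) (auto simp: AM_def intro: fam_poly.const)
  show c2: "(\<lambda>i z. 1 / idx3 i) \<in> fam_diff JM Om AM"
    by (rule fam_diff_atom[where f="\<lambda>i h. 0"]) (auto simp: AM_def intro: fam_poly.const)
  have i3: "(\<lambda>i z. idx3 i) \<in> fam_poly AM" by (rule mem) (simp add: AM_def)
  show u1: "u1 \<in> fam_diff JM Om AM"
  proof (rule fam_diff_atom[where f="\<lambda>i h. idx3 i * Re (fst h)"])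
    show "(u1 i has_derivative (\<lambda>h. idx3 i * Re (fst h))) (at z)" for i z
      unfolding u1_def by (auto intro!: derivative_eq_intros)
  qed (auto simp: AM_def intro!: fam_poly.mult fam_poly.const i3[unfolded AM_def])
  show u2: "u2 \<in> fam_diff JM Om AM"
  proof (rule fam_diff_atom[where f="\<lambda>i h. idx3 i * Re (snd h)"])
    show "(u2 i has_derivative (\<lambda>h. idx3 i * Re (snd h))) (at z)" for i z
      unfolding u2_def by (auto intro!: derivative_eq_intros)
  qed (auto simp: AM_def intro!: fam_poly.mult fam_poly.const i3[unfolded AM_def])
  show y1: "(\<lambda>i z. Im (fst z)) \<in> fam_diff JM Om AM"
    by (rule fam_diff_atom[where f="\<lambda>i h. Im (fst h)"])
       (auto simp: AM_def intro!: fam_poly.const derivative_eq_intros)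
  show y2: "(\<lambda>i z. Im (snd z)) \<in> fam_diff JM Om AM"
    by (rule fam_diff_atom[where f="\<lambda>i h. Im (snd h)"])
       (auto simp: AM_def intro!: fam_poly.const derivative_eq_intros)
  show iy1: "(\<lambda>i z. 1 / Im (fst z)) \<in> fam_diff JM Om AM"
    by (rule fam_diff_inverse[OF y1]) (use OmD in \<open>simp_all add: AM_def\<close>)
  show iy2: "(\<lambda>i z. 1 / Im (snd z)) \<in> fam_diff JM Om AM"
    by (rule fam_diff_inverse[OF y2]) (use OmD in \<open>simp_all add: AM_def\<close>)
  show X: "XM \<in> fam_diff JM Om AM"
    unfolding XM_def[abs_def] Q_re_def[abs_def] Q_im_def[abs_def]
    by (intro fam_diff_intros c1 c2 u1 u2 y1 y2 iy1 iy2)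
  show "(\<lambda>i z. 1 / XM i z) \<in> fam_diff JM Om AM"
    by (rule fam_diff_inverse[OF X]) (use XM_pos in \<open>simp_all add: AM_def\<close>)
qed

lemma FM_deriv:
  assumes "f \<in> fam_mod AM GM"
  shows "fam_deriv JM Om f (fam_mod AM GM)"
proof (rule fam_mod_deriv[OF _ _ assms])
  fix a assume "a \<in> AM"
  then have "a \<in> fam_diff JM Om AM" using AM_diff unfolding AM_def by auto
  then show "fam_deriv JM Om a (fam_poly AM)" by (simp add: fam_diff_def)
next
  fix e assume e: "e \<in> GM"
  have X: "fam_deriv JM Om XM (fam_poly AM)" using AM_diff(9) by (simp add: fam_diff_def)
  have g: "(\<lambda>i z. exp (- XM i z)) \<in> fam_mod AM GM" by (rule fam_mod.gen) (simp add: GM_def)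
  have iX: "(\<lambda>i z. 1 / XM i z) \<in> fam_poly AM" using AM_diff(10) by (simp add: fam_diff_def)
  have "fam_deriv JM Om (\<lambda>i z. exp (- XM i z)) (fam_mod AM GM)"
  proof (rule fam_deriv_chain[OF X, where h="\<lambda>i z. (- 1) * exp (- XM i z)"])
    show "((\<lambda>x. exp (- x)) has_real_derivative (- 1) * exp (- XM i z)) (at (XM i z))" for i z
      by (auto intro!: derivative_eq_intros)
    fix q assume "q \<in> fam_poly AM"
    then show "(\<lambda>i z. q i z * ((- 1) * exp (- XM i z))) \<in> fam_mod AM GM"
      by (intro fam_mod.mult fam_poly.const g)
  qed
  moreover have "fam_deriv JM Om (\<lambda>i z. nEi (XM i z)) (fam_mod AM GM)"
  proof (rule fam_deriv_chain[OF X, where h="\<lambda>i z. (- (1 / XM i z)) * exp (- XM i z)"])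
    show "(nEi has_real_derivative (- (1 / XM i z)) * exp (- XM i z)) (at (XM i z))" if "i \<in> JM" "z \<in> Om" for i z
      using nEi_has_derivative[OF XM_pos[OF that]] by simp
    fix q assume "q \<in> fam_poly AM"
    then show "(\<lambda>i z. q i z * ((- (1 / XM i z)) * exp (- XM i z))) \<in> fam_mod AM GM"
      by (intro fam_mod.mult fam_poly_minus iX g)
  qed
  ultimately show "fam_deriv JM Om e (fam_mod AM GM)" using e by (auto simp: GM_def)
qed

definition wt :: "nat \<Rightarrow> complex \<times> complex \<Rightarrow> real" where
  "wt N z = size_weight z ^ N * exp (- decay_rate * (Im (fst z) * Im (snd z)))"

lemma continuous_on_wt: "continuous_on Om (wt N)"
  unfolding wt_def size_weight_def cusp_height_def
  by (intro continuous_intros) (use OmD in force)+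

lemma wt_mono:
  assumes "z \<in> Om" "N \<le> N'"
  shows "wt N z \<le> wt N' z"
  unfolding wt_def using assms size_weight_ge(2) OmD by (intro mult_right_mono power_increasing) auto

lemma wt_nonneg: "z \<in> Om \<Longrightarrow> wt N z \<ge> 0"
  unfolding wt_def using size_weight_ge(2)[of z] OmD[of z] by fastforce

definition lenM :: "int \<times> int \<times> int \<Rightarrow> complex \<times> complex \<Rightarrow> real" where
  "lenM i z = (1 + \<bar>idx3 i\<bar>) * (1 + \<bar>u1 i z\<bar>) * (1 + \<bar>u2 i z\<bar>) * cusp_height z"

lemma lenM_bounds:
  assumes "z \<in> Om"
  shows "lenM i z \<ge> 1" "\<bar>idx3 i\<bar> \<le> lenM i z" "\<bar>u1 i z\<bar> \<le> lenM i z" "\<bar>u2 i z\<bar> \<le> lenM i z" "cusp_height z \<le> lenM i z"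
proof -
  define a b c h where "a = 1 + \<bar>idx3 i\<bar>" and "b = 1 + \<bar>u1 i z\<bar>" and "c = 1 + \<bar>u2 i z\<bar>" and "h = cusp_height z"
  have ge: "a \<ge> 1" "b \<ge> 1" "c \<ge> 1" "h \<ge> 1"
    using cusp_height_bounds(1)[of z] OmD[OF assms] by (auto simp: a_def b_def c_def h_def)
  have L: "lenM i z = a * b * c * h" by (simp add: lenM_def a_def b_def c_def h_def)
  have p: "a * b \<ge> a" "a * b \<ge> b" "a * b * c \<ge> a * b" "a * b * c \<ge> c" "a * b * c * h \<ge> a * b * c" "a * b * c * h \<ge> h"
  proof -
    have *: "x * y \<ge> x" "x * y \<ge> y" "x * y \<ge> 1" if "x \<ge> 1" "y \<ge> 1" for x y :: real
      using mult_left_mono[of 1 y x] mult_right_mono[of 1 x y] mult_mono[of 1 x 1 y] that by auto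
    show "a * b \<ge> a" "a * b \<ge> b" "a * b * c \<ge> a * b" "a * b * c \<ge> c" "a * b * c * h \<ge> a * b * c" "a * b * c * h \<ge> h"
      using * ge by auto
  qed
  show "lenM i z \<ge> 1" "\<bar>idx3 i\<bar> \<le> lenM i z" "\<bar>u1 i z\<bar> \<le> lenM i z" "\<bar>u2 i z\<bar> \<le> lenM i z" "cusp_height z \<le> lenM i z"
    unfolding L using p ge a_def b_def c_def h_def by linarith+
qed

lemma AM_bound:
  assumes "a \<in> AM"
  shows "\<exists>c\<ge>0. \<exists>N. \<forall>i\<in>JM. \<forall>z\<in>Om. \<bar>a i z\<bar> \<le> c * lenM i z ^ N"
proof -
  have one: "\<exists>c\<ge>0. \<exists>N. \<forall>i\<in>JM. \<forall>z\<in>Om. \<bar>a i z\<bar> \<le> c * lenM i z ^ N"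
    if "\<And>i z. i \<in> JM \<Longrightarrow> z \<in> Om \<Longrightarrow> \<bar>a i z\<bar> \<le> lenM i z" for a
    using that by (intro exI[of _ 1] conjI exI[of _ "1::nat"]) auto
  have h: "cusp_height z \<le> lenM i z" "0 < Im (fst z)" "0 < Im (snd z)" if "z \<in> Om" for i z
    using lenM_bounds(5) OmD that by auto
  consider "a = (\<lambda>i z. idx3 i)" | "a = (\<lambda>i z. 1 / idx3 i)" | "a = u1" | "a = u2" | "a = (\<lambda>i z. Im (fst z))"
    | "a = (\<lambda>i z. Im (snd z))" | "a = (\<lambda>i z. 1 / Im (fst z))" | "a = (\<lambda>i z. 1 / Im (snd z))" | "a = (\<lambda>i z. 1 / XM i z)"
    using assms unfolding AM_def by blast
  then show ?thesis
  proof cases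
    case 1
    then show ?thesis using lenM_bounds by (intro one) simp
  next
    case 2
    show ?thesis
    proof (rule one)
      fix i z assume i: "i \<in> JM" "z \<in> Om"
      have "\<bar>1 / idx3 i\<bar> \<le> 1" using JM_idx3[OF i(1)] by (simp add: divide_le_eq)
      then show "\<bar>a i z\<bar> \<le> lenM i z" using lenM_bounds(1)[OF i(2), of i] 2 by simp
    qed
  next
    case 3
    then show ?thesis using lenM_bounds by (intro one) simp
  next
    case 4
    then show ?thesis using lenM_bounds by (intro one) simp
  next
    case 5
    show ?thesis using h cusp_height_bounds(2) unfolding 5 by (intro one) (metis abs_of_pos order_trans)
  next
    case 6
    show ?thesis using h cusp_height_bounds(3) unfolding 6 by (intro one) (metis abs_of_pos order_trans)
  next
    case 7
    show ?thesis using h cusp_height_bounds(4) unfolding 7 by (intro one) (metis abs_of_pos order_trans zero_less_divide_1_iff)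
  next
    case 8
    show ?thesis using h cusp_height_bounds(5) unfolding 8 by (intro one) (metis abs_of_pos order_trans zero_less_divide_1_iff)
  next
    case 9
    have "\<bar>1 / XM i z\<bar> \<le> 2 / (pi * v)" if "i \<in> JM" "z \<in> Om" for i z
    proof -
      have "1 / XM i z \<le> 1 / (pi * v / 2)"
        using XM_lower(2)[OF that] XM_pos[OF that] v by (intro divide_left_mono) auto
      then show ?thesis using XM_pos[OF that] by simp
    qed
    then show ?thesis unfolding 9 using v by (intro exI[of _ "2 / (pi * v)"] conjI exI[of _ 0]) auto
  qed
qed

lemma GM_bound:
  assumes "e \<in> GM"
  shows "\<exists>c\<ge>0. \<forall>i\<in>JM. \<forall>z\<in>Om. \<bar>e i z\<bar> \<le> c * exM i z"
proof -
  have ex: "exp (- XM i z) \<le> exM i z" if "i \<in> JM" "z \<in> Om" for i z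
    unfolding exM_def using XM_lower(1)[OF that] by simp
  have "\<bar>nEi (XM i z)\<bar> \<le> 2 / (pi * v) * exM i z" if "i \<in> JM" "z \<in> Om" for i z
  proof -
    have "\<bar>nEi (XM i z)\<bar> \<le> 1 / XM i z * exp (- XM i z)"
      using nEi_le[OF XM_pos[OF that]] nEi_nonneg by simp
    also have "\<dots> \<le> 1 / (pi * v / 2) * exM i z"
      using XM_lower(2)[OF that] XM_pos[OF that] v ex[OF that] by (intro mult_mono divide_left_mono) auto
    finally show ?thesis by simp
  qed
  then have "\<exists>c\<ge>0. \<forall>i\<in>JM. \<forall>z\<in>Om. \<bar>nEi (XM i z)\<bar> \<le> c * exM i z"
    using v by (intro exI[of _ "2 / (pi * v)"]) auto
  moreover have "\<exists>c\<ge>0. \<forall>i\<in>JM. \<forall>z\<in>Om. \<bar>exp (- XM i z)\<bar> \<le> c * exM i z"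
    using ex by (intro exI[of _ 1]) auto
  ultimately show ?thesis using assms unfolding GM_def by fastforce
qed

lemma shifted_weight_le:
  fixes b d x :: real
  shows "1 / (1 + (d * x - b)\<^sup>2) \<le> 2 * (1 + d\<^sup>2) * (1 + x\<^sup>2) * (1 / (1 + b\<^sup>2))"
proof -
  have "(d * x - b)\<^sup>2 = (b - d * x)\<^sup>2" by (simp add: power2_commute)
  then have "1 / (1 + (d * x - b)\<^sup>2) \<le> 2 * (1 + (d * x)\<^sup>2) * (1 / (1 + b\<^sup>2))"
    using inverse_square_shift_le[of b "d * x"] by simp
  also have "1 + (d * x)\<^sup>2 \<le> (1 + d\<^sup>2) * (1 + x\<^sup>2)" by (simp add: power_mult_distrib algebra_simps)
  then have "2 * (1 + (d * x)\<^sup>2) * (1 / (1 + b\<^sup>2)) \<le> 2 * ((1 + d\<^sup>2) * (1 + x\<^sup>2)) * (1 / (1 + b\<^sup>2))"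
    by (intro mult_right_mono mult_left_mono) auto
  finally show ?thesis by (simp only: mult.assoc)
qed

text \<open>\<open>exM\<close> splits into Gaussians in d, \<open>u1\<close> and \<open>u2\<close>.
  Those in \<open>u1\<close> and \<open>u2\<close> yield the weights in b and c, each at the cost of
  a factor 1 + d^2 from the translation; the Gaussian in d pays for both, hence
  \<open>N + 4\<close>, and half of its exponent survives as decay in y1 y2. The powers of
  \<open>cusp_height\<close> add up to (N + 2) + (N + 2) + N = 3 N + 4.\<close>

lemma lenM_exM_bound:
  obtains c where "c \<ge> 0"
    "\<And>i z. i \<in> JM \<Longrightarrow> z \<in> Om \<Longrightarrow> lenM i z ^ N * exM i z \<le> c * wt (3 * N + 4) z * lattice_weight i"
proof -
  define k where "k = pi * v / 4"
  have k: "k > 0" "k / 2 > 0" using v by (auto simp: k_def)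
  obtain c1 where c1: "c1 \<ge> 0" "\<And>s h y :: real. h > 0 \<Longrightarrow> 1 \<le> y \<Longrightarrow> 1 / h \<le> y \<Longrightarrow>
    (1 + \<bar>s\<bar>) ^ (N + 4) * exp (- (k / 2) * (h * s\<^sup>2)) \<le> c1 * y ^ (N + 4 + 2) * (1 / (1 + s\<^sup>2))"
    using power_gaussian_le[OF k(2)] by metis
  obtain c2 where c2: "c2 \<ge> 0" "\<And>s h y :: real. h > 0 \<Longrightarrow> 1 \<le> y \<Longrightarrow> 1 / h \<le> y \<Longrightarrow>
    (1 + \<bar>s\<bar>) ^ N * exp (- k * (h * s\<^sup>2)) \<le> c2 * y ^ (N + 2) * (1 / (1 + s\<^sup>2))"
    using power_gaussian_le[OF k(1)] by metis
  show ?thesis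
  proof (rule that[of "c1 * c2 * c2 * 4"])
    show "c1 * c2 * c2 * 4 \<ge> 0" using c1(1) c2(1) by simp
    fix i z assume i: "i \<in> JM" and z: "z \<in> Om"
    define y1 y2 x1 x2 where "y1 = Im (fst z)" and "y2 = Im (snd z)" and "x1 = Re (fst z)" and "x2 = Re (snd z)"
    define b c d where "b = idx1 i" and "c = idx2 i" and "d = idx3 i"
    define p q Y T where "p = u1 i z" and "q = u2 i z" and "Y = cusp_height z" and "T = y1 * y2"
    have y: "y1 > 0" "y2 > 0" "T \<ge> 2" using OmD[OF z] by (auto simp: y1_def y2_def T_def)
    have Y: "Y \<ge> 1" "y2 / y1 \<le> Y" "y1 / y2 \<le> Y"
      using cusp_height_bounds[of z] y unfolding Y_def y1_def y2_def by auto
    have d: "1 \<le> d\<^sup>2" using JM_idx3[OF i] by (simp add: d_def abs_le_square_iff[of 1 "idx3 i", simplified])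
    have E: "exM i z = exp (- k * (d\<^sup>2 * T)) * exp (- k * (y2 / y1 * p\<^sup>2)) * exp (- k * (y1 / y2 * q\<^sup>2))"
      unfolding exM_def k_def[symmetric] exp_add[symmetric] p_def q_def d_def T_def y1_def y2_def
      by (simp only: distrib_left)
    have ep: "(1 + \<bar>p\<bar>) ^ N * exp (- k * (y2 / y1 * p\<^sup>2)) \<le> c2 * Y ^ (N + 2) * (2 * (1 + d\<^sup>2) * (1 + x1\<^sup>2) * (1 / (1 + b\<^sup>2)))"
    proof -
      have "(1 + \<bar>p\<bar>) ^ N * exp (- k * (y2 / y1 * p\<^sup>2)) \<le> c2 * Y ^ (N + 2) * (1 / (1 + p\<^sup>2))"
        by (rule c2(2)) (use y Y in auto)
      also have "\<dots> \<le> c2 * Y ^ (N + 2) * (2 * (1 + d\<^sup>2) * (1 + x1\<^sup>2) * (1 / (1 + b\<^sup>2)))"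
        using c2(1) Y unfolding p_def u1_def d_def b_def x1_def by (intro mult_left_mono shifted_weight_le) auto
      finally show ?thesis .
    qed
    have eq: "(1 + \<bar>q\<bar>) ^ N * exp (- k * (y1 / y2 * q\<^sup>2)) \<le> c2 * Y ^ (N + 2) * (2 * (1 + d\<^sup>2) * (1 + x2\<^sup>2) * (1 / (1 + c\<^sup>2)))"
    proof -
      have "(1 + \<bar>q\<bar>) ^ N * exp (- k * (y1 / y2 * q\<^sup>2)) \<le> c2 * Y ^ (N + 2) * (1 / (1 + q\<^sup>2))"
        by (rule c2(2)) (use y Y in auto)
      also have "\<dots> \<le> c2 * Y ^ (N + 2) * (2 * (1 + d\<^sup>2) * (1 + x2\<^sup>2) * (1 / (1 + c\<^sup>2)))"
        using c2(1) Y unfolding q_def u2_def d_def c_def x2_def by (intro mult_left_mono shifted_weight_le) auto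
      finally show ?thesis .
    qed
    have ed: "(1 + \<bar>d\<bar>) ^ N * (1 + d\<^sup>2)\<^sup>2 * exp (- k * (d\<^sup>2 * T)) \<le> exp (- (k / 2) * T) * (c1 * (1 / (1 + d\<^sup>2)))"
    proof -
      \<comment> \<open>Since d^2 and T are at least 1, T + d^2 <= 2 d^2 T. This divides the
        exponent between decay in T and summability in d.\<close>
      have "T \<le> d\<^sup>2 * T" "d\<^sup>2 \<le> d\<^sup>2 * T" using d y by (auto simp: mult_le_cancel_left1 mult_le_cancel_right1)
      then have "k / 2 * (T + 1 * d\<^sup>2) \<le> k / 2 * (2 * (d\<^sup>2 * T))" using k by (intro mult_left_mono) auto
      then have "exp (- k * (d\<^sup>2 * T)) \<le> exp (- (k / 2) * T) * exp (- (k / 2) * (1 * d\<^sup>2))"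
        by (simp add: exp_add[symmetric] algebra_simps)
      moreover have "(1 + d\<^sup>2)\<^sup>2 \<le> (1 + \<bar>d\<bar>) ^ 4"
      proof -
        have "1 + d\<^sup>2 \<le> (1 + \<bar>d\<bar>)\<^sup>2" by (simp add: power2_eq_square algebra_simps abs_mult_self_eq)
        then have "(1 + d\<^sup>2)\<^sup>2 \<le> ((1 + \<bar>d\<bar>)\<^sup>2)\<^sup>2" by (intro power_mono) auto
        then show ?thesis by (simp add: power_mult[symmetric])
      qed
      ultimately have "(1 + \<bar>d\<bar>) ^ N * (1 + d\<^sup>2)\<^sup>2 * exp (- k * (d\<^sup>2 * T))
        \<le> (1 + \<bar>d\<bar>) ^ N * (1 + \<bar>d\<bar>) ^ 4 * (exp (- (k / 2) * T) * exp (- (k / 2) * (1 * d\<^sup>2)))"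
        by (intro mult_mono mult_left_mono) auto
      also have "\<dots> = exp (- (k / 2) * T) * ((1 + \<bar>d\<bar>) ^ (N + 4) * exp (- (k / 2) * (1 * d\<^sup>2)))"
        by (simp only: power_add mult_ac)
      also have "\<dots> \<le> exp (- (k / 2) * T) * (c1 * 1 ^ (N + 4 + 2) * (1 / (1 + d\<^sup>2)))"
        by (intro mult_left_mono c1(2)) auto
      finally show ?thesis by simp
    qed
    have "lenM i z ^ N * exM i z = ((1 + \<bar>d\<bar>) ^ N * exp (- k * (d\<^sup>2 * T))) *
       ((1 + \<bar>p\<bar>) ^ N * exp (- k * (y2 / y1 * p\<^sup>2))) * ((1 + \<bar>q\<bar>) ^ N * exp (- k * (y1 / y2 * q\<^sup>2))) * Y ^ N"
      unfolding lenM_def E d_def[symmetric] p_def[symmetric] q_def[symmetric] Y_def[symmetric] power_mult_distrib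
      by (simp only: mult_ac)
    also have "\<dots> \<le> ((1 + \<bar>d\<bar>) ^ N * exp (- k * (d\<^sup>2 * T))) *
       (c2 * Y ^ (N + 2) * (2 * (1 + d\<^sup>2) * (1 + x1\<^sup>2) * (1 / (1 + b\<^sup>2)))) *
       (c2 * Y ^ (N + 2) * (2 * (1 + d\<^sup>2) * (1 + x2\<^sup>2) * (1 / (1 + c\<^sup>2)))) * Y ^ N"
      using Y c2(1) by (intro mult_right_mono mult_mono ep eq) auto
    also have "\<dots> = ((1 + \<bar>d\<bar>) ^ N * (1 + d\<^sup>2)\<^sup>2 * exp (- k * (d\<^sup>2 * T))) *
       (c2 * c2 * 4 * (Y ^ (N + 2) * Y ^ (N + 2) * Y ^ N) * ((1 + x1\<^sup>2) * (1 + x2\<^sup>2)) * (1 / (1 + b\<^sup>2) * (1 / (1 + c\<^sup>2))))"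
    proof -
      have "(P * e) * (C * Z * (2 * A * X1 * B')) * (C * Z * (2 * A * X2 * C')) * Z'
        = (P * A\<^sup>2 * e) * (C * C * 4 * (Z * Z * Z') * (X1 * X2) * (B' * C'))"
        for P e C Z A X1 B' X2 C' Z' :: real by (simp add: power2_eq_square)
      then show ?thesis .
    qed
    also have "\<dots> \<le> (exp (- (k / 2) * T) * (c1 * (1 / (1 + d\<^sup>2)))) *
       (c2 * c2 * 4 * (Y ^ (N + 2) * Y ^ (N + 2) * Y ^ N) * ((1 + x1\<^sup>2) * (1 + x2\<^sup>2)) * (1 / (1 + b\<^sup>2) * (1 / (1 + c\<^sup>2))))"
      using Y c2(1) by (intro mult_right_mono ed) auto
    also have "\<dots> = (c1 * c2 * c2 * 4) * (Y ^ (3 * N + 4) * ((1 + x1\<^sup>2) * (1 + x2\<^sup>2))) * exp (- (k / 2) * T) * lattice_weight i"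
    proof -
      have "3 * N + 4 = (N + 2) + (N + 2) + N" by simp
      then have "Y ^ (N + 2) * Y ^ (N + 2) * Y ^ N = Y ^ (3 * N + 4)" by (simp only: power_add)
      moreover have "lattice_weight i = 1 / (1 + b\<^sup>2) * (1 / (1 + c\<^sup>2) * (1 / (1 + d\<^sup>2)))"
        unfolding lattice_weight_def b_def c_def d_def by (simp add: case_prod_unfold)
      ultimately show ?thesis by (simp only: mult_ac)
    qed
    also have "\<dots> \<le> (c1 * c2 * c2 * 4) * size_weight z ^ (3 * N + 4) * exp (- decay_rate * T) * lattice_weight i"
    proof -
      have "decay_rate \<le> k / 2" by (simp add: decay_rate_def k_def)
      then have "exp (- (k / 2) * T) \<le> exp (- decay_rate * T)" using y by (simp add: mult_right_mono)
      moreover have "Y ^ (3 * N + 4) * ((1 + x1\<^sup>2) * (1 + x2\<^sup>2)) \<le> size_weight z ^ (3 * N + 4)"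
        unfolding Y_def x1_def x2_def by (rule size_weight_ge) (use OmD[OF z] in auto)
      ultimately show ?thesis
        using c1(1) c2(1) Y lattice_weight_nonneg size_weight_ge(2)[of z] OmD[OF z]
        by (intro mult_right_mono mult_mono mult_left_mono) auto
    qed
    finally show "lenM i z ^ N * exM i z \<le> c1 * c2 * c2 * 4 * wt (3 * N + 4) z * lattice_weight i"
      unfolding wt_def T_def y1_def y2_def by (simp only: mult_ac)
  qed
qed

lemma FM_bound:
  assumes "f \<in> fam_mod AM GM"
  shows "\<exists>c\<ge>0. \<exists>N. \<forall>i\<in>JM. \<forall>z\<in>Om. \<bar>f i z\<bar> \<le> (c * wt N z) * lattice_weight i"
proof -
  obtain c N where c: "c \<ge> 0" "\<And>i z. i \<in> JM \<Longrightarrow> z \<in> Om \<Longrightarrow> \<bar>f i z\<bar> \<le> c * (lenM i z ^ N * exM i z)"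
    using fam_mod_bound[OF AM_bound lenM_bounds(1) GM_bound _ assms] by (auto simp: exM_def)
  obtain c' where c': "c' \<ge> 0" "\<And>i z. i \<in> JM \<Longrightarrow> z \<in> Om \<Longrightarrow> lenM i z ^ N * exM i z \<le> c' * wt (3 * N + 4) z * lattice_weight i"
    using lenM_exM_bound by metis
  have "\<bar>f i z\<bar> \<le> (c * c' * wt (3 * N + 4) z) * lattice_weight i" if "i \<in> JM" "z \<in> Om" for i z
    using order_trans[OF c(2)[OF that] mult_left_mono[OF c'(2)[OF that] c(1)]] by (simp only: mult.assoc)
  then show ?thesis using c(1) c'(1) by (intro exI[of _ "c * c'"] conjI exI[of _ "3 * N + 4"]) auto
qed

definition CM :: "(complex \<times> complex \<Rightarrow> real) set" where
  "CM = {\<lambda>z. \<Sum>\<^sub>\<infinity>i\<in>JM. f i z | f. f \<in> fam_mod AM GM}"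

lemma closed_class_CM: "closed_class CM Om"
  unfolding CM_def
proof (rule fam_sum_closed_class[OF open_Om FM_deriv _ summable_lattice_weight lattice_weight_nonneg])
  fix f assume "f \<in> fam_mod AM GM"
  then obtain c N where "\<forall>i\<in>JM. \<forall>z\<in>Om. \<bar>f i z\<bar> \<le> (c * wt N z) * lattice_weight i"
    using FM_bound by blast
  then show "\<exists>H. continuous_on Om H \<and> (\<forall>i\<in>JM. \<forall>z\<in>Om. \<bar>f i z\<bar> \<le> H z * lattice_weight i)"
    by (intro exI[of _ "\<lambda>z. c * wt N z"] conjI continuous_intros continuous_on_wt)
qed

lemma lattice_infsum_bound:
  assumes "c \<ge> 0" "\<forall>i\<in>J. \<forall>z\<in>Om. \<bar>f i z\<bar> \<le> (c * wt N z) * lattice_weight i"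
  shows "\<exists>c\<ge>0. \<exists>N. \<forall>z\<in>Om. \<bar>\<Sum>\<^sub>\<infinity>i\<in>J. f i z\<bar> \<le> c * wt N z"
proof (intro exI[of _ "c * infsum lattice_weight J"] conjI exI[of _ N] ballI)
  show "0 \<le> c * infsum lattice_weight J" using assms(1) by (simp add: infsum_nonneg lattice_weight_nonneg)
  fix z assume z: "z \<in> Om"
  have "\<bar>\<Sum>\<^sub>\<infinity>i\<in>J. f i z\<bar> \<le> (\<Sum>\<^sub>\<infinity>i\<in>J. (c * wt N z) * lattice_weight i)"
    by (rule abs_infsum_le) (use assms(2) z in \<open>auto intro!: summable_on_cmult_right summable_lattice_weight\<close>)
  also have "\<dots> = c * infsum lattice_weight J * wt N z"
    by (subst infsum_cmult_right') (simp add: mult_ac)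
  finally show "\<bar>\<Sum>\<^sub>\<infinity>i\<in>J. f i z\<bar> \<le> c * infsum lattice_weight J * wt N z" .
qed

lemma CM_bound:
  assumes "g \<in> CM"
  shows "\<exists>c\<ge>0. \<exists>N. \<forall>z\<in>Om. \<bar>g z\<bar> \<le> c * wt N z"
proof -
  obtain f where f: "f \<in> fam_mod AM GM" "g = (\<lambda>z. \<Sum>\<^sub>\<infinity>i\<in>JM. f i z)" using assms unfolding CM_def by blast
  then show ?thesis using FM_bound[OF f(1)] lattice_infsum_bound by blast
qed

definition matrix_sum :: "complex \<times> complex \<Rightarrow> real" where
  "matrix_sum z = (\<Sum>\<^sub>\<infinity>i\<in>JM. nEi (XM i z))"

lemma matrix_sum_in_CM: "matrix_sum \<in> CM"
proof -
  have "(\<lambda>i z. nEi (XM i z)) \<in> fam_mod AM GM" by (rule fam_mod.gen) (simp add: GM_def)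
  then show ?thesis unfolding CM_def matrix_sum_def[abs_def] mem_Collect_eq
    by (intro exI[of _ "\<lambda>i z. nEi (XM i z)"] conjI refl)
qed

lemma summable_matrix_sum:
  assumes "z \<in> Om"
  shows "(\<lambda>i. nEi (XM i z)) summable_on JM"
proof -
  have "(\<lambda>i z. nEi (XM i z)) \<in> fam_mod AM GM" by (rule fam_mod.gen) (simp add: GM_def)
  then obtain c N where "\<forall>i\<in>JM. \<forall>z\<in>Om. \<bar>nEi (XM i z)\<bar> \<le> (c * wt N z) * lattice_weight i"
    using FM_bound by blast
  then show ?thesis using assms
    by (intro abs_summable_comparison[OF summable_on_cmult_right[OF summable_lattice_weight, of "c * wt N z"]]) auto
qed

subsection \<open>The tail of the Poisson sums\<close>

text \<open>The index \<open>(b, c, n)\<close> stands for the \<open>n\<close>-th Fourier mode of the sum over the matrices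
  with off-diagonal entries \<open>b\<close>, \<open>c\<close> and lower right entry \<open>0\<close>.\<close>

definition JT :: "(int \<times> int \<times> int) set" where
  "JT = {(b, c, n). - b * c = m \<and> n \<ge> 1}"

definition om :: "int \<times> int \<times> int \<Rightarrow> complex \<times> complex \<Rightarrow> real" where
  "om i z = idx1 i * Im (snd z) + idx2 i * Im (fst z)"

definition phase :: "int \<times> int \<times> int \<Rightarrow> complex \<times> complex \<Rightarrow> real" where
  "phase i z = 2 * pi * idx3 i * (idx1 i * Re (snd z) + idx2 i * Re (fst z))"

definition erf_arg :: "real \<Rightarrow> int \<times> int \<times> int \<Rightarrow> complex \<times> complex \<Rightarrow> real" where
  "erf_arg \<sigma> i z = (sqrt pi / sqrt v) * (idx3 i * tpar z) + (\<sigma> * (sqrt pi * sqrt v)) * (om i z * (1 / tpar z))"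

text \<open>The two summands of \<open>tail_term\<close>, for \<sigma> = 1 and \<sigma> = -1, up to
  the common denominator. Exponential and \<open>erfcI\<close> form one generator because the
  exponential alone may grow. Differentiating the \<open>erfcI\<close> factor gives a multiple of
  \<open>gT\<close> for both signs (\<open>eT_exponent\<close>), so these three generators are
  closed under differentiation.\<close>

definition eT :: "real \<Rightarrow> int \<times> int \<times> int \<Rightarrow> complex \<times> complex \<Rightarrow> real" where
  "eT \<sigma> i z = exp ((\<sigma> * (2 * pi)) * (idx3 i * om i z)) * erfcI (erf_arg \<sigma> i z)"

definition gT :: "int \<times> int \<times> int \<Rightarrow> complex \<times> complex \<Rightarrow> real" where
  "gT i z = exp (- ((pi / v) * ((idx3 i * idx3 i) * (Im (fst z) * Im (snd z)))
      + (pi * v) * ((om i z * om i z) * ((1 / Im (fst z)) * (1 / Im (snd z))))))"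

text \<open>In contrast to \<open>AM\<close>, the entries b and c may be atoms here: they divide m
  and are therefore bounded.\<close>

definition AT :: "(int \<times> int \<times> int \<Rightarrow> complex \<times> complex \<Rightarrow> real) set" where
  "AT = {\<lambda>i z. idx1 i, \<lambda>i z. idx2 i, \<lambda>i z. idx3 i, \<lambda>i z. 1 / idx3 i,
     \<lambda>i z. Im (fst z), \<lambda>i z. Im (snd z), \<lambda>i z. 1 / Im (fst z), \<lambda>i z. 1 / Im (snd z),
     \<lambda>i z. tpar z, \<lambda>i z. 1 / tpar z, \<lambda>i z. cos (phase i z), \<lambda>i z. sin (phase i z)}"

definition GT :: "(int \<times> int \<times> int \<Rightarrow> complex \<times> complex \<Rightarrow> real) set" where
  "GT = {eT 1, eT (- 1), gT}"

lemma tpar_bounds: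
  assumes "z \<in> Om"
  shows "tpar z \<ge> 1" "tpar z \<le> cusp_height z" "(tpar z)\<^sup>2 = Im (fst z) * Im (snd z)"
proof -
  define p where "p = Im (fst z) * Im (snd z)"
  have p: "p \<ge> 2" using OmD[OF assms] by (simp add: p_def)
  show "tpar z \<ge> 1" "(tpar z)\<^sup>2 = Im (fst z) * Im (snd z)" using p unfolding tpar_def p_def[symmetric] by auto
  have "p \<le> p\<^sup>2" using p by (simp add: power2_eq_square)
  then have "sqrt p \<le> p" using p by (intro real_le_lsqrt) auto
  also have "p \<le> cusp_height z" unfolding p_def using cusp_height_bounds(8) OmD[OF assms] by auto
  finally show "tpar z \<le> cusp_height z" by (simp add: tpar_def p_def)
qed

lemma AT_diff:
  shows "(\<lambda>i z. idx1 i) \<in> fam_diff JT Om AT" "(\<lambda>i z. idx2 i) \<in> fam_diff JT Om AT"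
    "(\<lambda>i z. idx3 i) \<in> fam_diff JT Om AT" "(\<lambda>i z. 1 / idx3 i) \<in> fam_diff JT Om AT"
    "(\<lambda>i z. Im (fst z)) \<in> fam_diff JT Om AT" "(\<lambda>i z. Im (snd z)) \<in> fam_diff JT Om AT"
    "(\<lambda>i z. 1 / Im (fst z)) \<in> fam_diff JT Om AT" "(\<lambda>i z. 1 / Im (snd z)) \<in> fam_diff JT Om AT"
    "(\<lambda>i z. tpar z) \<in> fam_diff JT Om AT" "(\<lambda>i z. 1 / tpar z) \<in> fam_diff JT Om AT"
    "(\<lambda>i z. cos (phase i z)) \<in> fam_diff JT Om AT" "(\<lambda>i z. sin (phase i z)) \<in> fam_diff JT Om AT"
    "om \<in> fam_diff JT Om AT" "erf_arg \<sigma> \<in> fam_diff JT Om AT"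
proof -
  have cst: "(\<lambda>i z. k i) \<in> AT \<Longrightarrow> (\<lambda>i z. k i) \<in> fam_diff JT Om AT" for k
    by (rule fam_diff_atom[where f="\<lambda>i h. 0"]) (auto intro: fam_poly.const)
  show c1: "(\<lambda>i z. idx1 i) \<in> fam_diff JT Om AT" by (rule cst) (simp add: AT_def)
  show c2: "(\<lambda>i z. idx2 i) \<in> fam_diff JT Om AT" by (rule cst) (simp add: AT_def)
  show c3: "(\<lambda>i z. idx3 i) \<in> fam_diff JT Om AT" by (rule cst) (simp add: AT_def)
  show c4: "(\<lambda>i z. 1 / idx3 i) \<in> fam_diff JT Om AT" by (rule cst) (simp add: AT_def)
  show y1: "(\<lambda>i z. Im (fst z)) \<in> fam_diff JT Om AT"
    by (rule fam_diff_atom[where f="\<lambda>i h. Im (fst h)"])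
       (auto simp: AT_def intro!: fam_poly.const derivative_eq_intros)
  show y2: "(\<lambda>i z. Im (snd z)) \<in> fam_diff JT Om AT"
    by (rule fam_diff_atom[where f="\<lambda>i h. Im (snd h)"])
       (auto simp: AT_def intro!: fam_poly.const derivative_eq_intros)
  show iy1: "(\<lambda>i z. 1 / Im (fst z)) \<in> fam_diff JT Om AT"
    by (rule fam_diff_inverse[OF y1]) (use OmD in \<open>simp_all add: AT_def\<close>)
  show iy2: "(\<lambda>i z. 1 / Im (snd z)) \<in> fam_diff JT Om AT"
    by (rule fam_diff_inverse[OF y2]) (use OmD in \<open>simp_all add: AT_def\<close>)
  have it: "(\<lambda>i z. 1 / tpar z) \<in> fam_poly AT" by (rule fam_poly.atom) (simp add: AT_def)
  show t: "(\<lambda>i z. tpar z) \<in> fam_diff JT Om AT"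
    unfolding tpar_def
  proof (rule fam_diff_chain[OF fam_diffD[OF fam_diff_mult[OF y1 y2]], where h="\<lambda>i z. 1 / 2 * (1 / tpar z)"])
    fix i z assume "z \<in> Om"
    then have "Im (fst z) * Im (snd z) > 0" using OmD[of z] by auto
    then show "(sqrt has_real_derivative 1 / 2 * (1 / tpar z)) (at (Im (fst z) * Im (snd z)))"
      unfolding tpar_def by (auto intro!: derivative_eq_intros simp: field_simps)
  next
    show "(\<lambda>i z. sqrt (Im (fst z) * Im (snd z))) \<in> AT" unfolding AT_def tpar_def by simp
  qed (intro fam_poly.mult fam_poly.const it)
  show it': "(\<lambda>i z. 1 / tpar z) \<in> fam_diff JT Om AT"
    by (rule fam_diff_inverse[OF t]) (use tpar_bounds(1) in \<open>fastforce simp: AT_def\<close>)+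
  have ph: "fam_deriv JT Om phase (fam_poly AT)"
  proof (rule fam_derivI[where f'="\<lambda>i z h. 2 * pi * idx3 i * (idx1 i * Re (snd h) + idx2 i * Re (fst h))"])
    show "(phase i has_derivative (\<lambda>h. 2 * pi * idx3 i * (idx1 i * Re (snd h) + idx2 i * Re (fst h)))) (at z)" for i z
      unfolding phase_def by (auto intro!: derivative_eq_intros)
    show "(\<lambda>i z. 2 * pi * idx3 i * (idx1 i * Re (snd w) + idx2 i * Re (fst w))) \<in> fam_poly AT" for w
      using c1 c2 c3 unfolding fam_diff_def by (intro fam_poly.mult fam_poly.add fam_poly.const) auto
  qed
  have cosA: "(\<lambda>i z. cos (phase i z)) \<in> AT" and sinA: "(\<lambda>i z. sin (phase i z)) \<in> AT" by (simp_all add: AT_def)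
  show "(\<lambda>i z. cos (phase i z)) \<in> fam_diff JT Om AT"
    by (rule fam_diff_chain[OF ph cosA DERIV_cos fam_poly_minus[OF fam_poly.atom[OF sinA]]])
  show "(\<lambda>i z. sin (phase i z)) \<in> fam_diff JT Om AT"
    by (rule fam_diff_chain[OF ph sinA DERIV_sin fam_poly.atom[OF cosA]])
  show o: "om \<in> fam_diff JT Om AT"
    unfolding om_def[abs_def] by (intro fam_diff_intros c1 c2 y1 y2)
  have o': "(\<lambda>i z. om i z) \<in> fam_diff JT Om AT" using o by simp
  show "erf_arg \<sigma> \<in> fam_diff JT Om AT"
    unfolding erf_arg_def[abs_def] by (intro fam_diff_intros c3 t it' o')
qed

lemma eT_exponent:
  assumes z: "z \<in> Om" and s: "\<sigma>\<^sup>2 = 1"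
  shows "exp ((\<sigma> * (2 * pi)) * (idx3 i * om i z)) * exp (- (erf_arg \<sigma> i z)\<^sup>2) = gT i z"
proof -
  define t where "t = tpar z"
  have t: "t \<ge> 1" "t\<^sup>2 = Im (fst z) * Im (snd z)" using tpar_bounds[OF z] by (auto simp: t_def)
  have "(erf_arg \<sigma> i z)\<^sup>2 = (pi / v) * ((idx3 i)\<^sup>2 * t\<^sup>2) + (\<sigma> * (2 * pi)) * (idx3 i * om i z) + \<sigma>\<^sup>2 * (pi * v) * ((om i z)\<^sup>2 * (1 / t\<^sup>2))"
  proof -
    define A where "A = (sqrt pi / sqrt v) * (idx3 i * t)"
    define B' where "B' = (\<sigma> * (sqrt pi * sqrt v)) * (om i z * (1 / t))"
    have "A\<^sup>2 = (pi / v) * ((idx3 i)\<^sup>2 * t\<^sup>2)" using v by (simp add: A_def power_mult_distrib power_divide)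
    moreover have "B'\<^sup>2 = \<sigma>\<^sup>2 * (pi * v) * ((om i z)\<^sup>2 * (1 / t\<^sup>2))" using v by (simp add: B'_def power_mult_distrib power_divide)
    moreover have "2 * A * B' = (\<sigma> * (2 * pi)) * (idx3 i * om i z)"
      using v t(1) by (simp add: A_def B'_def)
    moreover have "(erf_arg \<sigma> i z)\<^sup>2 = A\<^sup>2 + 2 * A * B' + B'\<^sup>2"
      unfolding erf_arg_def A_def B'_def t_def by (rule power2_sum[THEN trans]) simp
    ultimately show ?thesis by simp
  qed
  then show ?thesis unfolding gT_def exp_add[symmetric] using s t(2)
    by (simp add: power2_eq_square)
qed

lemma FT_deriv:
  assumes "f \<in> fam_mod AT GT"
  shows "fam_deriv JT Om f (fam_mod AT GT)"
proof (rule fam_mod_deriv[OF _ _ assms])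
  fix a assume "a \<in> AT"
  then have "a \<in> fam_diff JT Om AT" using AT_diff(1-12) unfolding AT_def by auto
  then show "fam_deriv JT Om a (fam_poly AT)" by (rule fam_diffD)
next
  have gT: "gT \<in> fam_mod AT GT" by (rule fam_mod.gen) (simp add: GT_def)
  have o: "(\<lambda>i z. om i z) \<in> fam_diff JT Om AT" using AT_diff(13) by simp
  have e: "fam_deriv JT Om (eT \<sigma>) (fam_mod AT GT)" if s: "\<sigma>\<^sup>2 = 1" "eT \<sigma> \<in> GT" for \<sigma>
  proof -
    have "(\<lambda>i z. (\<sigma> * (2 * pi)) * (idx3 i * om i z)) \<in> fam_diff JT Om AT"
      by (intro fam_diff_intros AT_diff(3) o)
    from fam_diffD[OF this] obtain p' where p': "\<And>i z. i \<in> JT \<Longrightarrow> z \<in> Om \<Longrightarrow> ((\<lambda>z. (\<sigma> * (2 * pi)) * (idx3 i * om i z)) has_derivative p' i z) (at z)"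
      "\<And>w. (\<lambda>i z. p' i z w) \<in> fam_poly AT" unfolding fam_deriv_def by blast
    obtain q' where q': "\<And>i z. i \<in> JT \<Longrightarrow> z \<in> Om \<Longrightarrow> (erf_arg \<sigma> i has_derivative q' i z) (at z)"
      "\<And>w. (\<lambda>i z. q' i z w) \<in> fam_poly AT"
      using fam_diffD[OF AT_diff(14)[of \<sigma>]] unfolding fam_deriv_def by blast
    show ?thesis
    proof (rule fam_derivI[where f'="\<lambda>i z w. p' i z w * eT \<sigma> i z + (- q' i z w) * gT i z"])
      fix i z assume i: "i \<in> JT" and z: "z \<in> Om"
      have d1: "((\<lambda>z. exp ((\<sigma> * (2 * pi)) * (idx3 i * om i z))) has_derivative
         (\<lambda>w. p' i z w * exp ((\<sigma> * (2 * pi)) * (idx3 i * om i z)))) (at z)"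
        by (rule DERIV_compose_FDERIV[OF DERIV_exp p'(1)[OF i z]])
      have d2: "((\<lambda>z. erfcI (erf_arg \<sigma> i z)) has_derivative (\<lambda>w. q' i z w * (- exp (- (erf_arg \<sigma> i z)\<^sup>2)))) (at z)"
        by (rule DERIV_compose_FDERIV[OF erfcI_has_derivative q'(1)[OF i z]])
      have "(eT \<sigma> i has_derivative (\<lambda>w. exp ((\<sigma> * (2 * pi)) * (idx3 i * om i z)) * (q' i z w * (- exp (- (erf_arg \<sigma> i z)\<^sup>2)))
         + (p' i z w * exp ((\<sigma> * (2 * pi)) * (idx3 i * om i z))) * erfcI (erf_arg \<sigma> i z))) (at z)"
        unfolding eT_def[abs_def] by (rule has_derivative_mult[OF d1 d2])
      moreover have "exp ((\<sigma> * (2 * pi)) * (idx3 i * om i z)) * (q' i z w * (- exp (- (erf_arg \<sigma> i z)\<^sup>2)))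
         + (p' i z w * exp ((\<sigma> * (2 * pi)) * (idx3 i * om i z))) * erfcI (erf_arg \<sigma> i z)
         = p' i z w * eT \<sigma> i z + (- q' i z w) * gT i z" for w
        unfolding eT_exponent[OF z s(1), symmetric] eT_def by simp
      ultimately show "(eT \<sigma> i has_derivative (\<lambda>w. p' i z w * eT \<sigma> i z + (- q' i z w) * gT i z)) (at z)"
        by (simp only:)
    next
      have "eT \<sigma> \<in> fam_mod AT GT" by (rule fam_mod.gen[OF s(2)])
      then show "(\<lambda>i z. p' i z w * eT \<sigma> i z + (- q' i z w) * gT i z) \<in> fam_mod AT GT" for w
        using fam_mod.add[OF fam_mod.mult[OF p'(2)[of w]] fam_mod.mult[OF fam_poly_minus[OF q'(2)[of w]] gT]] by blast
    qed
  qed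
  have g: "fam_deriv JT Om gT (fam_mod AT GT)"
  proof -
    have "(\<lambda>i z. (pi / v) * ((idx3 i * idx3 i) * (Im (fst z) * Im (snd z)))
      + (pi * v) * ((om i z * om i z) * ((1 / Im (fst z)) * (1 / Im (snd z))))) \<in> fam_diff JT Om AT"
      by (intro fam_diff_intros AT_diff o)
    from fam_diffD[OF this] show ?thesis
      unfolding gT_def[abs_def]
    proof (rule fam_deriv_chain[where \<phi>="\<lambda>x. exp (- x)" and h="\<lambda>i z. (- 1) * gT i z"])
      show "((\<lambda>x. exp (- x)) has_real_derivative (- 1) * gT i z) (at ((pi / v) * ((idx3 i * idx3 i) * (Im (fst z) * Im (snd z)))
         + (pi * v) * ((om i z * om i z) * ((1 / Im (fst z)) * (1 / Im (snd z))))))" for i z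
        unfolding gT_def by (auto intro!: derivative_eq_intros)
      show "(\<lambda>i z. q i z * ((- 1) * gT i z)) \<in> fam_mod AT GT" if "q \<in> fam_poly AT" for q
        by (intro fam_mod.mult fam_poly.const gT that)
    qed
  qed
  fix f assume "f \<in> GT"
  moreover have "(1::real)\<^sup>2 = 1" "(- 1 :: real)\<^sup>2 = 1" by auto
  moreover have "eT 1 \<in> GT" "eT (- 1) \<in> GT" by (auto simp: GT_def)
  ultimately show "fam_deriv JT Om f (fam_mod AT GT)" using e[of 1] e[of "- 1"] g unfolding GT_def by blast
qed

definition lenT :: "int \<times> int \<times> int \<Rightarrow> complex \<times> complex \<Rightarrow> real" where
  "lenT i z = idx3 i * cusp_height z"

definition exT :: "int \<times> int \<times> int \<Rightarrow> complex \<times> complex \<Rightarrow> real" where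
  "exT i z = exp (- (pi / v) * ((idx3 i)\<^sup>2 * (Im (fst z) * Im (snd z))))"

lemma JT_bounds:
  assumes "i \<in> JT"
  shows "idx3 i \<ge> 1" "\<bar>idx1 i\<bar> \<le> of_int \<bar>m\<bar>" "\<bar>idx2 i\<bar> \<le> of_int \<bar>m\<bar>"
proof -
  obtain b c n where i: "i = (b, c, n)" "- b * c = m" "n \<ge> 1" using assms by (auto simp: JT_def)
  show "idx3 i \<ge> 1" using i by simp
  have "b dvd m" "c dvd m" unfolding i(2)[symmetric] by auto
  then have "\<bar>b\<bar> \<le> \<bar>m\<bar>" "\<bar>c\<bar> \<le> \<bar>m\<bar>" using m by (auto intro: dvd_imp_le_int)
  then show "\<bar>idx1 i\<bar> \<le> of_int \<bar>m\<bar>" "\<bar>idx2 i\<bar> \<le> of_int \<bar>m\<bar>"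
    using i(1) by (simp_all flip: of_int_abs)
qed

lemma lenT_bounds:
  assumes "i \<in> JT" "z \<in> Om"
  shows "lenT i z \<ge> 1" "idx3 i \<le> lenT i z" "cusp_height z \<le> lenT i z"
proof -
  have "idx3 i \<ge> 1" "cusp_height z \<ge> 1"
    using JT_bounds[OF assms(1)] cusp_height_bounds(1) OmD[OF assms(2)] by auto
  then show "lenT i z \<ge> 1" "idx3 i \<le> lenT i z" "cusp_height z \<le> lenT i z"
    using mult_mono[of 1 "idx3 i" 1 "cusp_height z"] mult_left_mono[of 1 "cusp_height z" "idx3 i"]
      mult_right_mono[of 1 "idx3 i" "cusp_height z"] unfolding lenT_def by auto
qed

lemma AT_bound:
  assumes "a \<in> AT"
  shows "\<exists>c\<ge>0. \<exists>N. \<forall>i\<in>JT. \<forall>z\<in>Om. \<bar>a i z\<bar> \<le> c * lenT i z ^ N"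
proof -
  have one: "\<exists>c\<ge>0. \<exists>N. \<forall>i\<in>JT. \<forall>z\<in>Om. \<bar>a i z\<bar> \<le> c * lenT i z ^ N"
    if "\<And>i z. i \<in> JT \<Longrightarrow> z \<in> Om \<Longrightarrow> \<bar>a i z\<bar> \<le> lenT i z" for a
    using that by (intro exI[of _ 1] conjI exI[of _ "1::nat"]) auto
  have zero: "\<exists>c\<ge>0. \<exists>N. \<forall>i\<in>JT. \<forall>z\<in>Om. \<bar>a i z\<bar> \<le> c * lenT i z ^ N"
    if "K \<ge> 0" "\<And>i z. i \<in> JT \<Longrightarrow> z \<in> Om \<Longrightarrow> \<bar>a i z\<bar> \<le> K" for a K
    using that by (intro exI[of _ K] conjI exI[of _ "0::nat"]) auto
  have h: "x \<le> lenT i z" if "i \<in> JT" "z \<in> Om" "x \<le> cusp_height z" for i z x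
    using lenT_bounds(3)[OF that(1,2)] that(3) by linarith
  consider "a = (\<lambda>i z. idx1 i)" | "a = (\<lambda>i z. idx2 i)" | "a = (\<lambda>i z. idx3 i)" | "a = (\<lambda>i z. 1 / idx3 i)"
    | "a = (\<lambda>i z. Im (fst z))" | "a = (\<lambda>i z. Im (snd z))" | "a = (\<lambda>i z. 1 / Im (fst z))" | "a = (\<lambda>i z. 1 / Im (snd z))"
    | "a = (\<lambda>i z. tpar z)" | "a = (\<lambda>i z. 1 / tpar z)" | "a = (\<lambda>i z. cos (phase i z))" | "a = (\<lambda>i z. sin (phase i z))"
    using assms unfolding AT_def by blast
  then show ?thesis
  proof cases
    case 1
    show ?thesis unfolding 1 by (rule zero[of "of_int \<bar>m\<bar>"]) (use JT_bounds in auto)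
  next
    case 2
    show ?thesis unfolding 2 by (rule zero[of "of_int \<bar>m\<bar>"]) (use JT_bounds in auto)
  next
    case 3
    show ?thesis unfolding 3
    proof (rule one)
      fix i z assume "i \<in> JT" "z \<in> Om"
      then show "\<bar>idx3 i\<bar> \<le> lenT i z" using lenT_bounds(2)[of i z] JT_bounds(1)[of i] by linarith
    qed
  next
    case 4
    show ?thesis unfolding 4
    proof (rule zero[of 1])
      fix i z assume "i \<in> JT" "z \<in> Om"
      then show "\<bar>1 / idx3 i\<bar> \<le> 1" using JT_bounds(1)[of i] by (simp add: divide_le_eq)
    qed simp
  next
    case 5
    show ?thesis unfolding 5 using OmD cusp_height_bounds(2) by (intro one) (metis h abs_of_pos)
  next
    case 6
    show ?thesis unfolding 6 using OmD cusp_height_bounds(3) by (intro one) (metis h abs_of_pos)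
  next
    case 7
    show ?thesis unfolding 7 using OmD cusp_height_bounds(4) by (intro one) (metis h abs_of_pos zero_less_divide_1_iff)
  next
    case 8
    show ?thesis unfolding 8 using OmD cusp_height_bounds(5) by (intro one) (metis h abs_of_pos zero_less_divide_1_iff)
  next
    case 9
    show ?thesis unfolding 9
    proof (rule one)
      fix i z assume i: "i \<in> JT" "z \<in> Om"
      then show "\<bar>tpar z\<bar> \<le> lenT i z" using h[OF i tpar_bounds(2)[OF i(2)]] tpar_bounds(1)[OF i(2)] by linarith
    qed
  next
    case 10
    show ?thesis unfolding 10
    proof (rule zero[of 1])
      fix z assume "z \<in> Om"
      then show "\<bar>1 / tpar z\<bar> \<le> 1" using tpar_bounds(1)[of z] by (simp add: divide_le_eq)
    qed simp
  next
    case 11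
    show ?thesis unfolding 11 by (rule zero[of 1]) auto
  next
    case 12
    show ?thesis unfolding 12 by (rule zero[of 1]) auto
  qed
qed

text \<open>The exponent of \<open>eT\<close> is 2 A B' and the argument of \<open>erfcI\<close> is
  A + B' with A nonnegative, so \<open>exp_erfcI_le\<close> bounds the product by a Gaussian in A
  alone, whatever the size of \<open>om\<close>.\<close>

lemma eT_bound:
  assumes i: "i \<in> JT" and z: "z \<in> Om" and s: "\<sigma>\<^sup>2 = 1"
  shows "0 \<le> eT \<sigma> i z" "eT \<sigma> i z \<le> sqrt pi * exT i z"
proof -
  define t where "t = tpar z"
  have t: "t \<ge> 1" "t\<^sup>2 = Im (fst z) * Im (snd z)" using tpar_bounds[OF z] by (auto simp: t_def)
  define A where "A = (sqrt pi / sqrt v) * (idx3 i * t)"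
  define B' where "B' = (\<sigma> * (sqrt pi * sqrt v)) * (om i z * (1 / t))"
  have A0: "A \<ge> 0" unfolding A_def using v t JT_bounds(1)[OF i] by auto
  have A2: "A\<^sup>2 = (pi / v) * ((idx3 i)\<^sup>2 * t\<^sup>2)" using v by (simp add: A_def power_mult_distrib power_divide)
  have AB: "2 * A * B' = (\<sigma> * (2 * pi)) * (idx3 i * om i z)" using v t(1) by (simp add: A_def B'_def)
  have e: "eT \<sigma> i z = exp (2 * A * B') * erfcI (A + B')"
    unfolding eT_def erf_arg_def AB unfolding A_def B'_def t_def by simp
  show "0 \<le> eT \<sigma> i z" unfolding e by (simp add: erfcI_nonneg)
  show "eT \<sigma> i z \<le> sqrt pi * exT i z"
    unfolding e using exp_erfcI_le[OF A0, of B'] unfolding A2 t(2) exT_def by simp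
qed

lemma GT_bound:
  assumes "e \<in> GT"
  shows "\<exists>c\<ge>0. \<forall>i\<in>JT. \<forall>z\<in>Om. \<bar>e i z\<bar> \<le> c * exT i z"
proof -
  have "\<exists>c\<ge>0. \<forall>i\<in>JT. \<forall>z\<in>Om. \<bar>eT \<sigma> i z\<bar> \<le> c * exT i z" if "\<sigma>\<^sup>2 = 1" for \<sigma>
    using eT_bound[OF _ _ that] by (intro exI[of _ "sqrt pi"]) auto
  moreover have "\<exists>c\<ge>0. \<forall>i\<in>JT. \<forall>z\<in>Om. \<bar>gT i z\<bar> \<le> c * exT i z"
  proof (intro exI[of _ 1] conjI ballI)
    fix i z assume "i \<in> JT" "z \<in> Om"
    then have "(pi * v) * ((om i z * om i z) * ((1 / Im (fst z)) * (1 / Im (snd z)))) \<ge> 0"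
      using v OmD[of z] by (intro mult_nonneg_nonneg[OF _ mult_nonneg_nonneg[OF zero_le_square]]) auto
    then show "\<bar>gT i z\<bar> \<le> 1 * exT i z" unfolding gT_def exT_def by (simp add: power2_eq_square)
  qed simp
  moreover have "(1::real)\<^sup>2 = 1" "(- 1 :: real)\<^sup>2 = 1" by auto
  ultimately show ?thesis using assms unfolding GT_def by blast
qed

lemma lenT_exT_bound:
  obtains c where "c \<ge> 0"
    "\<And>i z. i \<in> JT \<Longrightarrow> z \<in> Om \<Longrightarrow> lenT i z ^ N * exT i z \<le> c * wt N z * lattice_weight i"
proof -
  define k where "k = pi / v"
  have k: "k / 2 > 0" using v by (auto simp: k_def)
  obtain c1 where c1: "c1 \<ge> 0" "\<And>s h y :: real. h > 0 \<Longrightarrow> 1 \<le> y \<Longrightarrow> 1 / h \<le> y \<Longrightarrow>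
    (1 + \<bar>s\<bar>) ^ N * exp (- (k / 2) * (h * s\<^sup>2)) \<le> c1 * y ^ (N + 2) * (1 / (1 + s\<^sup>2))"
    using power_gaussian_le[OF k] by metis
  \<comment> \<open>b and c run through divisors of m, so their lattice weights are bounded below by
    1 / M. This allows the weight of the three-dimensional lattice to be reused although only n is
    unbounded.\<close>
  define M where "M = 1 + (real_of_int m)\<^sup>2"
  have M: "M \<ge> 1" by (simp add: M_def)
  show ?thesis
  proof (rule that[of "c1 * M * M"])
    show "c1 * M * M \<ge> 0" using c1(1) M by simp
    fix i z assume i: "i \<in> JT" and z: "z \<in> Om"
    define b c n where "b = idx1 i" and "c = idx2 i" and "n = idx3 i"
    define Y T where "Y = cusp_height z" and "T = Im (fst z) * Im (snd z)"
    have T: "T \<ge> 2" using OmD[OF z] by (auto simp: T_def)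
    have Y: "Y \<ge> 1" "Y \<le> size_weight z"
      using cusp_height_bounds[of z] size_weight_ge(3)[of z] OmD[OF z] unfolding Y_def by auto
    have n: "n \<ge> 1" "n\<^sup>2 \<ge> 1" using JT_bounds(1)[OF i] by (auto simp: n_def)
    have "T \<le> n\<^sup>2 * T" "n\<^sup>2 \<le> n\<^sup>2 * T" using n T by (auto simp: mult_le_cancel_left1 mult_le_cancel_right1)
    then have "k / 2 * (T + 1 * n\<^sup>2) \<le> k / 2 * (2 * (n\<^sup>2 * T))" using k by (intro mult_left_mono) auto
    then have ex: "exT i z \<le> exp (- (k / 2) * T) * exp (- (k / 2) * (1 * n\<^sup>2))"
      unfolding exT_def T_def[symmetric] n_def[symmetric] k_def[symmetric] by (simp add: exp_add[symmetric] algebra_simps)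
    have bc: "1 \<le> M * (1 / (1 + b\<^sup>2))" "1 \<le> M * (1 / (1 + c\<^sup>2))"
    proof -
      have "b\<^sup>2 \<le> (real_of_int m)\<^sup>2" "c\<^sup>2 \<le> (real_of_int m)\<^sup>2"
        using JT_bounds(2,3)[OF i] unfolding b_def c_def by (simp_all add: abs_le_square_iff[symmetric])
      then show "1 \<le> M * (1 / (1 + b\<^sup>2))" "1 \<le> M * (1 / (1 + c\<^sup>2))"
        by (simp_all add: M_def le_divide_eq add_pos_nonneg)
    qed
    have "lenT i z ^ N * exT i z \<le> (n ^ N * Y ^ N) * (exp (- (k / 2) * T) * exp (- (k / 2) * (1 * n\<^sup>2)))"
      unfolding lenT_def n_def[symmetric] Y_def[symmetric] power_mult_distrib
      using n Y by (intro mult_left_mono ex) auto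
    also have "\<dots> \<le> ((1 + \<bar>n\<bar>) ^ N * Y ^ N) * (exp (- (k / 2) * T) * exp (- (k / 2) * (1 * n\<^sup>2)))"
      using n Y by (intro mult_right_mono power_mono) auto
    also have "\<dots> = Y ^ N * exp (- (k / 2) * T) * ((1 + \<bar>n\<bar>) ^ N * exp (- (k / 2) * (1 * n\<^sup>2)))" by (simp only: mult_ac)
    also have "\<dots> \<le> Y ^ N * exp (- (k / 2) * T) * (c1 * 1 ^ (N + 2) * (1 / (1 + n\<^sup>2)))"
      using Y by (intro mult_left_mono c1(2)) auto
    also have "\<dots> \<le> size_weight z ^ N * exp (- decay_rate * T) * (c1 * 1 ^ (N + 2) * (1 / (1 + n\<^sup>2)))"
    proof -
      have "decay_rate \<le> k / 2" by (simp add: decay_rate_def k_def)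
      then have "exp (- (k / 2) * T) \<le> exp (- decay_rate * T)" using T by (simp add: mult_right_mono)
      then show ?thesis using Y c1(1) by (intro mult_right_mono mult_mono power_mono) auto
    qed
    also have "\<dots> = (c1 * wt N z) * (1 * 1 * (1 / (1 + n\<^sup>2)))" unfolding wt_def T_def by simp
    also have "\<dots> \<le> (c1 * wt N z) * (M * (1 / (1 + b\<^sup>2)) * (M * (1 / (1 + c\<^sup>2))) * (1 / (1 + n\<^sup>2)))"
      using c1(1) wt_nonneg[OF z] M bc by (intro mult_left_mono mult_right_mono mult_mono) auto
    also have "\<dots> = c1 * M * M * wt N z * lattice_weight i"
      unfolding lattice_weight_def b_def c_def n_def case_prod_unfold by (simp only: mult_ac)
    finally show "lenT i z ^ N * exT i z \<le> c1 * M * M * wt N z * lattice_weight i" .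
  qed
qed

lemma FT_bound:
  assumes "f \<in> fam_mod AT GT"
  shows "\<exists>c\<ge>0. \<exists>N. \<forall>i\<in>JT. \<forall>z\<in>Om. \<bar>f i z\<bar> \<le> (c * wt N z) * lattice_weight i"
proof -
  obtain c N where c: "c \<ge> 0" "\<And>i z. i \<in> JT \<Longrightarrow> z \<in> Om \<Longrightarrow> \<bar>f i z\<bar> \<le> c * (lenT i z ^ N * exT i z)"
    using fam_mod_bound[OF AT_bound lenT_bounds(1) GT_bound _ assms] by (auto simp: exT_def)
  obtain c' where c': "c' \<ge> 0" "\<And>i z. i \<in> JT \<Longrightarrow> z \<in> Om \<Longrightarrow> lenT i z ^ N * exT i z \<le> c' * wt N z * lattice_weight i"
    using lenT_exT_bound by metis
  have "\<bar>f i z\<bar> \<le> (c * c' * wt N z) * lattice_weight i" if "i \<in> JT" "z \<in> Om" for i z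
    using order_trans[OF c(2)[OF that] mult_left_mono[OF c'(2)[OF that] c(1)]] by (simp only: mult.assoc)
  then show ?thesis using c(1) c'(1) by (intro exI[of _ "c * c'"] conjI exI[of _ N]) auto
qed

definition CT :: "(complex \<times> complex \<Rightarrow> real) set" where
  "CT = {\<lambda>z. \<Sum>\<^sub>\<infinity>i\<in>JT. f i z | f. f \<in> fam_mod AT GT}"

lemma closed_class_CT: "closed_class CT Om"
  unfolding CT_def
proof (rule fam_sum_closed_class[OF open_Om FT_deriv _ summable_lattice_weight lattice_weight_nonneg])
  fix f assume "f \<in> fam_mod AT GT"
  then obtain c N where "\<forall>i\<in>JT. \<forall>z\<in>Om. \<bar>f i z\<bar> \<le> (c * wt N z) * lattice_weight i"
    using FT_bound by blast
  then show "\<exists>H. continuous_on Om H \<and> (\<forall>i\<in>JT. \<forall>z\<in>Om. \<bar>f i z\<bar> \<le> H z * lattice_weight i)"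
    by (intro exI[of _ "\<lambda>z. c * wt N z"] conjI continuous_intros continuous_on_wt)
qed

lemma CT_bound:
  assumes "g \<in> CT"
  shows "\<exists>c\<ge>0. \<exists>N. \<forall>z\<in>Om. \<bar>g z\<bar> \<le> c * wt N z"
proof -
  obtain f where f: "f \<in> fam_mod AT GT" "g = (\<lambda>z. \<Sum>\<^sub>\<infinity>i\<in>JT. f i z)" using assms unfolding CT_def by blast
  then show ?thesis using FT_bound[OF f(1)] lattice_infsum_bound by blast
qed

definition fourier_term :: "int \<times> int \<times> int \<Rightarrow> complex \<times> complex \<Rightarrow> real" where
  "fourier_term i z = (- 2 / sqrt pi) * (cos (phase i z) * ((1 / idx3 i) * (eT 1 i z + eT (- 1) i z)))"

definition fourier_sum :: "complex \<times> complex \<Rightarrow> real" where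
  "fourier_sum z = (\<Sum>\<^sub>\<infinity>i\<in>JT. fourier_term i z)"

lemma fourier_term_in_fam_mod: "fourier_term \<in> fam_mod AT GT"
proof -
  have "(\<lambda>i z. eT 1 i z + eT (- 1) i z) \<in> fam_mod AT GT"
    by (intro fam_mod.add fam_mod.gen) (auto simp: GT_def)
  moreover have "(\<lambda>i z. 1 / idx3 i) \<in> fam_poly AT" "(\<lambda>i z. cos (phase i z)) \<in> fam_poly AT"
    by (rule fam_poly.atom, simp add: AT_def)+
  ultimately show ?thesis unfolding fourier_term_def[abs_def] by (intro fam_mod.mult fam_poly.const)
qed

lemma fourier_sum_in_CT: "fourier_sum \<in> CT"
  unfolding CT_def fourier_sum_def[abs_def] mem_Collect_eq
  by (intro exI[of _ fourier_term] conjI refl fourier_term_in_fam_mod)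

lemma finite_factorisations: "finite {(b, c). - b * c = m}"
proof (rule finite_subset)
  show "{(b, c). - b * c = m} \<subseteq> {- \<bar>m\<bar>..\<bar>m\<bar>} \<times> {- \<bar>m\<bar>..\<bar>m\<bar>}"
  proof
    fix p assume "p \<in> {(b, c). - b * c = m}"
    then obtain b c where p: "p = (b, c)" and bc: "- b * c = m" by auto
    have "b dvd m" "c dvd m" unfolding bc[symmetric] by auto
    then have "\<bar>b\<bar> \<le> \<bar>m\<bar>" "\<bar>c\<bar> \<le> \<bar>m\<bar>" using m by (auto intro: dvd_imp_le_int)
    then show "p \<in> {- \<bar>m\<bar>..\<bar>m\<bar>} \<times> {- \<bar>m\<bar>..\<bar>m\<bar>}" using p by auto
  qed
qed auto

text \<open>Grouping the modes by the finitely many factorisations of m gives the negatives of the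
  tails in \<open>line_sum_identity\<close>. The 0 in \<open>om (b, c, 0) z\<close> is a dummy,
  since \<open>om\<close> ignores the mode.\<close>

lemma fourier_sum_eq:
  assumes z: "z \<in> Om"
  shows "fourier_sum z = - (\<Sum>(b, c) | - b * c = m.
    tail_sum v (tpar z) (om (b, c, 0) z / tpar z) (of_int b * Re (snd z) + of_int c * Re (fst z)))"
proof -
  define P where "P = {(b, c). - b * c = m}"
  define h where "h = (\<lambda>(p :: int \<times> int, n :: nat). (fst p, snd p, int n))"
  have bij: "bij_betw h (P \<times> {1..}) JT"
    by (rule bij_betw_byWitness[where f'="\<lambda>(b, c, n). ((b, c), nat n)"])
       (auto simp: h_def P_def JT_def split: prod.splits)
  have fin: "finite P" using finite_factorisations by (simp add: P_def)
  obtain c N where "\<forall>i\<in>JT. \<forall>z\<in>Om. \<bar>fourier_term i z\<bar> \<le> (c * wt N z) * lattice_weight i"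
    using FT_bound[OF fourier_term_in_fam_mod] by blast
  then have "(\<lambda>i. fourier_term i z) summable_on JT" using z
    by (intro abs_summable_comparison[OF summable_on_cmult_right[OF summable_lattice_weight, of "c * wt N z"]]) auto
  then have sm: "(\<lambda>x. fourier_term (h x) z) summable_on (P \<times> {1..})"
    using summable_on_reindex_bij_betw[OF bij, of "\<lambda>i. fourier_term i z"] by simp
  have "fourier_sum z = (\<Sum>\<^sub>\<infinity>x\<in>P \<times> {1..}. fourier_term (h x) z)"
    unfolding fourier_sum_def using infsum_reindex_bij_betw[OF bij, of "\<lambda>i. fourier_term i z"] by simp
  also have "\<dots> = (\<Sum>\<^sub>\<infinity>p\<in>P. \<Sum>\<^sub>\<infinity>n\<in>{1..}. fourier_term (h (p, n)) z)"
    using infsum_Sigma_banach[OF sm] by simp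
  also have "\<dots> = (\<Sum>p\<in>P. \<Sum>\<^sub>\<infinity>n\<in>{1..}. fourier_term (h (p, n)) z)" using fin by simp
  also have "\<dots> = (\<Sum>p\<in>P. - (case p of (b, c) \<Rightarrow> tail_sum v (tpar z) (om (b, c, 0) z / tpar z)
      (of_int b * Re (snd z) + of_int c * Re (fst z))))"
  proof (rule sum.cong[OF refl])
    fix p assume "p \<in> P"
    obtain b c where p: "p = (b, c)" by (cases p)
    have tz: "tpar z \<noteq> 0" using tpar_bounds(1)[OF z] by auto
    have "fourier_term (h (p, n)) z = - (2 * cos (2 * pi * real n * (of_int b * Re (snd z) + of_int c * Re (fst z)))
        * tail_term v (tpar z) (om (b, c, 0) z / tpar z) n)" for n
    proof -
      define t w where "t = tpar z" and "w = om (b, c, 0) z / tpar z"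
      have wt: "om (b, c, int n) z = w * t" using tz by (simp add: om_def w_def t_def)
      have t0: "t \<noteq> 0" using tz by (simp add: t_def)
      have "erf_arg \<sigma> (b, c, int n) z = sqrt pi * (real n * t / sqrt v + \<sigma> * (sqrt v * w))" for \<sigma>
        unfolding erf_arg_def wt t_def[symmetric] using t0 by (simp add: distrib_left)
      then have e1: "eT 1 (b, c, int n) z = exp (2 * pi * real n * (w * t)) * erfcI (sqrt pi * (real n * t / sqrt v + sqrt v * w))"
        and e2: "eT (- 1) (b, c, int n) z = exp (- 2 * pi * real n * (w * t)) * erfcI (sqrt pi * (real n * t / sqrt v - sqrt v * w))"
        unfolding eT_def wt by (simp_all add: mult.assoc)
      have ph: "phase (b, c, int n) z = 2 * pi * real n * (of_int b * Re (snd z) + of_int c * Re (fst z))"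
        by (simp add: phase_def)
      have hp: "h (p, n) = (b, c, int n)" by (simp add: h_def p)
      show ?thesis
        unfolding fourier_term_def tail_term_def hp ph e1 e2 w_def[symmetric] unfolding t_def[symmetric] by simp
    qed
    then show "(\<Sum>\<^sub>\<infinity>n\<in>{1..}. fourier_term (h (p, n)) z) = - (case p of (b, c) \<Rightarrow> tail_sum v (tpar z) (om (b, c, 0) z / tpar z)
      (of_int b * Re (snd z) + of_int c * Re (fst z)))"
      unfolding tail_sum_def p by (simp add: infsum_uminus)
  qed
  finally show ?thesis unfolding P_def by (simp add: sum_negf)
qed

end

section \<open>Functions near the boundary divisor\<close>

text \<open>A right inverse of \<open>qmap\<close> off the coordinate axes by the principal
  logarithm. It jumps at the branch cut; periodic functions do not see this.\<close>

definition qlog :: "complex \<times> complex \<Rightarrow> complex \<times> complex" where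
  "qlog q = (Ln (fst q) / (2 * pi * \<i>), Ln (snd q) / (2 * pi * \<i>))"

lemma qmap_qlog:
  assumes "fst q * snd q \<noteq> 0"
  shows "qmap (qlog q) = q"
  using assms unfolding qmap_def qlog_def by (simp add: prod_eq_iff)

lemma Im_div_two_pi_i: "Im (w / (2 * complex_of_real pi * \<i>)) = - Re w / (2 * pi)"
  by (simp add: Im_divide power2_eq_square)

lemma Re_div_two_pi_i: "Re (w / (2 * complex_of_real pi * \<i>)) = Im w / (2 * pi)"
  by (simp add: Re_divide power2_eq_square)

text \<open>Dividing by \<open>f q\<close> moves the argument of \<open>Ln\<close> to 1, away from
  the branch cut, so this is a local branch of the logarithm around any point where \<open>f\<close>
  does not vanish.\<close>

lemma has_derivative_Ln_ratio:
  fixes f :: "complex \<times> complex \<Rightarrow> complex"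
  assumes f: "bounded_linear f" and nz: "f q \<noteq> 0"
  shows "((\<lambda>p. Ln (f p / f q) / (2 * pi * \<i>)) has_derivative (\<lambda>h. f h / (2 * pi * \<i>) / f q)) (at q)"
proof -
  have f': "((\<lambda>p. f p / f q) has_derivative (\<lambda>h. f h / f q)) (at q)"
    by (intro bounded_linear.has_derivative[OF bounded_linear_divide] bounded_linear_imp_has_derivative f)
  have "(Ln has_field_derivative 1) (at (f q / f q))"
    using has_field_derivative_Ln[of 1] nz by simp
  then have "(Ln has_derivative (\<lambda>w. 1 * w)) (at (f q / f q))" by (simp only: has_field_derivative_def)
  from has_derivative_compose[OF f' this]
  have "((\<lambda>p. Ln (f p / f q)) has_derivative (\<lambda>h. f h / f q)) (at q)" by simp
  then have "((\<lambda>p. Ln (f p / f q) / (2 * pi * \<i>)) has_derivative (\<lambda>h. (f h / f q) / (2 * pi * \<i>))) (at q)"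
    by (rule bounded_linear.has_derivative[OF bounded_linear_divide])
  then show ?thesis by (simp add: mult.commute)
qed

lemma cmod_qmap: "cmod (fst (qmap z)) = exp (- 2 * pi * Im (fst z))" "cmod (snd (qmap z)) = exp (- 2 * pi * Im (snd z))"
  by (simp_all add: qmap_def norm_exp_eq_Re)

lemma qmap_nonzero: "fst (qmap z) \<noteq> 0" "snd (qmap z) \<noteq> 0" "qmap z \<notin> D"
  by (simp_all add: qmap_def D_def)

lemma qmap_eqD:
  assumes "qmap z = qmap z'"
  obtains j k :: int where "z' = z + (of_int j, of_int k)"
proof -
  have "exp (2 * complex_of_real pi * \<i> * fst z') = exp (2 * complex_of_real pi * \<i> * fst z)"
    "exp (2 * complex_of_real pi * \<i> * snd z') = exp (2 * complex_of_real pi * \<i> * snd z)"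
    using assms by (auto simp: qmap_def)
  then obtain j k :: int where
    "2 * complex_of_real pi * \<i> * fst z' = 2 * complex_of_real pi * \<i> * fst z + (of_int (2 * j) * pi) * \<i>"
    "2 * complex_of_real pi * \<i> * snd z' = 2 * complex_of_real pi * \<i> * snd z + (of_int (2 * k) * pi) * \<i>"
    unfolding exp_eq by blast
  then have "2 * complex_of_real pi * \<i> * fst z' = 2 * complex_of_real pi * \<i> * (fst z + of_int j)"
    "2 * complex_of_real pi * \<i> * snd z' = 2 * complex_of_real pi * \<i> * (snd z + of_int k)"
    by (simp_all add: algebra_simps)
  then have "fst z' = fst z + of_int j" "snd z' = snd z + of_int k" by simp_all
  then show ?thesis using that by (simp add: prod_eq_iff)
qed

lemma qmap_add_int: "qmap (z + (of_int j, of_int k)) = qmap z"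
proof -
  have "exp (2 * complex_of_real pi * \<i> * (w + of_int j)) = exp (2 * complex_of_real pi * \<i> * w)" for w and j :: int
    using exp_plus_2pin[of "2 * complex_of_real pi * \<i> * w" j] by (simp add: algebra_simps)
  then show ?thesis by (simp add: qmap_def)
qed

lemma open_bidisc: "open (bidisc r)"
  unfolding bidisc_def by (intro open_Collect_conj open_Collect_less continuous_intros)

context boundary_expansion
begin

text \<open>The divisor together with the points under \<open>Om\<close>: ln |q1| ln |q2| = 4 pi^2
  y1 y2 turns the bound 2 |m| into 8 pi^2 |m|.\<close>

definition Uq :: "(complex \<times> complex) set" where
  "Uq = {q \<in> bidisc 1. fst q * snd q = 0 \<or> ln (cmod (fst q)) * ln (cmod (snd q)) > 8 * pi\<^sup>2 * of_int \<bar>m\<bar>}"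

lemma qmap_in_Uq: "qmap z \<in> Uq \<longleftrightarrow> z \<in> Om"
proof -
  have "ln (cmod (fst (qmap z))) * ln (cmod (snd (qmap z))) = 4 * pi\<^sup>2 * (Im (fst z) * Im (snd z))"
    unfolding cmod_qmap by (simp add: power2_eq_square)
  then have "ln (cmod (fst (qmap z))) * ln (cmod (snd (qmap z))) > 8 * pi\<^sup>2 * of_int \<bar>m\<bar> \<longleftrightarrow>
     4 * pi\<^sup>2 * (Im (fst z) * Im (snd z)) > 4 * pi\<^sup>2 * (2 * of_int \<bar>m\<bar>)" by simp
  also have "\<dots> \<longleftrightarrow> Im (fst z) * Im (snd z) > 2 * of_int \<bar>m\<bar>"
    by (subst mult_less_cancel_left_pos) auto
  finally show ?thesis unfolding Uq_def Om_def bidisc_def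
    using qmap_nonzero by (auto simp: cmod_qmap zero_less_mult_iff)
qed

lemma Uq_D: "q \<in> Uq - D \<longleftrightarrow> q \<in> Uq \<and> fst q * snd q \<noteq> 0"
  by (auto simp: Uq_def D_def)

lemma Uq_D_nonzero: "q \<in> Uq - D \<Longrightarrow> fst q \<noteq> 0" "q \<in> Uq - D \<Longrightarrow> snd q \<noteq> 0"
  unfolding Uq_D by auto

lemma Uq_D_less_1: "q \<in> Uq - D \<Longrightarrow> cmod (fst q) < 1" "q \<in> Uq - D \<Longrightarrow> cmod (snd q) < 1"
  unfolding Uq_D by (auto simp: Uq_def bidisc_def)

lemma D_subset_Uq: "D \<subseteq> Uq" by (auto simp: Uq_def D_def)

lemma Uq_subset: "Uq \<subseteq> bidisc 1" by (auto simp: Uq_def)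

lemma qlog_in_Om: "q \<in> Uq - D \<Longrightarrow> qlog q \<in> Om"
  using qmap_in_Uq[of "qlog q"] qmap_qlog[of q] unfolding Uq_D by metis

lemma open_Uq_D: "open (Uq - D)"
proof -
  have "open {q. fst q * snd q \<noteq> (0 :: complex)}" (is "open ?A")
    by (intro open_Collect_neq continuous_intros)
  then have op: "open (bidisc 1 \<inter> ?A)" using open_bidisc by blast
  have cont: "continuous_on (bidisc 1 \<inter> ?A) (\<lambda>q. ln (cmod (fst q)) * ln (cmod (snd q)))"
    by (intro continuous_intros) auto
  have "open ((\<lambda>q. ln (cmod (fst q)) * ln (cmod (snd q))) -` {8 * pi\<^sup>2 * of_int \<bar>m\<bar><..} \<inter> (bidisc 1 \<inter> ?A))"
    by (rule cont[unfolded continuous_on_open_vimage[OF op], rule_format, OF open_greaterThan])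
  moreover have "(\<lambda>q. ln (cmod (fst q)) * ln (cmod (snd q))) -` {8 * pi\<^sup>2 * of_int \<bar>m\<bar><..} \<inter> (bidisc 1 \<inter> ?A) = Uq - D"
  proof (rule set_eqI)
    fix q
    show "q \<in> (\<lambda>q. ln (cmod (fst q)) * ln (cmod (snd q))) -` {8 * pi\<^sup>2 * of_int \<bar>m\<bar><..} \<inter> (bidisc 1 \<inter> ?A) \<longleftrightarrow> q \<in> Uq - D"
      unfolding Uq_D unfolding Uq_def vimage_eq Int_iff mem_Collect_eq greaterThan_iff by blast
  qed
  ultimately show ?thesis by simp
qed

lemma ball_product_in_Uq:
  assumes p: "p \<in> bidisc 1" "fst p = 0 \<or> snd p = 0"
  shows "\<exists>r>0. \<forall>q. cmod (fst q - fst p) < r \<longrightarrow> cmod (snd q - snd p) < r \<longrightarrow> q \<in> Uq"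
proof -
  have *: "\<exists>r>0. \<forall>x y. cmod (x - a) < r \<longrightarrow> cmod y < r \<longrightarrow> (x, y) \<in> Uq \<and> (y, x) \<in> Uq" if a: "cmod a < 1" for a
  proof -
    define L where "L = (1 - cmod a) / 2"
    have L: "L > 0" using a by (simp add: L_def)
    define K where "K = 8 * pi\<^sup>2 * of_int \<bar>m\<bar>"
    have K: "K \<ge> 0" by (simp add: K_def)
    \<comment> \<open>The first entry keeps the coordinate near \<open>a\<close> below 1 - L, so its
      negative logarithm is at least L. The second makes the other negative logarithm at least (K +
      1) / L, and the product exceeds K.\<close>
    define r where "r = min L (exp (- (K + 1) / L))"
    have r: "r > 0" "r \<le> L" "r \<le> exp (- (K + 1) / L)" using L by (auto simp: r_def)
    have e1: "exp (- (K + 1) / L) < 1" using K L by (simp add: divide_less_0_iff)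
    have "(x, y) \<in> Uq \<and> (y, x) \<in> Uq" if x: "cmod (x - a) < r" and y: "cmod y < r" for x y
    proof -
      have "cmod x \<le> cmod a + cmod (x - a)" by (metis norm_triangle_sub)
      then have "cmod x < cmod a + L" using x r by linarith
      then have cx: "cmod x < 1 - L" by (simp add: L_def field_simps)
      have cy: "cmod y < 1" using y r e1 by linarith
      have "ln (cmod x) * ln (cmod y) > K" if nz: "x \<noteq> 0" "y \<noteq> 0"
      proof -
        have "ln (cmod x) \<le> - L" using ln_le_minus_one[of "cmod x"] cx nz by simp
        moreover have "ln (cmod y) \<le> ln (exp (- (K + 1) / L))"
          using nz y r by (subst ln_le_cancel_iff) auto
        then have "(K + 1) / L \<le> - ln (cmod y)" using minus_divide_left[of "K + 1" L] by simp
        ultimately have "L * ((K + 1) / L) \<le> (- ln (cmod x)) * (- ln (cmod y))"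
          using L K by (intro mult_mono) (auto simp: minus_divide_left)
        then show ?thesis using L by simp
      qed
      then show ?thesis using cx cy L unfolding Uq_def bidisc_def K_def by (auto simp: mult.commute)
    qed
    then show ?thesis using r by blast
  qed
  from p(2) show ?thesis
  proof
    assume f: "fst p = 0"
    from *[of "snd p"] p f show ?thesis unfolding bidisc_def
      by (metis (mono_tags, lifting) diff_zero mem_Collect_eq prod.collapse)
  next
    assume f: "snd p = 0"
    from *[of "fst p"] p f show ?thesis unfolding bidisc_def
      by (metis (mono_tags, lifting) diff_zero mem_Collect_eq prod.collapse)
  qed
qed

lemma open_Uq: "open Uq"
proof (rule openI)
  fix p assume p: "p \<in> Uq"
  show "\<exists>e>0. ball p e \<subseteq> Uq"
  proof (cases "p \<in> D")
    case True
    then obtain r where r: "r > 0" "\<And>q. cmod (fst q - fst p) < r \<Longrightarrow> cmod (snd q - snd p) < r \<Longrightarrow> q \<in> Uq"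
      using ball_product_in_Uq[of p] by (auto simp: D_def)
    have "q \<in> Uq" if "q \<in> ball p r" for q
    proof -
      have "dist p q < r" using that by simp
      moreover have "cmod (fst q - fst p) \<le> dist p q" "cmod (snd q - snd p) \<le> dist p q"
        using dist_fst_le[of p q] dist_snd_le[of p q] by (simp_all add: dist_norm norm_minus_commute)
      ultimately show ?thesis by (intro r(2)) auto
    qed
    then show ?thesis using r(1) by blast
  next
    case False
    then show ?thesis using open_Uq_D p open_contains_ball by (metis Diff_iff Diff_subset subset_trans)
  qed
qed

subsection \<open>From functions of \<open>z\<close> to functions of \<open>q\<close>\<close>

definition periodic :: "(complex \<times> complex \<Rightarrow> real) \<Rightarrow> bool" where
  "periodic g \<longleftrightarrow> (\<forall>z\<in>Om. \<forall>z'\<in>Om. qmap z = qmap z' \<longrightarrow> g z = g z')"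

text \<open>Periodicity is imposed on the sum as a whole, so that it passes to derivatives without a
  look at the individual families.\<close>

definition CP :: "(complex \<times> complex \<Rightarrow> real) set" where
  "CP = {g. (\<exists>f\<in>CM. \<exists>h\<in>CT. g = (\<lambda>z. f z + h z)) \<and> periodic g}"

text \<open>Two points over the same q differ by an integer vector, and near each of them the
  function is unchanged by that translation. Uniqueness of derivatives then makes the derivatives
  periodic as well.\<close>

lemma closed_class_CP: "closed_class CP Om"
  unfolding closed_class_def
proof (intro conjI ballI open_Om)
  fix g assume "g \<in> CP"
  then have g: "g \<in> {\<lambda>x. f x + h x | f h. f \<in> CM \<and> h \<in> CT}" and per: "periodic g" by (auto simp: CP_def)
  obtain g' where g': "\<forall>x\<in>Om. (g has_derivative g' x) (at x)"
    "\<forall>w. \<exists>k\<in>{\<lambda>x. f x + h x | f h. f \<in> CM \<and> h \<in> CT}. \<forall>x\<in>Om. g' x w = k x"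
    using closed_class_plus[OF closed_class_CM closed_class_CT] g unfolding closed_class_def by blast
  have g'_per: "g' z = g' z'" if z: "z \<in> Om" "z' \<in> Om" "qmap z = qmap z'" for z z'
  proof -
    obtain j k :: int where jk: "z' = z + (of_int j, of_int k)" using qmap_eqD[OF z(3)] by metis
    have "(g has_derivative g' z') (at (z + (of_int j, of_int k)))" using g'(1) z jk by auto
    moreover have "((\<lambda>y. y + (of_int j, of_int k)) has_derivative (\<lambda>h. h)) (at z)"
      by (auto intro!: derivative_eq_intros)
    ultimately have "((\<lambda>y. g (y + (of_int j, of_int k))) has_derivative g' z') (at z)"
      using has_derivative_compose[of "\<lambda>y. y + (of_int j, of_int k)" "\<lambda>h. h" z UNIV g "g' z'"] by simp
    then have "(g has_derivative g' z') (at z)"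
    proof (rule has_derivative_transform_within_open[OF _ open_Om z(1)])
      fix y assume y: "y \<in> Om"
      have "qmap (y + (of_int j, of_int k)) = qmap y" by (rule qmap_add_int)
      then show "g (y + (of_int j, of_int k)) = g y"
        using per y qmap_in_Uq unfolding periodic_def by metis
    qed
    then show ?thesis using has_derivative_unique g'(1) z(1) by blast
  qed
  show "\<exists>f'. (\<forall>x\<in>Om. (g has_derivative f' x) (at x)) \<and> (\<forall>w. \<exists>k\<in>CP. \<forall>x\<in>Om. f' x w = k x)"
  proof (intro exI[of _ g'] conjI g'(1) allI)
    fix w
    obtain f h where k: "f \<in> CM" "h \<in> CT" "\<forall>x\<in>Om. g' x w = f x + h x" using g'(2)[rule_format, of w] by blast
    then have "periodic (\<lambda>z. f z + h z)" unfolding periodic_def using g'_per by metis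
    then have "(\<lambda>z. f z + h z) \<in> CP" using k(1,2) unfolding CP_def by blast
    then show "\<exists>k\<in>CP. \<forall>x\<in>Om. g' x w = k x" using k(3) by (intro bexI[of _ "\<lambda>z. f z + h z"]) auto
  qed
qed

lemma CP_bound:
  assumes "g \<in> CP"
  shows "\<exists>c\<ge>0. \<exists>N. \<forall>z\<in>Om. \<bar>g z\<bar> \<le> c * wt N z"
proof -
  obtain f h where g: "f \<in> CM" "h \<in> CT" "g = (\<lambda>z. f z + h z)" using assms by (auto simp: CP_def)
  obtain c N where c: "c \<ge> 0" "\<forall>z\<in>Om. \<bar>f z\<bar> \<le> c * wt N z" using CM_bound[OF g(1)] by blast
  obtain c' N' where c': "c' \<ge> 0" "\<forall>z\<in>Om. \<bar>h z\<bar> \<le> c' * wt N' z" using CT_bound[OF g(2)] by blast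
  have "\<bar>g z\<bar> \<le> (c + c') * wt (N + N') z" if z: "z \<in> Om" for z
  proof -
    have "c * wt N z \<le> c * wt (N + N') z" "c' * wt N' z \<le> c' * wt (N + N') z"
      using c c' by (auto intro!: mult_left_mono wt_mono[OF z])
    then have "\<bar>f z\<bar> \<le> c * wt (N + N') z" "\<bar>h z\<bar> \<le> c' * wt (N + N') z"
      using c(2) c'(2) z by (meson order_trans)+
    then show ?thesis unfolding g by (simp add: distrib_right)
  qed
  then show ?thesis using c c' by (intro exI[of _ "c + c'"] conjI exI[of _ "N + N'"]) auto
qed

text \<open>For members of \<open>CP\<close> the choice of branch is immaterial
  (\<open>down_qmap\<close>). The value 0 on the axes is the limit established in
  \<open>down_tendsto\<close>.\<close>

definition down :: "(complex \<times> complex \<Rightarrow> real) \<Rightarrow> complex \<times> complex \<Rightarrow> real" where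
  "down g q = (if fst q * snd q = 0 then 0 else g (qlog q))"

lemma down_qmap:
  assumes "g \<in> CP" "z \<in> Om"
  shows "down g (qmap z) = g z"
proof -
  have nz: "fst (qmap z) * snd (qmap z) \<noteq> 0" using qmap_nonzero by simp
  have "qmap (qlog (qmap z)) = qmap z" by (rule qmap_qlog[OF nz])
  moreover from this have "qlog (qmap z) \<in> Om" using qmap_in_Uq assms(2) by metis
  ultimately have "g (qlog (qmap z)) = g z" using assms unfolding CP_def periodic_def by blast
  then show ?thesis using nz by (simp add: down_def)
qed

text \<open>\<open>qlog\<close> itself need not be continuous at \<open>q\<close>. The function
  \<open>Z\<close> is a local branch of the logarithm with the same value at \<open>q\<close>, and
  periodicity gives \<open>down g p = g (Z p)\<close> for all \<open>p\<close> off the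
  divisor.\<close>

lemma down_has_derivative:
  assumes g: "g \<in> CP" and g': "(g has_derivative g') (at (qlog q))" and q: "q \<in> Uq - D"
  shows "(down g has_derivative (\<lambda>h. g' (fst h / (2 * pi * \<i>) / fst q, snd h / (2 * pi * \<i>) / snd q))) (at q)"
proof -
  have nz: "fst q \<noteq> 0" "snd q \<noteq> 0" using Uq_D_nonzero[OF q] by auto
  define Z where "Z p = (fst (qlog q) + Ln (fst p / fst q) / (2 * pi * \<i>), snd (qlog q) + Ln (snd p / snd q) / (2 * pi * \<i>))"
    for p :: "complex \<times> complex"
  have Zq: "Z q = qlog q" using nz by (simp add: Z_def prod_eq_iff)
  note d1 = has_derivative_Ln_ratio[OF bounded_linear_fst nz(1)]
  note d2 = has_derivative_Ln_ratio[OF bounded_linear_snd nz(2)]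
  have dZ: "(Z has_derivative (\<lambda>h. (fst h / (2 * pi * \<i>) / fst q, snd h / (2 * pi * \<i>) / snd q))) (at q)"
    unfolding Z_def[abs_def]
    using has_derivative_Pair[OF has_derivative_add[OF has_derivative_const[of "fst (qlog q)"] d1]
        has_derivative_add[OF has_derivative_const[of "snd (qlog q)"] d2]] by simp
  have "((\<lambda>p. g (Z p)) has_derivative (\<lambda>h. g' (fst h / (2 * pi * \<i>) / fst q, snd h / (2 * pi * \<i>) / snd q))) (at q)"
    by (rule has_derivative_compose[OF dZ]) (use g' Zq in simp)
  then show ?thesis
  proof (rule has_derivative_transform_within_open[OF _ open_Uq_D q])
    fix p assume p: "p \<in> Uq - D"
    then have nzp: "fst p * snd p \<noteq> 0" using Uq_D_nonzero[OF p] by simp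
    have "qmap (Z p) = p"
    proof -
      have "exp (2 * complex_of_real pi * \<i> * (a + Ln (x / y) / (2 * pi * \<i>))) = x"
        if "exp (2 * complex_of_real pi * \<i> * a) = y" "x \<noteq> 0" "y \<noteq> 0" for a x y
        using that by (simp add: distrib_left exp_add)
      moreover have "exp (2 * complex_of_real pi * \<i> * fst (qlog q)) = fst q" "exp (2 * complex_of_real pi * \<i> * snd (qlog q)) = snd q"
        using qmap_qlog[of q] nz by (auto simp: qmap_def prod_eq_iff)
      ultimately show ?thesis unfolding qmap_def Z_def using nz nzp by (auto simp: prod_eq_iff)
    qed
    then have "Z p \<in> Om" using qmap_in_Uq[of "Z p"] p by simp
    from down_qmap[OF g this] show "g (Z p) = down g p" using \<open>qmap (Z p) = p\<close> by simp
  qed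
qed

section \<open>Derivatives in q and their order along the divisor\<close>

text \<open>\<open>N\<close> bounds the number of factors 1 / q1 and 1 / q2 and goes up by one with
  each derivative in q. Letting \<kappa> range over all complex numbers covers imaginary parts as
  well as real ones.\<close>

inductive QF :: "nat \<Rightarrow> (complex \<times> complex \<Rightarrow> real) \<Rightarrow> bool" where
  base: "g \<in> CP \<Longrightarrow> QF 0 (down g)"
| mul1: "QF N h \<Longrightarrow> QF (Suc N) (\<lambda>q. Re (\<kappa> / fst q) * h q)"
| mul2: "QF N h \<Longrightarrow> QF (Suc N) (\<lambda>q. Re (\<kappa> / snd q) * h q)"
| add: "QF N h \<Longrightarrow> QF N k \<Longrightarrow> QF N (\<lambda>q. h q + k q)"
| weaken: "QF N h \<Longrightarrow> QF (Suc N) h"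

lemma QF_zero: "QF N h \<Longrightarrow> fst q * snd q = 0 \<Longrightarrow> h q = 0"
  by (induction rule: QF.induct) (auto simp: down_def)

text \<open>Writes - Im a Im b in terms of real parts, so that the derivative of 1 / q1 or 1 / q2, a
  product of two reciprocals, is again expressed through the factors allowed in
  \<open>QF\<close>.\<close>

lemma Re_mult_Re: "Re (a * b) = Re a * Re b + Re (\<i> * a) * Re (- \<i> * b)"
  by simp

lemma QF_deriv:
  assumes "QF N h"
  shows "\<exists>h'. (\<forall>q\<in>Uq - D. (h has_derivative h' q) (at q)) \<and> (\<forall>w. \<exists>k. QF (Suc N) k \<and> (\<forall>q\<in>Uq - D. h' q w = k q))"
  using assms
proof (induction rule: QF.induct)
  case (base g)
  obtain g' where g': "\<forall>x\<in>Om. (g has_derivative g' x) (at x)" "\<forall>w. \<exists>k\<in>CP. \<forall>x\<in>Om. g' x w = k x"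
    using closed_class_CP base unfolding closed_class_def by blast
  \<comment> \<open>The direction handed to \<open>g'\<close> varies with q, whereas closedness of
    \<open>CP\<close> concerns fixed directions. It is therefore expanded over a real basis of the
    tangent space.\<close>
  obtain k1 k2 k3 k4 where k: "k1 \<in> CP" "\<forall>x\<in>Om. g' x (1, 0) = k1 x" "k2 \<in> CP" "\<forall>x\<in>Om. g' x (\<i>, 0) = k2 x"
    "k3 \<in> CP" "\<forall>x\<in>Om. g' x (0, 1) = k3 x" "k4 \<in> CP" "\<forall>x\<in>Om. g' x (0, \<i>) = k4 x"
    using g'(2) by metis
  show ?case
  proof (intro exI[of _ "\<lambda>q h. g' (qlog q) (fst h / (2 * pi * \<i>) / fst q, snd h / (2 * pi * \<i>) / snd q)"] conjI ballI allI)
    fix q assume q: "q \<in> Uq - D"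
    then show "(down g has_derivative (\<lambda>h. g' (qlog q) (fst h / (2 * pi * \<i>) / fst q, snd h / (2 * pi * \<i>) / snd q))) (at q)"
      using g'(1) qlog_in_Om by (intro down_has_derivative base) auto
  next
    fix w :: "complex \<times> complex"
    define \<kappa>1 \<kappa>2 where "\<kappa>1 = fst w / (2 * pi * \<i>)" and "\<kappa>2 = snd w / (2 * pi * \<i>)"
    define K where "K q = (Re (\<kappa>1 / fst q) * down k1 q + Re (- \<i> * \<kappa>1 / fst q) * down k2 q)
       + (Re (\<kappa>2 / snd q) * down k3 q + Re (- \<i> * \<kappa>2 / snd q) * down k4 q)" for q
    have "QF (Suc 0) K" unfolding K_def by (intro QF.intros k)
    moreover have "g' (qlog q) (\<kappa>1 / fst q, \<kappa>2 / snd q) = K q" if q: "q \<in> Uq - D" for q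
    proof -
      have z: "qlog q \<in> Om" by (rule qlog_in_Om[OF q])
      have nz: "fst q * snd q \<noteq> 0" using Uq_D_nonzero[OF q] by simp
      define a b where "a = \<kappa>1 / fst q" and "b = \<kappa>2 / snd q"
      interpret bounded_linear "g' (qlog q)" using g'(1) z has_derivative_bounded_linear by blast
      have "(a, b) = Re a *\<^sub>R (1, 0) + Im a *\<^sub>R (\<i>, 0) + (Re b *\<^sub>R (0, 1) + Im b *\<^sub>R (0, \<i>))"
        by (simp add: complex_eq_iff)
      then have "g' (qlog q) (a, b) = Re a * g' (qlog q) (1, 0) + Im a * g' (qlog q) (\<i>, 0)
         + (Re b * g' (qlog q) (0, 1) + Im b * g' (qlog q) (0, \<i>))"
        by (simp only: add scaleR real_scaleR_def)
      moreover have "Im a = Re (- \<i> * \<kappa>1 / fst q)" "Im b = Re (- \<i> * \<kappa>2 / snd q)"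
        by (simp_all add: a_def b_def flip: times_divide_eq_right)
      ultimately show ?thesis using k z nz unfolding K_def down_def a_def b_def by simp
    qed
    ultimately show "\<exists>k. QF (Suc 0) k \<and> (\<forall>q\<in>Uq - D. g' (qlog q) (fst w / (2 * pi * \<i>) / fst q, snd w / (2 * pi * \<i>) / snd q) = k q)"
      unfolding \<kappa>1_def \<kappa>2_def by blast
  qed
next
  case (mul1 N h \<kappa>)
  then obtain h' where h': "\<forall>q\<in>Uq - D. (h has_derivative h' q) (at q)" "\<forall>w. \<exists>k. QF (Suc N) k \<and> (\<forall>q\<in>Uq - D. h' q w = k q)"
    by blast
  show ?case
  proof (intro exI[of _ "\<lambda>q w. Re (\<kappa> / fst q) * h' q w + Re ((- \<kappa> * fst w / fst q) * (1 / fst q)) * h q"] conjI ballI allI)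
    fix q assume q: "q \<in> Uq - D"
    then have nz: "fst q \<noteq> 0" by (rule Uq_D_nonzero)
    have "((\<lambda>q. Re (\<kappa> / fst q)) has_derivative (\<lambda>w. Re ((- \<kappa> * fst w / fst q) * (1 / fst q)))) (at q)"
      using nz by (auto intro!: derivative_eq_intros simp: field_simps)
    from has_derivative_mult[OF this h'(1)[rule_format, OF q]]
    show "((\<lambda>q. Re (\<kappa> / fst q) * h q) has_derivative
       (\<lambda>w. Re (\<kappa> / fst q) * h' q w + Re ((- \<kappa> * fst w / fst q) * (1 / fst q)) * h q)) (at q)" .
  next
    fix w
    obtain k where k: "QF (Suc N) k" "\<forall>q\<in>Uq - D. h' q w = k q" using h'(2) by blast
    define A where "A = - \<kappa> * fst w"
    define K where "K q = Re (\<kappa> / fst q) * k q + (Re (A / fst q) * (Re (1 / fst q) * h q) + Re (\<i> * A / fst q) * (Re (- \<i> / fst q) * h q))" for q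
    have "QF (Suc (Suc N)) K" unfolding K_def by (intro QF.add QF.mul1 k mul1.hyps)
    moreover have re: "Re ((A / fst q) * (1 / fst q)) = Re (A / fst q) * Re (1 / fst q) + Re (\<i> * A / fst q) * Re (- \<i> / fst q)" for q
      by (subst Re_mult_Re) simp
    then have "Re (\<kappa> / fst q) * h' q w + Re ((- \<kappa> * fst w / fst q) * (1 / fst q)) * h q = K q" if "q \<in> Uq - D" for q
      using k(2) that unfolding K_def A_def[symmetric] by (simp only: re distrib_right mult.assoc)
    ultimately show "\<exists>k. QF (Suc (Suc N)) k \<and> (\<forall>q\<in>Uq - D. Re (\<kappa> / fst q) * h' q w + Re ((- \<kappa> * fst w / fst q) * (1 / fst q)) * h q = k q)"
      by blast
  qed
next
  case (mul2 N h \<kappa>)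
  then obtain h' where h': "\<forall>q\<in>Uq - D. (h has_derivative h' q) (at q)" "\<forall>w. \<exists>k. QF (Suc N) k \<and> (\<forall>q\<in>Uq - D. h' q w = k q)"
    by blast
  show ?case
  proof (intro exI[of _ "\<lambda>q w. Re (\<kappa> / snd q) * h' q w + Re ((- \<kappa> * snd w / snd q) * (1 / snd q)) * h q"] conjI ballI allI)
    fix q assume q: "q \<in> Uq - D"
    then have nz: "snd q \<noteq> 0" by (rule Uq_D_nonzero)
    have "((\<lambda>q. Re (\<kappa> / snd q)) has_derivative (\<lambda>w. Re ((- \<kappa> * snd w / snd q) * (1 / snd q)))) (at q)"
      using nz by (auto intro!: derivative_eq_intros simp: field_simps)
    from has_derivative_mult[OF this h'(1)[rule_format, OF q]]
    show "((\<lambda>q. Re (\<kappa> / snd q) * h q) has_derivative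
       (\<lambda>w. Re (\<kappa> / snd q) * h' q w + Re ((- \<kappa> * snd w / snd q) * (1 / snd q)) * h q)) (at q)" .
  next
    fix w
    obtain k where k: "QF (Suc N) k" "\<forall>q\<in>Uq - D. h' q w = k q" using h'(2) by blast
    define A where "A = - \<kappa> * snd w"
    define K where "K q = Re (\<kappa> / snd q) * k q + (Re (A / snd q) * (Re (1 / snd q) * h q) + Re (\<i> * A / snd q) * (Re (- \<i> / snd q) * h q))" for q
    have "QF (Suc (Suc N)) K" unfolding K_def by (intro QF.add QF.mul2 k mul2.hyps)
    moreover have re: "Re ((A / snd q) * (1 / snd q)) = Re (A / snd q) * Re (1 / snd q) + Re (\<i> * A / snd q) * Re (- \<i> / snd q)" for q
      by (subst Re_mult_Re) simp
    then have "Re (\<kappa> / snd q) * h' q w + Re ((- \<kappa> * snd w / snd q) * (1 / snd q)) * h q = K q" if "q \<in> Uq - D" for q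
      using k(2) that unfolding K_def A_def[symmetric] by (simp only: re distrib_right mult.assoc)
    ultimately show "\<exists>k. QF (Suc (Suc N)) k \<and> (\<forall>q\<in>Uq - D. Re (\<kappa> / snd q) * h' q w + Re ((- \<kappa> * snd w / snd q) * (1 / snd q)) * h q = k q)"
      by blast
  qed
next
  case (add N h k)
  obtain h' where h': "\<forall>q\<in>Uq - D. (h has_derivative h' q) (at q)" "\<forall>w. \<exists>k. QF (Suc N) k \<and> (\<forall>q\<in>Uq - D. h' q w = k q)"
    using add.IH(1) by blast
  obtain k' where k': "\<forall>q\<in>Uq - D. (k has_derivative k' q) (at q)" "\<forall>w. \<exists>k. QF (Suc N) k \<and> (\<forall>q\<in>Uq - D. k' q w = k q)"
    using add.IH(2) by blast
  show ?case
  proof (intro exI[of _ "\<lambda>q w. h' q w + k' q w"] conjI ballI allI)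
    fix q assume "q \<in> Uq - D"
    then show "((\<lambda>q. h q + k q) has_derivative (\<lambda>w. h' q w + k' q w)) (at q)"
      using h'(1) k'(1) by (intro has_derivative_add) auto
  next
    fix w
    obtain a b where "QF (Suc N) a" "\<forall>q\<in>Uq - D. h' q w = a q" "QF (Suc N) b" "\<forall>q\<in>Uq - D. k' q w = b q"
      using h'(2) k'(2) by meson
    then show "\<exists>k. QF (Suc N) k \<and> (\<forall>q\<in>Uq - D. h' q w + k' q w = k q)"
      by (intro exI[of _ "\<lambda>q. a q + b q"]) (auto intro: QF.add)
  qed
next
  case (weaken N h)
  then show ?case using QF.weaken by meson
qed

text \<open>Both coordinates have modulus below 1, so 1 / |q1| and 1 / |q2| are at most 1 / |q1 q2|,
  and a single exponent counts both kinds of poles.\<close>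

lemma QF_bound:
  assumes "QF N h"
  shows "\<exists>c\<ge>0. \<exists>M. \<forall>q\<in>Uq - D. \<bar>h q\<bar> \<le> c * wt M (qlog q) / cmod (fst q * snd q) ^ N"
  using assms
proof (induction rule: QF.induct)
  case (base g)
  then obtain c M where c: "c \<ge> 0" "\<forall>z\<in>Om. \<bar>g z\<bar> \<le> c * wt M z" using CP_bound by blast
  have "\<bar>down g q\<bar> \<le> c * wt M (qlog q)" if "q \<in> Uq - D" for q
    using c(2) qlog_in_Om[OF that] Uq_D_nonzero[OF that] by (simp add: down_def)
  then show ?case using c(1) by (intro exI[of _ c] conjI exI[of _ M]) auto
next
  case (mul1 N h \<kappa>)
  then obtain c M where c: "c \<ge> 0" "\<forall>q\<in>Uq - D. \<bar>h q\<bar> \<le> c * wt M (qlog q) / cmod (fst q * snd q) ^ N" by blast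
  have "\<bar>Re (\<kappa> / fst q) * h q\<bar> \<le> (cmod \<kappa> * c) * wt M (qlog q) / cmod (fst q * snd q) ^ Suc N" if q: "q \<in> Uq - D" for q
  proof -
    have nz: "fst q \<noteq> 0" "snd q \<noteq> 0" "cmod (snd q) < 1" using Uq_D_nonzero[OF q] Uq_D_less_1[OF q] by auto
    have "\<bar>Re (\<kappa> / fst q)\<bar> \<le> cmod \<kappa> / cmod (fst q)" using abs_Re_le_cmod[of "\<kappa> / fst q"] by (simp add: norm_divide)
    also have "\<dots> \<le> cmod \<kappa> / cmod (fst q * snd q)"
      using nz by (intro divide_left_mono) (auto simp: norm_mult mult_le_cancel_left1)
    finally have "\<bar>Re (\<kappa> / fst q)\<bar> * \<bar>h q\<bar> \<le> (cmod \<kappa> / cmod (fst q * snd q)) * (c * wt M (qlog q) / cmod (fst q * snd q) ^ N)"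
      using c q by (intro mult_mono) auto
    then show ?thesis by (simp add: abs_mult)
  qed
  then show ?case using c(1) by (intro exI[of _ "cmod \<kappa> * c"] conjI exI[of _ M]) auto
next
  case (mul2 N h \<kappa>)
  then obtain c M where c: "c \<ge> 0" "\<forall>q\<in>Uq - D. \<bar>h q\<bar> \<le> c * wt M (qlog q) / cmod (fst q * snd q) ^ N" by blast
  have "\<bar>Re (\<kappa> / snd q) * h q\<bar> \<le> (cmod \<kappa> * c) * wt M (qlog q) / cmod (fst q * snd q) ^ Suc N" if q: "q \<in> Uq - D" for q
  proof -
    have nz: "fst q \<noteq> 0" "snd q \<noteq> 0" "cmod (fst q) < 1" using Uq_D_nonzero[OF q] Uq_D_less_1[OF q] by auto
    have "\<bar>Re (\<kappa> / snd q)\<bar> \<le> cmod \<kappa> / cmod (snd q)" using abs_Re_le_cmod[of "\<kappa> / snd q"] by (simp add: norm_divide)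
    also have "\<dots> \<le> cmod \<kappa> / cmod (fst q * snd q)"
      using nz by (intro divide_left_mono) (auto simp: norm_mult mult_le_cancel_right1)
    finally have "\<bar>Re (\<kappa> / snd q)\<bar> * \<bar>h q\<bar> \<le> (cmod \<kappa> / cmod (fst q * snd q)) * (c * wt M (qlog q) / cmod (fst q * snd q) ^ N)"
      using c q by (intro mult_mono) auto
    then show ?thesis by (simp add: abs_mult)
  qed
  then show ?case using c(1) by (intro exI[of _ "cmod \<kappa> * c"] conjI exI[of _ M]) auto
next
  case (add N h k)
  obtain c M where c: "c \<ge> 0" "\<forall>q\<in>Uq - D. \<bar>h q\<bar> \<le> c * wt M (qlog q) / cmod (fst q * snd q) ^ N" using add.IH(1) by blast
  obtain c' M' where c': "c' \<ge> 0" "\<forall>q\<in>Uq - D. \<bar>k q\<bar> \<le> c' * wt M' (qlog q) / cmod (fst q * snd q) ^ N" using add.IH(2) by blast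
  have "\<bar>h q + k q\<bar> \<le> (c + c') * wt (M + M') (qlog q) / cmod (fst q * snd q) ^ N" if q: "q \<in> Uq - D" for q
  proof -
    have "c * wt M (qlog q) / cmod (fst q * snd q) ^ N \<le> c * wt (M + M') (qlog q) / cmod (fst q * snd q) ^ N"
      "c' * wt M' (qlog q) / cmod (fst q * snd q) ^ N \<le> c' * wt (M + M') (qlog q) / cmod (fst q * snd q) ^ N"
      using c c' qlog_in_Om[OF q] by (auto intro!: divide_right_mono mult_left_mono wt_mono)
    then have "\<bar>h q\<bar> \<le> c * wt (M + M') (qlog q) / cmod (fst q * snd q) ^ N" "\<bar>k q\<bar> \<le> c' * wt (M + M') (qlog q) / cmod (fst q * snd q) ^ N"
      using c(2) c'(2) q by (meson order_trans)+
    then show ?thesis by (simp add: distrib_right add_divide_distrib)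
  qed
  then show ?case using c(1) c'(1) by (intro exI[of _ "c + c'"] conjI exI[of _ "M + M'"]) auto
next
  case (weaken N h)
  then obtain c M where c: "c \<ge> 0" "\<forall>q\<in>Uq - D. \<bar>h q\<bar> \<le> c * wt M (qlog q) / cmod (fst q * snd q) ^ N" by blast
  have "\<bar>h q\<bar> \<le> c * wt M (qlog q) / cmod (fst q * snd q) ^ Suc N" if q: "q \<in> Uq - D" for q
  proof -
    have nz: "fst q * snd q \<noteq> 0" "cmod (fst q) < 1" "cmod (snd q) < 1" using Uq_D_nonzero[OF q] Uq_D_less_1[OF q] by auto
    have "cmod (fst q) * cmod (snd q) \<le> 1 * 1" using nz by (intro mult_mono) auto
    then have "cmod (fst q * snd q) ^ Suc N \<le> cmod (fst q * snd q) ^ N"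
      by (simp add: norm_mult mult_left_le_one_le)
    then have "c * wt M (qlog q) / cmod (fst q * snd q) ^ N \<le> c * wt M (qlog q) / cmod (fst q * snd q) ^ Suc N"
      using c(1) wt_nonneg[OF qlog_in_Om[OF q]] nz by (intro divide_left_mono) auto
    then show ?thesis using c(2) q by (meson order_trans)
  qed
  then show ?case using c(1) by (intro exI[of _ c] conjI exI[of _ M]) auto
qed

text \<open>From y1, y2 >= \<eta> follows y1 y2 >= \<eta> (y1 + y2) / 2, and exp (- 2 pi (y1 + y2))
  = |q1 q2|. Half of the resulting exponential absorbs the polynomial weight, the other half is the
  stated power. The principal logarithm keeps the real parts bounded.\<close>

lemma wt_qlog_le:
  assumes \<eta>: "\<eta> > 0"
  obtains K where "K \<ge> 0" "\<And>q. q \<in> Uq - D \<Longrightarrow> cmod (fst q) \<le> exp (- 2 * pi * \<eta>) \<Longrightarrow> cmod (snd q) \<le> exp (- 2 * pi * \<eta>)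
    \<Longrightarrow> wt M (qlog q) \<le> K * cmod (fst q * snd q) powr (decay_rate * \<eta> / (8 * pi))"
proof -
  define k where "k = decay_rate * \<eta> / 4"
  have k: "k > 0" using decay_rate_pos \<eta> by (simp add: k_def)
  define K where "K = (4 * (1 + 1 / \<eta>)\<^sup>2) ^ M * (1 + real (2 * M) / k) ^ (2 * M)"
  show ?thesis
  proof (rule that[of K])
    show "K \<ge> 0" using k \<eta> by (simp add: K_def)
    fix q assume q: "q \<in> Uq - D" and le: "cmod (fst q) \<le> exp (- 2 * pi * \<eta>)" "cmod (snd q) \<le> exp (- 2 * pi * \<eta>)"
    note nz = Uq_D_nonzero[OF q]
    define x1 x2 y1 y2 where "x1 = Re (fst (qlog q))" and "x2 = Re (snd (qlog q))"
      and "y1 = Im (fst (qlog q))" and "y2 = Im (snd (qlog q))"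
    have yv: "y1 = - ln (cmod (fst q)) / (2 * pi)" "y2 = - ln (cmod (snd q)) / (2 * pi)"
      unfolding y1_def y2_def qlog_def using nz Im_div_two_pi_i[of "Ln (fst q)"] Im_div_two_pi_i[of "Ln (snd q)"] by simp_all
    have "ln (cmod (fst q)) \<le> - 2 * pi * \<eta>" "ln (cmod (snd q)) \<le> - 2 * pi * \<eta>"
      using le nz by (simp_all add: ln_le_cancel_iff[of _ "exp (- 2 * pi * \<eta>)", simplified])
    then have y: "y1 \<ge> \<eta>" "y2 \<ge> \<eta>" unfolding yv by (simp_all add: field_simps)
    have "\<bar>Im (Ln w)\<bar> \<le> pi" if "w \<noteq> 0" for w using that Im_Ln_le_pi[of w] mpi_less_Im_Ln[of w] by auto
    then have "\<bar>x1\<bar> \<le> 1" "\<bar>x2\<bar> \<le> 1"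
      unfolding x1_def x2_def qlog_def using nz Re_div_two_pi_i[of "Ln (fst q)"] Re_div_two_pi_i[of "Ln (snd q)"]
      by (simp_all add: abs_divide divide_le_eq) (smt (verit) pi_gt_zero)+
    then have x: "x1\<^sup>2 \<le> 1" "x2\<^sup>2 \<le> 1" by (simp_all add: abs_square_le_1)
    define S where "S = y1 + y2"
    have S: "S \<ge> 0" using y \<eta> by (simp add: S_def)
    have inv: "1 / y1 \<le> 1 / \<eta>" "1 / y2 \<le> 1 / \<eta>" using y \<eta> by (auto intro!: divide_left_mono)
    have h: "y1 + 1 / y1 \<le> S + 1 / \<eta>" "y2 + 1 / y2 \<le> S + 1 / \<eta>" using inv y \<eta> by (auto simp: S_def)
    have S1: "S + 1 / \<eta> \<le> (1 + 1 / \<eta>) * (1 + S)" using S \<eta> by (simp add: field_simps)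
    have "size_weight (qlog q) \<le> (2 * 2) * (((1 + 1 / \<eta>) * (1 + S)) * ((1 + 1 / \<eta>) * (1 + S)))"
    proof -
      have "0 \<le> (1 + 1 / \<eta>) * (1 + S)" using S \<eta> by simp
      then show ?thesis
        unfolding size_weight_def cusp_height_def x1_def[symmetric] x2_def[symmetric] y1_def[symmetric] y2_def[symmetric]
        using x y h S1 \<eta> by (intro mult_mono) auto
    qed
    also have "\<dots> = (4 * (1 + 1 / \<eta>)\<^sup>2) * (1 + S)\<^sup>2" by (simp add: power2_eq_square)
    finally have "size_weight (qlog q) ^ M \<le> ((4 * (1 + 1 / \<eta>)\<^sup>2) * (1 + S)\<^sup>2) ^ M"
      using size_weight_ge(2)[of "qlog q"] OmD[OF qlog_in_Om[OF q]] by (intro power_mono) auto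
    also have "\<dots> = (4 * (1 + 1 / \<eta>)\<^sup>2) ^ M * (1 + S) ^ (2 * M)" by (simp only: power_mult_distrib power_mult)
    finally have sw: "size_weight (qlog q) ^ M \<le> (4 * (1 + 1 / \<eta>)\<^sup>2) ^ M * (1 + S) ^ (2 * M)" .
    have "\<eta> * y2 \<le> y1 * y2" "\<eta> * y1 \<le> y2 * y1" using y \<eta> by (auto intro!: mult_right_mono)
    then have "\<eta> * S \<le> 2 * (y1 * y2)" by (simp add: S_def distrib_left mult.commute)
    then have "decay_rate * (\<eta> * S) \<le> decay_rate * (2 * (y1 * y2))" using decay_rate_pos by (intro mult_left_mono) auto
    then have "exp (- decay_rate * (y1 * y2)) \<le> exp (- k * S) * exp (- k * S)"
      unfolding exp_add[symmetric] k_def by (simp add: mult_ac)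
    then have "wt M (qlog q) \<le> ((4 * (1 + 1 / \<eta>)\<^sup>2) ^ M * (1 + S) ^ (2 * M)) * (exp (- k * S) * exp (- k * S))"
      unfolding wt_def y1_def[symmetric] y2_def[symmetric] using S by (intro mult_mono sw) auto
    also have "\<dots> = (4 * (1 + 1 / \<eta>)\<^sup>2) ^ M * ((1 + S) ^ (2 * M) * exp (- k * S)) * exp (- k * S)" by (simp only: mult_ac)
    also have "\<dots> \<le> (4 * (1 + 1 / \<eta>)\<^sup>2) ^ M * (1 + real (2 * M) / k) ^ (2 * M) * exp (- k * S)"
      by (intro mult_right_mono mult_left_mono one_plus_power_exp_le k S) auto
    also have "exp (- k * S) = cmod (fst q * snd q) powr (decay_rate * \<eta> / (8 * pi))"
    proof -
      have "ln (cmod (fst q * snd q)) = - (2 * pi) * S"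
        using nz by (simp add: S_def yv norm_mult ln_mult field_simps)
      then show ?thesis using nz by (simp add: powr_def k_def)
    qed
    finally show "wt M (qlog q) \<le> K * cmod (fst q * snd q) powr (decay_rate * \<eta> / (8 * pi))" unfolding K_def .
  qed
qed

text \<open>Near a point of \<open>D\<close> both coordinates stay below some r < 1, so
  \<open>wt_qlog_le\<close> applies with a fixed positive exponent while |q1 q2| tends to 0.\<close>

lemma down_tendsto:
  assumes g: "g \<in> CP" and p: "p \<in> D"
  shows "(down g \<longlongrightarrow> 0) (nhds p)"
proof -
  \<comment> \<open>The midpoint between 1 and the larger modulus of the coordinates of
    \<open>p\<close>; it tends to 1 as \<open>p\<close> approaches the edge of the bidisc, which
    makes the exponent small but keeps it positive.\<close>
  define r where "r = (1 + max (cmod (fst p)) (cmod (snd p))) / 2"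
  have p1: "cmod (fst p) < 1" "cmod (snd p) < 1" "fst p * snd p = 0" using p by (auto simp: D_def bidisc_def)
  have r: "r > 0" "r < 1" "cmod (fst p) < r" "cmod (snd p) < r"
    using p1 norm_ge_zero[of "fst p"] norm_ge_zero[of "snd p"] unfolding r_def by (auto simp: max_def intro: add_pos_nonneg)
  define \<eta> where "\<eta> = - ln r / (2 * pi)"
  have \<eta>: "\<eta> > 0" "exp (- 2 * pi * \<eta>) = r" using r by (auto simp: \<eta>_def divide_less_0_iff)
  obtain c M where c: "c \<ge> 0" "\<forall>z\<in>Om. \<bar>g z\<bar> \<le> c * wt M z" using CP_bound[OF g] by blast
  obtain K where K: "K \<ge> 0" "\<And>q. q \<in> Uq - D \<Longrightarrow> cmod (fst q) \<le> exp (- 2 * pi * \<eta>) \<Longrightarrow> cmod (snd q) \<le> exp (- 2 * pi * \<eta>)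
    \<Longrightarrow> wt M (qlog q) \<le> K * cmod (fst q * snd q) powr (decay_rate * \<eta> / (8 * pi))"
    using wt_qlog_le[OF \<eta>(1)] by metis
  have "\<forall>\<^sub>F q in nhds p. q \<in> Uq \<inter> bidisc r"
    by (rule eventually_nhds_in_open) (use open_Uq open_bidisc D_subset_Uq p r in \<open>auto simp: bidisc_def\<close>)
  then have ev: "\<forall>\<^sub>F q in nhds p. norm (down g q) \<le> c * (K * cmod (fst q * snd q) powr (decay_rate * \<eta> / (8 * pi)))"
  proof eventually_elim
    case (elim q)
    show ?case
    proof (cases "fst q * snd q = 0")
      case False
      then have q: "q \<in> Uq - D" using elim by (simp add: D_def)
      have "\<bar>down g q\<bar> \<le> c * wt M (qlog q)" using c(2) qlog_in_Om[OF q] False by (simp add: down_def)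
      also have "\<dots> \<le> c * (K * cmod (fst q * snd q) powr (decay_rate * \<eta> / (8 * pi)))"
        using elim c(1) \<eta>(2) by (intro mult_left_mono K(2)[OF q]) (auto simp: bidisc_def)
      finally show ?thesis by simp
    qed (use c(1) K(1) in \<open>simp add: down_def\<close>)
  qed
  have "((\<lambda>q. cmod (fst q * snd q)) \<longlongrightarrow> cmod (fst p * snd p)) (nhds p)"
    by (intro tendsto_intros filterlim_ident)
  then have lim: "((\<lambda>q. cmod (fst q * snd q)) \<longlongrightarrow> 0) (nhds p)" unfolding p1(3) norm_zero .
  have rate: "0 < decay_rate * \<eta> / (8 * pi)" using \<eta>(1) decay_rate_pos by simp
  have "((\<lambda>q. cmod (fst q * snd q) powr (decay_rate * \<eta> / (8 * pi))) \<longlongrightarrow> 0) (nhds p)"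
    by (rule tendsto_zero_powrI[OF lim tendsto_const _ rate]) (simp add: always_eventually)
  then have "((\<lambda>q. c * (K * cmod (fst q * snd q) powr (decay_rate * \<eta> / (8 * pi)))) \<longlongrightarrow> c * (K * 0)) (nhds p)"
    by (intro tendsto_mult tendsto_const)
  then have "((\<lambda>q. c * (K * cmod (fst q * snd q) powr (decay_rate * \<eta> / (8 * pi)))) \<longlongrightarrow> 0) (nhds p)" by simp
  from Lim_null_comparison[OF ev this] show ?thesis .
qed

text \<open>For given \<open>L\<close> the bidisc is taken so small that the exponent in
  \<open>wt_qlog_le\<close> is at least L + 2. This beats a pole of order N <= L and leaves
  quadratic vanishing along the divisor. So the derivative there is zero, in agreement with the
  value 0 that every \<open>QF\<close> function takes there, and the induction over the order goes
  through.\<close>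

lemma QF_corner:
  obtains \<epsilon> where "\<epsilon> > 0" "bidisc \<epsilon> \<subseteq> Uq" "\<And>N h k. QF N h \<Longrightarrow> N + k \<le> L \<Longrightarrow> Ck_on k h (bidisc \<epsilon>)"
proof -
  \<comment> \<open>The first entry gives \<eta>^2 > 2 |m|, which puts the bidisc inside
    \<open>Uq\<close>; the second makes the exponent at least L + 2.\<close>
  define \<eta> where "\<eta> = max (2 * of_int \<bar>m\<bar> + 1) (8 * pi * real (L + 2) / decay_rate)"
  have \<eta>: "\<eta> \<ge> 2 * of_int \<bar>m\<bar> + 1" "\<eta> > 0" by (auto simp: \<eta>_def max_def)
  have "8 * pi * real (L + 2) / decay_rate \<le> \<eta>" by (simp add: \<eta>_def)
  then have rate: "decay_rate * \<eta> / (8 * pi) \<ge> real (L + 2)"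
    using decay_rate_pos by (simp add: field_simps)
  define \<epsilon> where "\<epsilon> = exp (- 2 * pi * \<eta>)"
  have \<epsilon>: "\<epsilon> > 0" "\<epsilon> < 1" using \<eta>(2) by (auto simp: \<epsilon>_def)
  have less1: "cmod (fst q) < 1" "cmod (snd q) < 1" if "q \<in> bidisc \<epsilon>" for q
    using that \<epsilon> by (auto simp: bidisc_def)
  have sub: "bidisc \<epsilon> \<subseteq> Uq"
  proof
    fix q assume q: "q \<in> bidisc \<epsilon>"
    have "ln (cmod (fst q)) * ln (cmod (snd q)) > 8 * pi\<^sup>2 * of_int \<bar>m\<bar>" if nz: "fst q * snd q \<noteq> 0"
    proof -
      have "ln (cmod (fst q)) < ln \<epsilon>" "ln (cmod (snd q)) < ln \<epsilon>"
        using nz q \<epsilon> by (auto simp: bidisc_def)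
      then have l: "2 * pi * \<eta> \<le> - ln (cmod (fst q))" "2 * pi * \<eta> \<le> - ln (cmod (snd q))" by (auto simp: \<epsilon>_def)
      have "\<eta> * 1 \<le> \<eta> * \<eta>" using \<eta> by (intro mult_left_mono) auto
      then have "2 * of_int \<bar>m\<bar> < \<eta> * \<eta>" using \<eta> by linarith
      then have "(4 * pi\<^sup>2) * (2 * of_int \<bar>m\<bar>) < (4 * pi\<^sup>2) * (\<eta> * \<eta>)" by (intro mult_strict_left_mono) auto
      then have "8 * pi\<^sup>2 * of_int \<bar>m\<bar> < (2 * pi * \<eta>) * (2 * pi * \<eta>)" by (simp add: power2_eq_square mult_ac)
      also have "\<dots> \<le> (- ln (cmod (fst q))) * (- ln (cmod (snd q)))"
      proof -
        have "0 \<le> 2 * pi * \<eta>" using \<eta> by simp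
        then show ?thesis using l by (intro mult_mono) linarith+
      qed
      finally show ?thesis by simp
    qed
    then show "q \<in> Uq" using less1[OF q] unfolding Uq_def by (auto simp: bidisc_def)
  qed
  have quad: "\<exists>c\<ge>0. \<forall>q\<in>bidisc \<epsilon>. \<bar>h q\<bar> \<le> c * (cmod (fst q * snd q))\<^sup>2" if h: "QF N h" and N: "N \<le> L" for N h
  proof -
    obtain c M where c: "c \<ge> 0" "\<forall>q\<in>Uq - D. \<bar>h q\<bar> \<le> c * wt M (qlog q) / cmod (fst q * snd q) ^ N"
      using QF_bound[OF h] by blast
    obtain K where K: "K \<ge> 0" "\<And>q. q \<in> Uq - D \<Longrightarrow> cmod (fst q) \<le> exp (- 2 * pi * \<eta>) \<Longrightarrow> cmod (snd q) \<le> exp (- 2 * pi * \<eta>)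
      \<Longrightarrow> wt M (qlog q) \<le> K * cmod (fst q * snd q) powr (decay_rate * \<eta> / (8 * pi))"
      using wt_qlog_le[OF \<eta>(2)] by metis
    have "\<bar>h q\<bar> \<le> (c * K) * (cmod (fst q * snd q))\<^sup>2" if q: "q \<in> bidisc \<epsilon>" for q
    proof (cases "fst q * snd q = 0")
      case True
      then show ?thesis using QF_zero[OF h True] c(1) K(1) by simp
    next
      case False
      then have qU: "q \<in> Uq - D" using q sub by (auto simp: D_def)
      define a where "a = cmod (fst q * snd q)"
      have a: "a > 0" "a \<le> 1" using False less1[OF q] mult_mono[of "cmod (fst q)" 1 "cmod (snd q)" 1] by (auto simp: a_def norm_mult)
      have "wt M (qlog q) \<le> K * a powr (decay_rate * \<eta> / (8 * pi))"
        unfolding a_def using q by (intro K(2)[OF qU]) (auto simp: bidisc_def \<epsilon>_def)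
      also have "a powr (decay_rate * \<eta> / (8 * pi)) \<le> a powr real (N + 2)"
        using a rate N by (intro powr_mono') auto
      also have "a powr real (N + 2) = a ^ (N + 2)" by (rule powr_realpow[OF a(1)])
      finally have w: "wt M (qlog q) \<le> K * a ^ (N + 2)" using K(1) by (simp add: mult_left_mono)
      have "\<bar>h q\<bar> \<le> c * wt M (qlog q) / a ^ N" using c(2) qU by (simp add: a_def)
      also have "\<dots> \<le> c * (K * a ^ (N + 2)) / a ^ N"
        using w c(1) a by (intro divide_right_mono mult_left_mono) auto
      also have "\<dots> = (c * K) * a\<^sup>2" using a by (simp add: power_add power2_eq_square)
      finally show ?thesis unfolding a_def .
    qed
    then show ?thesis using c(1) K(1) by (intro exI[of _ "c * K"]) auto
  qed
  have deriv0: "(h has_derivative (\<lambda>w. 0)) (at p)"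
    if h: "QF N h" "N \<le> L" and p: "p \<in> bidisc \<epsilon>" "fst p * snd p = 0" for N h p
  proof -
    obtain c where c: "c \<ge> 0" "\<And>q. q \<in> bidisc \<epsilon> \<Longrightarrow> \<bar>h q\<bar> \<le> c * (cmod (fst q * snd q))\<^sup>2" using quad[OF h] by blast
    have hp: "h p = 0" by (rule QF_zero[OF h(1) p(2)])
    obtain r where r: "r > 0" "ball p r \<subseteq> bidisc \<epsilon>" using open_bidisc p(1) open_contains_ball by blast
    have b: "\<bar>h q\<bar> \<le> c * (norm (q - p))\<^sup>2" if q: "norm (q - p) < r" for q
    proof -
      have qe: "q \<in> bidisc \<epsilon>" using q r by (auto simp: dist_norm norm_minus_commute)
      have "cmod (fst q * snd q) \<le> norm (q - p)"
      proof (cases "fst p = 0")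
        case True
        have "cmod (fst q) \<le> norm (q - p)" using dist_fst_le[of q p] True by (simp add: dist_norm)
        then show ?thesis using less1[OF qe] mult_mono[of "cmod (fst q)" "norm (q - p)" "cmod (snd q)" 1] by (simp add: norm_mult)
      next
        case False
        then have "snd p = 0" using p(2) by simp
        then have "cmod (snd q) \<le> norm (q - p)" using dist_snd_le[of q p] by (simp add: dist_norm)
        then show ?thesis using less1[OF qe] mult_mono[of "cmod (fst q)" 1 "cmod (snd q)" "norm (q - p)"] by (simp add: norm_mult)
      qed
      then have "(cmod (fst q * snd q))\<^sup>2 \<le> (norm (q - p))\<^sup>2" by (intro power_mono) auto
      then show ?thesis using c(1) c(2)[OF qe] by (meson mult_left_mono order_trans)
    qed
    show ?thesis unfolding has_derivative_at_alt
    proof (intro conjI allI impI)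
      fix e :: real assume e: "e > 0"
      show "\<exists>d>0. \<forall>y. norm (y - p) < d \<longrightarrow> norm (h y - h p - 0) \<le> e * norm (y - p)"
      proof (intro exI[of _ "min r (e / (c + 1))"] conjI allI impI)
        fix y assume y: "norm (y - p) < min r (e / (c + 1))"
        have "c * norm (y - p) \<le> (c + 1) * (e / (c + 1))" using y c(1) by (intro mult_mono) auto
        then have "c * norm (y - p) \<le> e" using c(1) by simp
        then have "c * norm (y - p) * norm (y - p) \<le> e * norm (y - p)" by (intro mult_right_mono) auto
        then show "norm (h y - h p - 0) \<le> e * norm (y - p)"
          using b[of y] y hp by (simp add: power2_eq_square mult.assoc)
      qed (use r e c in auto)
    qed simp
  qed
  have der: "\<exists>h'. (\<forall>q\<in>bidisc \<epsilon>. (h has_derivative h' q) (at q)) \<and> (\<forall>w. \<exists>k. QF (Suc N) k \<and> (\<forall>q\<in>bidisc \<epsilon>. h' q w = k q))"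
    if h: "QF N h" "N \<le> L" for N h
  proof -
    obtain h' where h': "\<forall>q\<in>Uq - D. (h has_derivative h' q) (at q)" "\<forall>w. \<exists>k. QF (Suc N) k \<and> (\<forall>q\<in>Uq - D. h' q w = k q)"
      using QF_deriv[OF h(1)] by blast
    define h'' where "h'' q w = (if fst q * snd q = 0 then 0 else h' q w)" for q w
    have qU: "q \<in> Uq - D" if "q \<in> bidisc \<epsilon>" "fst q * snd q \<noteq> 0" for q
      using that sub by (auto simp: D_def)
    show ?thesis
    proof (intro exI[of _ h''] conjI ballI allI)
      fix q assume q: "q \<in> bidisc \<epsilon>"
      show "(h has_derivative h'' q) (at q)"
      proof (cases "fst q * snd q = 0")
        case True
        then have "h'' q = (\<lambda>w. 0)" by (simp add: h''_def fun_eq_iff)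
        then show ?thesis using deriv0[OF h q True] by simp
      next
        case False
        then have "h'' q = h' q" by (simp add: h''_def fun_eq_iff)
        then show ?thesis using h'(1) qU[OF q False] by simp
      qed
    next
      fix w
      obtain k where k: "QF (Suc N) k" "\<forall>q\<in>Uq - D. h' q w = k q" using h'(2) by blast
      have "h'' q w = k q" if q: "q \<in> bidisc \<epsilon>" for q
      proof (cases "fst q * snd q = 0")
        case True
        then show ?thesis using QF_zero[OF k(1) True] by (simp add: h''_def)
      next
        case False
        then show ?thesis using k(2) qU[OF q False] by (simp add: h''_def)
      qed
      then show "\<exists>k. QF (Suc N) k \<and> (\<forall>q\<in>bidisc \<epsilon>. h'' q w = k q)" using k(1) by blast
    qed
  qed
  have "Ck_on k h (bidisc \<epsilon>)" if "QF N h" "N + k \<le> L" for N h k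
    using that
  proof (induction k arbitrary: N h)
    case 0
    obtain h' where "\<forall>q\<in>bidisc \<epsilon>. (h has_derivative h' q) (at q)" using der[OF 0(1)] 0(2) by auto
    then show ?case by (auto intro!: continuous_at_imp_continuous_on has_derivative_continuous)
  next
    case (Suc k)
    obtain h' where h': "\<forall>q\<in>bidisc \<epsilon>. (h has_derivative h' q) (at q)" "\<forall>w. \<exists>k. QF (Suc N) k \<and> (\<forall>q\<in>bidisc \<epsilon>. h' q w = k q)"
      using der[OF Suc.prems(1)] Suc.prems(2) by auto
    have fr: "frechet_derivative h (at q) = h' q" if "q \<in> bidisc \<epsilon>" for q
      using frechet_derivative_at[of h "h' q" q] h'(1) that by simp
    have "Ck_on k (\<lambda>q. frechet_derivative h (at q) w) (bidisc \<epsilon>)" for w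
    proof -
      obtain l where l: "QF (Suc N) l" "\<forall>q\<in>bidisc \<epsilon>. h' q w = l q" using h'(2) by blast
      have "Ck_on k l (bidisc \<epsilon>)" by (rule Suc.IH[OF l(1)]) (use Suc.prems in simp)
      then show ?thesis by (rule Ck_on_cong[OF open_bidisc, rotated]) (use l(2) fr in auto)
    qed
    then show ?case using h'(1) by (auto simp: differentiable_def)
  qed
  then show ?thesis using \<epsilon>(1) sub by (intro that[of \<epsilon>]) auto
qed

lemma closed_class_QF: "closed_class {h. \<exists>N. QF N h} (Uq - D)"
  unfolding closed_class_def
proof (intro conjI ballI open_Uq_D)
  fix h assume "h \<in> {h. \<exists>N. QF N h}"
  then obtain N where N: "QF N h" by blast
  then obtain h' where "\<forall>q\<in>Uq - D. (h has_derivative h' q) (at q)" "\<forall>w. \<exists>k. QF (Suc N) k \<and> (\<forall>q\<in>Uq - D. h' q w = k q)"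
    using QF_deriv[OF N] by blast
  then show "\<exists>f'. (\<forall>x\<in>Uq - D. (h has_derivative f' x) (at x)) \<and> (\<forall>w. \<exists>g\<in>{h. \<exists>N. QF N h}. \<forall>x\<in>Uq - D. f' x w = g x)"
    by (intro exI[of _ h']) blast
qed

lemma CM_scale: "g \<in> CM \<Longrightarrow> (\<lambda>z. r * g z) \<in> CM"
proof -
  assume "g \<in> CM"
  then obtain f where f: "f \<in> fam_mod AM GM" "g = (\<lambda>z. \<Sum>\<^sub>\<infinity>i\<in>JM. f i z)" by (auto simp: CM_def)
  have "(\<lambda>i z. r * f i z) \<in> fam_mod AM GM" by (intro fam_mod.mult fam_poly.const f(1))
  moreover have "(\<lambda>z. r * g z) = (\<lambda>z. \<Sum>\<^sub>\<infinity>i\<in>JM. r * f i z)" by (simp add: f(2) infsum_cmult_right')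
  ultimately show ?thesis unfolding CM_def mem_Collect_eq by (intro exI[of _ "\<lambda>i z. r * f i z"] conjI)
qed

lemma CT_scale: "g \<in> CT \<Longrightarrow> (\<lambda>z. r * g z) \<in> CT"
proof -
  assume "g \<in> CT"
  then obtain f where f: "f \<in> fam_mod AT GT" "g = (\<lambda>z. \<Sum>\<^sub>\<infinity>i\<in>JT. f i z)" by (auto simp: CT_def)
  have "(\<lambda>i z. r * f i z) \<in> fam_mod AT GT" by (intro fam_mod.mult fam_poly.const f(1))
  moreover have "(\<lambda>z. r * g z) = (\<lambda>z. \<Sum>\<^sub>\<infinity>i\<in>JT. r * f i z)" by (simp add: f(2) infsum_cmult_right')
  ultimately show ?thesis unfolding CT_def mem_Collect_eq by (intro exI[of _ "\<lambda>i z. r * f i z"] conjI)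
qed

text \<open>Translating z amounts to replacing (b, c, d) by (b - d j, c - d k, d). This permutes
  \<open>JM\<close>, because m + b c changes by a multiple of d, and it leaves the terms
  matched.\<close>

lemma matrix_sum_add_int: "matrix_sum (z + (of_int j, of_int k)) = matrix_sum z"
proof -
  define \<phi> where "\<phi> = (\<lambda>(b, c, d). (b - d * j, c - d * k, d :: int))"
  have dv: "d dvd m + (b - d * j) * (c - d * k) \<longleftrightarrow> d dvd m + b * c" for b c d :: int
  proof -
    have "m + (b - d * j) * (c - d * k) = (m + b * c) + d * (d * j * k - j * c - b * k)" by (simp add: algebra_simps)
    then show ?thesis by (metis dvd_add_times_triv_right_iff mult.commute)
  qed
  have dv': "d dvd m + (b + d * j) * (c + d * k) \<longleftrightarrow> d dvd m + b * c" for b c d :: int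
    using dv[of d "b + d * j" "c + d * k"] by simp
  have bij: "bij_betw \<phi> JM JM"
    by (rule bij_betw_byWitness[where f'="\<lambda>(b, c, d). (b + d * j, c + d * k, d)"])
       (auto simp: \<phi>_def JM_def dv dv')
  have "XM (\<phi> i) z = XM i (z + (of_int j, of_int k))" for i
  proof -
    obtain b c d where i: "i = (b, c, d)" by (cases i) auto
    have "u1 (\<phi> i) z = u1 i (z + (of_int j, of_int k))" "u2 (\<phi> i) z = u2 i (z + (of_int j, of_int k))"
      by (simp_all add: u1_def u2_def i \<phi>_def algebra_simps)
    moreover have "snd (snd (\<phi> i)) = snd (snd i)" by (simp add: i \<phi>_def)
    ultimately show ?thesis unfolding XM_def Q_re_def Q_im_def by simp
  qed
  then show ?thesis unfolding matrix_sum_def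
    using infsum_reindex_bij_betw[OF bij, of "\<lambda>i. nEi (XM i z)"] by simp
qed

lemma fourier_sum_add_int: "fourier_sum (z + (of_int j, of_int k)) = fourier_sum z"
proof -
  have "fourier_term i (z + (of_int j, of_int k)) = fourier_term i z" for i
  proof -
    obtain b c n where i: "i = (b, c, n)" by (cases i) auto
    have e: "phase i (z + (of_int j, of_int k)) = phase i z + 2 * pi * of_int (n * (b * k + c * j))"
      by (simp add: phase_def i algebra_simps)
    have "cos (phase i (z + (of_int j, of_int k))) = cos (phase i z)"
      unfolding e cos_add cos_int_2pin sin_int_2pin by simp
    then show ?thesis unfolding fourier_term_def eT_def erf_arg_def om_def tpar_def by simp
  qed
  then show ?thesis by (simp add: fourier_sum_def)
qed

definition smooth_part :: "complex \<times> complex \<Rightarrow> real" where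
  "smooth_part z = 1/2 * matrix_sum z + 1/2 * fourier_sum z"

lemma smooth_part_in_CP: "smooth_part \<in> CP"
proof -
  have "periodic smooth_part" unfolding periodic_def
  proof (intro ballI impI)
    fix z z' assume "qmap z = qmap z'"
    then obtain j k :: int where "z' = z + (of_int j, of_int k)" by (rule qmap_eqD)
    then show "smooth_part z = smooth_part z'"
      by (simp add: smooth_part_def matrix_sum_add_int fourier_sum_add_int)
  qed
  moreover have "smooth_part = (\<lambda>z. 1/2 * matrix_sum z + 1/2 * fourier_sum z)"
    by (simp add: smooth_part_def fun_eq_iff)
  ultimately show ?thesis unfolding CP_def mem_Collect_eq
    by (intro conjI bexI[OF _ CM_scale[OF matrix_sum_in_CM, of "1/2"]] bexI[OF _ CT_scale[OF fourier_sum_in_CT, of "1/2"]])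
qed

end

subsection \<open>The holomorphic part\<close>

text \<open>Contains the coefficients of the derivatives of the logarithms left over for m < 0 and
  is stable under complex differentiation. The exponents \<open>Suc j\<close> and
  \<open>Suc k\<close> are positive, so the monomial has modulus below 1 on the bidisc and the
  reciprocal has no pole there.\<close>

inductive_set hol_alg :: "(complex \<times> complex \<Rightarrow> complex) set" where
  const: "(\<lambda>q. c) \<in> hol_alg"
| coord1: "fst \<in> hol_alg"
| coord2: "snd \<in> hol_alg"
| add: "f \<in> hol_alg \<Longrightarrow> g \<in> hol_alg \<Longrightarrow> (\<lambda>q. f q + g q) \<in> hol_alg"
| mult: "f \<in> hol_alg \<Longrightarrow> g \<in> hol_alg \<Longrightarrow> (\<lambda>q. f q * g q) \<in> hol_alg"
| inv: "(\<lambda>q. 1 / (1 - fst q ^ Suc j * snd q ^ Suc k)) \<in> hol_alg"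

lemma hol_alg_power: "f \<in> hol_alg \<Longrightarrow> (\<lambda>q. f q ^ n) \<in> hol_alg"
  by (induction n) (auto intro: hol_alg.intros)

lemma hol_alg_coord_power: "(\<lambda>q. fst q ^ n) \<in> hol_alg" "(\<lambda>q. snd q ^ n) \<in> hol_alg"
  using hol_alg_power[OF hol_alg.coord1] hol_alg_power[OF hol_alg.coord2] by auto

lemma monomial_less_1:
  assumes "q \<in> bidisc 1"
  shows "cmod (fst q ^ Suc j * snd q ^ Suc k) < 1"
proof -
  have c: "cmod (fst q) < 1" "cmod (snd q) < 1" using assms by (auto simp: bidisc_def)
  have "cmod (fst q) ^ Suc j \<le> cmod (fst q) ^ 1" using c by (intro power_decreasing) auto
  moreover have "cmod (snd q) ^ Suc k \<le> 1" using c by (intro power_le_one) auto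
  ultimately have "cmod (fst q) ^ Suc j * cmod (snd q) ^ Suc k \<le> cmod (fst q) ^ 1 * 1"
    by (intro mult_mono) auto
  then have "cmod (fst q) ^ Suc j * cmod (snd q) ^ Suc k < 1" using c by simp
  then show ?thesis by (simp add: norm_mult norm_power)
qed

lemma has_derivative_monomial:
  fixes q :: "complex \<times> complex"
  shows "((\<lambda>q. fst q ^ Suc j * snd q ^ Suc k) has_derivative
     (\<lambda>h. fst h * (of_nat (Suc j) * fst q ^ j * snd q ^ Suc k) + snd h * (of_nat (Suc k) * (fst q ^ Suc j * snd q ^ k)))) (at q)"
proof -
  have 1: "((\<lambda>q. fst q ^ Suc j) has_derivative (\<lambda>h. of_nat (Suc j) * fst h * fst q ^ (Suc j - 1))) (at q)"
    by (intro has_derivative_power has_derivative_fst has_derivative_ident)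
  have 2: "((\<lambda>q. snd q ^ Suc k) has_derivative (\<lambda>h. of_nat (Suc k) * snd h * snd q ^ (Suc k - 1))) (at q)"
    by (intro has_derivative_power has_derivative_snd has_derivative_ident)
  have "fst q ^ Suc j * (of_nat (Suc k) * snd h * snd q ^ (Suc k - 1)) + of_nat (Suc j) * fst h * fst q ^ (Suc j - 1) * snd q ^ Suc k
    = fst h * (of_nat (Suc j) * fst q ^ j * snd q ^ Suc k) + snd h * (of_nat (Suc k) * (fst q ^ Suc j * snd q ^ k))" for h
    by (simp only: diff_Suc_1 mult_ac add.commute)
  then show ?thesis using has_derivative_mult[OF 1 2] by (simp only:)
qed

lemma hol_alg_deriv:
  assumes "f \<in> hol_alg"
  shows "\<exists>f1\<in>hol_alg. \<exists>f2\<in>hol_alg. \<forall>q\<in>bidisc 1. (f has_derivative (\<lambda>h. fst h * f1 q + snd h * f2 q)) (at q)"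
  using assms
proof induction
  case (const c)
  show ?case
    by (rule bexI[of _ "\<lambda>q. 0"], rule bexI[of _ "\<lambda>q. 0"]) (auto intro: hol_alg.const)
next
  case coord1
  show ?case
    by (rule bexI[of _ "\<lambda>q. 1"], rule bexI[of _ "\<lambda>q. 0"]) (auto intro: hol_alg.const has_derivative_fst)
next
  case coord2
  show ?case
    by (rule bexI[of _ "\<lambda>q. 0"], rule bexI[of _ "\<lambda>q. 1"]) (auto intro: hol_alg.const has_derivative_snd)
next
  case (add f g)
  then obtain f1 f2 g1 g2 where f: "f1 \<in> hol_alg" "f2 \<in> hol_alg" "g1 \<in> hol_alg" "g2 \<in> hol_alg"
    "\<forall>q\<in>bidisc 1. (f has_derivative (\<lambda>h. fst h * f1 q + snd h * f2 q)) (at q)"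
    "\<forall>q\<in>bidisc 1. (g has_derivative (\<lambda>h. fst h * g1 q + snd h * g2 q)) (at q)" by blast
  show ?case
  proof (rule bexI[of _ "\<lambda>q. f1 q + g1 q"], rule bexI[of _ "\<lambda>q. f2 q + g2 q"], rule ballI)
    fix q assume "q \<in> bidisc 1"
    then have "((\<lambda>q. f q + g q) has_derivative (\<lambda>h. (fst h * f1 q + snd h * f2 q) + (fst h * g1 q + snd h * g2 q))) (at q)"
      using f by (intro has_derivative_add) auto
    then show "((\<lambda>q. f q + g q) has_derivative (\<lambda>h. fst h * (f1 q + g1 q) + snd h * (f2 q + g2 q))) (at q)"
      by (simp add: algebra_simps)
  qed (auto intro!: hol_alg.add f)
next
  case (mult f g)
  then obtain f1 f2 g1 g2 where f: "f1 \<in> hol_alg" "f2 \<in> hol_alg" "g1 \<in> hol_alg" "g2 \<in> hol_alg"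
    "\<forall>q\<in>bidisc 1. (f has_derivative (\<lambda>h. fst h * f1 q + snd h * f2 q)) (at q)"
    "\<forall>q\<in>bidisc 1. (g has_derivative (\<lambda>h. fst h * g1 q + snd h * g2 q)) (at q)" by blast
  show ?case
  proof (rule bexI[of _ "\<lambda>q. f q * g1 q + f1 q * g q"], rule bexI[of _ "\<lambda>q. f q * g2 q + f2 q * g q"], rule ballI)
    fix q assume "q \<in> bidisc 1"
    then have "((\<lambda>q. f q * g q) has_derivative (\<lambda>h. f q * (fst h * g1 q + snd h * g2 q) + (fst h * f1 q + snd h * f2 q) * g q)) (at q)"
      using f by (intro has_derivative_mult) auto
    then show "((\<lambda>q. f q * g q) has_derivative (\<lambda>h. fst h * (f q * g1 q + f1 q * g q) + snd h * (f q * g2 q + f2 q * g q))) (at q)"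
      by (simp add: algebra_simps)
  qed (auto intro!: hol_alg.add hol_alg.mult f mult.hyps)
next
  case (inv j k)
  define r where "r q = 1 / (1 - fst q ^ Suc j * snd q ^ Suc k)" for q :: "complex \<times> complex"
  have r: "r \<in> hol_alg" unfolding r_def[abs_def] by (rule hol_alg.inv)
  show ?case
  proof (rule bexI[of _ "\<lambda>q. (of_nat (Suc j) * fst q ^ j * snd q ^ Suc k) * (r q * r q)"],
      rule bexI[of _ "\<lambda>q. (of_nat (Suc k) * (fst q ^ Suc j * snd q ^ k)) * (r q * r q)"], rule ballI)
    fix q :: "complex \<times> complex" assume q: "q \<in> bidisc 1"
    define Q where "Q q = fst q ^ Suc j * snd q ^ Suc k" for q :: "complex \<times> complex"
    have nz: "1 - Q q \<noteq> 0" using monomial_less_1[OF q, of j k] unfolding Q_def by auto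
    define dQ where "dQ h = fst h * (of_nat (Suc j) * fst q ^ j * snd q ^ Suc k) + snd h * (of_nat (Suc k) * (fst q ^ Suc j * snd q ^ k))"
      for h :: "complex \<times> complex"
    have Q: "(Q has_derivative dQ) (at q)" unfolding Q_def[abs_def] dQ_def[abs_def] by (rule has_derivative_monomial)
    have "((\<lambda>q. 1 / (1 - Q q)) has_derivative (\<lambda>h. dQ h * (1 / (1 - Q q) * (1 / (1 - Q q))))) (at q)"
      using nz by (auto intro!: derivative_eq_intros Q simp: field_simps)
    then show "((\<lambda>q. 1 / (1 - fst q ^ Suc j * snd q ^ Suc k)) has_derivative
      (\<lambda>h. fst h * ((of_nat (Suc j) * fst q ^ j * snd q ^ Suc k) * (r q * r q))
        + snd h * ((of_nat (Suc k) * (fst q ^ Suc j * snd q ^ k)) * (r q * r q)))) (at q)"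
      unfolding r_def Q_def dQ_def distrib_right mult.assoc .
  qed (intro hol_alg.mult hol_alg.const hol_alg_coord_power r)+
qed

definition log_term :: "nat \<Rightarrow> nat \<Rightarrow> complex \<times> complex \<Rightarrow> real" where
  "log_term j k q = - ln ((cmod (1 - fst q ^ Suc j * snd q ^ Suc k))\<^sup>2)"

text \<open>Each partial derivative keeps a factor of the other coordinate. Together with the factor
  q1 or q2 gained by passing to z this makes all derivatives in z multiples of q1 q2.\<close>

lemma log_term_deriv:
  "\<exists>l1\<in>hol_alg. \<exists>l2\<in>hol_alg. \<forall>q\<in>bidisc 1.
     (log_term j k has_derivative (\<lambda>h. Re (fst h * (snd q * l1 q) + snd h * (fst q * l2 q)))) (at q)"
proof (rule bexI[of _ "\<lambda>q. 2 * (of_nat (Suc j) * (fst q ^ j * snd q ^ k) * (1 / (1 - fst q ^ Suc j * snd q ^ Suc k)))"],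
      rule bexI[of _ "\<lambda>q. 2 * (of_nat (Suc k) * (fst q ^ j * snd q ^ k) * (1 / (1 - fst q ^ Suc j * snd q ^ Suc k)))"], rule ballI)
  fix q :: "complex \<times> complex" assume q: "q \<in> bidisc 1"
  define Q where "Q q = fst q ^ Suc j * snd q ^ Suc k" for q :: "complex \<times> complex"
  define dQ where "dQ h = fst h * (of_nat (Suc j) * fst q ^ j * snd q ^ Suc k) + snd h * (of_nat (Suc k) * (fst q ^ Suc j * snd q ^ k))"
    for h :: "complex \<times> complex"
  have Q: "(Q has_derivative dQ) (at q)" unfolding Q_def[abs_def] dQ_def[abs_def] by (rule has_derivative_monomial)
  have less: "cmod (Q p) < 1" if "p \<in> bidisc 1" for p using monomial_less_1[OF that] by (simp only: Q_def)
  have Repos: "Re (1 - Q p) > 0" if "p \<in> bidisc 1" for p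
    using less[OF that] complex_Re_le_cmod[of "Q p"] by simp
  have "1 - Q q \<notin> \<real>\<^sub>\<le>\<^sub>0" using Repos[OF q] by (auto simp: complex_nonpos_Reals_iff)
  then have Ln: "(Ln has_derivative (\<lambda>w. inverse (1 - Q q) * w)) (at (1 - Q q))"
    using has_field_derivative_Ln by (simp add: has_field_derivative_def)
  have "((\<lambda>p. 1 - Q p) has_derivative (\<lambda>h. 0 - dQ h)) (at q)"
    by (intro has_derivative_diff has_derivative_const Q)
  from has_derivative_compose[OF this Ln]
  have "((\<lambda>p. Ln (1 - Q p)) has_derivative (\<lambda>h. inverse (1 - Q q) * (0 - dQ h))) (at q)" .
  then have "((\<lambda>p. (- 2) * Re (Ln (1 - Q p))) has_derivative (\<lambda>h. (- 2) * Re (inverse (1 - Q q) * (0 - dQ h)))) (at q)"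
    by (intro has_derivative_mult_right has_derivative_Re)
  then have "(log_term j k has_derivative (\<lambda>h. (- 2) * Re (inverse (1 - Q q) * (0 - dQ h)))) (at q)"
  proof (rule has_derivative_transform_within_open[OF _ open_bidisc q])
    fix p :: "complex \<times> complex" assume p: "p \<in> bidisc 1"
    then have nz: "1 - Q p \<noteq> 0" using Repos[OF p] by force
    then show "(- 2) * Re (Ln (1 - Q p)) = log_term j k p"
      by (simp add: log_term_def Q_def[symmetric] ln_realpow del: power_Suc)
  qed
  moreover have "(- 2) * Re (inverse (1 - Q q) * (0 - dQ h)) =
     Re (fst h * (snd q * (2 * (of_nat (Suc j) * (fst q ^ j * snd q ^ k) * (1 / (1 - fst q ^ Suc j * snd q ^ Suc k)))))
       + snd h * (fst q * (2 * (of_nat (Suc k) * (fst q ^ j * snd q ^ k) * (1 / (1 - fst q ^ Suc j * snd q ^ Suc k))))))" for h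
  proof -
    have "fst h * (snd q * (2 * (of_nat (Suc j) * (fst q ^ j * snd q ^ k) * (1 / (1 - fst q ^ Suc j * snd q ^ Suc k)))))
       + snd h * (fst q * (2 * (of_nat (Suc k) * (fst q ^ j * snd q ^ k) * (1 / (1 - fst q ^ Suc j * snd q ^ Suc k)))))
       = 2 * (dQ h * (1 / (1 - Q q)))"
      unfolding dQ_def Q_def by (simp add: algebra_simps)
    also have "\<dots> = (- 2) *\<^sub>R (inverse (1 - Q q) * (0 - dQ h))"
      by (simp add: scaleR_conv_of_real inverse_eq_divide)
    finally show ?thesis by (simp only: scaleR_complex.sel)
  qed
  ultimately show "(log_term j k has_derivative (\<lambda>h. Re (fst h * (snd q * (2 * (of_nat (Suc j) * (fst q ^ j * snd q ^ k) * (1 / (1 - fst q ^ Suc j * snd q ^ Suc k)))))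
       + snd h * (fst q * (2 * (of_nat (Suc k) * (fst q ^ j * snd q ^ k) * (1 / (1 - fst q ^ Suc j * snd q ^ Suc k)))))))) (at q)"
    by (simp only:)
qed (intro hol_alg.mult hol_alg.const hol_alg_coord_power hol_alg.inv)+

lemma log_sum_deriv:
  assumes "finite P"
  shows "\<exists>l1\<in>hol_alg. \<exists>l2\<in>hol_alg. \<forall>q\<in>bidisc 1.
     ((\<lambda>q. \<Sum>p\<in>P. r * log_term (j p) (k p) q) has_derivative (\<lambda>h. Re (fst h * (snd q * l1 q) + snd h * (fst q * l2 q)))) (at q)"
  using assms
proof (induction P rule: finite_induct)
  case empty
  show ?case
    by (rule bexI[of _ "\<lambda>q. 0"], rule bexI[of _ "\<lambda>q. 0"]) (auto intro: hol_alg.const)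
next
  case (insert x P)
  obtain l1 l2 where l: "l1 \<in> hol_alg" "l2 \<in> hol_alg"
    "\<forall>q\<in>bidisc 1. ((\<lambda>q. \<Sum>p\<in>P. r * log_term (j p) (k p) q) has_derivative (\<lambda>h. Re (fst h * (snd q * l1 q) + snd h * (fst q * l2 q)))) (at q)"
    using insert.IH by blast
  obtain a1 a2 where a: "a1 \<in> hol_alg" "a2 \<in> hol_alg"
    "\<forall>q\<in>bidisc 1. (log_term (j x) (k x) has_derivative (\<lambda>h. Re (fst h * (snd q * a1 q) + snd h * (fst q * a2 q)))) (at q)"
    using log_term_deriv by blast
  show ?case
  proof (rule bexI[of _ "\<lambda>q. of_real r * a1 q + l1 q"], rule bexI[of _ "\<lambda>q. of_real r * a2 q + l2 q"], rule ballI)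
    fix q :: "complex \<times> complex" assume q: "q \<in> bidisc 1"
    have "((\<lambda>q. r * log_term (j x) (k x) q + (\<Sum>p\<in>P. r * log_term (j p) (k p) q)) has_derivative
       (\<lambda>h. r * Re (fst h * (snd q * a1 q) + snd h * (fst q * a2 q)) + Re (fst h * (snd q * l1 q) + snd h * (fst q * l2 q)))) (at q)"
      using a(3) l(3) q by (intro has_derivative_add has_derivative_mult_right) auto
    moreover have "r * Re (fst h * (snd q * a1 q) + snd h * (fst q * a2 q)) + Re (fst h * (snd q * l1 q) + snd h * (fst q * l2 q))
      = Re (fst h * (snd q * (of_real r * a1 q + l1 q)) + snd h * (fst q * (of_real r * a2 q + l2 q)))" for h
    proof -
      have "r * Re (fst h * (snd q * a1 q) + snd h * (fst q * a2 q)) = Re (of_real r * (fst h * (snd q * a1 q) + snd h * (fst q * a2 q)))" by simp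
      then have "r * Re (fst h * (snd q * a1 q) + snd h * (fst q * a2 q)) + Re (fst h * (snd q * l1 q) + snd h * (fst q * l2 q))
        = Re (of_real r * (fst h * (snd q * a1 q) + snd h * (fst q * a2 q)) + (fst h * (snd q * l1 q) + snd h * (fst q * l2 q)))"
        by (simp only: plus_complex.sel)
      also have "of_real r * (fst h * (snd q * a1 q) + snd h * (fst q * a2 q)) + (fst h * (snd q * l1 q) + snd h * (fst q * l2 q))
        = fst h * (snd q * (of_real r * a1 q + l1 q)) + snd h * (fst q * (of_real r * a2 q + l2 q))" by (simp add: algebra_simps)
      finally show ?thesis .
    qed
    ultimately show "((\<lambda>q. \<Sum>p\<in>insert x P. r * log_term (j p) (k p) q) has_derivative
      (\<lambda>h. Re (fst h * (snd q * (of_real r * a1 q + l1 q)) + snd h * (fst q * (of_real r * a2 q + l2 q))))) (at q)"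
      using insert.hyps by simp
  qed (auto intro!: hol_alg.add hol_alg.mult hol_alg.const a l)
qed

lemma closed_class_hol_alg:
  fixes H :: "complex \<times> complex \<Rightarrow> real"
  assumes H: "l1 \<in> hol_alg" "l2 \<in> hol_alg"
    "\<forall>q\<in>bidisc 1. (H has_derivative (\<lambda>h. Re (fst h * (snd q * l1 q) + snd h * (fst q * l2 q)))) (at q)"
  shows "closed_class (insert H {\<lambda>q. Re (f q) | f. f \<in> hol_alg}) (bidisc 1)"
  unfolding closed_class_def
proof (intro conjI ballI open_bidisc)
  fix g assume "g \<in> insert H {\<lambda>q. Re (f q) | f. f \<in> hol_alg}"
  then obtain f1 f2 where f: "f1 \<in> hol_alg" "f2 \<in> hol_alg"
    "\<forall>q\<in>bidisc 1. (g has_derivative (\<lambda>h. Re (fst h * f1 q + snd h * f2 q))) (at q)"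
  proof
    assume "g = H"
    then show ?thesis using H by (intro that[of "\<lambda>q. snd q * l1 q" "\<lambda>q. fst q * l2 q"]) (auto intro: hol_alg.intros)
  next
    assume "g \<in> {\<lambda>q. Re (f q) | f. f \<in> hol_alg}"
    then obtain f where g: "g = (\<lambda>q. Re (f q))" "f \<in> hol_alg" by blast
    then obtain f1 f2 where "f1 \<in> hol_alg" "f2 \<in> hol_alg" "\<forall>q\<in>bidisc 1. (f has_derivative (\<lambda>h. fst h * f1 q + snd h * f2 q)) (at q)"
      using hol_alg_deriv by blast
    note f = this
    have "\<forall>q\<in>bidisc 1. (g has_derivative (\<lambda>h. Re (fst h * f1 q + snd h * f2 q))) (at q)"
      unfolding g(1) using f(3) by (intro ballI has_derivative_Re) blast
    then show ?thesis using f by (intro that[of f1 f2])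
  qed
  show "\<exists>g'. (\<forall>q\<in>bidisc 1. (g has_derivative g' q) (at q)) \<and>
      (\<forall>w. \<exists>k\<in>insert H {\<lambda>q. Re (f q) | f. f \<in> hol_alg}. \<forall>q\<in>bidisc 1. g' q w = k q)"
  proof (intro exI[of _ "\<lambda>q h. Re (fst h * f1 q + snd h * f2 q)"] conjI f(3) allI)
    fix w
    have "(\<lambda>q. fst w * f1 q + snd w * f2 q) \<in> hol_alg" by (intro hol_alg.intros f)
    then have "(\<lambda>q. Re (fst w * f1 q + snd w * f2 q)) \<in> insert H {\<lambda>q. Re (f q) | f. f \<in> hol_alg}"
      by (intro insertI2 CollectI exI[of _ "\<lambda>q. fst w * f1 q + snd w * f2 q"]) auto
    then show "\<exists>k\<in>insert H {\<lambda>q. Re (f q) | f. f \<in> hol_alg}. \<forall>q\<in>bidisc 1. Re (fst w * f1 q + snd w * f2 q) = k q"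
      by (rule bexI[rotated]) simp
  qed
qed

lemma has_derivative_qmap:
  "(qmap has_derivative (\<lambda>h. (2 * pi * \<i> * fst h * fst (qmap z), 2 * pi * \<i> * snd h * snd (qmap z)))) (at z)"
proof -
  have e: "((\<lambda>z. exp (2 * pi * \<i> * f z)) has_derivative (\<lambda>h. 2 * pi * \<i> * f h * exp (2 * pi * \<i> * f z))) (at z)"
    if "bounded_linear f" for f :: "complex \<times> complex \<Rightarrow> complex"
  proof -
    have f: "((\<lambda>z. 2 * pi * \<i> * f z) has_derivative (\<lambda>h. 2 * pi * \<i> * f h)) (at z)"
      by (intro has_derivative_mult_right bounded_linear_imp_has_derivative that)
    have "(exp has_derivative (\<lambda>w. exp (2 * pi * \<i> * f z) * w)) (at (2 * pi * \<i> * f z))"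
      using DERIV_exp[of "2 * pi * \<i> * f z"] by (simp add: has_field_derivative_def)
    from has_derivative_compose[OF f this] show ?thesis by (simp only: mult.commute)
  qed
  show ?thesis unfolding qmap_def[abs_def] using has_derivative_Pair[OF e[OF bounded_linear_fst] e[OF bounded_linear_snd]]
    by (simp add: mult.commute)
qed

text \<open>The derivative in z_j is 2 pi i q_j times that in q_j. Starting from \<open>H\<close>
  this gives the real part of q1 q2 times a member of \<open>hol_alg\<close>, a form that further
  derivatives preserve and that vanishes on the divisor.\<close>

lemma closed_class_hol_alg_qmap:
  fixes H :: "complex \<times> complex \<Rightarrow> real"
  assumes H: "l1 \<in> hol_alg" "l2 \<in> hol_alg"
    "\<forall>q\<in>bidisc 1. (H has_derivative (\<lambda>h. Re (fst h * (snd q * l1 q) + snd h * (fst q * l2 q)))) (at q)"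
    and S: "open S" "\<And>z. z \<in> S \<Longrightarrow> qmap z \<in> bidisc 1"
  shows "closed_class (insert (\<lambda>z. H (qmap z)) {\<lambda>z. Re (fst (qmap z) * snd (qmap z) * f (qmap z)) | f. f \<in> hol_alg}) S"
  unfolding closed_class_def
proof (intro conjI ballI S)
  let ?C = "insert (\<lambda>z. H (qmap z)) {\<lambda>z. Re (fst (qmap z) * snd (qmap z) * f (qmap z)) | f. f \<in> hol_alg}"
  fix g assume "g \<in> ?C"
  then obtain G f1 f2 where g: "g = (\<lambda>z. G (qmap z))" and f: "f1 \<in> hol_alg" "f2 \<in> hol_alg"
    "\<forall>q\<in>bidisc 1. (G has_derivative (\<lambda>h. Re (fst h * (snd q * f1 q) + snd h * (fst q * f2 q)))) (at q)"
  proof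
    assume "g = (\<lambda>z. H (qmap z))"
    then show ?thesis using H by (intro that[of H l1 l2])
  next
    assume "g \<in> {\<lambda>z. Re (fst (qmap z) * snd (qmap z) * f (qmap z)) | f. f \<in> hol_alg}"
    then obtain f where g: "g = (\<lambda>z. Re (fst (qmap z) * snd (qmap z) * f (qmap z)))" "f \<in> hol_alg" by blast
    then obtain f1 f2 where f: "f1 \<in> hol_alg" "f2 \<in> hol_alg" "\<forall>q\<in>bidisc 1. (f has_derivative (\<lambda>h. fst h * f1 q + snd h * f2 q)) (at q)"
      using hol_alg_deriv by blast
    show ?thesis
    proof (rule that[of "\<lambda>q. Re (fst q * snd q * f q)" "\<lambda>q. f q + fst q * f1 q" "\<lambda>q. f q + snd q * f2 q"])
      show "\<forall>q\<in>bidisc 1. ((\<lambda>q. Re (fst q * snd q * f q)) has_derivative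
        (\<lambda>h. Re (fst h * (snd q * (f q + fst q * f1 q)) + snd h * (fst q * (f q + snd q * f2 q))))) (at q)"
      proof
        fix q :: "complex \<times> complex" assume "q \<in> bidisc 1"
        then have "(f has_derivative (\<lambda>h. fst h * f1 q + snd h * f2 q)) (at q)" using f(3) by blast
        then have "((\<lambda>q. fst q * snd q * f q) has_derivative
           (\<lambda>h. fst q * snd q * (fst h * f1 q + snd h * f2 q) + (fst q * snd h + fst h * snd q) * f q)) (at q)"
          by (intro has_derivative_mult has_derivative_fst has_derivative_snd has_derivative_ident)
        moreover have "fst q * snd q * (fst h * f1 q + snd h * f2 q) + (fst q * snd h + fst h * snd q) * f q
          = fst h * (snd q * (f q + fst q * f1 q)) + snd h * (fst q * (f q + snd q * f2 q))" for h :: "complex \<times> complex"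
          by (simp add: algebra_simps)
        ultimately show "((\<lambda>q. Re (fst q * snd q * f q)) has_derivative
          (\<lambda>h. Re (fst h * (snd q * (f q + fst q * f1 q)) + snd h * (fst q * (f q + snd q * f2 q))))) (at q)"
          by (intro has_derivative_Re) (simp only:)
      qed
    qed (use g f in \<open>auto intro!: hol_alg.add hol_alg.mult hol_alg.coord1 hol_alg.coord2\<close>)
  qed
  show "\<exists>g'. (\<forall>z\<in>S. (g has_derivative g' z) (at z)) \<and> (\<forall>w. \<exists>k\<in>?C. \<forall>z\<in>S. g' z w = k z)"
  proof (intro exI[of _ "\<lambda>z h. Re (2 * pi * \<i> * fst h * fst (qmap z) * (snd (qmap z) * f1 (qmap z))
       + 2 * pi * \<i> * snd h * snd (qmap z) * (fst (qmap z) * f2 (qmap z)))"] conjI ballI allI)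
    fix z assume z: "z \<in> S"
    have "(G has_derivative (\<lambda>h. Re (fst h * (snd (qmap z) * f1 (qmap z)) + snd h * (fst (qmap z) * f2 (qmap z))))) (at (qmap z))"
      using f(3) S(2)[OF z] by blast
    from has_derivative_compose[OF has_derivative_qmap this]
    show "(g has_derivative (\<lambda>h. Re (2 * pi * \<i> * fst h * fst (qmap z) * (snd (qmap z) * f1 (qmap z))
       + 2 * pi * \<i> * snd h * snd (qmap z) * (fst (qmap z) * f2 (qmap z))))) (at z)"
      unfolding g by simp
  next
    fix w :: "complex \<times> complex"
    define k where "k q = (2 * pi * \<i> * fst w) * f1 q + (2 * pi * \<i> * snd w) * f2 q" for q
    have "k \<in> hol_alg" unfolding k_def[abs_def] by (intro hol_alg.intros f)
    then have "(\<lambda>z. Re (fst (qmap z) * snd (qmap z) * k (qmap z))) \<in> ?C" by blast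
    moreover have "2 * pi * \<i> * fst w * fst q * (snd q * f1 q) + 2 * pi * \<i> * snd w * snd q * (fst q * f2 q)
      = fst q * snd q * k q" for q by (simp add: k_def algebra_simps)
    ultimately show "\<exists>k\<in>?C. \<forall>z\<in>S. Re (2 * pi * \<i> * fst w * fst (qmap z) * (snd (qmap z) * f1 (qmap z))
       + 2 * pi * \<i> * snd w * snd (qmap z) * (fst (qmap z) * f2 (qmap z))) = k z"
      by (intro bexI[of _ "\<lambda>z. Re (fst (qmap z) * snd (qmap z) * k (qmap z))"]) simp_all
  qed
qed

section \<open>The expansion\<close>

text \<open>The usual exponential exp (2 pi i (x + i y)), with height and real part as separate
  arguments.\<close>

definition cexp :: "real \<Rightarrow> real \<Rightarrow> complex" where
  "cexp y x = exp (Complex (- 2 * pi * y) (2 * pi * x))"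

lemma cexp_add: "cexp y x * cexp y' x' = cexp (y + y') (x + x')"
proof -
  have "Complex (- 2 * pi * y) (2 * pi * x) + Complex (- 2 * pi * y') (2 * pi * x')
    = Complex (- 2 * pi * (y + y')) (2 * pi * (x + x'))" by (simp add: complex_eq_iff algebra_simps)
  then show ?thesis unfolding cexp_def exp_add[symmetric] by simp
qed

lemma cmod_cexp: "cmod (cexp y x) = exp (- 2 * pi * y)"
  by (simp add: cexp_def norm_exp_eq_Re)

lemma cexp_power: "cexp y x ^ n = cexp (real n * y) (real n * x)"
proof -
  have "of_nat n * Complex (- 2 * pi * y) (2 * pi * x) = Complex (- 2 * pi * (real n * y)) (2 * pi * (real n * x))"
    by (simp add: complex_eq_iff)
  then show ?thesis unfolding cexp_def exp_of_nat_mult[symmetric] by simp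
qed

lemma qmap_cexp: "fst (qmap z) = cexp (Im (fst z)) (Re (fst z))" "snd (qmap z) = cexp (Im (snd z)) (Re (snd z))"
proof -
  have "2 * complex_of_real pi * \<i> * w = Complex (- 2 * pi * Im w) (2 * pi * Re w)" for w
    by (simp add: complex_eq_iff)
  then show "fst (qmap z) = cexp (Im (fst z)) (Re (fst z))" "snd (qmap z) = cexp (Im (snd z)) (Re (snd z))"
    by (simp_all add: qmap_def cexp_def)
qed

lemma cmod_one_minus_cexp_minus: "cmod (1 - cexp y (- x)) = cmod (1 - cexp y x)"
proof -
  have "Complex (- 2 * pi * y) (2 * pi * - x) = cnj (Complex (- 2 * pi * y) (2 * pi * x))" by (simp add: complex_eq_iff)
  then have "cexp y (- x) = cnj (cexp y x)" unfolding cexp_def by (simp only: exp_cnj)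
  then have "1 - cexp y (- x) = cnj (1 - cexp y x)" by simp
  then show ?thesis by (simp only: complex_mod_cnj)
qed

lemma cexp_eq_1: "cexp y x = 1 \<Longrightarrow> y = 0 \<and> x \<in> \<int>"
proof -
  assume "cexp y x = 1"
  then obtain n :: int where n: "- 2 * pi * y = 0" "2 * pi * x = of_int (2 * n) * pi"
    unfolding cexp_def exp_eq_1 by auto
  then have "x = of_int n" by simp
  then show ?thesis using n by auto
qed

text \<open>The larger of the two exponentials, the one of smaller height, is factored out of their
  difference. Its modulus exp (- 2 pi min) is the origin of the correction \<open>I\<close>.\<close>

lemma ln_one_minus_cexp_diff:
  assumes "cexp \<bar>Y1 - Y2\<bar> (X1 - X2) \<noteq> 1"
  shows "- ln ((cmod (1 - cexp \<bar>Y1 - Y2\<bar> (X1 - X2)))\<^sup>2)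
    = - ln ((cmod (cexp Y1 X1 - cexp Y2 X2))\<^sup>2) - 4 * pi * min Y2 Y1"
proof -
  have main: "- ln ((cmod (1 - cexp (Y1 - Y2) (X1 - X2)))\<^sup>2) = - ln ((cmod (cexp Y1 X1 - cexp Y2 X2))\<^sup>2) - 4 * pi * Y2"
    if nz: "cexp (Y1 - Y2) (X1 - X2) \<noteq> 1" for Y1 Y2 X1 X2
  proof -
    have "cexp Y2 X2 - cexp Y1 X1 = cexp Y2 X2 * (1 - cexp (Y1 - Y2) (X1 - X2))"
      by (simp add: right_diff_distrib cexp_add)
    then have "cmod (cexp Y1 X1 - cexp Y2 X2) = exp (- 2 * pi * Y2) * cmod (1 - cexp (Y1 - Y2) (X1 - X2))"
      by (metis cmod_cexp norm_minus_commute norm_mult)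
    moreover have "cmod (1 - cexp (Y1 - Y2) (X1 - X2)) > 0" using nz by simp
    ultimately show ?thesis by (simp add: ln_mult ln_realpow)
  qed
  show ?thesis
  proof (cases "Y1 \<ge> Y2")
    case True
    then show ?thesis using main[of Y1 Y2 X1 X2] assms by simp
  next
    case False
    then have eq: "\<bar>Y1 - Y2\<bar> = Y2 - Y1" by simp
    have s: "cmod (1 - cexp (Y2 - Y1) (X1 - X2)) = cmod (1 - cexp (Y2 - Y1) (X2 - X1))"
      using cmod_one_minus_cexp_minus[of "Y2 - Y1" "X2 - X1"] by simp
    have "cmod (1 - cexp (Y2 - Y1) (X1 - X2)) \<noteq> 0" using assms eq by simp
    then have "cexp (Y2 - Y1) (X2 - X1) \<noteq> 1" unfolding s by auto
    from main[OF this] show ?thesis using False unfolding eq s by (simp add: norm_minus_commute min_def)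
  qed
qed

lemma B_eq_heat_tail:
  assumes v: "v > 0"
  shows "B v s b c = sqrt v * heat_tail v (of_int b / s + of_int c * s)"
proof -
  define w where "w = of_int b / s + of_int c * s"
  have "B v s b c = (LINT r:{v..}|lborel. exp (- pi * v * w\<^sup>2 * (r / v)) * (r / v) powr (- 3/2)) / v"
    unfolding B_def w_def by (rule set_integral_Ici_scale[OF v])
  also have "(LINT r:{v..}|lborel. exp (- pi * v * w\<^sup>2 * (r / v)) * (r / v) powr (- 3/2))
     = (LINT r:{v..}|lborel. v powr (3/2) * (exp (- pi * w\<^sup>2 * r) * r powr (- 3/2)))"
  proof (rule set_lebesgue_integral_cong)
    show "\<forall>r. r \<in> {v..} \<longrightarrow> exp (- pi * v * w\<^sup>2 * (r / v)) * (r / v) powr (- 3/2) = v powr (3/2) * (exp (- pi * w\<^sup>2 * r) * r powr (- 3/2))"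
    proof (intro allI impI)
      fix r assume r: "r \<in> {v..}"
      have "(r / v) powr (- 3/2) = r powr (- 3/2) * v powr (3/2)"
        using r v by (simp add: powr_divide powr_minus_divide)
      moreover have "- pi * v * w\<^sup>2 * (r / v) = - pi * w\<^sup>2 * r" using v by simp
      ultimately show "exp (- pi * v * w\<^sup>2 * (r / v)) * (r / v) powr (- 3/2) = v powr (3/2) * (exp (- pi * w\<^sup>2 * r) * r powr (- 3/2))"
        by (simp only: mult_ac)
    qed
  qed simp
  also have "\<dots> = v powr (3/2) * heat_tail v w" unfolding heat_tail_def by (rule set_integral_mult_right)
  also have "v powr (3/2) = v * sqrt v"
  proof -
    have "v powr (3/2) = v powr (1 + 1/2)" by simp
    also have "\<dots> = v * sqrt v" using v unfolding powr_add by (simp add: powr_half_sqrt)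
    finally show ?thesis .
  qed
  finally show ?thesis using v unfolding w_def by simp
qed

definition mat4 :: "int \<Rightarrow> int \<Rightarrow> int \<Rightarrow> int \<Rightarrow> int^2^2" where
  "mat4 a b c d = vector [vector [a, b], vector [c, d]]"

lemma mat4_nth [simp]: "mat4 a b c d $ 1 $ 1 = a" "mat4 a b c d $ 1 $ 2 = b" "mat4 a b c d $ 2 $ 1 = c" "mat4 a b c d $ 2 $ 2 = d"
  by (simp_all add: mat4_def)

lemma mat4_collapse: "mat4 (M $ 1 $ 1) (M $ 1 $ 2) (M $ 2 $ 1) (M $ 2 $ 2) = M"
  by (simp add: vec_eq_iff forall_2)

lemma Lset_iff: "M \<in> Lset m \<longleftrightarrow> M $ 1 $ 1 * M $ 2 $ 2 - M $ 1 $ 2 * M $ 2 $ 1 = m"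
  by (simp add: Lset_def det_2)

context boundary_expansion
begin

lemma R_eq_XM:
  assumes i: "(b, c, d) \<in> JM" and z: "z \<in> Om"
  shows "2 * pi * v * R z (mat4 ((m + b * c) div d) b c d) = XM (b, c, d) z"
proof -
  define x1 x2 y1 y2 where "x1 = Re (fst z)" and "x2 = Re (snd z)" and "y1 = Im (fst z)" and "y2 = Im (snd z)"
  have y: "y1 > 0" "y2 > 0" using OmD[OF z] by (auto simp: y1_def y2_def)
  have d: "d \<noteq> 0" "d dvd m + b * c" using i by (auto simp: JM_def)
  define a where "a = (m + b * c) div d"
  have "a * d = m + b * c" using d unfolding a_def by simp
  then have "real_of_int (a * d) = real_of_int (m + b * c)" by simp
  then have ad: "of_int a * real_of_int d = of_int m + of_int b * of_int c" by simp
  have z1: "fst z = Complex x1 y1" "snd z = Complex x2 y2" by (simp_all add: x1_def x2_def y1_def y2_def)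
  define w where "w = of_int a - of_int b * snd z - of_int c * fst z + of_int d * fst z * snd z"
  have dr: "real_of_int d \<noteq> 0" using d by simp
  have Rw: "Re w = of_int a - of_int b * x2 - of_int c * x1 + of_int d * (x1 * x2 - y1 * y2)"
    by (simp add: w_def z1 algebra_simps)
  have Iw: "Im w = - of_int b * y2 - of_int c * y1 + of_int d * (x1 * y2 + y1 * x2)"
    by (simp add: w_def z1 algebra_simps)
  have "Q_re (b, c, d) z * of_int d = Re w * of_int d"
    unfolding Q_re_def u1_def u2_def Rw x1_def[symmetric] x2_def[symmetric] y1_def[symmetric] y2_def[symmetric]
    using dr by (simp add: algebra_simps) (simp add: ad[symmetric] algebra_simps)
  then have Qr: "Q_re (b, c, d) z = Re w" using dr by simp
  have Qi: "Q_im (b, c, d) z = Im w"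
    unfolding Q_im_def u1_def u2_def Iw x1_def[symmetric] x2_def[symmetric] y1_def[symmetric] y2_def[symmetric]
    by (simp add: algebra_simps)
  have "R z (mat4 a b c d) = (cmod w)\<^sup>2 / (2 * y1 * y2)"
    unfolding R_def w_def y1_def y2_def by simp
  also have "(cmod w)\<^sup>2 = Q_re (b, c, d) z * Q_re (b, c, d) z + Q_im (b, c, d) z * Q_im (b, c, d) z"
    unfolding Qr Qi cmod_power2 by (simp only: power2_eq_square)
  finally show ?thesis unfolding a_def XM_def y1_def y2_def by simp
qed

lemma R_eq_line_arg:
  assumes z: "z \<in> Om"
  shows "2 * pi * v * R z (mat4 a b c 0) = v * line_arg (tpar z) (om (b, c, 0) z / tpar z) (of_int b * Re (snd z) + of_int c * Re (fst z)) a"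
proof -
  define x1 x2 y1 y2 where "x1 = Re (fst z)" and "x2 = Re (snd z)" and "y1 = Im (fst z)" and "y2 = Im (snd z)"
  have y: "y1 > 0" "y2 > 0" using OmD[OF z] by (auto simp: y1_def y2_def)
  have z1: "fst z = Complex x1 y1" "snd z = Complex x2 y2" by (simp_all add: x1_def x2_def y1_def y2_def)
  define w where "w = of_int a - of_int b * snd z - of_int c * fst z"
  have "R z (mat4 a b c 0) = (cmod w)\<^sup>2 / (2 * y1 * y2)"
    unfolding R_def w_def y1_def y2_def by simp
  also have "(cmod w)\<^sup>2 = (of_int a - (of_int b * x2 + of_int c * x1))\<^sup>2 + (of_int b * y2 + of_int c * y1)\<^sup>2"
    unfolding cmod_power2 w_def z1 by (simp add: power2_eq_square algebra_simps)
  finally show ?thesis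
    unfolding line_arg_def om_def using tpar_bounds(3)[OF z] y
    by (simp add: power_divide x1_def[symmetric] x2_def[symmetric] y1_def[symmetric] y2_def[symmetric] field_simps)
qed

text \<open>The matrices are sorted by whether the lower right entry vanishes. As to the second
  conclusion, a line with w = 0 and x an integer a would contain a matrix with upper left entry a
  and R = 0, which \<open>nz\<close> excludes.\<close>

lemma Xi_eq:
  assumes z: "z \<in> Om" and nz: "\<forall>M\<in>Lset m. R z M \<noteq> 0"
  shows "Xi v z m = 1/2 * matrix_sum z + 1/2 * (\<Sum>(b, c) | - b * c = m.
    line_sum v (tpar z) (om (b, c, 0) z / tpar z) (of_int b * Re (snd z) + of_int c * Re (fst z)))"
    and "\<And>b c. - b * c = m \<Longrightarrow> om (b, c, 0) z / tpar z \<noteq> 0 \<or> of_int b * Re (snd z) + of_int c * Re (fst z) \<notin> \<int>"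
proof -
  define f where "f M = nEi (2 * pi * v * R z M)" for M
  define P where "P = {(b, c). - b * c = m}"
  have fin: "finite P" unfolding P_def by (rule finite_factorisations)
  have t: "tpar z > 0" using tpar_bounds(1)[OF z] by simp
  define w where "w = (\<lambda>(b, c). om (b, c, 0) z / tpar z)"
  define x where "x = (\<lambda>(b, c). of_int b * Re (snd z) + of_int c * Re (fst z))"
  have wx: "w p \<noteq> 0 \<or> x p \<notin> \<int>" if p: "p \<in> P" for p
  proof (rule ccontr)
    assume n: "\<not> (w p \<noteq> 0 \<or> x p \<notin> \<int>)"
    obtain b c where bc: "p = (b, c)" "- b * c = m" using p by (auto simp: P_def)
    from n obtain a where a: "x p = of_int a" "w p = 0" by (auto elim: Ints_cases)
    have "2 * pi * v * R z (mat4 a b c 0) = v * line_arg (tpar z) (w p) (x p) a"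
      unfolding R_eq_line_arg[OF z] by (simp add: w_def x_def bc)
    also have "\<dots> = 0" using a by (simp add: line_arg_def)
    finally have "R z (mat4 a b c 0) = 0" using v by simp
    moreover have "mat4 a b c 0 \<in> Lset m" using bc by (simp add: Lset_iff)
    ultimately show False using nz by blast
  qed
  then show "om (b, c, 0) z / tpar z \<noteq> 0 \<or> of_int b * Re (snd z) + of_int c * Re (fst z) \<notin> \<int>" if "- b * c = m" for b c
    using that unfolding P_def w_def x_def by auto
  define L1 where "L1 = {M \<in> Lset m. M $ 2 $ 2 \<noteq> 0}"
  define L0 where "L0 = {M \<in> Lset m. M $ 2 $ 2 = 0}"
  define h1 where "h1 = (\<lambda>(b, c, d). mat4 ((m + b * c) div d) b c d)"
  define h0 where "h0 = (\<lambda>(p :: int \<times> int, a). mat4 a (fst p) (snd p) 0)"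
  have bij1: "bij_betw h1 JM L1"
  proof (rule bij_betw_byWitness[where f'="\<lambda>M. (M $ 1 $ 2, M $ 2 $ 1, M $ 2 $ 2)"])
    show "\<forall>i\<in>JM. (h1 i $ 1 $ 2, h1 i $ 2 $ 1, h1 i $ 2 $ 2) = i" by (auto simp: h1_def)
    show "h1 ` JM \<subseteq> L1" by (auto simp: h1_def JM_def L1_def Lset_iff)
    have *: "M $ 1 $ 1 * M $ 2 $ 2 = m + M $ 1 $ 2 * M $ 2 $ 1" if "M \<in> Lset m" for M
      using that by (simp add: Lset_iff algebra_simps)
    show "\<forall>M\<in>L1. h1 (M $ 1 $ 2, M $ 2 $ 1, M $ 2 $ 2) = M"
    proof
      fix M assume M: "M \<in> L1"
      then have M': "M \<in> Lset m" "M $ 2 $ 2 \<noteq> 0" unfolding L1_def by simp_all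
      have "(m + M $ 1 $ 2 * M $ 2 $ 1) div M $ 2 $ 2 = M $ 1 $ 1"
        unfolding *[OF M'(1), symmetric] by (rule nonzero_mult_div_cancel_right[OF M'(2)])
      then show "h1 (M $ 1 $ 2, M $ 2 $ 1, M $ 2 $ 2) = M" by (simp add: h1_def mat4_collapse)
    qed
    show "(\<lambda>M. (M $ 1 $ 2, M $ 2 $ 1, M $ 2 $ 2)) ` L1 \<subseteq> JM"
    proof (rule image_subsetI)
      fix M assume M: "M \<in> L1"
      then have M': "M \<in> Lset m" "M $ 2 $ 2 \<noteq> 0" unfolding L1_def by simp_all
      have "M $ 2 $ 2 dvd m + M $ 1 $ 2 * M $ 2 $ 1" unfolding *[OF M'(1), symmetric] by (rule dvd_triv_right)
      then show "(M $ 1 $ 2, M $ 2 $ 1, M $ 2 $ 2) \<in> JM" using M'(2) by (simp add: JM_def)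
    qed
  qed
  have bij0: "bij_betw h0 (P \<times> UNIV) L0"
  proof (rule bij_betw_byWitness[where f'="\<lambda>M. ((M $ 1 $ 2, M $ 2 $ 1), M $ 1 $ 1)"])
    show "\<forall>M\<in>L0. h0 ((M $ 1 $ 2, M $ 2 $ 1), M $ 1 $ 1) = M"
    proof
      fix M assume "M \<in> L0"
      then have "M $ 2 $ 2 = 0" by (simp add: L0_def)
      then show "h0 ((M $ 1 $ 2, M $ 2 $ 1), M $ 1 $ 1) = M" using mat4_collapse[of M] by (simp add: h0_def)
    qed
  qed (auto simp: h0_def P_def L0_def Lset_iff)
  have f1: "f (h1 i) = nEi (XM i z)" if "i \<in> JM" for i
    using that R_eq_XM[OF _ z] by (cases i) (simp add: f_def h1_def)
  have f0: "f (h0 (p, a)) = nEi (v * line_arg (tpar z) (w p) (x p) a)" for p a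
    by (cases p) (simp only: f_def h0_def w_def x_def prod.case fst_conv snd_conv R_eq_line_arg[OF z])
  have s1: "(\<lambda>i. f (h1 i)) summable_on JM"
    using summable_matrix_sum[OF z] by (subst summable_on_cong[OF f1])
  have s0: "(\<lambda>y. f (h0 y)) summable_on (P \<times> UNIV)"
  proof (rule summable_on_SigmaI[where g="\<lambda>p. line_sum v (tpar z) (w p) (x p)"])
    fix p assume "p \<in> P"
    then show "((\<lambda>a. f (h0 (p, a))) has_sum line_sum v (tpar z) (w p) (x p)) UNIV"
      unfolding f0 line_sum_def by (intro has_sum_infsum summable_line_sum v t wx)
  qed (use fin in \<open>auto simp: f0 nEi_nonneg\<close>)
  have "Lset m = L1 \<union> L0" "L1 \<inter> L0 = {}" by (auto simp: L1_def L0_def)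
  moreover have "f summable_on L1" using s1 summable_on_reindex_bij_betw[OF bij1, of f] by simp
  moreover have "f summable_on L0" using s0 summable_on_reindex_bij_betw[OF bij0, of f] by simp
  ultimately have "infsum f (Lset m) = infsum f L1 + infsum f L0" by (simp add: infsum_Un_disjoint)
  also have "infsum f L1 = matrix_sum z"
  proof -
    have "(\<Sum>\<^sub>\<infinity>i\<in>JM. f (h1 i)) = (\<Sum>\<^sub>\<infinity>i\<in>JM. nEi (XM i z))" by (rule infsum_cong) (rule f1)
    then show ?thesis unfolding matrix_sum_def using infsum_reindex_bij_betw[OF bij1, of f] by simp
  qed
  also have "infsum f L0 = (\<Sum>\<^sub>\<infinity>y\<in>P \<times> UNIV. f (h0 y))"
    using infsum_reindex_bij_betw[OF bij0, of f] by simp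
  also have "\<dots> = (\<Sum>\<^sub>\<infinity>p\<in>P. \<Sum>\<^sub>\<infinity>a. f (h0 (p, a)))" using infsum_Sigma_banach[OF s0] by simp
  also have "\<dots> = (\<Sum>p\<in>P. line_sum v (tpar z) (w p) (x p))" using fin by (simp add: f0 line_sum_def)
  finally have "infsum f (Lset m) = matrix_sum z + (\<Sum>p\<in>P. line_sum v (tpar z) (w p) (x p))" .
  moreover have "(\<Sum>p\<in>P. line_sum v (tpar z) (w p) (x p)) = (\<Sum>(b, c) | - b * c = m.
    line_sum v (tpar z) (om (b, c, 0) z / tpar z) (of_int b * Re (snd z) + of_int c * Re (fst z)))"
    unfolding P_def w_def x_def by (intro sum.cong) auto
  ultimately show "Xi v z m = 1/2 * matrix_sum z + 1/2 * (\<Sum>(b, c) | - b * c = m.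
    line_sum v (tpar z) (om (b, c, 0) z / tpar z) (of_int b * Re (snd z) + of_int c * Re (fst z)))"
    unfolding Xi_def f_def by simp
qed

text \<open>The logarithms of the lines with m < 0; for m > 0 they are in \<open>Lfun\<close>
  already. Subtracting 1 from the exponents undoes the \<open>Suc\<close> in
  \<open>log_term\<close>.\<close>

definition log_part :: "complex \<times> complex \<Rightarrow> real" where
  "log_part q = (\<Sum>p\<in>(if m < 0 then {(b, c). - b * c = m} else {}).
     1/2 * log_term (nat \<bar>snd p\<bar> - 1) (nat \<bar>fst p\<bar> - 1) q)"

text \<open>The sign of b c = - m decides. For m > 0 the imaginary part of b z2 + c z1 is, up to
  sign, a difference of two positive heights, which yields \<open>Lfun\<close> and the minimum in
  \<open>I\<close>. For m < 0 it is their sum up to sign, the exponential is a monomial in q1 and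
  q2, and I = 0.\<close>

lemma line_term_eq:
  assumes z: "z \<in> Om" and bc: "- b * c = m"
    and nz: "om (b, c, 0) z / tpar z \<noteq> 0 \<or> of_int b * Re (snd z) + of_int c * Re (fst z) \<notin> \<int>"
  shows "line_sum v (tpar z) (om (b, c, 0) z / tpar z) (of_int b * Re (snd z) + of_int c * Re (fst z))
      + tail_sum v (tpar z) (om (b, c, 0) z / tpar z) (of_int b * Re (snd z) + of_int c * Re (fst z))
    = (if m > 0 then - ln ((cmod (fst (qmap z) ^ nat \<bar>c\<bar> - snd (qmap z) ^ nat \<bar>b\<bar>))\<^sup>2)
        else log_term (nat \<bar>c\<bar> - 1) (nat \<bar>b\<bar> - 1) (qmap z))
      + tpar z / sqrt v * (B v (spar z) b c - I v (spar z) b c)"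
proof -
  define x1 x2 y1 y2 where "x1 = Re (fst z)" and "x2 = Re (snd z)" and "y1 = Im (fst z)" and "y2 = Im (snd z)"
  have y: "y1 > 0" "y2 > 0" using OmD[OF z] by (auto simp: y1_def y2_def)
  define t where "t = tpar z"
  define s where "s = spar z"
  have t: "t > 0" using tpar_bounds(1)[OF z] by (simp add: t_def)
  have s: "s > 0" using y by (simp add: s_def spar_def y1_def[symmetric] y2_def[symmetric])
  have ts: "t * s = y1" "t / s = y2"
    using y by (simp_all add: t_def s_def tpar_def spar_def y1_def[symmetric] y2_def[symmetric] real_sqrt_mult real_sqrt_divide)
  define w where "w = om (b, c, 0) z / t"
  define x where "x = of_int b * x2 + of_int c * x1"
  have wt: "w * t = of_int b * y2 + of_int c * y1" using t by (simp add: w_def om_def y1_def y2_def)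
  have w: "w = of_int b / s + of_int c * s"
  proof -
    have "w * t = (of_int b / s + of_int c * s) * t" unfolding wt ts[symmetric] by (simp add: algebra_simps)
    then show ?thesis using t by simp
  qed
  have heat: "t * heat_tail v w = t / sqrt v * B v s b c"
    unfolding B_eq_heat_tail[OF v] w using v by simp
  have cne: "cexp (\<bar>w\<bar> * t) x \<noteq> 1"
  proof
    assume "cexp (\<bar>w\<bar> * t) x = 1"
    then have "\<bar>w\<bar> * t = 0" "x \<in> \<int>" using cexp_eq_1 by blast+
    then show False using nz t unfolding w_def t_def x_def x1_def x2_def by simp
  qed
  have id: "line_sum v t w x = t * heat_tail v w - ln ((cmod (1 - cexp (\<bar>w\<bar> * t) x))\<^sup>2) - tail_sum v t w x"
    unfolding cexp_def using nz by (intro line_sum_identity v t) (simp add: w_def t_def x_def x1_def x2_def)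
  have wta: "\<bar>w\<bar> * t = \<bar>of_int b * y2 + of_int c * y1\<bar>" unfolding wt[symmetric] using t by (simp add: abs_mult)
  have b0: "b \<noteq> 0" "c \<noteq> 0" using bc m by auto
  define \<beta> \<gamma> where "\<beta> = real (nat \<bar>b\<bar>)" and "\<gamma> = real (nat \<bar>c\<bar>)"
  have bg: "\<beta> = \<bar>of_int b\<bar>" "\<gamma> = \<bar>of_int c\<bar>" by (simp_all add: \<beta>_def \<gamma>_def)
  have qp: "fst (qmap z) ^ nat \<bar>c\<bar> = cexp (\<gamma> * y1) (\<gamma> * x1)" "snd (qmap z) ^ nat \<bar>b\<bar> = cexp (\<beta> * y2) (\<beta> * x2)"
    unfolding qmap_cexp cexp_power \<beta>_def \<gamma>_def x1_def x2_def y1_def y2_def by simp_all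
  have log: "- ln ((cmod (1 - cexp (\<bar>w\<bar> * t) x))\<^sup>2) = (if m > 0 then - ln ((cmod (fst (qmap z) ^ nat \<bar>c\<bar> - snd (qmap z) ^ nat \<bar>b\<bar>))\<^sup>2)
        else log_term (nat \<bar>c\<bar> - 1) (nat \<bar>b\<bar> - 1) (qmap z)) - t / sqrt v * I v s b c"
  proof (cases "m > 0")
    case True
    then have neg: "b * c < 0" using bc by simp
    have I: "t / sqrt v * I v s b c = 4 * pi * min (\<beta> * y2) (\<gamma> * y1)"
    proof -
      have "t * min (\<bar>of_int b\<bar> / s) (\<bar>of_int c\<bar> * s) = min (t * (\<bar>of_int b\<bar> / s)) (t * (\<bar>of_int c\<bar> * s))"
        using t by (simp add: min_mult_distrib_left)
      moreover have "t * (\<bar>of_int b\<bar> / s) = \<beta> * y2" "t * (\<bar>of_int c\<bar> * s) = \<gamma> * y1"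
        unfolding bg ts[symmetric] by simp_all
      ultimately have "t * min (\<bar>of_int b\<bar> / s) (\<bar>of_int c\<bar> * s) = min (\<beta> * y2) (\<gamma> * y1)" by simp
      moreover have "t / sqrt v * I v s b c = 4 * pi * (t * min (\<bar>of_int b\<bar> / s) (\<bar>of_int c\<bar> * s))"
        unfolding I_def using neg v by simp
      ultimately show ?thesis by simp
    qed
    have sg: "(b > 0 \<and> c < 0) \<or> (b < 0 \<and> c > 0)" using neg by (auto simp: mult_less_0_iff)
    have a: "\<bar>w\<bar> * t = \<bar>\<gamma> * y1 - \<beta> * y2\<bar>" and xs: "x = \<gamma> * x1 - \<beta> * x2 \<or> x = - (\<gamma> * x1 - \<beta> * x2)"
      unfolding wta x_def bg using sg by (auto simp: algebra_simps)
    \<comment> \<open>Changing the sign of \<open>x\<close> conjugates the exponential, so the sign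
      left open in \<open>xs\<close> does not affect the modulus.\<close>
    have cm: "cmod (1 - cexp (\<bar>w\<bar> * t) x) = cmod (1 - cexp \<bar>\<gamma> * y1 - \<beta> * y2\<bar> (\<gamma> * x1 - \<beta> * x2))"
      using xs cmod_one_minus_cexp_minus unfolding a by metis
    have "cexp \<bar>\<gamma> * y1 - \<beta> * y2\<bar> (\<gamma> * x1 - \<beta> * x2) \<noteq> 1"
    proof
      assume "cexp \<bar>\<gamma> * y1 - \<beta> * y2\<bar> (\<gamma> * x1 - \<beta> * x2) = 1"
      then have "cmod (1 - cexp (\<bar>w\<bar> * t) x) = 0" unfolding cm by simp
      then show False using cne by simp
    qed
    from ln_one_minus_cexp_diff[OF this] show ?thesis unfolding cm qp I using True by simp
  next
    case False
    then have pos: "b * c > 0" using bc m by linarith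
    have I: "I v s b c = 0" unfolding I_def using pos by simp
    have sg: "(b > 0 \<and> c > 0) \<or> (b < 0 \<and> c < 0)" using pos by (auto simp: zero_less_mult_iff)
    have a: "\<bar>w\<bar> * t = \<gamma> * y1 + \<beta> * y2" and xs: "x = \<gamma> * x1 + \<beta> * x2 \<or> x = - (\<gamma> * x1 + \<beta> * x2)"
    proof -
      show "x = \<gamma> * x1 + \<beta> * x2 \<or> x = - (\<gamma> * x1 + \<beta> * x2)"
        unfolding x_def bg using sg by auto
      have "of_int b * y2 + of_int c * y1 = \<gamma> * y1 + \<beta> * y2 \<or> of_int b * y2 + of_int c * y1 = - (\<gamma> * y1 + \<beta> * y2)"
        unfolding bg using sg by auto
      moreover have "\<gamma> * y1 + \<beta> * y2 \<ge> 0" unfolding bg using y by simp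
      ultimately show "\<bar>w\<bar> * t = \<gamma> * y1 + \<beta> * y2" unfolding wta by (metis abs_minus_cancel abs_of_nonneg)
    qed
    have cm: "cmod (1 - cexp (\<bar>w\<bar> * t) x) = cmod (1 - cexp (\<gamma> * y1 + \<beta> * y2) (\<gamma> * x1 + \<beta> * x2))"
      using xs cmod_one_minus_cexp_minus unfolding a by metis
    have "Suc (nat \<bar>c\<bar> - 1) = nat \<bar>c\<bar>" "Suc (nat \<bar>b\<bar> - 1) = nat \<bar>b\<bar>" using b0 by auto
    then have "log_term (nat \<bar>c\<bar> - 1) (nat \<bar>b\<bar> - 1) (qmap z) = - ln ((cmod (1 - cexp (\<gamma> * y1 + \<beta> * y2) (\<gamma> * x1 + \<beta> * x2)))\<^sup>2)"
      unfolding log_term_def by (simp only: qp cexp_add)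
    then show ?thesis using False unfolding cm I by simp
  qed
  have "line_sum v t w x + tail_sum v t w x = - ln ((cmod (1 - cexp (\<bar>w\<bar> * t) x))\<^sup>2) + t * heat_tail v w"
    unfolding id by simp
  also have "\<dots> = (if m > 0 then - ln ((cmod (fst (qmap z) ^ nat \<bar>c\<bar> - snd (qmap z) ^ nat \<bar>b\<bar>))\<^sup>2)
        else log_term (nat \<bar>c\<bar> - 1) (nat \<bar>b\<bar> - 1) (qmap z)) + t / sqrt v * (B v s b c - I v s b c)"
    unfolding log heat by (simp add: right_diff_distrib)
  finally show ?thesis unfolding w_def x_def t_def s_def x1_def x2_def .
qed

definition remainder :: "complex \<times> complex \<Rightarrow> real" where
  "remainder q = down smooth_part q + log_part q"

lemma Xi_expansion:
  assumes z: "z \<in> Om" and nz: "\<forall>M\<in>Lset m. R z M \<noteq> 0"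
  shows "Xi v z m = Lfun (qmap z) m
    + 1/2 * (\<Sum>(b, c) | - b * c = m. tpar z / sqrt v * (B v (spar z) b c - I v (spar z) b c))
    + remainder (qmap z)"
proof -
  define P where "P = {(b, c). - b * c = m}"
  define ls where "ls = (\<lambda>(b, c). line_sum v (tpar z) (om (b, c, 0) z / tpar z) (of_int b * Re (snd z) + of_int c * Re (fst z)))"
  define ts where "ts = (\<lambda>(b, c). tail_sum v (tpar z) (om (b, c, 0) z / tpar z) (of_int b * Re (snd z) + of_int c * Re (fst z)))"
  define lg where "lg = (\<lambda>(b, c). if m > 0 then - ln ((cmod (fst (qmap z) ^ nat \<bar>c\<bar> - snd (qmap z) ^ nat \<bar>b\<bar>))\<^sup>2)
        else log_term (nat \<bar>c\<bar> - 1) (nat \<bar>b\<bar> - 1) (qmap z))"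
  define bi where "bi = (\<lambda>(b, c). tpar z / sqrt v * (B v (spar z) b c - I v (spar z) b c))"
  have "ls p + ts p = lg p + bi p" if "p \<in> P" for p
  proof -
    obtain b c where p: "p = (b, c)" "- b * c = m" using \<open>p \<in> P\<close> by (auto simp: P_def)
    show ?thesis using line_term_eq[OF z p(2) Xi_eq(2)[OF z nz p(2)]] unfolding p ls_def ts_def lg_def bi_def by simp
  qed
  then have "(\<Sum>p\<in>P. ls p) + (\<Sum>p\<in>P. ts p) = (\<Sum>p\<in>P. lg p) + (\<Sum>p\<in>P. bi p)"
    unfolding sum.distrib[symmetric] by (rule sum.cong[OF refl])
  moreover have "Xi v z m = 1/2 * matrix_sum z + 1/2 * (\<Sum>p\<in>P. ls p)"
    using Xi_eq(1)[OF z nz] unfolding P_def ls_def .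
  moreover have "fourier_sum z = - (\<Sum>p\<in>P. ts p)"
    using fourier_sum_eq[OF z] unfolding P_def ts_def .
  moreover have "1/2 * (\<Sum>p\<in>P. lg p) = Lfun (qmap z) m + log_part (qmap z)"
  proof (cases "m > 0")
    case True
    then have "(\<Sum>p\<in>P. lg p) = (\<Sum>(b, c) | - b * c = m. - ln ((cmod (fst (qmap z) ^ nat \<bar>c\<bar> - snd (qmap z) ^ nat \<bar>b\<bar>))\<^sup>2))"
      unfolding P_def lg_def by (intro sum.cong) auto
    then show ?thesis using True unfolding Lfun_def log_part_def by simp
  next
    case False
    then have "1/2 * (\<Sum>p\<in>P. lg p) = (\<Sum>p\<in>P. 1/2 * log_term (nat \<bar>snd p\<bar> - 1) (nat \<bar>fst p\<bar> - 1) (qmap z))"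
      unfolding sum_distrib_left lg_def by (intro sum.cong) (auto simp: case_prod_unfold)
    then show ?thesis using False m unfolding Lfun_def log_part_def P_def by simp
  qed
  moreover have "remainder (qmap z) = 1/2 * matrix_sum z + 1/2 * fourier_sum z + log_part (qmap z)"
    unfolding remainder_def down_qmap[OF smooth_part_in_CP z] by (simp add: smooth_part_def)
  ultimately show ?thesis unfolding P_def bi_def by linarith
qed

lemma smooth_vanishing_remainder: "smooth_vanishing_along_D remainder Uq"
proof -
  define P where "P = (if m < 0 then {(b, c). - b * c = m} else {})"
  have fin: "finite P" unfolding P_def using finite_factorisations by auto
  obtain l1 l2 where l: "l1 \<in> hol_alg" "l2 \<in> hol_alg"
    "\<forall>q\<in>bidisc 1. (log_part has_derivative (\<lambda>h. Re (fst h * (snd q * l1 q) + snd h * (fst q * l2 q)))) (at q)"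
    using log_sum_deriv[OF fin, of "1/2" "\<lambda>p. nat \<bar>snd p\<bar> - 1" "\<lambda>p. nat \<bar>fst p\<bar> - 1"]
    unfolding log_part_def[abs_def] P_def by blast
  have log0: "log_part q = 0" if "q \<in> D" for q
  proof -
    have "log_term j k q = 0" for j k using that by (auto simp: log_term_def D_def)
    then show ?thesis by (simp add: log_part_def)
  qed
  have down0: "down smooth_part q = 0" if "q \<in> D" for q using that by (auto simp: down_def D_def)
  have QF: "QF 0 (down smooth_part)" by (rule QF.base[OF smooth_part_in_CP])
  note cl = closed_class_hol_alg[OF l]
  have logC: "Ck_on k log_part (bidisc 1)" for k
    by (rule closed_class_Ck_on[OF cl, of log_part]) auto
  have logcont: "isCont log_part q" if "q \<in> bidisc 1" for q
    using l(3) that has_derivative_continuous by blast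
  have smooth: "smooth_on remainder (Uq - D)"
    unfolding smooth_on_def remainder_def[abs_def]
  proof
    fix k
    have "Ck_on k (down smooth_part) (Uq - D)"
      by (rule closed_class_Ck_on[OF closed_class_QF, of "down smooth_part"]) (use QF in auto)
    moreover have "Ck_on k log_part (Uq - D)" using Uq_subset by (intro Ck_on_mono[OF logC]) auto
    ultimately show "Ck_on k (\<lambda>q. down smooth_part q + log_part q) (Uq - D)"
      by (rule Ck_on_add[OF open_Uq_D])
  qed
  have cont: "continuous_on Uq remainder"
  proof (rule continuous_at_imp_continuous_on, rule ballI)
    fix q assume q: "q \<in> Uq"
    have "isCont (down smooth_part) q"
    proof (cases "q \<in> D")
      case True
      have "(down smooth_part \<longlongrightarrow> down smooth_part q) (nhds q)"
        using down_tendsto[OF smooth_part_in_CP True] down0[OF True] by simp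
      then show ?thesis unfolding isCont_def tendsto_at_iff_tendsto_nhds .
    next
      case False
      then show ?thesis using QF_deriv[OF QF] q has_derivative_continuous by blast
    qed
    moreover have "isCont log_part q" using logcont q Uq_subset by blast
    ultimately show "isCont remainder q" unfolding remainder_def[abs_def] by (rule continuous_add)
  qed
  \<comment> \<open>No derivative is computed: on \<open>Om\<close> every iterated derivative is a
    member of \<open>CP\<close> plus a member of \<open>C2\<close>, and members of both classes tend
    to 0 along the divisor.\<close>
  have iter: "(iter_deriv ws (\<lambda>z. remainder (qmap z)) \<longlongrightarrow> 0) (inf (filtercomap qmap (nhds p)) (principal H2))"
    if p: "p \<in> D" for ws p
  proof -
    let ?F = "inf (filtercomap qmap (nhds p)) (principal H2)"
    have lim: "filterlim qmap (nhds p) ?F"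
      by (rule filterlim_mono[OF filterlim_filtercomap order_refl inf_le1])
    have evOm: "eventually (\<lambda>z. z \<in> Om) ?F"
    proof -
      have "eventually (\<lambda>q. q \<in> Uq) (nhds p)" using open_Uq D_subset_Uq p by (intro eventually_nhds_in_open) auto
      then have "eventually (\<lambda>z. qmap z \<in> Uq) ?F" by (rule lim[unfolded filterlim_iff, rule_format])
      then show ?thesis by (simp add: qmap_in_Uq)
    qed
    define C2 where "C2 = insert (\<lambda>z. log_part (qmap z)) {\<lambda>z. Re (fst (qmap z) * snd (qmap z) * f (qmap z)) | f. f \<in> hol_alg}"
    have "closed_class C2 Om"
      unfolding C2_def using Uq_subset qmap_in_Uq by (intro closed_class_hol_alg_qmap[OF l open_Om]) blast
    note cc = closed_class_plus[OF closed_class_CP this]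
    have mem: "(\<lambda>z. smooth_part z + log_part (qmap z)) \<in> {\<lambda>x. f x + g x | f g. f \<in> CP \<and> g \<in> C2}"
      using smooth_part_in_CP unfolding C2_def mem_Collect_eq
      by (intro exI[of _ smooth_part] exI[of _ "\<lambda>z. log_part (qmap z)"]) auto
    have eq: "remainder (qmap z) = smooth_part z + log_part (qmap z)" if "z \<in> Om" for z
      unfolding remainder_def down_qmap[OF smooth_part_in_CP that] ..
    obtain f g where fg: "f \<in> CP" "g \<in> C2" "\<forall>z\<in>Om. iter_deriv ws (\<lambda>z. remainder (qmap z)) z = f z + g z"
      using closed_class_iter_deriv[OF cc mem eq, of ws] by blast
    have "((\<lambda>z. down f (qmap z)) \<longlongrightarrow> 0) ?F"
      by (rule filterlim_compose[OF down_tendsto[OF fg(1) p] lim])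
    then have f0: "(f \<longlongrightarrow> 0) ?F"
      by (rule Lim_transform_eventually) (use evOm in \<open>auto elim!: eventually_mono simp: down_qmap[OF fg(1)]\<close>)
    have p1: "p \<in> bidisc 1" "fst p * snd p = 0" using p by (auto simp: D_def)
    have g0: "(g \<longlongrightarrow> 0) ?F"
    proof -
      \<comment> \<open>Each member of \<open>C2\<close> factors through \<open>qmap\<close> as a
        function continuous on the whole bidisc, divisor included, and zero at
        \<open>p\<close>.\<close>
      obtain \<Psi> where \<Psi>: "g = (\<lambda>z. \<Psi> (qmap z))" "isCont \<Psi> p" "\<Psi> p = 0"
        using fg(2) unfolding C2_def
      proof
        assume "g = (\<lambda>z. log_part (qmap z))"
        then show ?thesis using that logcont[OF p1(1)] log0[OF p] by blast
      next
        assume "g \<in> {\<lambda>z. Re (fst (qmap z) * snd (qmap z) * f (qmap z)) | f. f \<in> hol_alg}"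
        then obtain k where k: "g = (\<lambda>z. Re (fst (qmap z) * snd (qmap z) * k (qmap z)))" "k \<in> hol_alg" by blast
        have "isCont k p" using hol_alg_deriv[OF k(2)] p1(1) has_derivative_continuous by blast
        then have "isCont (\<lambda>q. Re (fst q * snd q * k q)) p"
          by (intro bounded_linear.isCont[OF bounded_linear_Re] continuous_mult continuous_fst continuous_snd continuous_ident)
        then show ?thesis using that[of "\<lambda>q. Re (fst q * snd q * k q)"] k(1) p1(2) by simp
      qed
      have "(\<Psi> \<longlongrightarrow> \<Psi> p) (nhds p)" using \<Psi>(2) unfolding isCont_def tendsto_at_iff_tendsto_nhds .
      then have "(\<Psi> \<longlongrightarrow> 0) (nhds p)" by (simp only: \<Psi>(3))
      from filterlim_compose[OF this lim] show ?thesis unfolding \<Psi>(1) .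
    qed
    have "((\<lambda>z. f z + g z) \<longlongrightarrow> 0 + 0) ?F" by (rule tendsto_add[OF f0 g0])
    then have "((\<lambda>z. f z + g z) \<longlongrightarrow> 0) ?F" by simp
    then show ?thesis
      by (rule Lim_transform_eventually) (use evOm fg(3) in \<open>auto elim!: eventually_mono\<close>)
  qed
  have corner: "\<exists>\<epsilon>>0. bidisc \<epsilon> \<subseteq> Uq \<and> Ck_on k remainder (bidisc \<epsilon>)" for k
  proof -
    obtain \<epsilon> where e: "\<epsilon> > 0" "bidisc \<epsilon> \<subseteq> Uq" "\<And>N h j. QF N h \<Longrightarrow> N + j \<le> k \<Longrightarrow> Ck_on j h (bidisc \<epsilon>)"
      using QF_corner[of k] by metis
    have "Ck_on k (down smooth_part) (bidisc \<epsilon>)" by (rule e(3)[OF QF]) simp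
    moreover have "Ck_on k log_part (bidisc \<epsilon>)" using e(2) Uq_subset by (intro Ck_on_mono[OF logC]) blast
    ultimately have "Ck_on k remainder (bidisc \<epsilon>)" unfolding remainder_def[abs_def] by (rule Ck_on_add[OF open_bidisc])
    then show ?thesis using e by blast
  qed
  show ?thesis unfolding smooth_vanishing_along_D_def
    using smooth cont iter corner log0 down0 by (auto simp: remainder_def)
qed

end

theorem mainTheorem5:
  fixes v :: real and m :: int
  assumes "v > 0" and "m \<noteq> 0"
  shows "\<exists>U F. open U \<and> D \<subseteq> U \<and> U \<subseteq> bidisc 1 \<and>
           smooth_vanishing_along_D F U \<and>
           (\<forall>z\<in>H2. qmap z \<in> U \<longrightarrow> (\<forall>M\<in>Lset m. R z M \<noteq> 0) \<longrightarrow>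
              Xi v z m =
                Lfun (qmap z) m
                + 1/2 * (\<Sum>(b,c) | - b * c = m.
                    tpar z / sqrt v * (B v (spar z) b c - I v (spar z) b c))
                + F (qmap z))"
proof -
  interpret boundary_expansion v m by standard (fact assms)+
  show ?thesis
    using open_Uq D_subset_Uq Uq_subset smooth_vanishing_remainder Xi_expansion qmap_in_Uq
    by (intro exI[of _ Uq] exI[of _ remainder]) blast
qed

end
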